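(* Let $s\in(0,1)$, $N>2s$, $1<p<\frac{N+2s}{N-2s}$. Let $a$ satisfy $a(x)\in(0,1]$ for all $x$, $\inf a>0$, $|\{a\neq1\}|>0$, $a(x)\to1$ as $|x|\to\infty$, and $1-a(x)\le\frac{C}{1+|x|^{\mu(N+2s)}}$ for all $x$, for some $C>0$ and $\mu>p+1+\frac{N}{N+2s}$. Let $r_1>0$, $d_1>0$ be constants such that for every nonnegative $f\in H^{-s}(\mathbb R^N)$, $f\not\equiv0$, with $\|f\|_{H^{-s}}\le d_1$, the functional $I_{a,f}$ is strictly convex on $B(r_1)=\{\|u\|_{H^s}<r_1\}$ and has a unique critical point $u_{locmin}(a,f;\cdot)$ in $B(r_1)$. Then there exists $d_5\in(0,d_1]$ such that if $f\in H^{-s}(\mathbb R^N)$ is nonnegative, $f\not\equiv0$ and $\|f\|_{H^{-s}}\le d_5$, then $J_{a,f}$ has at least two critical points in $$\{v\in\tilde\Sigma_+:\ J_{a,f}(v)<I_{a,f}(u_{locmin}(a,f;\cdot))+I_{1,0}(w^* )\}.$$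
   Context: $\|u\|_{H^s}^2=\int_{\mathbb R^N}|u|^2+\iint_{\mathbb R^{2N}}\frac{|u(x)-u(y)|^2}{|x-y|^{N+2s}}dx\,dy$; $\langle\cdot,\cdot\rangle$ is the $H^{-s}$–$H^s$ duality; $f$ nonnegative means $\langle f,u\rangle\ge0$ for all nonnegative $u$. For $b\in L^\infty$, $g\in H^{-s}$: $I_{b,g}(u)=\frac12\|u\|_{H^s}^2-\frac1{p+1}\int b(x)u_+^{p+1}dx-\langle g,u\rangle$. $\tilde\Sigma_+:=\{u\in H^s:\|u\|_{H^s}=1,\ u_+\not\equiv0\}$, a $C^1$ submanifold of the unit sphere of $H^s$, and $J_{a,f}(v):=\max_{t>0}I_{a,f}(tv)$ for $v\in\tilde\Sigma_+$; critical points of $J_{a,f}$ are taken on $\tilde\Sigma_+$ (derivative vanishing on tangent vectors $h$ with $\langle h,v\rangle_{H^s}=0$). $w^*$ is the unique (up to translation) positive ground state solution of $(-\Delta)^s w+w=w^p$ in $\mathbb R^N$, $w\in H^s$. *)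

theory Defs
  imports "HOL-Analysis.Analysis"
begin

type_synonym 'n fn = "real ^ 'n \<Rightarrow> real"


definition gag :: "real \<Rightarrow> ('n::finite) fn \<Rightarrow> ('n fn) \<Rightarrow> ((real^'n) \<times> (real^'n)) \<Rightarrow> real" where
  "gag s u v = (\<lambda>(x,y). (u x - u y) * (v x - v y) / norm (x - y) powr (real CARD('n) + 2 * s))"

text \<open>The fractional Sobolev space H^s(R^N) (as a set of representatives)\<close>
definition Hs :: "real \<Rightarrow> ('n::finite) fn set" where
  "Hs s = {u. u \<in> borel_measurable lborel \<and> integrable lborel (\<lambda>x. (u x)\<^sup>2) \<and>
              integrable (lborel \<Otimes>\<^sub>M lborel) (gag s u u)}"

definition Hs_norm :: "real \<Rightarrow> ('n::finite) fn \<Rightarrow> real" where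
  "Hs_norm s u = sqrt ((\<integral>x. (u x)\<^sup>2 \<partial>lborel) + (\<integral>z. gag s u u z \<partial>(lborel \<Otimes>\<^sub>M lborel)))"

text \<open>H^{-s}: bounded linear functionals on H^s; duality is application.\<close>
definition Hneg :: "real \<Rightarrow> (('n::finite) fn \<Rightarrow> real) set" where
  "Hneg s = {f. (\<forall>u\<in>Hs s. \<forall>v\<in>Hs s. f (\<lambda>x. u x + v x) = f u + f v) \<and>
               (\<forall>u\<in>Hs s. \<forall>c. f (\<lambda>x. c * u x) = c * f u) \<and>
               (\<exists>K. \<forall>u\<in>Hs s. \<bar>f u\<bar> \<le> K * Hs_norm s u)}"

definition Hneg_norm :: "real \<Rightarrow> (('n::finite) fn \<Rightarrow> real) \<Rightarrow> real" where
  "Hneg_norm s f = Sup {\<bar>f u\<bar> | u. u \<in> Hs s \<and> Hs_norm s u \<le> 1}"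

definition nonneg_dual :: "real \<Rightarrow> (('n::finite) fn \<Rightarrow> real) \<Rightarrow> bool" where
  "nonneg_dual s f \<longleftrightarrow> (\<forall>u\<in>Hs s. (AE x in lborel. u x \<ge> 0) \<longrightarrow> f u \<ge> 0)"

definition nonzero_dual :: "real \<Rightarrow> (('n::finite) fn \<Rightarrow> real) \<Rightarrow> bool" where
  "nonzero_dual s f \<longleftrightarrow> (\<exists>u\<in>Hs s. f u \<noteq> 0)"

definition Ifun :: "real \<Rightarrow> real \<Rightarrow> ('n::finite) fn \<Rightarrow> ('n fn \<Rightarrow> real) \<Rightarrow> 'n fn \<Rightarrow> real" where
  "Ifun s p b g u = Hs_norm s u ^ 2 / 2
     - (1 / (p + 1)) * (\<integral>x. b x * (max (u x) 0) powr (p + 1) \<partial>lborel) - g u"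

definition Hball :: "real \<Rightarrow> real \<Rightarrow> ('n::finite) fn set" where
  "Hball s r = {u \<in> Hs s. Hs_norm s u < r}"

definition crit_Hs :: "real \<Rightarrow> (('n::finite) fn \<Rightarrow> real) \<Rightarrow> 'n fn \<Rightarrow> bool" where
  "crit_Hs s F u \<longleftrightarrow> u \<in> Hs s \<and>
     (\<forall>e>0. \<exists>d>0. \<forall>h\<in>Hs s. Hs_norm s h < d \<longrightarrow>
         \<bar>F (\<lambda>x. u x + h x) - F u\<bar> \<le> e * Hs_norm s h)"

definition strictly_convex_on_Hs :: "real \<Rightarrow> ('n::finite) fn set \<Rightarrow> ('n fn \<Rightarrow> real) \<Rightarrow> bool" where
  "strictly_convex_on_Hs s A F \<longleftrightarrow>
     (\<forall>u\<in>A. \<forall>v\<in>A. \<not> (AE x in lborel. u x = v x) \<longrightarrow>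
        (\<forall>t. 0 < t \<and> t < 1 \<longrightarrow>
           F (\<lambda>x. t * u x + (1 - t) * v x) < t * F u + (1 - t) * F v))"

definition Sigma_plus :: "real \<Rightarrow> ('n::finite) fn set" where
  "Sigma_plus s = {v \<in> Hs s. Hs_norm s v = 1 \<and> \<not> (AE x in lborel. max (v x) 0 = 0)}"

definition Jfun :: "real \<Rightarrow> real \<Rightarrow> ('n::finite) fn \<Rightarrow> ('n fn \<Rightarrow> real) \<Rightarrow> 'n fn \<Rightarrow> real" where
  "Jfun s p a f v = (SUP t\<in>{0<..}. Ifun s p a f (\<lambda>x. t * v x))"

text \<open>Critical point of J on the manifold: the differential of J restricted
  to the manifold vanishes at v.\<close>
definition crit_Sigma :: "real \<Rightarrow> (('n::finite) fn \<Rightarrow> real) \<Rightarrow> 'n fn \<Rightarrow> bool" where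
  "crit_Sigma s F v \<longleftrightarrow> v \<in> Sigma_plus s \<and>
     (\<forall>e>0. \<exists>d>0. \<forall>w\<in>Sigma_plus s. Hs_norm s (\<lambda>x. w x - v x) < d \<longrightarrow>
         \<bar>F w - F v\<bar> \<le> e * Hs_norm s (\<lambda>x. w x - v x))"

text \<open>Positive ground state of (-\<Delta>)^s w + w = w^p: a positive critical point of
  I_{1,0} of least energy among nontrivial critical points.\<close>
definition ground_state :: "real \<Rightarrow> real \<Rightarrow> ('n::finite) fn \<Rightarrow> bool" where
  "ground_state s p w \<longleftrightarrow> w \<in> Hs s \<and> (\<forall>x. w x > 0) \<and>
     crit_Hs s (Ifun s p (\<lambda>_. 1) (\<lambda>_. 0)) w \<and>
     (\<forall>u::'n fn. crit_Hs s (Ifun s p (\<lambda>_. 1) (\<lambda>_. 0)) u \<and> \<not> (AE x in lborel. u x = 0) \<longrightarrow>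
        Ifun s p (\<lambda>_. 1) (\<lambda>_. 0) w \<le> Ifun s p (\<lambda>_. 1) (\<lambda>_. 0) u)"

end

theory Submission
 imports Defs "HOL-Library.Diagonal_Subsequence"
begin

text \<open>
  Below the level \<open>c = I f u + c0\<close>, where \<open>u\<close> is the local minimiser and \<open>c0\<close> the ground state energy,
  the functional \<open>J f\<close> satisfies the Palais-Smale condition, because a noncompact sequence loses at least one ground state.
  For large \<open>y\<close> the projection of \<open>u + w(\<cdot> - y)\<close> lies below this level: the interaction of \<open>u\<close> with the
  translated ground state \<open>w\<close> dominates the loss caused by \<open>a \<noteq> 1\<close>, since \<open>u\<close> decays no faster than
  \<open>(1 + |x|) powr - (N + 2 s)\<close> and \<open>w\<close> satisfies a Caccioppoli estimate with that weight.
  Below the level the barycentre does not vanish. If there were only one critical point there, gradient descent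
  would push the sphere of the projections with \<open>|y| = R\<close> into a small neighbourhood of it, and the barycentre
  would contract a sphere in the complement of the origin.
\<close>

text \<open>The best constant \<open>KK\<close> of the embedding into L^(p+1) governs both
  compactness statements: the ground state has norm \<open>tK\<close> and energy
  \<open>kap * tK^2\<close>, so a lost bump costs at least \<open>c0\<close> on top of the energy of
  the weak limit. The threshold is right because \<open>u\<close> has the least energy among all
  critical points of \<open>I f\<close>: in the small ball it is the only one, outside it smallness
  of \<open>f\<close> makes the energy nonnegative, while \<open>I f u \<le> 0\<close>. With the
  weight \<open>a\<close> the constant \<open>KK\<close> is not attained, since maximisers are
  positive and \<open>a\<close> differs from 1 on a set of positive measure; this is why barycentres
  below the level do not vanish. The quantitative core is a comparison of exponents: if
  \<open>X\<close> is the interaction and \<open>r = max 2 p\<close>, the weighted energy of the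
  translate is \<open>O(X powr (2/r))\<close>, so the loss is \<open>O(X powr ((p + 1)/r))\<close>,
  of higher order because \<open>r < p + 1\<close>. Projecting the sum along its ray adds an error
  \<open>O(hn u * X)\<close>, absorbed when \<open>f\<close> is small. Elements of the space are
  functions, not classes: \<open>hn\<close> is a seminorm and identities hold almost
  everywhere.\<close>

abbreviation (input) seq_tendsto (infixr "--->" 60) where "X ---> l == (X \<longlonglongrightarrow> l)"

section \<open>Lebesgue measure under translations and shears; square-integrable functions\<close>

lemma nn_integral_lborel_shift:
 fixes c :: "'a::euclidean_space"
 assumes "f \<in> borel_measurable borel"
 shows "(\<integral>\<^sup>+x. f (x + c) \<partial>lborel) = (\<integral>\<^sup>+x. f x \<partial>lborel)"
proof -
 have "(\<integral>\<^sup>+x. f x \<partial>lborel) = (\<integral>\<^sup>+x. f x \<partial>(distr lborel borel ((+) c)))"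
  by (simp add: lborel_distr_plus)
 also have "... = (\<integral>\<^sup>+x. f (c + x) \<partial>lborel)"
  using assms by (subst nn_integral_distr) auto
 finally show ?thesis by (simp add: add.commute)
qed

lemma integral_lborel_shift:
 fixes c :: "'a::euclidean_space" and f :: "'a => 'b::{banach,second_countable_topology}"
 assumes "f \<in> borel_measurable borel"
 shows "(LINT x|lborel. f (x + c)) = (LINT x|lborel. f x)"
  and "integrable lborel (%x. f (x + c)) = integrable lborel f"
proof -
 have "(LINT x|lborel. f x) = (\<integral>x. f x \<partial>(distr lborel borel ((+) c)))"
  by (simp add: lborel_distr_plus)
 also have "... = (LINT x|lborel. f (c + x))"
  using assms by (subst integral_distr) auto
 finally show "(LINT x|lborel. f (x + c)) = (LINT x|lborel. f x)" by (simp add: add.commute)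
 have "integrable lborel f = integrable (distr lborel borel ((+) c)) f"
  by (simp add: lborel_distr_plus)
 also have "... = integrable lborel (%x. f (c + x))"
  using assms by (subst integrable_distr_eq) auto
 finally show "integrable lborel (%x. f (x + c)) = integrable lborel f" by (simp add: add.commute)
qed

text \<open>For fixed \<open>x\<close> the second coordinate is merely translated, so Fubini gives
  invariance. The substitution \<open>y = x + h\<close> lets Gagliardo double integrals be estimated
  one increment \<open>h\<close> at a time.\<close>

lemma distr_shear:
 fixes t :: "'a::euclidean_space itself"
 shows "distr (lborel \<Otimes>\<^sub>M lborel) (lborel \<Otimes>\<^sub>M lborel) (%(x::'a,h). (x, x + h)) = lborel \<Otimes>\<^sub>M lborel"
  (is "?D = ?M")
proof (rule measure_eqI)
 fix A :: "('a \<times> 'a) set" assume "A \<in> sets ?D"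
 hence A[measurable]: "A \<in> sets (borel \<Otimes>\<^sub>M borel)" by (simp cong: sets_pair_measure_cong)
 have m[measurable]: "(%(x::'a,h). (x, x + h)) \<in> ?M \<rightarrow>\<^sub>M ?M" by measurable
 have "emeasure ?D A = (\<integral>\<^sup>+z. indicator A z \<partial>?D)" using \<open>A \<in> sets ?D\<close> by simp
 also have "... = (\<integral>\<^sup>+z. indicator A (fst z, fst z + snd z) \<partial>?M)"
  by (subst nn_integral_distr) (auto simp: case_prod_unfold)
 also have "... = (\<integral>\<^sup>+x. \<integral>\<^sup>+h. indicator A (x, x + h) \<partial>lborel \<partial>lborel)"
  by (subst lborel.nn_integral_fst[symmetric]) auto
 also have "... = (\<integral>\<^sup>+x. \<integral>\<^sup>+h. indicator A (x, h) \<partial>lborel \<partial>lborel)"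
  using nn_integral_lborel_shift[of "%h. indicator A (_, h)"]
  by (auto simp: add.commute intro!: nn_integral_cong)
 also have "... = (\<integral>\<^sup>+z. indicator A z \<partial>?M)"
  by (subst lborel.nn_integral_fst[symmetric]) auto
 also have "... = emeasure ?M A" using \<open>A \<in> sets ?D\<close> by simp
 finally show "emeasure ?D A = emeasure ?M A" .
qed simp

text \<open>One predicate serves for functions on the space and for their difference quotients on
  the product space, so each L2 fact is proved once for both parts of the norm.\<close>

definition sqi :: "'a measure => ('a => real) => bool" where
 "sqi M f \<longleftrightarrow> f \<in> borel_measurable M & integrable M (%x. (f x)^2)"

lemma sqiD: "sqi M f ==> f \<in> borel_measurable M" "sqi M f ==> integrable M (%x. (f x)^2)"
 by (auto simp: sqi_def)

lemma sqi_mono: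
 assumes "sqi M g" "f \<in> borel_measurable M" "!!x. x \<in> space M ==> abs (f x) <= abs (g x)"
 shows "sqi M f"
 unfolding sqi_def
proof
 show "integrable M (%x. (f x)^2)"
  using assms by (intro Bochner_Integration.integrable_bound[OF sqiD(2)[OF assms(1)]])
   (auto intro!: AE_I2 simp: abs_le_square_iff)
qed fact

lemma sqi_mult_integrable:
 assumes "sqi M f" "sqi M g" shows "integrable M (%x. f x*g x)"
proof (rule Bochner_Integration.integrable_bound)
 show "integrable M (%x. (f x)^2 + (g x)^2)" using assms by (auto simp: sqi_def)
 show "(%x. f x*g x) \<in> borel_measurable M" using assms by (auto simp: sqi_def)
 have "abs (f x*g x) <= (f x)^2 + (g x)^2" for x
 proof -
  have "0 <= abs (f x)*abs (g x)" by simp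
  moreover have "2*(abs (f x)*abs (g x)) <= (f x)^2 + (g x)^2"
   using sum_squares_bound[of "abs (f x)" "abs (g x)"] by (simp add: mult.assoc)
  ultimately show ?thesis by (simp only: abs_mult)
 qed
 thus "AE x in M. norm (f x*g x) <= norm ((f x)^2 + (g x)^2)" by auto
qed

lemma sqi_scale: "sqi M f ==> sqi M (%x. c*f x)"
 by (auto simp: sqi_def power_mult_distrib)

lemma sqi_add: assumes "sqi M f" "sqi M g" shows "sqi M (%x. f x + g x)"
 using assms sqi_mult_integrable[OF assms]
 by (auto simp: sqi_def power2_sum mult.assoc)

lemma sqi_diff: assumes "sqi M f" "sqi M g" shows "sqi M (%x. f x - g x)"
 using sqi_add[OF assms(1) sqi_scale[OF assms(2), of "-1"]] by simp

section \<open>The Hilbert structure of the fractional Sobolev space\<close>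

locale frac_sobolev =
 fixes s dd :: real and n_type :: "'n::finite itself"
 assumes s_pos: "0 < s" and s_lt_1: "s < 1" and s_lt_N: "2 * s < real CARD('n)"
  and dd_def: "dd = real CARD('n) + 2 * s"
begin

abbreviation H :: "'n fn set" where "H \<equiv> Hs s"
abbreviation hn :: "'n fn => real" where "hn \<equiv> Hs_norm s"
abbreviation L :: "(real^'n) measure" where "L \<equiv> lborel"
abbreviation LL :: "((real^'n) \<times> (real^'n)) measure" where "LL \<equiv> lborel \<Otimes>\<^sub>M lborel"

text \<open>Half of the singular kernel goes to each factor, so that the Gagliardo seminorm is the
  plain L2 norm of \<open>df u\<close> on the product space. On the diagonal the value is 0.\<close>

definition df :: "'n fn => (real^'n) \<times> (real^'n) => real" where
 "df u z = (u (fst z) - u (snd z))/norm (fst z - snd z) powr (dd/2)"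

definition ip :: "'n fn => 'n fn => real" where
 "ip u v = (LINT x|L. u x * v x) + (LINT z|LL. df u z*df v z)"

lemma dd_pos: "dd > 0" using s_pos by (simp add: dd_def)

lemma gag_df: "gag s u v z = df u z*df v z"
 by (cases z) (simp add: gag_def df_def powr_add[symmetric] flip: dd_def)

lemma df_measurable[measurable]:
 assumes [measurable]: "u \<in> borel_measurable borel"
 shows "df u \<in> borel_measurable LL"
proof -
 have [measurable]: "fst \<in> LL \<rightarrow>\<^sub>M borel" "snd \<in> LL \<rightarrow>\<^sub>M borel"
  using measurable_fst[of L L] measurable_snd[of L L] by (simp_all add: measurable_lborel1)
 show ?thesis unfolding df_def by measurable
qed

lemma H_iff: "u \<in> H \<longleftrightarrow> sqi L u & sqi LL (df u)"
proof -
 have "gag s u u = (%z. (df u z)^2)" by (simp add: fun_eq_iff gag_df power2_eq_square)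
 thus ?thesis
  unfolding Hs_def sqi_def by (auto intro: df_measurable)
qed

lemma H_meas: "u \<in> H ==> u \<in> borel_measurable borel" by (auto simp: Hs_def)
lemma H_sqi: "u \<in> H ==> sqi L u" and H_sqi_df: "u \<in> H ==> sqi LL (df u)" by (auto simp: H_iff)

lemma df_add: "df (%x. u x + v x) z = df u z + df v z"
 and df_diff: "df (%x. u x - v x) z = df u z - df v z"
 and df_scale: "df (%x. c*u x) z = c*df u z"
 by (auto simp: df_def add_divide_distrib diff_divide_distrib algebra_simps)

lemma H_add: "u \<in> H ==> v \<in> H ==> (%x. u x + v x) \<in> H"
 by (auto simp: H_iff df_add[abs_def] intro!: sqi_add)
lemma H_scale: "u \<in> H ==> (%x. c*u x) \<in> H"
 by (auto simp: H_iff df_scale[abs_def] intro!: sqi_scale)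
lemma H_diff: "u \<in> H ==> v \<in> H ==> (%x. u x - v x) \<in> H"
 by (auto simp: H_iff df_diff[abs_def] intro!: sqi_diff)
lemma H_zero: "(%x. 0) \<in> H" by (simp add: H_iff sqi_def df_def)
lemma H_minus: "u \<in> H ==> (%x. - u x) \<in> H" using H_scale[of u "-1"] by simp

lemma ip_commute: "ip u v = ip v u" by (simp add: ip_def mult.commute)

lemma ip_add_left: "u \<in> H ==> v \<in> H ==> w \<in> H ==> ip (%x. u x + v x) w = ip u w + ip v w"
 unfolding ip_def df_add distrib_right
 by (simp add: Bochner_Integration.integral_add sqi_mult_integrable H_sqi H_sqi_df)
lemma ip_scale_left: "ip (%x. c*u x) w = c*ip u w"
 unfolding ip_def df_scale mult.assoc by (simp add: distrib_left)
lemma ip_add_right: "u \<in> H ==> v \<in> H ==> w \<in> H ==> ip w (%x. u x + v x) = ip w u + ip w v"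
 by (subst (1 2 3) ip_commute) (rule ip_add_left)
lemma ip_scale_right: "ip w (%x. c*u x) = c*ip w u"
 by (subst (1 2) ip_commute) (rule ip_scale_left)
lemma ip_diff_left: "u \<in> H ==> v \<in> H ==> w \<in> H ==> ip (%x. u x - v x) w = ip u w - ip v w"
 using ip_add_left[of u "%x. -1 * v x" w] ip_scale_left[of "-1" v w] H_scale[of v "-1"] by simp
lemma ip_diff_right: "u \<in> H ==> v \<in> H ==> w \<in> H ==> ip w (%x. u x - v x) = ip w u - ip w v"
 by (subst (1 2 3) ip_commute) (rule ip_diff_left)

lemma ip_self_nonneg: "ip u u >= 0"
 unfolding ip_def by (intro add_nonneg_nonneg integral_nonneg_AE) auto

lemma hn_def2: "hn u = sqrt (ip u u)"
 by (simp add: Hs_norm_def ip_def gag_df power2_eq_square)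
lemma hn_sq: "(hn u)^2 = ip u u" by (simp add: hn_def2 ip_self_nonneg)
lemma hn_nonneg: "0 <= hn u" by (simp add: hn_def2 ip_self_nonneg)

lemma hn_sq_eq: "(hn u)^2 = (LINT x|L. (u x)^2) + (LINT z|LL. (df u z)^2)"
 unfolding hn_sq ip_def by (simp add: power2_eq_square)

lemma hn_scale: "hn (%x. c*u x) = abs c*hn u"
proof -
 have "ip (%x. c*u x) (%x. c*u x) = c^2*ip u u"
  by (simp add: ip_scale_left ip_scale_right power2_eq_square)
 thus ?thesis by (simp add: hn_def2 real_sqrt_mult)
qed
lemma hn_zero: "hn (%x. 0) = 0" using hn_scale[of 0 "%x. 0"] by simp
lemma hn_minus: "hn (%x. - u x) = hn u" using hn_scale[of "-1" u] by simp

lemma hn_sq_add: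
 assumes "u \<in> H" "v \<in> H"
 shows "(hn (%x. u x + v x))^2 = (hn u)^2 + 2*ip u v + (hn v)^2"
 using assms by (simp add: hn_sq ip_add_left ip_add_right H_add ip_commute[of v u])

lemma hn_sq_diff:
 assumes "u \<in> H" "v \<in> H"
 shows "(hn (%x. u x - v x))^2 = (hn u)^2 - 2*ip u v + (hn v)^2"
 using assms by (simp add: hn_sq ip_diff_left ip_diff_right H_diff ip_commute[of v u])

lemma ip_CS:
 assumes "u \<in> H" "v \<in> H" shows "abs (ip u v) <= hn u*hn v"
proof -
 have q: "0 <= (hn u)^2 + 2*t*ip u v + t^2*(hn v)^2" for t
  using hn_sq_add[OF assms(1) H_scale[OF assms(2), of t]] zero_le_power2[of "hn (%x. u x + t * v x)"]
  by (simp add: ip_scale_right hn_scale power_mult_distrib mult_ac)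
 have "(ip u v)^2 <= (hn u)^2*(hn v)^2"
 proof (cases "hn v = 0")
  case False
  have "0 <= (hn u)^2 - (ip u v)\<^sup>2/(hn v)^2"
   using q[of "- ip u v/(hn v)^2"] False by (simp add: field_simps power2_eq_square)
  thus ?thesis using False by (simp add: field_simps)
 next
  case True
  have "ip u v = 0"
  proof (rule ccontr)
   assume n: "ip u v ~= 0"
   \<comment> \<open>Since \<open>hn v = 0\<close>, the quadratic is affine in \<open>t\<close>;
     this \<open>t\<close> gives it the value \<open>-1\<close>.\<close>
   show False using q[of "- ((hn u)^2 + 1)/(2*ip u v)"] n True by (simp add: field_simps)
  qed
  thus ?thesis by simp
 qed
 thus ?thesis
  by (metis abs_le_square_iff abs_mult abs_of_nonneg hn_nonneg power_mult_distrib)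
qed

lemma hn_triangle:
 assumes "u \<in> H" "v \<in> H" shows "hn (%x. u x + v x) <= hn u + hn v"
proof (rule power2_le_imp_le)
 show "(hn (%x. u x + v x))^2 <= (hn u + hn v)^2"
  using ip_CS[OF assms] by (simp add: hn_sq_add[OF assms] power2_sum)
qed (simp add: hn_nonneg)

lemma hn_diff_triangle:
 assumes "u \<in> H" "v \<in> H" "w \<in> H"
 shows "hn (%x. u x - w x) <= hn (%x. u x - v x) + hn (%x. v x - w x)"
 using hn_triangle[OF H_diff[OF assms(1,2)] H_diff[OF assms(2,3)]] by simp
lemma hn_diff_commute: "hn (%x. u x - v x) = hn (%x. v x - u x)"
 using hn_minus[of "%x. u x - v x"] by simp
lemma hn_diff_le: "u \<in> H ==> v \<in> H ==> hn (%x. u x - v x) <= hn u + hn v"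
 using hn_triangle[OF _ H_minus, of u v] by (simp add: hn_minus)
lemma hn_reverse_triangle:
 assumes "u \<in> H" "v \<in> H" shows "abs (hn u - hn v) <= hn (%x. u x - v x)"
 using hn_triangle[OF H_diff[OF assms] assms(2)] hn_triangle[OF H_diff[OF assms(2,1)] assms(1)]
 by (simp add: hn_diff_commute[of u v])

lemma AE_LL:
 assumes "AE x in L. P x" shows "AE z in LL. P (fst z)" "AE z in LL. P (snd z)"
proof -
 obtain N where N: "{x \<in> space L. ~ P x} \<subseteq> N" "N \<in> sets L" "emeasure L N = 0"
  using assms by (rule AE_E)
 have n: "N \<times> UNIV \<in> null_sets LL" "UNIV \<times> N \<in> null_sets LL"
  using N(2,3) lborel.emeasure_pair_measure_Times[of N L UNIV] lborel.emeasure_pair_measure_Times[of UNIV L N]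
  by (auto simp: null_sets_def intro!: pair_measureI)
 show "AE z in LL. P (fst z)"
  using N(1) by (intro AE_I'[OF n(1)]) (auto simp: space_pair_measure)
 show "AE z in LL. P (snd z)"
  using N(1) by (intro AE_I'[OF n(2)]) (auto simp: space_pair_measure)
qed

lemma df_AE_cong: assumes "AE x in L. u x = v x" shows "AE z in LL. df u z = df v z"
 using AE_LL[OF assms] by eventually_elim (simp add: df_def)

lemma ip_AE_cong:
 assumes "u \<in> H" "u' \<in> borel_measurable borel" "AE x in L. u x = u' x" "v \<in> H"
 shows "ip u v = ip u' v"
proof -
 have [measurable]: "u \<in> borel_measurable borel" "v \<in> borel_measurable borel" "u' \<in> borel_measurable borel"
  using assms H_meas by auto
 have "(LINT x|L. u x * v x) = (LINT x|L. u' x * v x)"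
  using assms(3) by (intro integral_cong_AE) auto
 moreover have "(LINT z|LL. df u z*df v z) = (LINT z|LL. df u' z*df v z)"
  using df_AE_cong[OF assms(3)] by (intro integral_cong_AE) auto
 ultimately show ?thesis by (simp add: ip_def)
qed

lemma H_AE_cong:
 assumes "u \<in> H" "u' \<in> borel_measurable borel" "AE x in L. u x = u' x"
 shows "u' \<in> H"
proof -
 have [measurable]: "u \<in> borel_measurable borel" "u' \<in> borel_measurable borel" using assms H_meas by auto
 have "integrable L (%x. (u' x)^2)"
  using assms(3) by (intro integrable_cong_AE_imp[OF sqiD(2)[OF H_sqi[OF assms(1)]]]) auto
 moreover have "integrable LL (%z. (df u' z)^2)"
  using df_AE_cong[OF assms(3)] by (intro integrable_cong_AE_imp[OF sqiD(2)[OF H_sqi_df[OF assms(1)]]]) auto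
 ultimately show ?thesis by (simp add: H_iff sqi_def)
qed

lemma hn_AE_cong:
 assumes "u \<in> H" "u' \<in> borel_measurable borel" "AE x in L. u x = u' x"
 shows "hn u = hn u'"
 using ip_AE_cong[OF assms assms(1)] ip_AE_cong[OF assms H_AE_cong[OF assms]]
 by (simp add: hn_def2 ip_commute)

lemma L2_le_hn: "(LINT x|L. (u x)^2) <= (hn u)^2"
 by (simp add: hn_sq_eq)

lemma hn_eq_0_iff: assumes "u \<in> H" shows "hn u = 0 \<longleftrightarrow> (AE x in L. u x = 0)"
proof
 assume "hn u = 0"
 hence "(LINT x|L. (u x)^2) = 0" using L2_le_hn[of u] by (simp add: antisym)
 thus "AE x in L. u x = 0"
  using integral_nonneg_eq_0_iff_AE[OF sqiD(2)[OF H_sqi[OF assms]]] by simp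
next
 assume "AE x in L. u x = 0"
 thus "hn u = 0" using hn_AE_cong[OF assms, of "%x. 0"] by (simp add: hn_zero)
qed

text \<open>The Markov property of the norm: a normal contraction decreases both of its parts
  pointwise under the integral. Positive parts, absolute values and truncations stay in
  \<open>H\<close> for this reason.\<close>

lemma contraction:
 assumes "u \<in> H" "v \<in> borel_measurable borel" "!!x. abs (v x) <= abs (u x)" "!!x y. abs (v x - v y) <= abs (u x - u y)"
 shows "v \<in> H" "hn v <= hn u"
proof -
 have [measurable]: "u \<in> borel_measurable borel" "v \<in> borel_measurable borel" using assms H_meas by auto
 have d: "abs (df v z) <= abs (df u z)" for z
  using assms(4) by (auto simp: df_def abs_divide intro!: divide_right_mono)
 show v: "v \<in> H"
  using assms by (auto simp: H_iff intro!: sqi_mono[OF H_sqi[OF assms(1)]] sqi_mono[OF H_sqi_df[OF assms(1)]] d)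
 have "(hn v)^2 <= (hn u)^2"
  unfolding hn_sq_eq
  using assms v d by (intro add_mono integral_mono sqiD(2) H_sqi H_sqi_df) (auto simp: abs_le_square_iff)
 thus "hn v <= hn u" by (rule power2_le_imp_le[OF _ hn_nonneg])
qed

abbreviation pp :: "'n fn => 'n fn" where "pp u \<equiv> (%x. max (u x) 0)"

lemma pp_H: "u \<in> H ==> pp u \<in> H" and hn_pp: "u \<in> H ==> hn (pp u) <= hn u"
 using contraction[of u "pp u"] H_meas[of u] by (auto simp: max_def abs_if)

text \<open>In the nonlocal form the positive and negative parts interact, but the cross terms have
  a favourable sign. This replaces the orthogonality of the local case when a negative part is shown
  to vanish.\<close>

lemma ip_pp_le:
 assumes "u \<in> H" shows "ip u (pp u) >= (hn (pp u))^2"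
proof -
 have "(a - b)*(max a 0 - max b 0) >= (max a 0 - max b 0)^2" for a b :: real
 proof -
  have "(a - b)*(max a 0 - max b 0) - (max a 0 - max b 0)\<^sup>2
   = max a 0*(max b 0 - b) + max b 0*(max a 0 - a) + (a - max a 0)*max a 0 + (b - max b 0)*max b 0"
   by (simp add: power2_eq_square algebra_simps)
  moreover have "(c - max c 0)*max c 0 = 0" for c :: real by (simp add: max_def)
  ultimately show ?thesis
   by (smt (verit) max.cobounded1 max.cobounded2 mult_nonneg_nonneg)
 qed
 hence "df u z*df (pp u) z >= (df (pp u) z)^2" for z
  by (auto simp: df_def power2_eq_square divide_right_mono)
 hence "(LINT z|LL. df u z*df (pp u) z) >= (LINT z|LL. (df (pp u) z)^2)"
  using assms by (intro integral_mono sqi_mult_integrable sqiD(2) H_sqi_df pp_H)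
 moreover have "(LINT x|L. u x*pp u x) = (LINT x|L. (pp u x)^2)"
  by (intro Bochner_Integration.integral_cong) (auto simp: max_def power2_eq_square)
 ultimately show ?thesis by (simp add: ip_def hn_sq_eq)
qed

text \<open>The diagonal translation preserves the product measure, and the kernel depends only on
  the difference of the two points.\<close>

lemma shift_H:
 assumes "u \<in> H"
 shows "(%x. u (x + c)) \<in> H" "v \<in> H ==> ip (%x. u (x + c)) (%x. v (x + c)) = ip u v"
proof -
 have m[measurable]: "u \<in> borel_measurable borel" using assms H_meas by auto
 have dist: "distr LL LL (%z. (fst z + c, snd z + c)) = LL"
 proof -
  have "LL = distr L borel ((+) c) \<Otimes>\<^sub>M distr L borel ((+) c)" by (simp only: lborel_distr_plus)
  also have "... = distr LL (borel \<Otimes>\<^sub>M borel) (%(x, y). (c + x, c + y))"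
   by (rule pair_measure_distr) (simp_all add: lborel_distr_plus lborel.sigma_finite_measure_axioms)
  also have "... = distr LL LL (%z. (fst z + c, snd z + c))"
   by (intro distr_cong sets_pair_measure_cong) (auto simp: case_prod_unfold add.commute)
  finally show ?thesis by (rule sym)
 qed
 have df_sh: "df (%x. w (x + c)) z = df w (fst z + c, snd z + c)" for w z by (simp add: df_def)
 have ii: "integrable LL (%z. g (fst z + c, snd z + c)) = integrable LL g"
   "(LINT z|LL. g (fst z + c, snd z + c)) = (LINT z|LL. g z)" if [measurable]: "g \<in> borel_measurable LL" for g :: "_ => real"
 proof -
  have [measurable]: "(%z. (fst z + c, snd z + c)) \<in> LL \<rightarrow>\<^sub>M LL" by measurable
  show "integrable LL (%z. g (fst z + c, snd z + c)) = integrable LL g"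
   by (subst (2) dist[symmetric], subst integrable_distr_eq) auto
  show "(LINT z|LL. g (fst z + c, snd z + c)) = (LINT z|LL. g z)"
   by (subst (2) dist[symmetric], subst integral_distr) auto
 qed
 show "(%x. u (x + c)) \<in> H"
  unfolding H_iff sqi_def df_sh
  using assms ii(1)[of "%z. (df u z)^2"] integral_lborel_shift(2)[of "%x. (u x)^2" c]
  by (auto simp: df_sh[abs_def] dest: H_sqi H_sqi_df sqiD(2))
 show "ip (%x. u (x + c)) (%x. v (x + c)) = ip u v" if "v \<in> H"
 proof -
  have [measurable]: "v \<in> borel_measurable borel" using that H_meas by auto
  show ?thesis
   unfolding ip_def df_sh
   using ii(2)[of "%z. df u z*df v z"] integral_lborel_shift(1)[of "%x. u x * v x" c] by auto
 qed
qed

lemma hn_shift: "u \<in> H ==> hn (%x. u (x + c)) = hn u"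
 by (simp add: hn_def2 shift_H)

lemma integral_LL_shear:
 fixes F :: "(real^'n) \<times> (real^'n) => real"
 assumes "integrable LL F"
 shows "integrable LL (%z. F (fst z, fst z + snd z))"
  "(LINT z|LL. F z) = (LINT z|LL. F (fst z, fst z + snd z))"
proof -
 have [measurable]: "(%z. (fst z, fst z + snd z)) \<in> LL \<rightarrow>\<^sub>M LL" by measurable
 have d: "distr LL LL (%z. (fst z, fst z + snd z)) = LL"
  using distr_shear[where 'a="real^'n"] by (simp add: case_prod_unfold)
 have [measurable]: "F \<in> borel_measurable LL" using assms by auto
 show "integrable LL (%z. F (fst z, fst z + snd z))"
  using assms by (subst (asm) d[symmetric], subst (asm) integrable_distr_eq) auto
 show "(LINT z|LL. F z) = (LINT z|LL. F (fst z, fst z + snd z))"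
  by (subst d[symmetric], subst integral_distr) auto
qed

end

lemma integrable_boundI:
 fixes f g :: "'a => real"
 assumes "integrable M g" "f \<in> borel_measurable M" "!!x. abs (f x) <= g x"
 shows "integrable M f"
proof (rule Bochner_Integration.integrable_bound[OF assms(1,2)])
 show "AE x in M. norm (f x) <= norm (g x)"
  by (intro AE_I2) (metis abs_ge_self assms(3) order_trans real_norm_def)
qed

text \<open>The integrand lies below the sum of the constants \<open>c k\<close> on the balls of
  radius \<open>r k\<close>, and a ball has volume proportional to \<open>r k ^ DIM('a)\<close>.
  Dyadic radii turn the integrability of radial functions into the convergence of a geometric
  series.\<close>

lemma nn_integral_le_balls:
 fixes f :: "'a::euclidean_space => real" and r c :: "nat => real"
 assumes cov: "!!x. \<exists>k. ennreal (f x) <= ennreal (c k)*indicator (ball 0 (r k)) x"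
  and pos: "!!k. c k >= 0" "!!k. r k >= 0"
  and sm: "summable (%k. c k*r k ^ DIM('a))"
 shows "(\<integral>\<^sup>+x. f x \<partial>lborel) < \<infinity>"
proof -
 have [measurable]: "ball (0::'a) (r k) \<in> sets borel" for k by simp
 have "(\<integral>\<^sup>+x. f x \<partial>lborel) <= (\<integral>\<^sup>+x. (\<Sum>k. ennreal (c k)*indicator (ball 0 (r k)) x) \<partial>(lborel :: 'a measure))"
 proof (intro nn_integral_mono)
  fix x :: 'a
  obtain k where "ennreal (f x) <= ennreal (c k)*indicator (ball 0 (r k)) x" using cov by blast
  also have "... <= (\<Sum>k. ennreal (c k)*indicator (ball 0 (r k)) x)"
   by (metis ennreal_suminf_lessD not_le order_less_irrefl)
  finally show "ennreal (f x) <= (\<Sum>k. ennreal (c k)*indicator (ball 0 (r k)) x)" .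
 qed
 also have "... = (\<Sum>k. \<integral>\<^sup>+x. ennreal (c k)*indicator (ball 0 (r k)) x \<partial>(lborel :: 'a measure))"
  by (intro nn_integral_suminf) measurable
 also have "... = (\<Sum>k. ennreal (unit_ball_vol (real DIM('a))*(c k*r k ^ DIM('a))))"
  using pos by (intro suminf_cong)
   (simp add: nn_integral_cmult_indicator emeasure_ball ennreal_mult' mult_ac)
 also have "... < \<infinity>"
 proof -
  have s: "summable (%k. unit_ball_vol (real DIM('a))*(c k*r k ^ DIM('a)))"
   using sm by (rule summable_mult)
  show ?thesis
   using s pos by (subst suminf_ennreal_eq[OF _ summable_sums[OF s]]) auto
 qed
 finally show ?thesis .
qed

lemma integrable_of_balls:
 fixes f :: "'a::euclidean_space => real" and r c :: "nat => real"
 assumes "f \<in> borel_measurable borel" "!!x. f x >= 0"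
  and cov: "!!x. f x = 0 \<or> (\<exists>k. f x <= c k & norm x < r k)"
  and pos: "!!k. c k >= 0" "!!k. r k >= 0"
  and sm: "summable (%k. c k*r k ^ DIM('a))"
 shows "integrable lborel f"
proof (rule integrableI_nonneg)
 have "\<exists>k. ennreal (f x) <= ennreal (c k)*indicator (ball 0 (r k)) x" for x
  using cov[of x] by (auto simp: indicator_def intro!: ennreal_leI)
 thus "(\<integral>\<^sup>+x. f x \<partial>lborel) < \<infinity>" by (rule nn_integral_le_balls[OF _ pos sm])
qed (use assms in auto)

text \<open>A substitute for dominated convergence when only part of the sequence has a fixed
  majorant. The excess of \<open>abs (h n)\<close> over \<open>ep * e n\<close> is dominated by
  \<open>psa\<close> and tends to 0, while the remaining part has integral at most
  \<open>ep * C\<close>. All passages to the limit in products and in powers rest on it.\<close>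

lemma small_plus_dominated:
 fixes h e :: "nat => 'a => real"
 assumes h: "!!n. h n \<in> borel_measurable M" "AE x in M. (%n. h n x) ---> 0"
  and e: "!!n. integrable M (e n)" "!!n x. 0 <= e n x" "!!n. (LINT x|M. e n x) <= C"
  and b: "!!ep. ep > 0 ==> \<exists>psa. integrable M psa & (\<forall>n x. abs (h n x) <= ep*e n x + psa x)"
 shows "integrable M (h n)" "(%n. LINT x|M. abs (h n x)) ---> 0" "(%n. LINT x|M. h n x) ---> 0"
proof -
 show int: "integrable M (h n)" for n
 proof -
  obtain psa where psa: "integrable M psa" "!!n x. abs (h n x) <= 1*e n x + psa x" using b[of 1] by auto
  show ?thesis
  proof (rule integrable_boundI[OF _ h(1)])
   show "integrable M (%x. 1*e n x + psa x)" using e(1)[of n] psa(1) by simp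
  qed (rule psa(2))
 qed
 have C: "C >= 0" using e(3)[of 0] Bochner_Integration.integral_nonneg[of M "e 0"] e(2) by fastforce
 show lim: "(%n. LINT x|M. abs (h n x)) ---> 0"
 proof (rule LIMSEQ_I)
  fix r :: real assume r: "0 < r"
  define ep where "ep = r/(2*(C + 1))"
  have ep: "ep > 0" "ep*C < r/2" using r C by (auto simp: ep_def field_simps)
  obtain psa where psa: "integrable M psa" "\<forall>n x. abs (h n x) <= ep*e n x + psa x" using b[OF ep(1)] by auto
  define g where "g n x = max (abs (h n x) - ep*e n x) 0" for n x
  have [measurable]: "g n \<in> borel_measurable M" for n
   unfolding g_def using h(1)[of n] borel_measurable_integrable[OF e(1)[of n]] by measurable
  have dom: "abs (g n x) <= abs (psa x)" for n x using psa(2)[rule_format, of n x] by (auto simp: g_def max_def)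
  have gi: "integrable M (g n)" for n
   using psa(1) dom by (intro Bochner_Integration.integrable_bound[OF psa(1)]) auto
  have "(%n. LINT x|M. g n x) ---> (LINT x|M. 0)"
  proof (rule integral_dominated_convergence[where w="%x. abs (psa x)"])
   show "AE x in M. (%n. g n x) ---> 0"
    using h(2)
   proof eventually_elim
    case (elim x)
    hence "(%n. abs (h n x)) ---> 0" by (simp add: tendsto_rabs_zero_iff)
    moreover have "0 <= g n x" "g n x <= abs (h n x)" for n
     using e(2)[of n x] ep(1) by (auto simp: g_def)
    ultimately show ?case using tendsto_sandwich[of "%_. 0" "%n. g n x" sequentially "%n. abs (h n x)" 0] by auto
   qed
  qed (use psa(1) dom in auto)
  hence "(%n. LINT x|M. g n x) ---> 0" by simp
  hence "\<forall>\<^sub>F n in sequentially. (LINT x|M. g n x) < r/2"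
   using r by (intro order_tendstoD(2)) auto
  thus "\<exists>n0. \<forall>n\<ge>n0. norm ((LINT x|M. abs (h n x)) - 0) < r"
   unfolding eventually_sequentially
  proof (elim exE, intro exI allI impI)
   fix n0 n assume n0: "\<forall>n\<ge>n0. (LINT x|M. g n x) < r/2" and "n >= n0"
   have "(LINT x|M. abs (h n x)) <= (LINT x|M. ep*e n x + g n x)"
    using int[of n] e(1)[of n] gi[of n] by (intro integral_mono) (auto simp: g_def)
   also have "... = ep*(LINT x|M. e n x) + (LINT x|M. g n x)"
    using e(1)[of n] gi[of n] by simp
   also have "... < r"
    using n0 \<open>n >= n0\<close> ep e(3)[of n] mult_left_mono[OF e(3)[of n], of ep] by (smt (verit) field_sum_of_halves)
   finally show "norm ((LINT x|M. abs (h n x)) - 0) < r" by (simp add: abs_of_nonneg)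
  qed
 qed
 show "(%n. LINT x|M. h n x) ---> 0"
  by (rule tendsto_0_le[OF lim, of _ 1]) (auto intro!: always_eventually integral_abs_bound)
qed

lemma fatou_sqi:
 assumes "!!n. sqi M (f n)" "AE x in M. (%n. f n x) ---> g x" "g \<in> borel_measurable M"
  and "!!n. (LINT x|M. (f n x)^2) <= C"
 shows "sqi M g" "(LINT x|M. (g x)^2) <= C"
proof -
 have C: "C >= 0" using assms(4)[of 0] by (smt (verit) integral_nonneg_AE AE_I2 zero_le_power2)
 have [measurable]: "f n \<in> borel_measurable M" for n using assms(1) by (auto simp: sqi_def)
 note assms(3)[measurable]
 have "(\<integral>\<^sup>+x. ennreal ((g x)^2) \<partial>M) = (\<integral>\<^sup>+x. liminf (%n. ennreal ((f n x)^2)) \<partial>M)"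
  using assms(2)
 proof (intro nn_integral_cong_AE, eventually_elim)
  case (elim x)
  hence "(%n. ennreal ((f n x)^2)) ---> ennreal ((g x)^2)" by (intro tendsto_ennrealI tendsto_power)
  thus ?case by (intro lim_imp_Liminf[symmetric]) auto
 qed
 also have "... <= liminf (%n. \<integral>\<^sup>+x. ennreal ((f n x)^2) \<partial>M)"
  by (intro nn_integral_liminf) auto
 also have "... <= ennreal C"
  using assms(1,4) by (intro Liminf_le always_eventually allI)
   (auto simp: nn_integral_eq_integral sqiD intro!: ennreal_leI)
 finally have *: "(\<integral>\<^sup>+x. ennreal ((g x)^2) \<partial>M) <= ennreal C" .
 thus "sqi M g"
  unfolding sqi_def using assms(3) by (auto intro!: integrableI_nonneg simp: le_less_trans)
 hence "ennreal (LINT x|M. (g x)^2) <= ennreal C"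
  using * by (simp add: nn_integral_eq_integral sqiD)
 thus "(LINT x|M. (g x)^2) <= C" using C by (simp add: ennreal_le_iff)
qed

text \<open>Boundedness in L2 and convergence almost everywhere imply weak convergence: Young's
  inequality splits the product into a small multiple of a bounded term and a multiple of
  \<open>(v x)^2\<close>.\<close>

lemma weak_sqi:
 assumes "!!n. sqi M (f n)" "AE x in M. (%n. f n x) ---> g x" "sqi M g" "sqi M v"
  and "!!n. (LINT x|M. (f n x)^2) <= C"
 shows "(%n. LINT x|M. f n x * v x) ---> (LINT x|M. g x * v x)"
proof -
 have [measurable]: "f n \<in> borel_measurable M" "g \<in> borel_measurable M" "v \<in> borel_measurable M" for n
  using assms by (auto simp: sqi_def)
 have "(%n. LINT x|M. (f n x - g x) * v x) ---> 0"
 proof (rule small_plus_dominated(3)[where e="%n x. (f n x - g x)^2" and C="2*C + 2*(LINT x|M. (g x)^2)"])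
  show "AE x in M. (%n. (f n x - g x) * v x) ---> 0"
   using assms(2) by eventually_elim (auto intro!: tendsto_mult_left_zero simp: LIM_zero_iff)
  show "integrable M (%x. (f n x - g x)^2)" for n using assms by (auto intro!: sqiD sqi_diff)
  have le: "(LINT x|M. (f n x - g x)^2) <= (LINT x|M. 2*(f n x)^2 + 2*(g x)^2)" for n
  proof (rule integral_mono)
   show "(f n x - g x)^2 <= 2*(f n x)^2 + 2*(g x)^2" for x
    using zero_le_power2[of "f n x + g x"] by (simp add: power2_sum power2_diff)
  qed (use assms in \<open>auto intro!: sqiD sqi_diff integrable_mult_right Bochner_Integration.integrable_add\<close>)
  show "(LINT x|M. (f n x - g x)^2) <= 2*C + 2*(LINT x|M. (g x)^2)" for n
     proof -
   have "(LINT x|M. 2*(f n x)^2 + 2*(g x)^2) = 2*(LINT x|M. (f n x)^2) + 2*(LINT x|M. (g x)^2)"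
    using sqiD(2)[OF assms(1)[of n]] sqiD(2)[OF assms(3)] by simp
   thus ?thesis using le[of n] assms(5)[of n] by linarith
  qed
  fix ep :: real assume "ep > 0"
  have "abs ((f n x - g x) * v x) <= ep*(f n x - g x)^2 + (v x)^2/ep" for n x
  proof -
   have "0 <= (ep*abs (f n x - g x) - abs (v x))^2" by simp
   hence "2*ep*abs (f n x - g x)*abs (v x) <= ep^2*(f n x - g x)^2 + (v x)^2"
    by (simp add: power2_diff power_mult_distrib algebra_simps)
   moreover have "0 <= ep*abs (f n x - g x)*abs (v x)" using \<open>ep > 0\<close> by simp
   ultimately have "ep*abs ((f n x - g x) * v x) <= ep^2*(f n x - g x)^2 + (v x)^2" by (simp add: abs_mult)
   thus ?thesis using \<open>ep > 0\<close> by (simp add: field_simps power2_eq_square)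
  qed
  thus "\<exists>psa. integrable M psa & (\<forall>n x. abs ((f n x - g x) * v x) <= ep*(f n x - g x)^2 + psa x)"
   using assms(4) by (intro exI[of _ "%x. (v x)^2/ep"]) (auto simp: sqiD)
 qed auto
 hence "(%n. (LINT x|M. f n x * v x) - (LINT x|M. g x * v x)) ---> 0"
  using assms by (simp add: left_diff_distrib sqi_mult_integrable)
 thus ?thesis by (simp add: LIM_zero_iff)
qed

section \<open>The polynomial weight and the integrability of the truncated kernel\<close>

context frac_sobolev
begin

text \<open>The decay rate is that of the kernel at infinity. The weight is used in three ways: as
  an integrable localisation in the compactness theorem, as the lower barrier of supersolutions, and
  as the weight of the energy estimate for the ground state.\<close>

definition om :: "real^'n => real" where "om x = (1 + norm x) powr - dd"

lemma om_pos: "om x > 0"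
 using norm_ge_zero[of x] by (simp add: om_def add_nonneg_eq_0_iff)

lemma om_le_1: "om x <= 1"
 using dd_pos ge_one_powr_ge_zero[of "1 + norm x" dd] by (simp add: om_def powr_minus_divide divide_le_eq)

lemma ex_power2_bracket: fixes x :: real assumes "x >= 1" shows "\<exists>k::nat. 2 ^ k <= x & x < 2 ^ (k + 1)"
proof -
 define k where "k = nat \<lfloor>log 2 x\<rfloor>"
 have l: "log 2 x >= 0" using assms by simp
 have "real k <= log 2 x" "log 2 x < real k + 1" using l by (auto simp: k_def)
 hence "2 powr real k <= x" "x < 2 powr (real k + 1)"
  using assms by (auto simp: le_log_iff log_less_iff)
 thus ?thesis by (intro exI[of _ k]) (auto simp: powr_realpow powr_add)
qed

lemma om_meas[measurable]: "om \<in> borel_measurable borel" unfolding om_def by measurable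

text \<open>On the shell where \<open>1 + norm x\<close> lies between \<open>2^k\<close> and
  \<open>2^(k+1)\<close> the weight is at most \<open>2 powr -(k dd)\<close>; multiplied by the
  volume of the ball this is geometric with ratio \<open>2 powr (- 2 s)\<close>.\<close>

lemma om_integrable: "integrable L om"
proof (rule integrable_of_balls[where c="%k. 2 powr (- (real k*dd))" and r="%k. 2 ^ (k + 1)"])
 fix x :: "real^'n"
 obtain k where k: "2 ^ k <= 1 + norm x" "1 + norm x < 2 ^ (k + 1)"
  using ex_power2_bracket[of "1 + norm x"] by auto
 have "om x <= (2 ^ k) powr - dd"
  unfolding om_def using k dd_pos by (intro powr_mono2') auto
 also have "... = 2 powr (- (real k*dd))" by (simp add: powr_realpow[symmetric] powr_powr)
 finally show "om x = 0 \<or> (\<exists>k. om x <= 2 powr (- (real k*dd)) & norm x < 2 ^ (k + 1))"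
  using k by (intro disjI2 exI[of _ k]) auto
next
 have "2 powr (- (real k*dd))*(2 ^ (k + 1)) ^ DIM(real^'n) = 2 ^ CARD('n)*(2 powr (- 2 * s)) ^ k" for k
  by (simp add: powr_realpow[symmetric] powr_powr powr_add[symmetric] dd_def algebra_simps)
 moreover have "summable (%k. 2 ^ CARD('n)*(2 powr (- 2 * s)) ^ k)"
  using s_pos by (intro summable_mult summable_geometric) (simp add: powr_less_one)
 ultimately show "summable (%k. 2 powr (- (real k*dd))*(2 ^ (k + 1)) ^ DIM(real^'n))" by (simp only:)
qed (auto simp: less_imp_le om_pos)

text \<open>Near the origin the dyadic series has ratio \<open>2 powr (2 s - 2)\<close>, which is
  where \<open>s < 1\<close> enters; for \<open>norm h > 1\<close> the kernel is comparable with
  \<open>om\<close>.\<close>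

lemma kernel_integrable: "integrable L (%h. min ((norm h)^2) 1/norm h powr dd)"
proof -
 have near: "integrable L (%h. if norm h <= 1 then (norm h)\<^sup>2/norm h powr dd else 0)"
 proof (rule integrable_of_balls[where c="%k. 2 powr (2*dd + real k*(dd - 2))" and r="%k. 2*(1/2) ^ k"])
  fix h :: "real^'n"
  show "(if norm h <= 1 then (norm h)\<^sup>2/norm h powr dd else 0) = 0 \<or>
   (\<exists>k. (if norm h <= 1 then (norm h)\<^sup>2/norm h powr dd else 0) <= 2 powr (2*dd + real k*(dd - 2)) & norm h < 2*(1/2) ^ k)"
  proof (cases "norm h <= 1 & h ~= 0")
   case True
   obtain k where k: "2 ^ k <= 1/norm h" "1/norm h < 2 ^ (k + 1)"
    using ex_power2_bracket[of "1/norm h"] True by auto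
   have h0: "norm h > 0" using True by simp
   have l: "norm h <= 2 powr - real k" "2 powr - (real k + 1) <= norm h"
    using k h0 by (auto simp: powr_minus powr_realpow field_simps powr_add powr_diff)
   have a: "(norm h)^2 <= 2 powr (- 2*real k)"
    using power_mono[OF l(1), of 2] by (simp add: power2_eq_square powr_add[symmetric])
   have "(2 powr - (real k + 1)) powr dd <= norm h powr dd"
    using l(2) dd_pos by (intro powr_mono2) auto
   hence b: "2 powr (- (real k + 1)*dd) <= norm h powr dd" by (simp add: powr_powr)
   have "(norm h)^2/norm h powr dd <= 2 powr (- 2*real k)/2 powr (- (real k + 1)*dd)"
    using a b by (intro frac_le) auto
   also have "... = 2 powr (dd + real k*(dd - 2))" by (simp add: powr_diff[symmetric] algebra_simps)
   also have "... <= 2 powr (2*dd + real k*(dd - 2))" using dd_pos by simp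
   finally have "(norm h)^2/norm h powr dd <= 2 powr (2*dd + real k*(dd - 2))" .
   moreover have "norm h < 2*(1/2) ^ k"
   proof -
    have "2 powr - real k = (1/2) ^ k" by (simp add: powr_minus powr_realpow power_one_over inverse_eq_divide)
    thus ?thesis using l(1) zero_less_power[of "1/2::real" k] by linarith
   qed
   ultimately show ?thesis using True by auto
  qed auto
 next
  have "2 powr (2*dd + real k*(dd - 2))*(2*(1/2) ^ k) ^ DIM(real^'n)
    = 2 powr (2*dd)*2 ^ CARD('n)*(2 powr (2 * s - 2)) ^ k" for k
  proof -
   have "((1/2::real) ^ k) ^ CARD('n) = 2 powr (- real k*real CARD('n))"
   proof -
    have "((1/2::real) ^ k) ^ CARD('n) = inverse (2 ^ (k*CARD('n)))"
     by (simp add: power_mult[symmetric] power_one_over inverse_eq_divide)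
    also have "2 ^ (k*CARD('n)) = (2::real) powr (real k*real CARD('n))"
     by (subst powr_realpow[symmetric]) simp_all
    finally show ?thesis by (simp add: powr_minus)
   qed
   thus ?thesis
    by (simp add: power_mult_distrib powr_realpow[symmetric] powr_powr powr_add[symmetric] dd_def algebra_simps)
  qed
  moreover have "summable (%k. 2 powr (2*dd)*2 ^ CARD('n)*(2 powr (2 * s - 2)) ^ k)"
   using s_lt_1 by (intro summable_mult summable_geometric) (simp add: powr_less_one)
  ultimately show "summable (%k. 2 powr (2*dd + real k*(dd - 2))*(2*(1/2) ^ k) ^ DIM(real^'n))" by (simp only:)
 qed auto
 have "integrable L (%h. (if norm h <= 1 then (norm h)\<^sup>2/norm h powr dd else 0) + 2 powr dd * om h)"
  using near om_integrable by auto
 thus ?thesis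
 proof (rule Bochner_Integration.integrable_bound)
  have "min ((norm h)^2) 1/norm h powr dd <= (if norm h <= 1 then (norm h)\<^sup>2/norm h powr dd else 0) + 2 powr dd * om h" for h :: "real^'n"
  proof (cases "norm h <= 1")
   case False
   have "(1 + norm h) powr dd <= (2*norm h) powr dd" using False dd_pos by (intro powr_mono2) auto
   hence "1/norm h powr dd <= 2 powr dd * om h"
   proof -
    have "norm h powr dd > 0" "(1 + norm h) powr dd > 0" using False by (auto simp: add_nonneg_eq_0_iff)
    thus ?thesis using \<open>_ <= (2 * norm h) powr dd\<close>
     by (simp add: om_def powr_minus powr_mult field_simps)
   qed
   moreover have "min ((norm h)^2) 1/norm h powr dd <= 1/norm h powr dd" by (intro divide_right_mono) auto
   ultimately show ?thesis using False by simp
  qed (use om_pos[of h] in \<open>auto simp: min_def power_le_one less_imp_le intro!: divide_right_mono\<close>)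
  thus "AE h in L. norm (min ((norm h)^2) 1/norm h powr dd)
    <= norm ((if norm h <= 1 then (norm h)\<^sup>2/norm h powr dd else 0) + 2 powr dd * om h)"
   by (intro AE_I2) (smt (verit) real_norm_def divide_nonneg_nonneg min_def powr_ge_zero zero_le_power2)
 qed measurable
qed

subsection \<open>Averages over dyadic cubes\<close>

text \<open>The integer vector labelling the half-open dyadic cube of side \<open>1/2^k\<close> that
  contains \<open>x\<close>. The labels form a countable type, which makes step functions measurable
  and allows a diagonal extraction over all cubes of all scales.\<close>

definition ix :: "nat => real^'n => int^'n" where "ix k x = (\<chi> i. \<lfloor>2 ^ k*x $ i\<rfloor>)"
definition cube :: "nat => int^'n => (real^'n) set" where "cube k z = {y. ix k y = z}"
definition vol :: "nat => real" where "vol k = (1/2 ^ k) ^ CARD('n)"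
definition cavg :: "nat => 'n fn => int^'n => real" where
 "cavg k u z = (LINT y|L. indicator (cube k z) y*u y)/vol k"
definition avg :: "nat => 'n fn => 'n fn" where "avg k u x = cavg k u (ix k x)"

lemma vol_pos: "vol k > 0" by (simp add: vol_def)

lemma cube_meas[measurable]: "cube k z \<in> sets borel"
proof -
 have "cube k z = (\<Inter>i\<in>UNIV. {y \<in> space borel. \<lfloor>2 ^ k*y $ i\<rfloor> = z $ i})"
  by (auto simp: cube_def ix_def vec_eq_iff)
 moreover have "{y \<in> space borel. \<lfloor>2 ^ k*(y::real^'n) $ i\<rfloor> = z $ i} \<in> sets borel" for i
  by measurable
 ultimately show ?thesis by (auto intro!: sets.finite_INT)
qed

lemma cube_emeasure: "emeasure L (cube k z) = ennreal (vol k)"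
proof -
 define l :: "real^'n" where "l = (\<chi> i. of_int (z $ i)/2 ^ k)"
 define r :: "real^'n" where "r = (\<chi> i. (of_int (z $ i) + 1)/2 ^ k)"
 have ineq: "\<lfloor>2 ^ k*t\<rfloor> = m \<longleftrightarrow> of_int m/2 ^ k <= t & t < (of_int m + 1)/2 ^ k" for t :: real and m
  by (auto simp: floor_eq_iff field_simps)
 have sub: "box l r \<subseteq> cube k z" "cube k z \<subseteq> cbox l r"
  by (auto simp: mem_box_cart cube_def ix_def vec_eq_iff ineq l_def r_def less_imp_le)
 have le: "b \<in> Basis ==> l \<bullet> b <= r \<bullet> b" for b
  by (auto simp: Basis_vec_def l_def r_def inner_axis divide_right_mono)
 have "(\<Prod>b\<in>Basis. (r - l) \<bullet> b) = (\<Prod>b\<in>(Basis :: (real^'n) set). 1/2 ^ k)"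
  by (intro prod.cong) (auto simp: Basis_vec_def l_def r_def inner_axis diff_divide_distrib[symmetric])
 also have "... = vol k" by (simp add: vol_def)
 finally have "emeasure L (box l r) = vol k" "emeasure L (cbox l r) = vol k"
  using le by (simp_all add: emeasure_lborel_box emeasure_lborel_cbox)
 thus ?thesis
  using emeasure_mono[OF sub(1), of L] emeasure_mono[OF sub(2), of L] by (auto intro: antisym)
qed

lemma cube_integral: "integrable L (indicator (cube k z) :: _ => real)"
  "(LINT y|L. indicator (cube k z) y) = vol k"
 using vol_pos[of k] by (auto simp: measure_def cube_emeasure)

lemma cube_norm: assumes "ix k x = ix k y" shows "norm (x - y) <= real CARD('n)/2 ^ k"
proof -
 have "abs (x $ i - y $ i) <= 1/2 ^ k" for i
 proof -
  have "\<lfloor>2 ^ k*x $ i\<rfloor> = \<lfloor>2 ^ k*y $ i\<rfloor>" using assms by (simp add: ix_def vec_eq_iff)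
  hence "abs (2 ^ k*x $ i - 2 ^ k*y $ i) <= 1" by linarith
  thus ?thesis by (simp add: field_simps abs_le_iff)
 qed
 hence "norm (x - y) <= (\<Sum>i\<in>(UNIV::'n set). 1/2 ^ k)"
  by (intro order_trans[OF norm_le_l1_cart] sum_mono) auto
 thus ?thesis by simp
qed

lemma indicator_sq: "(indicator A x :: real)^2 = indicator A x" by (simp add: indicator_def)

lemma cube_int_sqi: assumes "sqi L u" shows "integrable L (%y. indicator (cube k z) y*u y)"
 by (rule sqi_mult_integrable[OF _ assms]) (use cube_integral(1)[of k z] in \<open>auto simp: sqi_def indicator_sq\<close>)

lemma cavg_diff: "sqi L u ==> sqi L v ==> cavg k (%x. u x - v x) z = cavg k u z - cavg k v z"
 by (simp add: cavg_def right_diff_distrib cube_int_sqi diff_divide_distrib)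

text \<open>Splitting values at the level \<open>La\<close> gives
  \<open>abs t \<le> La + abs t powr r / La powr (r - 1)\<close>. The level is chosen so that both
  parts contribute \<open>La * vol k\<close> after integration, whence the factor 2.\<close>

lemma cavg_bound:
 assumes "sqi L u" "integrable L (%x. abs (u x) powr r)" "(LINT x|L. abs (u x) powr r) <= C" "C > 0" "r >= 1"
 shows "abs (cavg k u z) <= 2*(C/vol k) powr (1/r)"
proof -
 define La where "La = (C/vol k) powr (1/r)"
 have La: "La > 0" "La powr r = C/vol k" using assms vol_pos[of k] by (auto simp: La_def powr_powr)
 have pt: "abs t <= La + abs t powr r/La powr (r - 1)" for t
 proof (cases "abs t <= La")
  case False
  have "abs t*La powr (r - 1) <= abs t*abs t powr (r - 1)"
   using False La assms by (intro mult_left_mono powr_mono2) auto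
  also have "... = abs t powr r" using False La by (simp add: powr_mult_base)
  finally have "abs t <= abs t powr r/La powr (r - 1)" using La by (simp add: field_simps)
  thus ?thesis using La by simp
 qed (use La in \<open>auto intro: add_increasing2\<close>)
 have "\<bar>\<integral>y. indicator (cube k z) y*u y \<partial>L\<bar> <= (LINT y|L. abs (indicator (cube k z) y*u y))"
  by (rule integral_abs_bound)
 also have "... <= (LINT y|L. La*indicator (cube k z) y + abs (u y) powr r/La powr (r - 1))"
 proof (intro integral_mono integrable_abs cube_int_sqi assms(1))
  show "integrable L (%y. La*indicator (cube k z) y + abs (u y) powr r/La powr (r - 1))"
   using assms(2) cube_integral(1)[of k z] by auto
 qed (use pt La in \<open>auto simp: indicator_def intro!: add_nonneg_nonneg\<close>)
 also have "... = La * vol k + (LINT y|L. abs (u y) powr r)/La powr (r - 1)"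
  using assms cube_integral[of k z] by simp
 also have "... <= La * vol k + C/La powr (r - 1)"
  using assms La by (intro add_left_mono divide_right_mono) auto
 also have "C/La powr (r - 1) = La * vol k"
  using La vol_pos[of k] by (simp add: powr_diff field_simps)
 finally have "\<bar>\<integral>y. indicator (cube k z) y*u y \<partial>L\<bar> <= 2*La * vol k" by simp
 thus ?thesis using vol_pos[of k] by (simp add: cavg_def La_def field_simps abs_divide)
qed

lemma ix_meas[measurable]: "ix k \<in> borel \<rightarrow>\<^sub>M count_space UNIV"
 by (rule measurable_count_space_eq_countable[THEN iffD2])
  (use cube_meas[of k] in \<open>auto simp: cube_def vimage_def\<close>)

lemma avg_meas[measurable]: "avg k u \<in> borel_measurable borel"
 unfolding avg_def by measurable

text \<open>A Poincare inequality on cubes: the squared deviation from the mean is at most the mean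
  squared deviation, and inside a cube \<open>norm (x - y)\<close> is at most
  \<open>CARD('n)/2^k\<close>. The factor \<open>2 powr (- 2 s k)\<close> is this diameter to the
  power \<open>dd\<close> divided by the volume.\<close>

lemma avg_L2:
 assumes "u \<in> H"
 shows "sqi L (%x. u x - avg k u x)"
  "(LINT x|L. (u x - avg k u x)^2) <= real CARD('n) powr dd*2 powr (- 2 * s * k)*(LINT z|LL. (df u z)^2)"
proof -
 have [measurable]: "u \<in> borel_measurable borel" using assms H_meas by auto
 define c where "c = real CARD('n) powr dd*2 powr (- 2 * s * k)"
 define E where "E x = (LINT y|L. (df u (x, y))^2)" for x
 have int: "integrable LL (%z. (df u z)^2)" using assms by (auto intro: sqiD H_sqi_df)
 have E: "integrable L E" "(LINT x|L. E x) = (LINT z|LL. (df u z)^2)"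
  unfolding E_def using lborel_pair.integrable_fst'[OF int] lborel_pair.integral_fst'[OF int] by auto
 have AEi: "AE x in L. integrable L (%y. (df u (x, y))^2)" using lborel_pair.AE_integrable_fst'[OF int] .
 have pt: "AE x in L. (u x - avg k u x)^2 <= c*E x"
  using AEi
 proof eventually_elim
  case (elim x)
  let ?Q = "indicator (cube k (ix k x)) :: real^'n => real"
  have Qi: "integrable L ?Q" "(LINT y|L. ?Q y) = vol k" by (rule cube_integral)+
  have Qs: "sqi L ?Q" using Qi by (auto simp: sqi_def indicator_sq)
  have s1: "integrable L (%y. ?Q y*(u x - u y))"
   using Qi cube_int_sqi[OF H_sqi[OF assms]] by (simp add: right_diff_distrib)
  define D where "D = u x - avg k u x"
  have D: "D * vol k = (LINT y|L. ?Q y*(u x - u y))"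
   using Qi cube_int_sqi[OF H_sqi[OF assms]] vol_pos[of k]
   by (simp add: D_def avg_def cavg_def right_diff_distrib left_diff_distrib)
  have b: "?Q y*(u x - u y)^2 <= (real CARD('n)/2 ^ k) powr dd*(df u (x, y))^2" for y
  proof (cases "y \<in> cube k (ix k x) & x ~= y")
   case True
   hence n: "0 < norm (x - y)" "norm (x - y) <= real CARD('n)/2 ^ k"
    using cube_norm[of k x y] by (auto simp: cube_def)
   have "(u x - u y)^2 = norm (x - y) powr dd*(df u (x, y))^2"
    using n(1) by (simp add: df_def power_divide power2_eq_square[of "_ powr _"] powr_add[symmetric])
   also have "... <= (real CARD('n)/2 ^ k) powr dd*(df u (x, y))^2"
    using n dd_pos by (intro mult_right_mono powr_mono2) auto
   finally show ?thesis using True by simp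
  qed auto
  have s2: "integrable L (%y. ?Q y*(u x - u y)^2)"
   by (rule Bochner_Integration.integrable_bound[OF integrable_mult_right[OF elim, of "(real CARD('n)/2 ^ k) powr dd"]])
    (use b in \<open>auto simp: abs_mult\<close>)
  have "0 <= (LINT y|L. ?Q y*(u x - u y - D)^2)" by (intro integral_nonneg_AE) auto
  also have "... = (LINT y|L. ?Q y*(u x - u y)^2 - 2*D*(?Q y*(u x - u y)) + D^2*?Q y)"
   by (intro Bochner_Integration.integral_cong) (auto simp: power2_diff power2_sum algebra_simps)
  also have "... = (LINT y|L. ?Q y*(u x - u y)^2) - 2*D*(D * vol k) + D^2 * vol k"
   using s1 s2 Qi D by simp
  finally have "D^2 * vol k <= (LINT y|L. ?Q y*(u x - u y)^2)" by (simp add: power2_eq_square algebra_simps)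
  also have "... <= (LINT y|L. (real CARD('n)/2 ^ k) powr dd*(df u (x, y))^2)"
   using s2 elim b by (intro integral_mono) auto
  also have "... = (real CARD('n)/2 ^ k) powr dd*E x" by (simp add: E_def)
  finally have "D^2 <= (real CARD('n)/2 ^ k) powr dd/vol k*E x" using vol_pos[of k] by (simp add: field_simps)
  also have "(real CARD('n)/2 ^ k) powr dd/vol k = c"
   by (simp add: c_def vol_def powr_divide powr_realpow[symmetric] powr_powr dd_def powr_minus powr_add field_simps)
  finally show ?case by (simp add: D_def)
 qed
 have i: "integrable L (%x. (u x - avg k u x)^2)"
  using pt by (intro Bochner_Integration.integrable_bound[OF integrable_mult_right[OF E(1), of c]]) (auto elim: AE_mp)
 thus "sqi L (%x. u x - avg k u x)" by (simp add: sqi_def)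
 have "(LINT x|L. (u x - avg k u x)^2) <= (LINT x|L. c*E x)" using i E(1) pt by (intro integral_mono_AE) auto
 thus "(LINT x|L. (u x - avg k u x)^2) <= real CARD('n) powr dd*2 powr (- 2 * s * k)*(LINT z|LL. (df u z)^2)"
  by (simp add: E(2) c_def)
qed

end

lemma integral_suminf_bound:
 fixes f :: "'a => real" and g :: "nat => 'a => real"
 assumes f: "f \<in> borel_measurable M" "!!x. 0 <= f x"
  and g: "!!k. integrable M (g k)" "!!k x. 0 <= g k x" "!!k. (LINT x|M. g k x) <= c k" "summable c"
  and le: "!!x. \<exists>k. f x <= g k x"
 shows "integrable M f" "(LINT x|M. f x) <= suminf c"
proof -
 have c0: "c k >= 0" for k using g(3)[of k] g(2)[of k] by (smt (verit) Bochner_Integration.integral_nonneg)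
 have [measurable]: "g k \<in> borel_measurable M" for k using g(1) by auto
 have "(\<integral>\<^sup>+x. ennreal (f x) \<partial>M) <= (\<integral>\<^sup>+x. (\<Sum>k. ennreal (g k x)) \<partial>M)"
 proof (intro nn_integral_mono)
  fix x
  obtain k where "f x <= g k x" using le by blast
  hence "ennreal (f x) <= ennreal (g k x)" by (rule ennreal_leI)
  also have "... <= (\<Sum>k. ennreal (g k x))" by (metis ennreal_suminf_lessD not_le order_less_irrefl)
  finally show "ennreal (f x) <= (\<Sum>k. ennreal (g k x))" .
 qed
 also have "... = (\<Sum>k. \<integral>\<^sup>+x. ennreal (g k x) \<partial>M)" by (intro nn_integral_suminf) auto
 also have "... <= (\<Sum>k. ennreal (c k))"
  using g by (intro suminf_le) (auto simp: nn_integral_eq_integral intro!: ennreal_leI)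
 also have "... = ennreal (suminf c)" using c0 g(4) by (simp add: suminf_ennreal2)
 finally have *: "(\<integral>\<^sup>+x. ennreal (f x) \<partial>M) <= ennreal (suminf c)" .
 thus i: "integrable M f" using f by (intro integrableI_nonneg) (auto simp: le_less_trans)
 have "ennreal (LINT x|M. f x) <= ennreal (suminf c)" using * i f by (simp add: nn_integral_eq_integral)
 thus "(LINT x|M. f x) <= suminf c" using c0 g(4) by (simp add: ennreal_le_iff suminf_nonneg)
qed

context frac_sobolev
begin

subsection \<open>Subcritical Sobolev embedding\<close>

definition emb :: "real => real => bool" where
 "emb q C \<longleftrightarrow> (\<forall>u\<in>H. hn u <= 1 --> integrable L (%x. abs (u x) powr q) & (LINT x|L. abs (u x) powr q) <= C)"

lemma df_le_hn: "(LINT z|LL. (df u z)^2) <= (hn u)^2"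
 by (simp add: hn_sq_eq)

text \<open>A bound in L^r limits averages over cubes of scale \<open>k\<close> to about
  \<open>2 powr (k N/r)\<close>. Where the size of \<open>u\<close> first fits the next level, it is
  controlled by the deviation from its average, whose squared norm decays like
  \<open>2 powr (- 2 s k)\<close>. Against the factor \<open>2 powr (k N (q - 2)/r)\<close> this is
  summable exactly when \<open>q < 2 + 2 s r/N\<close>.\<close>

lemma emb_step:
 assumes "emb r C" "r >= 2" "2 <= q" "q < 2 + 2 * s * r/real CARD('n)"
 shows "\<exists>C'. emb q C'"
proof -
 define C1 where "C1 = max C 1"
 have C1: "C1 > 0" "C <= C1" by (auto simp: C1_def)
 define La where "La k = 2*(C1/vol k) powr (1/r)" for k
 have Lae: "La k = 2*C1 powr (1/r)*(2 powr (real CARD('n)/r)) ^ k" for k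
  using C1 by (simp add: La_def vol_def powr_mult power_one_over divide_inverse power_inverse power_mult[symmetric]
    powr_powr powr_realpow[symmetric] mult_ac)
 define rh where "rh = 2 powr (real CARD('n)/r)"
 have rh: "rh > 1" using assms by (simp add: rh_def)
 have Lapos: "La k > 0" for k using C1 rh by (simp add: Lae rh_def[symmetric])
 have Lainf: "\<exists>k. t <= 2*La k" for t :: real
 proof -
  define A where "A = 4*C1 powr (1/r)"
  have A: "A > 0" "!!k. 2*La k = A*rh ^ k" using C1 by (auto simp: A_def Lae rh_def)
  obtain k where "t/A < rh ^ k" using real_arch_pow[OF rh] by blast
  thus ?thesis using A by (intro exI[of _ k]) (auto simp: field_simps)
 qed
 define b where "b k = 4*(2*La (Suc k)) powr (q - 2)" for k
 define cc where "cc k = b k*(real CARD('n) powr dd*2 powr (- 2 * s * k))" for k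
 define c where "c k = (case k of 0 => (2*La 0) powr (q - 2) | Suc j => cc j)" for k :: nat
 have e1: "cc k = cc 0*(rh powr (q - 2)*2 powr (- 2 * s)) ^ k" for k
 proof -
  have "La (Suc k) = La 1*rh ^ k" by (simp add: Lae rh_def)
  hence "b k = b 0*(rh powr (q - 2)) ^ k"
   using rh Lapos by (simp add: b_def powr_mult powr_realpow[symmetric] powr_powr mult_ac less_imp_le)
  thus ?thesis
   by (simp add: cc_def power_mult_distrib powr_realpow[symmetric] powr_powr mult_ac)
 qed
 have e2: "rh powr (q - 2)*2 powr (- 2 * s) = 2 powr (real CARD('n)/r*(q - 2) - 2 * s)"

 proof -
  have "rh powr (q - 2)*2 powr (- 2 * s) = 2 powr (real CARD('n)/r*(q - 2) + - 2 * s)"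
   unfolding rh_def powr_powr powr_add ..
  thus ?thesis by simp
 qed
 have e3: "real CARD('n)/r*(q - 2) - 2 * s < 0"
  using assms by (simp add: field_simps)
 have e: "cc k = cc 0*(2 powr (real CARD('n)/r*(q - 2) - 2 * s)) ^ k" for k
  using e1[of k] unfolding e2 .
 have lt: "2 powr (real CARD('n)/r*(q - 2) - 2 * s) < 1" using e3 by (simp add: powr_less_one)
 have "summable cc"
  by (rule summable_cong[THEN iffD1, OF always_eventually[OF allI[OF e[symmetric]]]])
   (intro summable_mult summable_geometric, use lt in simp)
 hence sc: "summable c" by (subst summable_Suc_iff[symmetric]) (simp add: c_def)
 have "emb q (suminf c)"
  unfolding emb_def
 proof (intro ballI impI)
  fix u assume u: "u \<in> H" "hn u <= 1"
  have [measurable]: "u \<in> borel_measurable borel" using u H_meas by auto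
  have ur: "integrable L (%x. abs (u x) powr r)" "(LINT x|L. abs (u x) powr r) <= C1"
   using assms(1) u C1 by (force simp: emb_def)+
  have av: "abs (avg k u x) <= La k" for k x
   using cavg_bound[OF H_sqi[OF u(1)] ur C1(1), of k] assms by (simp add: avg_def La_def)
  have hn1: "(hn u)^2 <= 1" using u hn_nonneg[of u] by (simp add: power_le_one)
  define g where "g k x = (case k of 0 => (2*La 0) powr (q - 2)*(u x)^2
    | Suc j => b j*(u x - avg j u x)^2)" for k :: nat and x
   have G1: "integrable L (g k)" for k
    using H_sqi[OF u(1)] avg_L2(1)[OF u(1)] by (cases k) (auto simp: g_def[abs_def] intro: sqiD)
   have G2: "0 <= g k x" for k x by (cases k) (auto simp: g_def b_def)
   have G3: "(LINT x|L. g k x) <= c k" for k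
   proof (cases k)
    case 0
    have "(LINT x|L. (u x)^2) <= 1" using L2_le_hn[of u] hn1 by linarith
    thus ?thesis using 0 mult_left_mono[of "LINT x|L. (u x)^2" 1 "(2*La 0) powr (q - 2)"]
     by (simp add: g_def c_def)
   next
    case (Suc j)
    have "(LINT x|L. (u x - avg j u x)^2) <= real CARD('n) powr dd*2 powr (- 2 * s * j)*1"
     using df_le_hn[of u] hn1
     by (intro order_trans[OF avg_L2(2)[OF u(1)]] mult_left_mono) auto
    thus ?thesis using Suc mult_left_mono[of "LINT x|L. (u x - avg j u x)^2" _ "b j"]
     by (simp add: g_def c_def cc_def b_def)
   qed
   have G4: "\<exists>k. abs (u x) powr q <= g k x" for x
   proof -
    have sq: "abs (u x) powr q = abs (u x) powr (q - 2)*(u x)^2"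
    proof (cases "u x = 0")
     case False
     thus ?thesis using powr_add[of "abs (u x)" "q - 2" 2] powr_realpow[of "abs (u x)" 2] by simp
    qed simp
    \<comment> \<open>At the level just below the least admissible one, \<open>abs (u x)\<close>
      exceeds twice every possible average, so at least half of it is deviation from the
      average.\<close>
    define j where "j = (LEAST j. abs (u x) <= 2*La j)"
    have j: "abs (u x) <= 2*La j" unfolding j_def using Lainf[of "abs (u x)"] by (rule LeastI_ex)
    have p: "abs (u x) powr (q - 2) <= (2*La j) powr (q - 2)" using j assms by (intro powr_mono2) auto
    show ?thesis
    proof (cases j)
     case 0
     thus ?thesis using p by (intro exI[of _ 0]) (auto simp: g_def sq intro: mult_right_mono)
    next
     case (Suc i)
     hence "abs (u x) > 2*La i" using not_less_Least[of i "%j. abs (u x) <= 2*La j"] by (auto simp: j_def)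
     hence "abs (u x) <= 2*abs (u x - avg i u x)"
      using av[of i x] by (smt (verit))
     hence "abs (u x) <= abs (2*(u x - avg i u x))" by (simp only: abs_mult abs_numeral)
     hence "(u x)^2 <= (2*(u x - avg i u x))^2" by (rule abs_le_square_iff[THEN iffD1])
     hence "(u x)^2 <= 4*(u x - avg i u x)^2" unfolding power_mult_distrib by simp
     hence "abs (u x) powr q <= (2*La (Suc i)) powr (q - 2)*(4*(u x - avg i u x)^2)"
      unfolding sq using p Suc by (intro mult_mono) auto
     thus ?thesis by (intro exI[of _ "Suc i"]) (auto simp: g_def b_def mult_ac)
    qed
   qed
  have m: "(%x. abs (u x) powr q) \<in> borel_measurable L" by measurable
  show "integrable L (%x. abs (u x) powr q) & (LINT x|L. abs (u x) powr q) <= suminf c"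
   using integral_suminf_bound[OF m powr_ge_zero G1 G2 G3 sc G4] by auto
 qed
 thus ?thesis ..
qed

abbreviation crit2 :: "'n itself => real" where "crit2 _ \<equiv> 2*real CARD('n)/(real CARD('n) - 2 * s)"

lemma emb_2: "emb 2 1"
 unfolding emb_def
proof (intro ballI impI)
 fix u assume u: "u \<in> H" "hn u <= 1"
 have e: "abs (u x) powr 2 = (u x)^2" for x by (simp add: powr_numeral)
 have "(LINT x|L. (u x)^2) <= 1" using L2_le_hn[of u] power_le_one[OF hn_nonneg u(2), of 2] by linarith
 thus "integrable L (%x. abs (u x) powr 2) & (LINT x|L. abs (u x) powr 2) <= 1"
  using sqiD(2)[OF H_sqi[OF u(1)]] by (simp add: e)
qed

text \<open>Iterating the gain \<open>r \<mapsto> 2 + 2 s r/N\<close> approaches its fixed point,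
  the critical exponent. The iteration is replaced by a supremum argument: from an exponent close to
  the supremum \<open>R \<le> q\<close> one more step would pass beyond \<open>R\<close>, unless
  \<open>q\<close> itself is reached.\<close>

lemma emb_subcritical:
 assumes "2 <= q" "q < crit2 TYPE('n)"
 shows "\<exists>C. emb q C"
proof (rule ccontr)
 assume no: "\<nexists>C. emb q C"
 define N where "N = real CARD('n)"
 have N: "0 < 2 * s" "2 * s < N" using s_pos s_lt_N by (auto simp: N_def)
 define S where "S = {r. 2 <= r & r <= q & (\<exists>C. emb r C)}"
 have S2: "2 \<in> S" using emb_2 assms by (auto simp: S_def)
 have bdd: "bdd_above S" by (auto simp: S_def bdd_above_def)
 define R where "R = Sup S"
 have R: "2 <= R" "R <= q"
  unfolding R_def using cSup_upper[OF S2 bdd] S2 by (auto simp: S_def intro!: cSup_least)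
 have q: "q*(N - 2 * s) < 2*N" using assms N by (simp add: N_def field_simps)
 have gap: "2 + 2 * s * R/N - R > 0"
 proof -
  have "R*(N - 2 * s) <= q*(N - 2 * s)" using R N by (intro mult_right_mono) auto
  thus ?thesis using q N by (simp add: field_simps)
 qed
 \<comment> \<open>Half of the gain available at \<open>R\<close>. The slope \<open>2 s/N\<close> is
   below 1, so starting less than \<open>dl\<close> below \<open>R\<close> still reaches
   \<open>R + dl\<close>.\<close>
 define dl where "dl = (2 + 2 * s * R/N - R)/2"
 obtain r where r: "r \<in> S" "R - dl < r"
  using less_cSupD[of S "R - dl"] S2 gap unfolding R_def[symmetric] dl_def by auto
 have rR: "r <= R" unfolding R_def using r(1) bdd by (rule cSup_upper)
 define t where "t = min q (R + dl)"
 have "2 * s/N < 1" "0 < 2 * s/N" using N by auto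
 hence "2 * s/N*(R - r) < 1*dl"
 proof -
  have "2 * s/N*(R - r) <= 1*(R - r)" using \<open>2 * s / N < 1\<close> rR by (intro mult_right_mono) auto
  moreover have "R - r < dl" using r(2) by linarith
  ultimately show ?thesis by (simp only: mult_1)
 qed
 hence "2 * s * R/N - 2 * s * r/N < dl" by (simp add: right_diff_distrib)
 hence tl: "t < 2 + 2 * s * r/N"
 proof -
  have "t <= R + dl" by (simp add: t_def)
  moreover have "R + dl = 2 + 2 * s * R/N - dl" by (simp add: dl_def field_simps)
  ultimately show ?thesis using \<open>2 * s * R / N - 2 * s * r / N < dl\<close> by linarith
 qed
 have "dl > 0" using gap by (simp add: dl_def)
 hence t2: "2 <= t" using assms R by (auto simp: t_def)
 obtain C where "emb r C" "2 <= r" using r by (auto simp: S_def)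
 then obtain C' where C': "emb t C'" using emb_step[of r C t] tl t2 by (auto simp: N_def)
 hence "t \<in> S" using t2 by (auto simp: S_def t_def)
 hence "t <= R" unfolding R_def using bdd by (rule cSup_upper)
 hence "t = q" using gap by (auto simp: t_def dl_def min_def split: if_splits)
 thus False using C' no by auto
qed

lemma sobolev:
 assumes "2 <= q" "q < crit2 TYPE('n)"
 obtains C where "C > 0" "!!u. u \<in> H ==> integrable L (%x. abs (u x) powr q)"
  "!!u. u \<in> H ==> (LINT x|L. abs (u x) powr q) <= C*hn u powr q"
proof -
 obtain C0 where C0: "emb q C0" using emb_subcritical assms by blast
 define C where "C = max C0 1"
 have "integrable L (%x. abs (u x) powr q) & (LINT x|L. abs (u x) powr q) <= C*hn u powr q" if u: "u \<in> H" for u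
 proof (cases "hn u = 0")
  case True
  hence ae: "AE x in L. abs (u x) powr q = 0" using hn_eq_0_iff[OF u] by auto
  have [measurable]: "u \<in> borel_measurable borel" using u H_meas by auto
  have "integrable L (%x. abs (u x) powr q)"
   using ae by (intro integrable_cong_AE_imp[OF integrable_zero]) auto
  moreover have "(LINT x|L. abs (u x) powr q) = 0" using integral_cong_AE[OF _ _ ae] by auto
  ultimately show ?thesis by (simp add: C_def)
 next
  case False
  hence h: "hn u > 0" using hn_nonneg[of u] by linarith
  let ?v = "%x. (1/hn u)*u x"
  have v: "?v \<in> H" "hn ?v <= 1" using H_scale[OF u, of "1/hn u"] h hn_scale[of "1/hn u" u] by (simp_all only: abs_of_pos divide_pos_pos zero_less_one) auto
  have e: "abs (?v x) powr q = abs (u x) powr q/hn u powr q" for x using h by (simp add: abs_mult powr_divide)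
  have "integrable L (%x. abs (?v x) powr q)" "(LINT x|L. abs (?v x) powr q) <= C0"
   using C0 v unfolding emb_def by blast+
  hence "integrable L (%x. abs (u x) powr q/hn u powr q)" "(LINT x|L. abs (u x) powr q/hn u powr q) <= C"
   unfolding e C_def by (auto simp del: integral_divide_zero)
  moreover have "integrable L (%x. abs (u x) powr q/hn u powr q) = integrable L (%x. abs (u x) powr q)"
   proof
   assume "integrable L (%x. abs (u x) powr q/hn u powr q)"
   from integrable_mult_right[OF this, of "hn u powr q"] show "integrable L (%x. abs (u x) powr q)" using h by simp
  qed simp
  ultimately show ?thesis using h by (auto simp: field_simps)
 qed
 thus ?thesis using that[of C] by (auto simp: C_def)
qed

subsection \<open>Compactness of bounded sequences\<close>

text \<open>Averages over dyadic cubes are bounded scalars, and a diagonal subsequence makes all of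
  them converge. By \<open>avg_L2\<close> the functions differ from their averages by an amount
  uniformly small in the scale, so the subsequence is Cauchy in L2. The integrable weight is
  essential: mass may escape to infinity by translation.\<close>

lemma bounded_seq_AE_subseq:
 fixes u :: "nat => 'n fn"
 assumes u: "!!n. u n \<in> H" "!!n. hn (u n) <= C"
 shows "\<exists>pha v. strict_mono pha & v \<in> borel_measurable borel & (AE x in L. (%n. u (pha n) x) ---> v x) &
   (\<forall>e>0. \<exists>n0. \<forall>n\<ge>n0. \<forall>m\<ge>n0. (LINT x|L. om x*(u (pha n) x - u (pha m) x)^2) <= e)"
proof -
 have C: "C >= 0" using u(2)[of 0] hn_nonneg[of "u 0"] by linarith
 have [measurable]: "u n \<in> borel_measurable borel" for n using u H_meas by auto
 have sq: "(hn (u n))^2 <= C^2" for n using u(2)[of n] hn_nonneg by (intro power_mono) auto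
 have Cb: "abs (cavg k (u n) z) <= 2*((C^2 + 1)/vol k) powr (1/2)" for k n z
 proof (rule cavg_bound)
  have e: "abs (u n x) powr 2 = (u n x)^2" for x by (simp add: powr_numeral)
  show "integrable L (%x. abs (u n x) powr 2)" using H_sqi[OF u(1)] by (simp add: e sqiD)
  show "(LINT x|L. abs (u n x) powr 2) <= C^2 + 1" using L2_le_hn[of "u n"] sq[of n] by (simp add: e)
 qed (use H_sqi[OF u(1)] in \<open>auto simp: add_nonneg_pos\<close>)
 define dec :: "nat => nat \<times> (int^'n)" where "dec = from_nat"
 have dec: "dec (to_nat z) = z" for z by (simp add: dec_def)
 interpret subseqs "%i pha. convergent (%n. cavg (fst (dec i)) (u (pha n)) (snd (dec i)))"
 proof
  fix i and pha :: "nat => nat"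
  have "bounded (range (%n. cavg (fst (dec i)) (u (pha n)) (snd (dec i))))"
   using Cb by (auto simp: bounded_iff)
  then obtain l psa where "strict_mono psa" "((%n. cavg (fst (dec i)) (u (pha n)) (snd (dec i))) \<circ> psa) ---> l"
   using bounded_imp_convergent_subsequence by metis
  thus "\<exists>psa. strict_mono psa & convergent (%n. cavg (fst (dec i)) (u ((pha \<circ> psa) n)) (snd (dec i)))"
   by (intro exI[of _ psa]) (auto simp: convergent_def comp_def)
 qed
 have conv: "convergent (%n. cavg k (u (diagseq n)) z)" for k z
 proof -
  have "convergent (%n. cavg (fst (dec (to_nat (k, z)))) (u ((diagseq \<circ> ((+) (Suc (to_nat (k, z))))) n)) (snd (dec (to_nat (k, z)))))"
  proof (rule diagseq_holds)
   fix x and s :: "nat => nat" and r :: "nat => nat"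
   assume "strict_mono r" "convergent (%n. cavg (fst (dec x)) (u (s n)) (snd (dec x)))"
   thus "convergent (%n. cavg (fst (dec x)) (u ((s \<circ> r) n)) (snd (dec x)))"
    using convergent_subseq_convergent[of "%n. cavg (fst (dec x)) (u (s n)) (snd (dec x))" r] by (simp add: comp_def)
  qed
  hence "convergent (%n. cavg k (u (diagseq (n + Suc (to_nat (k, z))))) z)" by (simp add: dec comp_def add.commute)
  thus ?thesis by (rule convergent_ignore_initial_segment[THEN iffD1])
 qed
 define v where "v n = u (diagseq n)" for n
 have v: "v n \<in> H" "hn (v n) <= C" "(hn (v n))^2 <= C^2" for n using u sq by (auto simp: v_def)
 have [measurable]: "v n \<in> borel_measurable borel" for n by (simp add: v_def)
 define lim_avg where "lim_avg k x = lim (%n. avg k (v n) x)" for k x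
 have la: "(%n. avg k (v n) x) ---> lim_avg k x" for k x
  using conv by (simp add: avg_def v_def lim_avg_def convergent_LIMSEQ_iff)
 have [measurable]: "lim_avg k \<in> borel_measurable borel" for k
  by (rule borel_measurable_LIMSEQ_real[OF la]) auto
 define K where "K k = 2*((C^2 + 1)/vol k) powr (1/2)" for k
 have Kb: "abs (avg k (v n) x) <= K k" for k n x using Cb by (simp add: avg_def v_def K_def)
 have Kl: "abs (lim_avg k x) <= K k" for k x
  using LIMSEQ_le_const2[OF tendsto_rabs[OF la]] Kb by blast
 have K0: "K k >= 0" for k by (simp add: K_def)
 have wint: "integrable L (%x. om x*(g x)^2)" if "g \<in> borel_measurable borel" "!!x. abs (g x) <= B" for g :: "'n fn" and B
 proof (rule integrable_boundI)
  show "integrable L (%x. om x*B^2)" using om_integrable by simp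
  show "abs (om x*(g x)^2) <= om x*B^2" for x
   using power_mono[OF that(2)[of x], of 2] om_pos[of x] by (simp add: abs_mult)
 qed (use that in measurable)
 have wint2: "integrable L (%x. om x*(g x)^2)" if "sqi L g" for g :: "'n fn"
 proof (rule integrable_boundI)
  show "integrable L (%x. (g x)^2)" using that by (rule sqiD)
  show "abs (om x*(g x)^2) <= (g x)^2" for x
   using om_pos[of x] om_le_1[of x] by (simp add: abs_mult mult_left_le_one_le)
 qed (use that in \<open>auto simp: sqi_def\<close>)
 have wle: "(LINT x|L. om x*(g x)^2) <= (LINT x|L. (g x)^2)" if "sqi L g" for g :: "'n fn"
  using that wint2[OF that] om_pos om_le_1
  by (intro integral_mono) (auto simp: sqiD mult_left_le_one_le less_imp_le)
 have avlim: "(%n. LINT x|L. om x*(avg k (v n) x - lim_avg k x)^2) ---> 0" for k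
 proof -
  have "(%n. LINT x|L. om x*(avg k (v n) x - lim_avg k x)^2) ---> (LINT x|L. 0)"
  proof (rule integral_dominated_convergence[where w="%x. om x*(2*K k)^2"])
   show "AE x in L. (%n. om x*(avg k (v n) x - lim_avg k x)^2) ---> 0"
    using la by (auto intro!: AE_I2 tendsto_eq_intros)
   show "AE x in L. norm (om x*(avg k (v n) x - lim_avg k x)^2) <= om x*(2*K k)^2" for n
   proof (intro AE_I2)
    fix x
    have "abs (avg k (v n) x - lim_avg k x) <= abs (2*K k)" using Kb[of k n x] Kl[of k x] by linarith
    hence "(avg k (v n) x - lim_avg k x)^2 <= (2*K k)^2" by (rule abs_le_square_iff[THEN iffD1])
    thus "norm (om x*(avg k (v n) x - lim_avg k x)^2) <= om x*(2*K k)^2"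
     using om_pos[of x] by (simp add: abs_mult)
   qed
  qed (use om_integrable in auto)
  thus ?thesis by simp
 qed
 define c where "c = real CARD('n) powr dd*C^2"
 have av2: "(LINT x|L. (v n x - avg k (v n) x)^2) <= c*(2 powr (- 2 * s)) ^ k" for n k
 proof -
  have "(LINT x|L. (v n x - avg k (v n) x)^2) <= real CARD('n) powr dd*2 powr (- 2 * s * k)*C^2"
   using df_le_hn[of "v n"] v(3)[of n] by (intro order_trans[OF avg_L2(2)[OF v(1)]] mult_left_mono) auto
  thus ?thesis by (simp add: c_def powr_realpow[symmetric] powr_powr mult_ac)
 qed
 have cauchy: "\<exists>n0. \<forall>n\<ge>n0. \<forall>m\<ge>n0. (LINT x|L. om x*(v n x - v m x)^2) <= e" if e: "e > 0" for e
 proof -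
  have "(%k. c*(2 powr (- 2 * s)) ^ k) ---> c*0"
   using s_pos by (intro tendsto_intros LIMSEQ_power_zero) (simp add: powr_less_one)
  hence "\<forall>\<^sub>F k in sequentially. c*(2 powr (- 2 * s)) ^ k < e/16" using e by (intro order_tendstoD(2)) auto
  then obtain k where k: "c*(2 powr (- 2 * s)) ^ k < e/16" by (auto simp: eventually_sequentially)
  have "\<forall>\<^sub>F n in sequentially. (LINT x|L. om x*(avg k (v n) x - lim_avg k x)^2) < e/16"
   using avlim[of k] e by (intro order_tendstoD(2)) auto
  then obtain n0 where n0: "!!n. n >= n0 ==> (LINT x|L. om x*(avg k (v n) x - lim_avg k x)^2) < e/16"
   by (auto simp: eventually_sequentially)
  show ?thesis
  proof (intro exI[of _ n0] allI impI)
   fix n m assume nm: "n >= n0" "m >= n0"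
   let ?d = "%n x. v n x - avg k (v n) x" and ?l = "%n x. avg k (v n) x - lim_avg k x"
   have sd: "sqi L (?d n)" for n using avg_L2(1)[OF v(1)] .
   have id: "integrable L (%x. om x*(?d n x)^2)" for n by (rule wint2[OF sd])
   have il: "integrable L (%x. om x*(?l n x)^2)" for n
   proof (rule wint[where B="2*K k"])
    show "abs (avg k (v n) x - lim_avg k x) <= 2*K k" for x using Kb[of k n x] Kl[of k x] by linarith
   qed measurable
   have pt: "om x*(v n x - v m x)^2 <= 4*(om x*(?d n x)^2) + 4*(om x*(?l n x)^2) + 4*(om x*(?l m x)^2) + 4*(om x*(?d m x)^2)" for x
   proof -
    have q4: "(a + b - c - d)^2 <= 4*a^2 + 4*b^2 + 4 * c^2 + 4*d^2" for a b c d :: real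
    proof -
     have "4*a^2 + 4*b^2 + 4 * c^2 + 4*d^2 - (a + b - c - d)\<^sup>2 = (a - b)^2 + (a + c)^2 + (a + d)^2 + (b + c)^2 + (b + d)^2 + (c - d)^2"
      by (simp add: power2_eq_square algebra_simps)
     thus ?thesis by (smt (verit) zero_le_power2)
    qed
    have "(v n x - v m x)^2 <= 4*(?d n x)^2 + 4*(?l n x)^2 + 4*(?l m x)^2 + 4*(?d m x)^2"
     using q4[of "?d n x" "?l n x" "?l m x" "?d m x"] by (simp add: algebra_simps)
    thus ?thesis using mult_left_mono[OF _ less_imp_le[OF om_pos[of x]]] by (fastforce simp: algebra_simps)
   qed
   have "(LINT x|L. om x*(v n x - v m x)^2) <= (LINT x|L. 4*(om x*(?d n x)^2) + 4*(om x*(?l n x)^2) + 4*(om x*(?l m x)^2) + 4*(om x*(?d m x)^2))"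
    using pt id il wint2[OF sqi_diff[OF H_sqi[OF v(1)[of n]] H_sqi[OF v(1)[of m]]]]
    by (intro integral_mono Bochner_Integration.integrable_add integrable_mult_right) auto
   also have "... = 4*(LINT x|L. om x*(?d n x)^2) + 4*(LINT x|L. om x*(?l n x)^2) + 4*(LINT x|L. om x*(?l m x)^2) + 4*(LINT x|L. om x*(?d m x)^2)"
    using id il by simp
   also have "... <= e"
    using n0[OF nm(1)] n0[OF nm(2)] wle[OF sd[of n]] wle[OF sd[of m]] av2[of n k] av2[of m k] k by linarith
   finally show "(LINT x|L. om x*(v n x - v m x)^2) <= e" .
  qed
 qed
 \<comment> \<open>The rate \<open>(1/4)^j\<close> for squared weighted distances makes the weighted
   L1 distances of consecutive terms of order \<open>(1/2)^j\<close>, hence summable, which gives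
   convergence almost everywhere.\<close>
 have "\<forall>j. \<exists>n0. \<forall>n\<ge>n0. \<forall>m\<ge>n0. (LINT x|L. om x*(v n x - v m x)^2) <= (1/4) ^ j"
  by (intro allI cauchy) simp
 from choice[OF this] obtain f where
  f: "!!j n m. n >= f j ==> m >= f j ==> (LINT x|L. om x*(v n x - v m x)^2) <= (1/4) ^ j" by auto
 define g where "g = rec_nat (f 0) (%j r. max (Suc r) (f (Suc j)))"
 have g: "g (Suc j) > g j" "g j >= f j" for j by (auto simp: g_def) (cases j; simp add: g_def)
 have gm: "strict_mono g" using g(1) by (simp add: strict_mono_Suc_iff)
 define d where "d j x = v (g (Suc j)) x - v (g j) x" for j x
 have dH: "sqi L (d j)" for j unfolding d_def[abs_def] by (intro sqi_diff H_sqi v)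
 have [measurable]: "d j \<in> borel_measurable borel" for j unfolding d_def by measurable
 have d1: "integrable L (%x. om x*abs (d j x)) & (LINT x|L. om x*abs (d j x)) <= (1/2) ^ j*((LINT x|L. om x) + 1)" for j
 proof -
  have b: "abs (om x*abs (d j x)) <= (1/2) ^ j * om x + 2 ^ j*(om x*(d j x)^2)" for x
  proof -
   have "0 <= (1 - 2 ^ j*abs (d j x))^2" by simp
   hence "2*(2 ^ j*abs (d j x)) <= 1 + (2 ^ j)^2*(d j x)^2" by (simp add: power2_diff power_mult_distrib)
   hence "2 ^ j*abs (d j x) <= 1 + (2 ^ j)^2*(d j x)^2"
   proof -
    have "0 <= 2 ^ j*abs (d j x)" by simp
    thus ?thesis using \<open>2 * (2 ^ j * abs (d j x)) <= _\<close> by linarith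
   qed
   hence "abs (d j x) <= (1/2) ^ j + 2 ^ j*(d j x)^2" by (simp add: power_one_over field_simps power2_eq_square)
   hence "om x*abs (d j x) <= om x*((1/2) ^ j + 2 ^ j*(d j x)^2)" using om_pos[of x] by (intro mult_left_mono) auto
   thus ?thesis using om_pos[of x] by (simp add: abs_mult algebra_simps)
  qed
  have i2: "integrable L (%x. (1/2) ^ j * om x + 2 ^ j*(om x*(d j x)^2))"
   using om_integrable wint2[OF dH] by simp
  have i1: "integrable L (%x. om x*abs (d j x))" by (rule integrable_boundI[OF i2 _ b]) measurable
  have "(LINT x|L. om x*abs (d j x)) <= (LINT x|L. (1/2) ^ j * om x + 2 ^ j*(om x*(d j x)^2))"
   using b by (intro integral_mono i1 i2) (auto simp: abs_le_iff)
  also have "... = (1/2) ^ j*(LINT x|L. om x) + 2 ^ j*(LINT x|L. om x*(d j x)^2)"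
   using om_integrable wint2[OF dH] by simp
  also have "... <= (1/2) ^ j*(LINT x|L. om x) + 2 ^ j*(1/4) ^ j"
   unfolding d_def using f[of j "g (Suc j)" "g j"] g[of j] by (intro add_left_mono mult_left_mono) auto
  also have "2 ^ j*(1/4::real) ^ j = (1/2) ^ j" by (simp add: power_mult_distrib[symmetric])
  finally show ?thesis using i1 by (simp add: algebra_simps)
 qed
 have ae: "AE x in L. summable (%j. abs (d j x))"
 proof -
  have "(\<integral>\<^sup>+x. (\<Sum>j. ennreal (om x*abs (d j x))) \<partial>L) = (\<Sum>j. \<integral>\<^sup>+x. ennreal (om x*abs (d j x)) \<partial>L)"
   by (intro nn_integral_suminf) measurable
  also have "... <= (\<Sum>j. ennreal ((1/2) ^ j*((LINT x|L. om x) + 1)))"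
   using d1 om_pos by (intro suminf_le) (auto simp: nn_integral_eq_integral less_imp_le intro!: ennreal_leI)
  also have "... < \<infinity>"
  proof -
   have "(LINT x|L. om x) >= 0" by (intro Bochner_Integration.integral_nonneg) (simp add: less_imp_le om_pos)
   hence "(\<Sum>j. ennreal ((1/2) ^ j*((LINT x|L. om x) + 1))) = ennreal (\<Sum>j. (1/2) ^ j*((LINT x|L. om x) + 1))"
    by (intro suminf_ennreal2 summable_mult2 summable_geometric) auto
   thus ?thesis by simp
  qed
  finally have "(\<integral>\<^sup>+x. (\<Sum>j. ennreal (om x*abs (d j x))) \<partial>L) ~= \<infinity>" by simp
  hence "AE x in L. (\<Sum>j. ennreal (om x*abs (d j x))) ~= \<infinity>"
   by (intro nn_integral_noteq_infinite) measurable
  thus ?thesis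
  proof eventually_elim
   case (elim x)
   have "summable (%j. om x*abs (d j x))"
    using elim om_pos[of x] by (intro summable_suminf_not_top) (auto simp: less_imp_le)
   thus ?case using om_pos[of x] summable_mult_D[of "om x" "%j. abs (d j x)"] by auto
  qed
 qed
 have ae2: "AE x in L. convergent (%j. v (g j) x)"
  using ae
 proof eventually_elim
  case (elim x)
  hence "summable (%j. d j x)" by (rule summable_rabs_cancel)
  hence "convergent (%n. \<Sum>j<n. d j x)" by (simp add: summable_iff_convergent)
  hence "convergent (%n. (\<Sum>j<n. d j x) + v (g 0) x)" by (simp add: convergent_add_const_right_iff)
  moreover have "(\<Sum>j<n. d j x) + v (g 0) x = v (g n) x" for n
   unfolding d_def using sum_lessThan_telescope[of "%j. v (g j) x" n] by simp
  ultimately show ?case by simp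
 qed
 define w where "w x = lim (%j. v (g j) x)" for x
 show ?thesis
 proof (intro exI[of _ "diagseq \<circ> g"] exI[of _ w] conjI allI impI)
  show "strict_mono (diagseq \<circ> g)" using subseq_diagseq gm by (rule strict_mono_o)
  show "w \<in> borel_measurable borel" unfolding w_def by measurable
  show "AE x in L. (%n. u ((diagseq \<circ> g) n) x) ---> w x"
   using ae2 by eventually_elim (simp add: w_def v_def convergent_LIMSEQ_iff)
  fix e :: real assume "e > 0"
  then obtain n0 where n0: "\<forall>n\<ge>n0. \<forall>m\<ge>n0. (LINT x|L. om x*(v n x - v m x)^2) <= e" using cauchy by blast
  show "\<exists>n0. \<forall>n\<ge>n0. \<forall>m\<ge>n0. (LINT x|L. om x*(u ((diagseq \<circ> g) n) x - u ((diagseq \<circ> g) m) x)^2) <= e"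

  proof (intro exI[of _ n0] allI impI)
   fix n m assume "n0 <= n" "n0 <= m"
   hence "n0 <= g n" "n0 <= g m" using seq_suble[OF gm, of n] seq_suble[OF gm, of m] by auto
   thus "(LINT x|L. om x*(u ((diagseq \<circ> g) n) x - u ((diagseq \<circ> g) m) x)^2) <= e"
    using n0 by (simp add: v_def)
  qed
 qed
qed

text \<open>Convergence almost everywhere passes to the difference quotients on the product space,
  so \<open>weak_sqi\<close> applies to both parts of the inner product. The norm bound follows by
  testing with the limit itself.\<close>

lemma weak_limit:
 assumes "!!n. u n \<in> H" "!!n. hn (u n) <= C" "v \<in> borel_measurable borel" "AE x in L. (%n. u n x) ---> v x"
 shows "v \<in> H" "g \<in> H ==> (%n. ip (u n) g) ---> ip v g" "hn v <= C"
proof -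
 have C: "C >= 0" using assms(2)[of 0] hn_nonneg[of "u 0"] by linarith
 have sq: "(hn (u n))^2 <= C^2" for n using assms(2)[of n] hn_nonneg by (intro power_mono) auto
 have b: "(LINT x|L. (u n x)^2) <= C^2" "(LINT z|LL. (df (u n) z)^2) <= C^2" for n
  using sq[of n] L2_le_hn[of "u n"] df_le_hn[of "u n"] by auto
 have ae: "AE z in LL. (%n. df (u n) z) ---> df v z"
  using AE_LL[OF assms(4)]
 proof eventually_elim
  case (elim z)
  have "(%n. (u n (fst z) - u n (snd z))/norm (fst z - snd z) powr (dd/2)) ---> (v (fst z) - v (snd z))/norm (fst z - snd z) powr (dd/2)"
   using elim unfolding divide_inverse by (intro tendsto_intros)
  thus ?case by (simp add: df_def)
 qed
 have s1: "sqi L v" using fatou_sqi(1)[OF H_sqi[OF assms(1)] assms(4) _ b(1)] assms(3) by simp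
 have s2: "sqi LL (df v)" using fatou_sqi(1)[OF H_sqi_df[OF assms(1)] ae _ b(2)] assms(3) by simp
 show vH: "v \<in> H" using s1 s2 by (simp add: H_iff)
 show w: "(%n. ip (u n) g) ---> ip v g" if "g \<in> H" for g
  unfolding ip_def
  using weak_sqi[OF H_sqi[OF assms(1)] assms(4) s1 H_sqi[OF that] b(1)]
   weak_sqi[OF H_sqi_df[OF assms(1)] ae s2 H_sqi_df[OF that] b(2)] by (rule tendsto_add)
 have "(hn v)^2 <= C*hn v"
  unfolding hn_sq
 proof (rule LIMSEQ_le_const2[OF w[OF vH]], intro exI allI impI)
  fix n show "ip (u n) v <= C*hn v"
   using ip_CS[OF assms(1) vH, of n] mult_right_mono[OF assms(2)[of n] hn_nonneg[of v]] by linarith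
 qed
 thus "hn v <= C" using hn_nonneg[of v] C by (cases "hn v = 0") (auto simp: power2_eq_square)
qed

lemma rellich:
 assumes u: "!!n. u n \<in> H" "!!n. hn (u n) <= C"
 obtains pha v where "strict_mono (pha :: nat => nat)" "v \<in> H" "hn v <= C" "AE x in L. (%n. u (pha n) x) ---> v x"
  "(%n. LINT x|L. om x*(u (pha n) x - v x)^2) ---> 0" "!!g. g \<in> H ==> (%n. ip (u (pha n)) g) ---> ip v g"
proof -
 obtain pha v where pha: "strict_mono pha" "v \<in> borel_measurable borel" "AE x in L. (%n. u (pha n) x) ---> v x"
  and cau: "!!e. e > 0 ==> \<exists>n0. \<forall>n\<ge>n0. \<forall>m\<ge>n0. (LINT x|L. om x*(u (pha n) x - u (pha m) x)^2) <= e"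
  using bounded_seq_AE_subseq[of u C, OF u] by blast
 note w = weak_limit[of "%n. u (pha n)", OF u(1) u(2) pha(2,3)]
 have sw: "sqi L (%x. sqrt (om x)*g x)" if "sqi L g" for g :: "'n fn"
  using that om_le_1 om_pos by (intro sqi_mono[OF that]) (auto simp: sqi_def abs_mult less_imp_le intro!: mult_left_le_one_le)
 have e: "(sqrt (om x)*t)^2 = om x*t^2" for x t by (simp add: power_mult_distrib less_imp_le om_pos)
 have "(%n. LINT x|L. om x*(u (pha n) x - v x)^2) ---> 0"
 proof (rule LIMSEQ_I)
  fix r :: real assume r: "r > 0"
  then obtain n0 where n0: "!!n m. n >= n0 ==> m >= n0 ==> (LINT x|L. om x*(u (pha n) x - u (pha m) x)^2) <= r/2"
   using cau[of "r/2"] by auto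
  have "(LINT x|L. om x*(u (pha n) x - v x)^2) <= r/2" if n: "n >= n0" for n
  proof -
   have "(LINT x|L. (sqrt (om x)*(u (pha n) x - v x))^2) <= r/2"
   proof (rule fatou_sqi(2)[where f="%m x. sqrt (om x)*(u (pha n) x - u (pha (m + n0)) x)"])
    show "AE x in L. (%m. sqrt (om x)*(u (pha n) x - u (pha (m + n0)) x)) ---> sqrt (om x)*(u (pha n) x - v x)"
     using pha(3) by eventually_elim (intro tendsto_intros LIMSEQ_ignore_initial_segment)
    show "(LINT x|L. (sqrt (om x)*(u (pha n) x - u (pha (m + n0)) x))^2) <= r/2" for m
     using n0[OF n, of "m + n0"] by (simp add: e)
    show "sqi L (%x. sqrt (om x)*(u (pha n) x - u (pha (m + n0)) x))" for m
     by (intro sw sqi_diff H_sqi u)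
    show "(%x. sqrt (om x)*(u (pha n) x - v x)) \<in> borel_measurable L"
     using sw[OF sqi_diff[OF H_sqi[OF u(1)] H_sqi[OF w(1)]]] by (auto simp: sqi_def)
   qed
   thus ?thesis by (simp add: e)
  qed
  thus "\<exists>n0. \<forall>n\<ge>n0. norm ((LINT x|L. om x*(u (pha n) x - v x)^2) - 0) < r"
  proof (intro exI[of _ n0] allI impI)
   fix n assume "n >= n0"
   have "0 <= (LINT x|L. om x*(u (pha n) x - v x)^2)"
    by (intro Bochner_Integration.integral_nonneg mult_nonneg_nonneg) (auto simp: less_imp_le om_pos)
   thus "norm ((LINT x|L. om x*(u (pha n) x - v x)^2) - 0) < r"
    using \<open>!!n. n >= n0 ==> _ <= r / 2\<close>[OF \<open>n >= n0\<close>] r by simp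
  qed
 qed
 thus ?thesis using that[OF pha(1) w(1) w(3) pha(3)] w(2) by blast
qed

text \<open>The limit almost everywhere along a subsequence is the candidate; weak lower
  semicontinuity, applied to the differences \<open>u n - u m\<close> as \<open>m\<close> grows,
  turns it into a norm limit.\<close>

lemma H_complete:
 assumes u: "!!n. u n \<in> H" and cau: "!!e. e > 0 ==> \<exists>n0. \<forall>n\<ge>n0. \<forall>m\<ge>n0. hn (%x. u n x - u m x) <= e"
 obtains v where "v \<in> H" "(%n. hn (%x. u n x - v x)) ---> 0"
proof -
 obtain n0 where n0: "!!n. n >= n0 ==> hn (%x. u n x - u n0 x) <= 1" using cau[of 1] by auto
 define C where "C = 1 + hn (u n0)"
 have b: "hn (u (n + n0)) <= C" for n
  using n0[of "n + n0"] hn_triangle[OF H_diff[OF u[of "n + n0"] u[of n0]] u[of n0]] by (simp add: C_def)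
 obtain pha v where pha: "strict_mono pha" "v \<in> H" "AE x in L. (%n. u (pha n + n0) x) ---> v x"
  by (rule rellich[of "%n. u (n + n0)" C]) (use u b in auto)
 have "(%n. hn (%x. u n x - v x)) ---> 0"
 proof (rule LIMSEQ_I)
  fix r :: real assume r: "r > 0"
  then obtain n1 where n1: "!!n m. n >= n1 ==> m >= n1 ==> hn (%x. u n x - u m x) <= r/2"
   using cau[of "r/2"] by auto
  have "hn (%x. u n x - v x) <= r/2" if n: "n >= n1" for n
  proof (rule weak_limit(3)[where u="%m x. u n x - u (pha (m + n1) + n0) x"])
   show "hn (%x. u n x - u (pha (m + n1) + n0) x) <= r/2" for m
    using n1[OF n, of "pha (m + n1) + n0"] seq_suble[OF pha(1), of "m + n1"] by linarith
   show "AE x in L. (%m. u n x - u (pha (m + n1) + n0) x) ---> u n x - v x"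
    using pha(3)
   proof eventually_elim
    case (elim x)
    thus ?case using LIMSEQ_ignore_initial_segment[OF elim, of n1] by (intro tendsto_intros)
   qed
  qed (use H_diff[OF u pha(2)] H_diff[OF u u] H_meas in auto)
  thus "\<exists>n1. \<forall>n\<ge>n1. norm (hn (%x. u n x - v x) - 0) < r"
  proof (intro exI[of _ n1] allI impI)
   fix n assume "n >= n1"
   show "norm (hn (%x. u n x - v x) - 0) < r"
    using \<open>!!n. n >= n1 ==> _ <= r / 2\<close>[OF \<open>n >= n1\<close>] r hn_nonneg[of "%x. u n x - v x"] by simp
  qed
 qed
 thus ?thesis using that pha(2) by blast
qed

end

section \<open>Elementary inequalities for real powers\<close>

lemma powr_diff_le:
 fixes x y r :: real
 assumes "r >= 1" "x >= 0" "y >= 0"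
 shows "abs (x powr r - y powr r) <= r*(x + y) powr (r - 1)*abs (x - y)"
proof -
 have *: "y powr r - x powr r <= r*(x + y) powr (r - 1)*(y - x)" if "0 <= x" "x < y" for x y :: real
 proof (cases "x = 0")
  case True
  thus ?thesis using that assms mult_right_mono[of 1 r "y powr r"] powr_add[of y "r - 1" 1] by (simp add: mult.assoc)
 next
  case False
  hence "0 < x" using that by simp
  obtain z where z: "x < z" "z < y" "y powr r - x powr r = (y - x)*(r*z powr (r - 1))"
  proof -
   have "((%x. x powr r) has_real_derivative r*t powr (r - 1)) (at t)" if "x <= t" for t
    using that \<open>0 < x\<close> by (auto intro!: derivative_eq_intros)
   thus ?thesis using that MVT2[of x y "%x. x powr r" "%x. r*x powr (r - 1)"] \<open>x < y\<close> by metis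
  qed
  have "z powr (r - 1) <= (x + y) powr (r - 1)" using z \<open>0 < x\<close> assms by (intro powr_mono2) auto
  hence "(y - x)*(r*z powr (r - 1)) <= (y - x)*(r*(x + y) powr (r - 1))"
   using that assms by (intro mult_left_mono) auto
  thus ?thesis using z by (simp add: mult_ac)
 qed
 have m: "a <= b ==> a powr r <= b powr r" if "0 <= a" for a b using that assms by (intro powr_mono2) auto
 consider "x = y" | "x < y" | "y < x" by linarith
 thus ?thesis
  using *[of x y] *[of y x] m[of x y] m[of y x] assms by cases (auto simp: add.commute)
qed

lemma pos_powr_diff_le:
 fixes x y r :: real
 assumes "r >= 1"
 shows "abs (max x 0 powr r - max y 0 powr r) <= r*(abs x + abs y) powr (r - 1)*abs (x - y)"
proof -
 have "abs (max x 0 powr r - max y 0 powr r) <= r*(max x 0 + max y 0) powr (r - 1)*abs (max x 0 - max y 0)"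
  using assms by (intro powr_diff_le) auto
 also have "... <= r*(abs x + abs y) powr (r - 1)*abs (x - y)"
  using assms by (intro mult_mono powr_mono2 mult_nonneg_nonneg add_mono) (auto simp: max_def)
 finally show ?thesis .
qed

lemma DERIV_pos_powr:
 fixes x p :: real
 assumes "p > 1"
 shows "((%x. max x 0 powr (p + 1)) has_real_derivative (p + 1)*max x 0 powr p) (at x)"
proof -
 consider "x > 0" | "x < 0" | "x = 0" by linarith
 thus ?thesis
 proof cases
  case 1
  have "((%x. x powr (p + 1)) has_real_derivative (p + 1)*x powr p) (at x)"
   using 1 by (auto intro!: derivative_eq_intros)
  hence "((%x. max x 0 powr (p + 1)) has_real_derivative (p + 1)*x powr p) (at x)"
   by (rule has_field_derivative_transform_within_open[of _ _ _ "{0<..}"]) (use 1 in auto)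
  thus ?thesis using 1 by simp
 next
  case 2
  have "((%x. max x 0 powr (p + 1)) has_real_derivative 0) (at x)"
   by (rule has_field_derivative_transform_within_open[of "%x. 0" _ _ "{..<0}"]) (use 2 in auto)
  thus ?thesis using 2 by simp
 next
  case 3
  have "((%h. max h 0 powr (p + 1)/h) \<longlongrightarrow> 0) (at 0)"
  proof (rule tendsto_0_le[where K=1])
   show "((%h. abs h powr p) \<longlongrightarrow> 0) (at (0::real))"
    using assms by (intro tendsto_eq_intros tendsto_zero_powrI) auto
   have "norm (max h 0 powr (p + 1)/h) <= norm (abs h powr p)*1" for h :: real
    by (cases "h > 0") (auto simp: max_def powr_add)
   thus "\<forall>\<^sub>F h in at 0. norm (max h 0 powr (p + 1)/h) <= norm (abs h powr p)*1" by simp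
  qed
  thus ?thesis using 3 by (simp add: has_field_derivative_iff)
 qed
qed

lemma pos_powr_taylor:
 fixes t h p :: real
 assumes "p > 1"
 shows "abs (max (t + h) 0 powr (p + 1) - max t 0 powr (p + 1) - (p + 1)*max t 0 powr p*h)
   <= (p + 1)*p*2 powr (p - 1)*(abs t + abs h) powr (p - 1)*h^2"
proof -
 let ?F = "%x. max x 0 powr (p + 1)" and ?F' = "%x. (p + 1)*max x 0 powr p"
 have "\<exists>z. abs (z - t) <= abs h & ?F (t + h) - ?F t = h*?F' z"
 proof -
  consider "h = 0" | "h > 0" | "h < 0" by linarith
  thus ?thesis
  proof cases
   case 2
   obtain z where "t < z" "z < t + h" "?F (t + h) - ?F t = (t + h - t)*?F' z"
    using MVT2[of t "t + h" ?F ?F'] 2 DERIV_pos_powr[OF assms] by auto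
   thus ?thesis by (intro exI[of _ z]) auto
  next
   case 3
   obtain z where "t + h < z" "z < t" "?F t - ?F (t + h) = (t - (t + h))*?F' z"
    using MVT2[of "t + h" t ?F ?F'] 3 DERIV_pos_powr[OF assms] by auto
   thus ?thesis by (intro exI[of _ z]) auto
  qed auto
 qed
 then obtain z where z: "abs (z - t) <= abs h" "?F (t + h) - ?F t = h*?F' z" by blast
 have "?F (t + h) - ?F t - (p + 1)*max t 0 powr p*h = (p + 1)*(max z 0 powr p - max t 0 powr p)*h"
  using z(2) by (simp add: algebra_simps)
 hence "abs (?F (t + h) - ?F t - (p + 1)*max t 0 powr p*h) = (p + 1)*abs (max z 0 powr p - max t 0 powr p)*abs h"
  using assms by (simp add: abs_mult)
 also have "... <= (p + 1)*(p*(abs z + abs t) powr (p - 1)*abs (z - t))*abs h"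
  using assms pos_powr_diff_le[of p z t] by (intro mult_right_mono mult_left_mono) auto
 also have "... <= (p + 1)*(p*(2*(abs t + abs h)) powr (p - 1)*abs h)*abs h"
  using assms z(1) by (intro mult_right_mono mult_left_mono mult_mono powr_mono2 mult_nonneg_nonneg) auto
 also have "... = (p + 1)*p*2 powr (p - 1)*(abs t + abs h) powr (p - 1)*h^2"
 proof -
  have "abs h*abs h = h^2" by (simp add: power2_eq_square)
  moreover have "(2*(abs t + abs h)) powr (p - 1) = 2 powr (p - 1)*(abs t + abs h) powr (p - 1)" by (rule powr_mult)
  ultimately show ?thesis by (simp only: mult.assoc)
 qed
 finally show ?thesis .
qed

text \<open>Young's inequality with a free small constant, obtained by comparing \<open>y\<close>
  with \<open>ep * x\<close> instead of optimising.\<close>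

lemma powr_mult_split:
 fixes x y p ep :: real
 assumes "p > 0" "ep > 0" "x >= 0" "y >= 0"
 shows "x powr p*y <= ep*x powr (p + 1) + (1/ep) powr p*y powr (p + 1)"
proof (cases "y <= ep*x")
 case True
 have "x powr p*y <= x powr p*(ep*x)" using True by (intro mult_left_mono) auto
 also have "... = ep*x powr (p + 1)" using assms by (cases "x = 0") (auto simp: powr_add)
 finally show ?thesis by (simp add: add_increasing2)
next
 case False
 hence "x <= 1/ep*y" using assms by (simp add: field_simps)
 hence "x powr p <= (1/ep) powr p*y powr p"
  using assms powr_mono2[of p x "1/ep*y"] by (simp only: powr_mult)
 hence "x powr p*y <= (1/ep) powr p*y powr p*y" using assms by (intro mult_right_mono) auto
 also have "... = (1/ep) powr p*y powr (p + 1)" using assms by (cases "y = 0") (auto simp: powr_add)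
 finally show ?thesis using assms by (simp add: add_increasing)
qed

lemma powr_add_le:
 fixes x y r :: real assumes "x >= 0" "y >= 0" "r >= 0"
 shows "(x + y) powr r <= 2 powr r*(x powr r + y powr r)"
proof -
 have "(x + y) powr r <= (2*max x y) powr r" using assms by (intro powr_mono2) auto
 also have "... = 2 powr r*max x y powr r" using assms by (simp add: powr_mult)
 also have "max x y powr r <= x powr r + y powr r" by (simp add: max_def)
 finally show ?thesis by simp
qed

section \<open>The nonlinear term of the energy\<close>

locale nonlinear = frac_sobolev s dd n_type for s dd and n_type :: "'n::finite itself" +
 fixes p :: real
 assumes p_gt_1: "1 < p" and p_sub: "p < (real CARD('n) + 2 * s)/(real CARD('n) - 2 * s)"
begin

lemma p1_subcritical: "p + 1 < crit2 TYPE('n)"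
 using p_sub s_lt_N by (simp add: field_simps)

definition Sq :: real where
 "Sq = (SOME C. C > 0 & (\<forall>u\<in>H. integrable L (%x. abs (u x) powr (p + 1)) & (LINT x|L. abs (u x) powr (p + 1)) <= C*hn u powr (p + 1)))"

lemma Sq_props: "Sq > 0 & (\<forall>u\<in>H. integrable L (%x. abs (u x) powr (p + 1)) & (LINT x|L. abs (u x) powr (p + 1)) <= Sq*hn u powr (p + 1))"
 unfolding Sq_def
proof (rule someI_ex)
 obtain C where "C > 0" "!!u. u \<in> H ==> integrable L (%x. abs (u x) powr (p + 1))"
  "!!u. u \<in> H ==> (LINT x|L. abs (u x) powr (p + 1)) <= C*hn u powr (p + 1)"
  using sobolev[of "p + 1"] p1_subcritical p_gt_1 by auto
 thus "\<exists>C. C > 0 & (\<forall>u\<in>H. integrable L (%x. abs (u x) powr (p + 1)) & (LINT x|L. abs (u x) powr (p + 1)) <= C*hn u powr (p + 1))" by blast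
qed

lemma Sq_pos: "Sq > 0" using Sq_props by blast
lemma int_p1: "u \<in> H ==> integrable L (%x. abs (u x) powr (p + 1))" using Sq_props by blast
lemma le_p1: "u \<in> H ==> (LINT x|L. abs (u x) powr (p + 1)) <= Sq*hn u powr (p + 1)" using Sq_props by blast

lemma tri_pointwise:
 fixes a b c :: real
 assumes "a >= 0" "b >= 0" "c >= 0" "al >= 0" "be >= 0" "ga >= 0" "al + be + ga = p + 1"
 shows "a powr al*b powr be * c powr ga <= a powr (p + 1) + b powr (p + 1) + c powr (p + 1)"
proof -
 define m where "m = max a (max b c)"
 have m: "a <= m" "b <= m" "c <= m" "m >= 0" using assms by (auto simp: m_def)
 have "a powr al*b powr be * c powr ga <= m powr al*m powr be*m powr ga"
  using assms m by (intro mult_mono powr_mono2) auto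
 also have "... = m powr (p + 1)" by (simp add: powr_add[symmetric] assms(7))
 also have "... <= a powr (p + 1) + b powr (p + 1) + c powr (p + 1)"
  by (auto simp: m_def max_def add_increasing add_increasing2)
 finally show ?thesis .
qed

text \<open>A three-factor Hoelder inequality combined with the Sobolev bound. For functions of norm
  1 the product is at most the sum of the three powers of exponent \<open>p + 1\<close>; homogeneity
  restores the norms at the price of the factor 3.\<close>

lemma tri:
 assumes "u \<in> H" "v \<in> H" "w \<in> H" "al > 0" "be > 0" "ga > 0" "al + be + ga = p + 1"
 shows "integrable L (%x. abs (u x) powr al*abs (v x) powr be*abs (w x) powr ga)"
  "(LINT x|L. abs (u x) powr al*abs (v x) powr be*abs (w x) powr ga) <= 3*Sq*(hn u powr al*hn v powr be*hn w powr ga)"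
proof -
 have [measurable]: "u \<in> borel_measurable borel" "v \<in> borel_measurable borel" "w \<in> borel_measurable borel"
  using assms H_meas by auto
 let ?s = "%u v w x. abs (u x) powr (p + 1) + abs (v x) powr (p + 1) + abs (w x) powr (p + 1) :: real"
 let ?f = "%x. abs (u x) powr al*abs (v x) powr be*abs (w x) powr ga"
 show i: "integrable L ?f"
 proof (rule integrable_boundI)
  show "integrable L (?s u v w)" using assms by (intro Bochner_Integration.integrable_add int_p1)
  show "abs (?f x) <= ?s u v w x" for x
   using tri_pointwise[of "abs (u x)" "abs (v x)" "abs (w x)" al be ga] assms by (simp add: abs_mult)
 qed measurable
 show "(LINT x|L. ?f x) <= 3*Sq*(hn u powr al*hn v powr be*hn w powr ga)"
 proof (cases "hn u = 0 \<or> hn v = 0 \<or> hn w = 0")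
  case True
  hence "AE x in L. ?f x = 0"
   using hn_eq_0_iff[OF assms(1)] hn_eq_0_iff[OF assms(2)] hn_eq_0_iff[OF assms(3)] by auto
  hence "(LINT x|L. ?f x) = 0" by (intro integral_eq_zero_AE)
  thus ?thesis using Sq_pos by simp
 next
  case False
  hence pos: "hn u > 0" "hn v > 0" "hn w > 0" using hn_nonneg[of u] hn_nonneg[of v] hn_nonneg[of w] by linarith+
  define A where "A = hn u powr al*hn v powr be*hn w powr ga"
  have A: "A > 0" using pos by (simp add: A_def)
  let ?n = "%u x. (1/hn u)*u x"
  have nH: "?n u \<in> H" "?n v \<in> H" "?n w \<in> H" using assms by (auto intro: H_scale simp del: times_divide_eq_left)
  have n1: "hn (?n g) = 1" if "hn g > 0" for g using that hn_scale[of "1/hn g" g] by simp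
  have e: "abs (?n u x) powr al*abs (?n v x) powr be*abs (?n w x) powr ga = ?f x/A" for x
   using pos by (simp add: A_def abs_mult powr_divide)
  have "(LINT x|L. ?f x/A) <= (LINT x|L. ?s (?n u) (?n v) (?n w) x)"
  proof (intro integral_mono Bochner_Integration.integrable_add int_p1 nH)
   show "integrable L (%x. ?f x/A)" using i by simp
   show "?f x/A <= ?s (?n u) (?n v) (?n w) x" for x
    unfolding e[symmetric] using assms by (intro tri_pointwise) auto
  qed
  also have "... <= Sq + Sq + Sq"
   using le_p1[OF nH(1)] le_p1[OF nH(2)] le_p1[OF nH(3)] int_p1[OF nH(1)] int_p1[OF nH(2)] int_p1[OF nH(3)] n1[OF pos(1)] n1[OF pos(2)] n1[OF pos(3)]
   by (simp only: Bochner_Integration.integral_add Bochner_Integration.integrable_add powr_one_eq_one mult_1_right add_mono)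
  finally have "(LINT x|L. ?f x) <= 3*Sq*A" using A by (simp add: field_simps)
  thus ?thesis by (simp only: A_def)
 qed
qed

lemma bi:
 assumes "u \<in> H" "v \<in> H" "al > 0" "be > 0" "al + be = p + 1"
 shows "integrable L (%x. abs (u x) powr al*abs (v x) powr be)"
  "(LINT x|L. abs (u x) powr al*abs (v x) powr be) <= 3*Sq*(hn u powr al*hn v powr be)"
 using tri[OF assms(1,2,2,3), of "be/2" "be/2"] assms
 by (simp_all add: mult.assoc flip: powr_add)

definition coef :: "'n fn => bool" where
 "coef b \<longleftrightarrow> b \<in> borel_measurable borel & (\<forall>x. 0 <= b x & b x <= 1)"

lemma coefD: "coef b ==> b \<in> borel_measurable borel" "coef b ==> 0 <= b x" "coef b ==> b x <= 1"
 by (auto simp: coef_def)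
lemma coef_one: "coef (%_. 1)" by (simp add: coef_def)

text \<open>\<open>(p + 1) * Nf b u\<close> is the derivative of \<open>Bf b\<close> at
  \<open>u\<close>. Keeping the coefficient \<open>b\<close> as a parameter treats the weight
  \<open>a\<close> and the constant weight at infinity together.\<close>

definition Bf :: "'n fn => 'n fn => real" where "Bf b u = (LINT x|L. b x*max (u x) 0 powr (p + 1))"
definition Nf :: "'n fn => 'n fn => 'n fn => real" where "Nf b u h = (LINT x|L. b x*max (u x) 0 powr p*h x)"

lemma Ifun_eq: "Ifun s p b g u = (hn u)^2/2 - Bf b u/(p + 1) - g u"
 by (simp add: Ifun_def Bf_def)

lemma coef_mult_le: assumes "coef b" "abs t <= r" shows "abs (b x*t) <= r"
 using coefD(2,3)[OF assms(1), of x] assms(2) mult_left_le_one_le[of "abs t" "b x"] by (simp add: abs_mult)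

lemma pos_powr_le: "r >= 0 ==> max t 0 powr r <= abs t powr r" for t r :: real
 by (intro powr_mono2) (auto simp: max_def)

lemma Bf_integrable: assumes "coef b" "u \<in> H" shows "integrable L (%x. b x*max (u x) 0 powr (p + 1))"
proof (rule integrable_boundI[OF int_p1[OF assms(2)]])
 have [measurable]: "u \<in> borel_measurable borel" "b \<in> borel_measurable borel" using assms H_meas coefD by auto
 show "(%x. b x*max (u x) 0 powr (p + 1)) \<in> borel_measurable L" by measurable
 show "abs (b x*max (u x) 0 powr (p + 1)) <= abs (u x) powr (p + 1)" for x
  using p_gt_1 pos_powr_le[of "p + 1" "u x"] by (intro coef_mult_le[OF assms(1)]) auto
qed

lemma Bf_nonneg: "coef b ==> Bf b u >= 0"
 unfolding Bf_def by (intro Bochner_Integration.integral_nonneg mult_nonneg_nonneg) (auto simp: coefD)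

lemma Bf_mono: assumes "coef b" "coef c" "u \<in> H" "!!x. b x <= c x" shows "Bf b u <= Bf c u"
 unfolding Bf_def using assms Bf_integrable by (intro integral_mono mult_right_mono) auto

lemma Bf_le: assumes "coef b" "u \<in> H" shows "Bf b u <= Sq*hn u powr (p + 1)"
proof -
 have "Bf b u <= (LINT x|L. abs (u x) powr (p + 1))"
  unfolding Bf_def
 proof (intro integral_mono Bf_integrable int_p1 assms)
  show "b x*max (u x) 0 powr (p + 1) <= abs (u x) powr (p + 1)" for x
   using p_gt_1 pos_powr_le[of "p + 1" "u x"] coef_mult_le[OF assms(1), of "max (u x) 0 powr (p + 1)" _ x] by (smt (verit) powr_ge_zero)
 qed
 thus ?thesis using le_p1[OF assms(2)] by linarith
qed

lemma Bf_scale: assumes "t >= 0" shows "Bf b (%x. t*u x) = t powr (p + 1)*Bf b u"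
proof -
 have "b x*max (t*u x) 0 powr (p + 1) = t powr (p + 1)*(b x*max (u x) 0 powr (p + 1))" for x
 proof -
  have "max (t*u x) 0 = t*max (u x) 0" using assms by (auto simp: max_def mult_le_0_iff zero_le_mult_iff)
  thus ?thesis using assms by (simp add: powr_mult mult_ac)
 qed
 hence "Bf b (%x. t*u x) = (LINT x|L. t powr (p + 1)*(b x*max (u x) 0 powr (p + 1)))" by (simp only: Bf_def)
 thus ?thesis by (simp add: Bf_def)
qed

lemma Nf_integrable: assumes "coef b" "u \<in> H" "h \<in> H" shows "integrable L (%x. b x*max (u x) 0 powr p*h x)"
proof (rule integrable_boundI[OF bi(1)[OF assms(2,3), of p 1]])
 have [measurable]: "u \<in> borel_measurable borel" "b \<in> borel_measurable borel" "h \<in> borel_measurable borel" using assms H_meas coefD by auto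
 show "(%x. b x*max (u x) 0 powr p*h x) \<in> borel_measurable L" by measurable
 show "abs (b x*max (u x) 0 powr p*h x) <= abs (u x) powr p*abs (h x) powr 1" for x
  using p_gt_1 pos_powr_le[of p "u x"] unfolding mult.assoc
  by (intro coef_mult_le[OF assms(1)]) (auto simp: abs_mult intro!: mult_right_mono)
qed (use p_gt_1 in auto)

lemma Nf_bound: assumes "coef b" "u \<in> H" "h \<in> H" shows "abs (Nf b u h) <= 3*Sq*(hn u powr p*hn h)"
proof -
 have "abs (Nf b u h) <= (LINT x|L. abs (b x*max (u x) 0 powr p*h x))" unfolding Nf_def by (rule integral_abs_bound)
 also have "... <= (LINT x|L. abs (u x) powr p*abs (h x) powr 1)"
 proof (intro integral_mono integrable_abs Nf_integrable assms bi(1))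
  show "abs (b x*max (u x) 0 powr p*h x) <= abs (u x) powr p*abs (h x) powr 1" for x
   using p_gt_1 pos_powr_le[of p "u x"] unfolding mult.assoc
   by (intro coef_mult_le[OF assms(1)]) (auto simp: abs_mult intro!: mult_right_mono)
 qed (use p_gt_1 in auto)
 also have "... <= 3*Sq*(hn u powr p*hn h powr 1)" using bi(2)[OF assms(2,3), of p 1] p_gt_1 by simp
 finally show ?thesis by (simp add: hn_nonneg)
qed

lemma Nf_add: assumes "coef b" "u \<in> H" "h \<in> H" "k \<in> H" shows "Nf b u (%x. h x + k x) = Nf b u h + Nf b u k"
 using Nf_integrable[OF assms(1,2,3)] Nf_integrable[OF assms(1,2,4)] by (simp add: Nf_def distrib_left)
lemma Nf_scale: "Nf b u (%x. c*h x) = c*Nf b u h"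
proof -
 have "b x*max (u x) 0 powr p*(c*h x) = c*(b x*max (u x) 0 powr p*h x)" for x by simp
 hence "Nf b u (%x. c*h x) = (LINT x|L. c*(b x*max (u x) 0 powr p*h x))" by (simp only: Nf_def)
 thus ?thesis by (simp add: Nf_def)
qed
lemma Nf_self: "Nf b u u = Bf b u"
proof -
 have "max t 0 powr p*t = max t 0 powr (p + 1)" for t :: real by (auto simp: max_def powr_add)
 thus ?thesis by (simp add: Nf_def Bf_def mult.assoc)
qed

lemma abs_H: "u \<in> H ==> (%x. abs (u x)) \<in> H" and hn_abs: "u \<in> H ==> hn (%x. abs (u x)) <= hn u"
 using contraction[of u "%x. abs (u x)"] H_meas[of u] by (auto simp: abs_triangle_ineq3)

lemma abs_sum_H:
 assumes "u \<in> H" "v \<in> H"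
 shows "(%x. abs (u x) + abs (v x)) \<in> H" "hn (%x. abs (u x) + abs (v x)) <= hn u + hn v"
 using H_add[OF abs_H[OF assms(1)] abs_H[OF assms(2)]] hn_triangle[OF abs_H[OF assms(1)] abs_H[OF assms(2)]]
  hn_abs[OF assms(1)] hn_abs[OF assms(2)] by auto

lemma Nf_lip:
 assumes "coef b" "u \<in> H" "v \<in> H" "h \<in> H"
 shows "abs (Nf b u h - Nf b v h) <= 3*p*Sq*(hn u + hn v) powr (p - 1)*hn (%x. u x - v x)*hn h"
proof -
 let ?f = "%x. abs (abs (u x) + abs (v x)) powr (p - 1)*abs (u x - v x) powr 1*abs (h x) powr 1"
 note t = tri[OF abs_sum_H(1)[OF assms(2,3)] H_diff[OF assms(2,3)] assms(4), of "p - 1" 1 1]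
 have i: "integrable L ?f" using t(1) p_gt_1 by simp
 have "abs (Nf b u h - Nf b v h) = \<bar>\<integral>x. b x*max (u x) 0 powr p*h x - b x*max (v x) 0 powr p*h x \<partial>L\<bar>"
  unfolding Nf_def using Nf_integrable assms by (subst Bochner_Integration.integral_diff) auto
 also have "... <= (LINT x|L. abs (b x*max (u x) 0 powr p*h x - b x*max (v x) 0 powr p*h x))" by (rule integral_abs_bound)
 also have "... <= (LINT x|L. p*?f x)"
 proof (intro integral_mono integrable_abs Bochner_Integration.integrable_diff Nf_integrable assms integrable_mult_right i)
  fix x
  have e: "b x*max (u x) 0 powr p*h x - b x*max (v x) 0 powr p*h x = b x*((max (u x) 0 powr p - max (v x) 0 powr p)*h x)"
   by (simp add: algebra_simps)
  show "abs (b x*max (u x) 0 powr p*h x - b x*max (v x) 0 powr p*h x) <= p*?f x"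
   unfolding e using mult_right_mono[OF pos_powr_diff_le[of p "u x" "v x"], of "abs (h x)"] p_gt_1
   by (intro coef_mult_le[OF assms(1)]) (simp add: abs_mult mult_ac)
 qed
 also have "... = p*(LINT x|L. ?f x)" by simp
 also have "... <= p*(3*Sq*(hn (%x. abs (u x) + abs (v x)) powr (p - 1)*hn (%x. u x - v x) powr 1*hn h powr 1))"
  using t(2) p_gt_1 by (intro mult_left_mono) auto
 also have "... <= p*(3*Sq*((hn u + hn v) powr (p - 1)*hn (%x. u x - v x) powr 1*hn h powr 1))"
  using abs_sum_H(2)[OF assms(2,3)] p_gt_1 Sq_pos hn_nonneg
  by (intro mult_left_mono mult_right_mono powr_mono2) (auto intro!: mult_nonneg_nonneg)
 finally show ?thesis by (simp add: hn_nonneg mult_ac)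
qed

definition Ct :: real where "Ct = 3*(p + 1)*p*2 powr (p - 1)*Sq"

lemma Ct_pos: "Ct > 0" using p_gt_1 Sq_pos by (simp add: Ct_def)

lemma Bf_taylor:
 assumes "coef b" "u \<in> H" "h \<in> H"
 shows "abs (Bf b (%x. u x + h x) - Bf b u - (p + 1)*Nf b u h) <= Ct*(hn u + hn h) powr (p - 1)*(hn h)^2"
proof -
 let ?f = "%x. abs (abs (u x) + abs (h x)) powr (p - 1)*abs (h x) powr 2"
 note t = bi[OF abs_sum_H(1)[OF assms(2,3)] assms(3), of "p - 1" 2]
 have i: "integrable L ?f" using t(1) p_gt_1 by simp
 let ?g = "%x. b x*max (u x + h x) 0 powr (p + 1) - b x*max (u x) 0 powr (p + 1) - (p + 1)*(b x*max (u x) 0 powr p*h x)"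
 have gi: "integrable L ?g"
  using Bf_integrable[OF assms(1) H_add[OF assms(2,3)]] Bf_integrable[OF assms(1,2)] Nf_integrable[OF assms] by simp
 have "Bf b (%x. u x + h x) - Bf b u - (p + 1)*Nf b u h = (LINT x|L. ?g x)"
  unfolding Bf_def Nf_def
  using Bf_integrable[OF assms(1) H_add[OF assms(2,3)]] Bf_integrable[OF assms(1,2)] Nf_integrable[OF assms] by simp
 hence "abs (Bf b (%x. u x + h x) - Bf b u - (p + 1)*Nf b u h) <= (LINT x|L. abs (?g x))" by (simp add: integral_abs_bound)
 also have "... <= (LINT x|L. (p + 1)*p*2 powr (p - 1)*?f x)"
 proof (intro integral_mono integrable_abs gi integrable_mult_right i)
  fix x
  have e: "?g x = b x*(max (u x + h x) 0 powr (p + 1) - max (u x) 0 powr (p + 1) - (p + 1)*max (u x) 0 powr p*h x)"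
   by (simp add: algebra_simps)
  show "abs (?g x) <= (p + 1)*p*2 powr (p - 1)*?f x"
   unfolding e using pos_powr_taylor[OF p_gt_1, of "u x" "h x"]
   by (intro coef_mult_le[OF assms(1)]) (simp add: mult_ac powr_numeral)
 qed
 also have "... = (p + 1)*p*2 powr (p - 1)*(LINT x|L. ?f x)" by simp
 also have "... <= (p + 1)*p*2 powr (p - 1)*(3*Sq*(hn (%x. abs (u x) + abs (h x)) powr (p - 1)*hn h powr 2))"
  using t(2) p_gt_1 by (intro mult_left_mono) auto
 also have "... <= (p + 1)*p*2 powr (p - 1)*(3*Sq*((hn u + hn h) powr (p - 1)*hn h powr 2))"
  using abs_sum_H(2)[OF assms(2,3)] p_gt_1 Sq_pos hn_nonneg
  by (intro mult_left_mono mult_right_mono powr_mono2) (auto intro!: mult_nonneg_nonneg)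
 also have "... = Ct*(hn u + hn h) powr (p - 1)*(hn h)^2"
  by (simp add: Ct_def hn_nonneg powr_numeral algebra_simps)
 finally show ?thesis .
qed

lemma Bf_AE_cong: assumes "u \<in> borel_measurable borel" "v \<in> borel_measurable borel" "coef b" "AE x in L. u x = v x" shows "Bf b u = Bf b v"
 unfolding Bf_def using assms coefD(1)[OF assms(3)] by (intro integral_cong_AE) auto

lemma Bf_shift: "u \<in> H ==> Bf (%_. 1) (%x. u (x + c)) = Bf (%_. 1) u"
 using H_meas[of u] integral_lborel_shift(1)[of "%x. max (u x) 0 powr (p + 1)" c] by (simp add: Bf_def)

lemma p1_sum_bound:
 assumes "u \<in> H" "v \<in> H" "hn u <= C" "hn v <= C"
 shows "(LINT x|L. abs (u x) powr (p + 1) + abs (v x) powr (p + 1)) <= 2*Sq*C powr (p + 1)"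
proof -
 have "hn u powr (p + 1) <= C powr (p + 1)" "hn v powr (p + 1) <= C powr (p + 1)"
  using assms p_gt_1 by (auto intro!: powr_mono2 hn_nonneg)
 hence "Sq*hn u powr (p + 1) <= Sq*C powr (p + 1)" "Sq*hn v powr (p + 1) <= Sq*C powr (p + 1)"
  using Sq_pos by auto
 thus ?thesis using le_p1[OF assms(1)] le_p1[OF assms(2)] int_p1[OF assms(1)] int_p1[OF assms(2)] by simp
qed

text \<open>The mixed terms produced by subtracting the limit are bounded by a small multiple of
  \<open>abs (u n - v) powr (p + 1)\<close>, whose integrals are bounded, plus a multiple of the
  fixed integrable function \<open>abs v powr (p + 1)\<close>.\<close>

lemma brezis_lieb:
 assumes "coef b" "!!n. u n \<in> H" "!!n. hn (u n) <= C" "v \<in> H" "AE x in L. (%n. u n x) ---> v x"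
 shows "(%n. Bf b (u n) - Bf b (%x. u n x - v x)) ---> Bf b v"
proof -
 have [measurable]: "u n \<in> borel_measurable borel" "v \<in> borel_measurable borel" "b \<in> borel_measurable borel" for n
  using assms H_meas coefD by auto
 have d: "(%x. u n x - v x) \<in> H" "hn (%x. u n x - v x) <= C + hn v" for n
  using H_diff[OF assms(2,4)] hn_diff_le[OF assms(2,4), of n] assms(3)[of n] by auto
 let ?F = "%t. max t 0 powr (p + 1) :: real"
 let ?h = "%n x. b x*(?F (u n x) - ?F (u n x - v x) - ?F (v x))"
 \<comment> \<open>The control term \<open>e\<close> below consists of two equal copies, so that the
   bound \<open>p1_sum_bound\<close> for a sum of two functions applies verbatim.\<close>
 have "(%n. LINT x|L. ?h n x) ---> 0"
 proof (rule small_plus_dominated(3)[where e="%n x. abs (u n x - v x) powr (p + 1) + abs (u n x - v x) powr (p + 1)" and C="2*Sq*(C + hn v) powr (p + 1)"])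
  show "AE x in L. (%n. ?h n x) ---> 0"
   using assms(5)
  proof eventually_elim
   case (elim x)
   have c: "isCont (%t. max t 0 powr (p + 1)) t" for t :: real
    using DERIV_isCont[OF DERIV_pos_powr[OF p_gt_1]] .
   have "(%n. u n x - v x) ---> 0" using elim by (simp add: LIM_zero_iff)
   from isCont_tendsto_compose[OF c this] isCont_tendsto_compose[OF c elim]
   have "(%n. b x*(?F (u n x) - ?F (u n x - v x) - ?F (v x))) ---> b x*(?F (v x) - ?F 0 - ?F (v x))"
    by (intro tendsto_mult tendsto_diff tendsto_const)
   thus ?case by simp
  qed
  show "(LINT x|L. abs (u n x - v x) powr (p + 1) + abs (u n x - v x) powr (p + 1)) <= 2*Sq*(C + hn v) powr (p + 1)" for n
   using p1_sum_bound[OF d(1) d(1) d(2) d(2)] .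
  fix ep :: real assume ep: "ep > 0"
  define K where "K = 2 powr (p + 1)*2 powr (p + 1)"
  have K: "K > 0" by (simp add: K_def)
  \<comment> \<open>Chosen so that \<open>(p + 1) * (etaa * K) = ep\<close>, where \<open>K\<close>
    collects the constants from splitting the power of a sum.\<close>
  define etaa where "etaa = ep/((p + 1)*K)"
  have etaa: "etaa > 0" using ep K p_gt_1 by (simp add: etaa_def)
  define M where "M = (p + 1)*(etaa*K + (1/etaa) powr p) + 1"
  have bound: "abs (?F (A + D) - ?F D - ?F A) <= ep*abs D powr (p + 1) + M*abs A powr (p + 1)" for A D :: real
  proof -
   have "abs (?F (A + D) - ?F D) <= (p + 1)*(abs (A + D) + abs D) powr p*abs A"
    using pos_powr_diff_le[of "p + 1" "A + D" D] p_gt_1 by simp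
   also have "... <= (p + 1)*((2*(abs A + abs D)) powr p*abs A)"
    unfolding mult.assoc using p_gt_1 by (intro mult_left_mono mult_right_mono powr_mono2) auto
   also have "... <= (p + 1)*(etaa*(2*(abs A + abs D)) powr (p + 1) + (1/etaa) powr p*abs A powr (p + 1))"
    using p_gt_1 etaa by (intro mult_left_mono powr_mult_split) auto
   also have "(2*(abs A + abs D)) powr (p + 1) <= K*(abs A powr (p + 1) + abs D powr (p + 1))"
    unfolding powr_mult K_def mult.assoc using powr_add_le[of "abs A" "abs D" "p + 1"] p_gt_1 by (intro mult_left_mono) auto
   finally have "abs (?F (A + D) - ?F D) <= (p + 1)*(etaa*(K*(abs A powr (p + 1) + abs D powr (p + 1))) + (1/etaa) powr p*abs A powr (p + 1))"
    using p_gt_1 etaa by (simp add: mult_left_mono)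
   also have "... = ep*abs D powr (p + 1) + (M - 1)*abs A powr (p + 1)"
   proof -
    have "(p + 1)*(etaa*K) = ep" using p_gt_1 K by (simp add: etaa_def)
    thus ?thesis by (simp add: M_def algebra_simps flip: \<open>(p + 1) * (etaa * K) = ep\<close>)
   qed
   finally have "abs (?F (A + D) - ?F D) <= ep*abs D powr (p + 1) + (M - 1)*abs A powr (p + 1)" .
   moreover have "abs (?F A) <= abs A powr (p + 1)" using pos_powr_le[of "p + 1" A] p_gt_1 by simp
   ultimately show ?thesis
    using abs_triangle_ineq4[of "?F (A + D) - ?F D" "?F A"] by (simp add: left_diff_distrib)
  qed
  have "abs (?h n x) <= ep*(abs (u n x - v x) powr (p + 1) + abs (u n x - v x) powr (p + 1)) + M*abs (v x) powr (p + 1)" for n x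
  proof (rule coef_mult_le[OF assms(1)])
   have "0 <= ep*abs (u n x - v x) powr (p + 1)" using ep by simp
   thus "abs (?F (u n x) - ?F (u n x - v x) - ?F (v x)) <= ep*(abs (u n x - v x) powr (p + 1) + abs (u n x - v x) powr (p + 1)) + M*abs (v x) powr (p + 1)"
    using bound[of "v x" "u n x - v x"] by (simp add: distrib_left)
  qed
  thus "\<exists>psa. integrable L psa & (\<forall>n x. abs (?h n x) <= ep*(abs (u n x - v x) powr (p + 1) + abs (u n x - v x) powr (p + 1)) + psa x)"
   using int_p1[OF assms(4)] by (intro exI[of _ "%x. M*abs (v x) powr (p + 1)"]) auto
 qed (use int_p1[OF d(1)] in auto)
 moreover have "(LINT x|L. ?h n x) = Bf b (u n) - Bf b (%x. u n x - v x) - Bf b v" for n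
  unfolding Bf_def right_diff_distrib
  using Bf_integrable[OF assms(1,2), of n] Bf_integrable[OF assms(1) d(1), of n] Bf_integrable[OF assms(1,4)] by simp
 ultimately show ?thesis by (simp add: LIM_zero_iff)
qed

lemma Nf_weak:
 assumes "coef b" "!!n. u n \<in> H" "!!n. hn (u n) <= C" "v \<in> H" "AE x in L. (%n. u n x) ---> v x" "g \<in> H"
 shows "(%n. Nf b (u n) g) ---> Nf b v g"
proof -
 have [measurable]: "u n \<in> borel_measurable borel" "v \<in> borel_measurable borel" "b \<in> borel_measurable borel" "g \<in> borel_measurable borel" for n
  using assms H_meas coefD by auto
 let ?h = "%n x. b x*((max (u n x) 0 powr p - max (v x) 0 powr p)*g x)"
 define C' where "C' = max C (hn v)"
 have "(%n. LINT x|L. ?h n x) ---> 0"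
 proof (rule small_plus_dominated(3)[where e="%n x. abs (u n x) powr (p + 1) + abs (v x) powr (p + 1)" and C="2*Sq*C' powr (p + 1)"])
  show "AE x in L. (%n. ?h n x) ---> 0"
   using assms(5)
  proof eventually_elim
   case (elim x)
   have "(%n. max (u n x) 0 powr p) ---> max (v x) 0 powr p"
    using elim p_gt_1 by (intro tendsto_powr2 tendsto_intros) auto
   hence "(%n. ?h n x) ---> b x*((max (v x) 0 powr p - max (v x) 0 powr p)*g x)"
    by (intro tendsto_mult tendsto_diff tendsto_const)
   thus ?case by simp
  qed
  show "(LINT x|L. abs (u n x) powr (p + 1) + abs (v x) powr (p + 1)) <= 2*Sq*C' powr (p + 1)" for n
   using assms(3)[of n] by (intro p1_sum_bound assms(2,4)) (auto simp: C'_def)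
  fix ep :: real assume ep: "ep > 0"
  have "abs (?h n x) <= ep*(abs (u n x) powr (p + 1) + abs (v x) powr (p + 1)) + 2*(1/ep) powr p*abs (g x) powr (p + 1)" for n x
  proof (rule coef_mult_le[OF assms(1)])
   have "abs ((max (u n x) 0 powr p - max (v x) 0 powr p)*g x) <= (abs (u n x) powr p + abs (v x) powr p)*abs (g x)"
    using pos_powr_le[of p "u n x"] pos_powr_le[of p "v x"] p_gt_1
    unfolding abs_mult by (intro mult_right_mono) (smt (verit) powr_ge_zero, simp)
   also have "... <= ep*(abs (u n x) powr (p + 1) + abs (v x) powr (p + 1)) + 2*(1/ep) powr p*abs (g x) powr (p + 1)"
    using powr_mult_split[of p ep "abs (u n x)" "abs (g x)"] powr_mult_split[of p ep "abs (v x)" "abs (g x)"] p_gt_1 ep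
    by (simp add: algebra_simps)
   finally show "abs ((max (u n x) 0 powr p - max (v x) 0 powr p)*g x) <= ep*(abs (u n x) powr (p + 1) + abs (v x) powr (p + 1)) + 2*(1/ep) powr p*abs (g x) powr (p + 1)" .
  qed
  thus "\<exists>psa. integrable L psa & (\<forall>n x. abs (?h n x) <= ep*(abs (u n x) powr (p + 1) + abs (v x) powr (p + 1)) + psa x)"
   using int_p1[OF assms(6)] by (intro exI[of _ "%x. 2*(1/ep) powr p*abs (g x) powr (p + 1)"]) auto
 qed (use int_p1 assms(2,4) in auto)
 moreover have "(LINT x|L. ?h n x) = Nf b (u n) g - Nf b v g" for n
 proof -
  have "(LINT x|L. ?h n x) = (LINT x|L. b x*max (u n x) 0 powr p*g x - b x*max (v x) 0 powr p*g x)"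
   by (simp add: algebra_simps)
  thus ?thesis unfolding Nf_def using Nf_integrable[OF assms(1,2,6)] Nf_integrable[OF assms(1,4,6)] by simp
 qed
 ultimately show ?thesis by (simp add: LIM_zero_iff)
qed

text \<open>The coefficient is invisible to sequences tending to 0: large values are controlled by a
  power \<open>q\<close> between \<open>p + 1\<close> and the critical exponent, bounded values by
  the integrable function \<open>1 - b\<close>. Hence lost mass obeys the problem with constant
  coefficient.\<close>

lemma coef_defect_vanish:
 assumes "coef b" "integrable L (%x. 1 - b x)" "!!n. z n \<in> H" "!!n. hn (z n) <= C" "AE x in L. (%n. z n x) ---> 0"
 shows "(%n. Bf (%_. 1) (z n) - Bf b (z n)) ---> 0"
proof -
 have [measurable]: "z n \<in> borel_measurable borel" "b \<in> borel_measurable borel" for n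
  using assms H_meas coefD by auto
 define q where "q = (p + 1 + crit2 TYPE('n))/2"
 have q: "p + 1 < q" "q < crit2 TYPE('n)" "2 <= q" using p1_subcritical p_gt_1 by (auto simp: q_def)
 obtain K where K: "K > 0" "!!u. u \<in> H ==> integrable L (%x. abs (u x) powr q)"
  "!!u. u \<in> H ==> (LINT x|L. abs (u x) powr q) <= K*hn u powr q" using sobolev[OF q(3,2)] by metis
 let ?h = "%n x. (1 - b x)*max (z n x) 0 powr (p + 1)"
 have "(%n. LINT x|L. ?h n x) ---> 0"
 proof (rule small_plus_dominated(3)[where e="%n x. abs (z n x) powr q" and C="K*C powr q"])
  show "AE x in L. (%n. ?h n x) ---> 0"
   using assms(5)
  proof eventually_elim
   case (elim x)
   have "(%n. max (z n x) 0 powr (p + 1)) ---> max 0 0 powr (p + 1)"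
    using elim p_gt_1 by (intro tendsto_powr2 tendsto_intros) auto
   hence "(%n. ?h n x) ---> (1 - b x)*max 0 0 powr (p + 1)" by (intro tendsto_mult tendsto_const)
   thus ?case by simp
  qed
  show "(LINT x|L. abs (z n x) powr q) <= K*C powr q" for n
  proof -
   have "hn (z n) powr q <= C powr q" using assms(4) q by (intro powr_mono2 hn_nonneg) auto
   thus ?thesis using K(3)[OF assms(3), of n] K(1) by (smt (verit) mult_left_mono)
  qed
  fix ep :: real assume ep: "ep > 0"
  define r where "r = q - p - 1"
  have r: "r > 0" using q by (simp add: r_def)
  define M where "M = (1/ep) powr ((p + 1)/r)"
  have "abs (?h n x) <= ep*abs (z n x) powr q + M*(1 - b x)" for n x
  proof -
   have b: "0 <= 1 - b x" "1 - b x <= 1" using coefD[OF assms(1)] by auto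
   have le: "abs (?h n x) <= (1 - b x)*abs (z n x) powr (p + 1)"
    using b pos_powr_le[of "p + 1" "z n x"] p_gt_1 by (simp add: abs_mult mult_left_mono)
   show ?thesis
   proof (cases "abs (z n x) powr r >= 1/ep")
    case True
    have "abs (z n x) powr (p + 1)*1 <= abs (z n x) powr (p + 1)*(ep*abs (z n x) powr r)"
     using True ep by (intro mult_left_mono) (auto simp: field_simps)
    also have "... = ep*abs (z n x) powr q" by (simp add: r_def powr_add[symmetric])
    finally have "(1 - b x)*abs (z n x) powr (p + 1) <= ep*abs (z n x) powr q"
     using b mult_right_mono[of "1 - b x" 1 "abs (z n x) powr (p + 1)"] by simp
    moreover have "0 <= M*(1 - b x)" using b by (simp add: M_def)
    ultimately show ?thesis using le by linarith
   next
    case False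
    have "abs (z n x) powr (p + 1) = (abs (z n x) powr r) powr ((p + 1)/r)" using r by (simp add: powr_powr)
    also have "... <= M" unfolding M_def using False r p_gt_1 by (intro powr_mono2) auto
    finally have "(1 - b x)*abs (z n x) powr (p + 1) <= M*(1 - b x)" using b by (subst mult.commute) (rule mult_right_mono)
    moreover have "0 <= ep*abs (z n x) powr q" using ep by simp
    ultimately show ?thesis using le by linarith
   qed
  qed
  thus "\<exists>psa. integrable L psa & (\<forall>n x. abs (?h n x) <= ep*abs (z n x) powr q + psa x)"
   using assms(2) by (intro exI[of _ "%x. M*(1 - b x)"]) auto
 qed (use K(2) assms(3) in auto)
 moreover have "(LINT x|L. ?h n x) = Bf (%_. 1) (z n) - Bf b (z n)" for n
  unfolding Bf_def left_diff_distrib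
  using Bf_integrable[OF coef_one assms(3), of n] Bf_integrable[OF assms(1,3), of n] by simp
 ultimately show ?thesis by simp
qed

end

section \<open>The energy along a ray as a function of one variable\<close>

lemma bernoulli_powr:
 fixes x p :: real assumes "p >= 1" "x >= 0"
 shows "x powr p >= 1 + p*(x - 1)"
proof (cases "x = 0")
 case False
 have "0 <= x powr p - 1 - p*(x - 1)"
 proof (cases "x >= 1")
  case True
  have "(%x. x powr p - p*x) 1 <= (%x. x powr p - p*x) x"
  proof (rule DERIV_nonneg_imp_nondecreasing[OF True, where f="%x. x powr p - p*x"])
   fix t :: real assume t: "1 <= t" "t <= x"
   have "((%x. x powr p - p*x) has_real_derivative (p*t powr (p - 1) - p)) (at t)"
    using t by (auto intro!: derivative_eq_intros)
   moreover have "p*t powr (p - 1) - p >= 0" using t assms ge_one_powr_ge_zero[of t "p - 1"] mult_left_mono[of 1 "t powr (p - 1)" p] by simp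
   ultimately show "\<exists>y. ((%x. x powr p - p*x) has_real_derivative y) (at t) & 0 <= y" by blast
  qed
  thus ?thesis by (simp add: algebra_simps)
 next
  case x: False
  have "(%x. x powr p - p*x) x >= (%x. x powr p - p*x) 1"
  proof (rule DERIV_nonpos_imp_nonincreasing[where f="%x. x powr p - p*x"])
   fix t :: real assume t: "x <= t" "t <= 1"
   have t0: "t > 0" using t assms False by auto
   have "((%x. x powr p - p*x) has_real_derivative (p*t powr (p - 1) - p)) (at t)"
    using t0 by (auto intro!: derivative_eq_intros)
   moreover have "p*t powr (p - 1) - p <= 0" using t t0 assms powr_le1[of "p - 1" t] mult_left_mono[of "t powr (p - 1)" 1 p] by simp
   ultimately show "\<exists>y. ((%x. x powr p - p*x) has_real_derivative y) (at t) & y <= 0" by blast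
  qed (use x in auto)
  thus ?thesis by (simp add: algebra_simps)
 qed
 thus ?thesis by linarith
qed (use assms in auto)

text \<open>The energy at \<open>t v\<close> for a function \<open>v\<close> of norm 1, with
  \<open>B\<close> the weighted power integral of \<open>v\<close> and \<open>pha\<close> the value
  of the dual element at \<open>v\<close>.\<close>

definition gfun :: "real => real => real => real => real" where
 "gfun p B pha t = t^2/2 - t powr (p + 1)*B/(p + 1) - t*pha"

lemma gfun_deriv:
 assumes "x > 0" "p > 1"
 shows "(gfun p B pha has_real_derivative (x - B*x powr p - pha)) (at x)"
proof -
 have "((%t. t^2/2 - t powr (p + 1)*B/(p + 1) - t*pha) has_real_derivative
  (2*x/2 - (p + 1)*x powr p*B/(p + 1) - pha)) (at x)"
  using assms by (auto intro!: derivative_eq_intros)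
 moreover have "(p + 1)*x powr p*B/(p + 1) = B*x powr p" using assms by simp
 ultimately show ?thesis unfolding gfun_def[abs_def] by simp
qed

text \<open>For positive \<open>pha\<close> the function decreases before it increases, so there is
  a local minimum as well. A positive value somewhere forces the maximum away from
  \<open>t = 0\<close>, where the function vanishes, and into the interior.\<close>

lemma gfun_max_exists:
 assumes p: "p > 1" and B: "B > 0" and pos: "\<exists>t>0. gfun p B pha t > 0"
 shows "\<exists>t>0. (\<forall>r>0. gfun p B pha r <= gfun p B pha t) & t - B*t powr p = pha & gfun p B pha t > 0"
proof -
 obtain t1 where t1: "t1 > 0" "gfun p B pha t1 > 0" using pos by blast
 \<comment> \<open>From \<open>T\<close> on, \<open>t powr (p - 1) * B/(p + 1)\<close> is at least
   \<open>1 + abs pha\<close>, so the power beats the quadratic and the linear term.\<close>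
 define T where "T = max (max t1 1) ((p + 1)*(1 + abs pha)/B) powr (1/(p - 1)) + t1"
 have T: "T > t1" "T > 0" using t1 by (auto simp: T_def add_pos_nonneg intro!: max.strict_coboundedI1)
 have neg: "gfun p B pha t < 0" if t: "t >= T" for t
 proof -
  let ?m = "max (max t1 1) ((p + 1)*(1 + abs pha)/B)"
  have m: "?m >= 1" by simp
  have "?m powr (1/(p - 1)) <= t" using t t1 by (simp add: T_def)
  hence "(?m powr (1/(p - 1))) powr (p - 1) <= t powr (p - 1)" using p by (intro powr_mono2) auto
  hence "?m <= t powr (p - 1)" using p m by (simp add: powr_powr)
  hence a: "(p + 1)*(1 + abs pha)/B <= t powr (p - 1)" by linarith
  have t1': "t >= 1" using \<open>?m powr (1 / (p - 1)) <= t\<close> ge_one_powr_ge_zero[OF m, of "1/(p - 1)"] p by simp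
  have e: "t powr (p + 1) = t powr (p - 1)*t^2" using t1' powr_add[of t "p - 1" 2] by (simp add: powr_numeral add.commute)
  have "1 + abs pha <= t powr (p - 1)*B/(p + 1)" using a B p by (simp add: field_simps)
  hence "(1 + abs pha)*t^2 <= t powr (p + 1)*B/(p + 1)"
  proof -
   assume "1 + abs pha <= t powr (p - 1)*B/(p + 1)"
   hence "(1 + abs pha)*t^2 <= t powr (p - 1)*B/(p + 1)*t^2" by (rule mult_right_mono) simp
   thus ?thesis by (simp add: e mult_ac)
  qed
  moreover have "abs (t*pha) <= abs pha*t^2" using t1' mult_right_mono[of t "t^2" "abs pha"] self_le_power[of t 2] by (simp add: abs_mult mult.commute)
  moreover have "t^2 > 0" using t1' by simp
  moreover have "(1 + abs pha)*t^2 = t^2 + abs pha*t^2" by (simp add: algebra_simps)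
  ultimately show ?thesis unfolding gfun_def by (smt (verit) field_sum_of_halves)
 qed
 have cont: "continuous_on {0..T} (gfun p B pha)"
  unfolding gfun_def using p by (intro continuous_intros continuous_on_powr') auto
 obtain t where t: "t \<in> {0..T}" "!!r. r \<in> {0..T} ==> gfun p B pha r <= gfun p B pha t"
  using continuous_attains_sup[OF compact_Icc _ cont] T by force
 have gt: "gfun p B pha t > 0" using t(2)[of t1] t1 T by auto
 have t0: "t > 0" using gt t(1) by (cases "t = 0") (auto simp: gfun_def)
 have glob: "gfun p B pha r <= gfun p B pha t" if "r > 0" for r
  using t(2)[of r] neg[of r] gt that by (cases "r <= T") auto
 have D: "(gfun p B pha has_real_derivative (t - B*t powr p - pha)) (at t)"
  using t0 p by (intro gfun_deriv) auto
 have "t - B*t powr p - pha = 0"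
  by (rule DERIV_local_max[OF D t0]) (use glob t0 in auto)
 thus ?thesis using t0 glob gt by (intro exI[of _ t]) auto
qed

text \<open>The first-order condition eliminates \<open>B\<close> from the value; the second-order
  condition gives the lower bound used for \<open>tlow\<close>. Two maximisers would enclose a third
  zero of the derivative, and Rolle's theorem would give two zeros of the strictly monotone second
  derivative.\<close>

lemma gfun_max_props:
 assumes p: "p > 1" and B: "B > 0" and t: "t > 0" and mx: "\<forall>r>0. gfun p B pha r <= gfun p B pha t"
  and cr: "t - B*t powr p = pha"
 shows "gfun p B pha t = (p - 1)/(2*(p + 1))*t^2 - p/(p + 1)*t*pha"
  "1 <= p*B*t powr (p - 1)"
  "t' > 0 ==> \<forall>r>0. gfun p B pha r <= gfun p B pha t' ==> t' = t"
proof -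
 have e: "t powr (p + 1) = t powr p*t" using t by (simp add: powr_add)
 have Bt: "B*t powr p = t - pha" using cr by simp
 have "t powr (p + 1)*B = (t - pha)*t" unfolding e using Bt by (simp add: mult_ac)
 thus "gfun p B pha t = (p - 1)/(2*(p + 1))*t^2 - p/(p + 1)*t*pha"

 proof -
  assume q: "t powr (p + 1)*B = (t - pha)*t"
  have "p + 1 ~= 0" using p by simp
  thus ?thesis unfolding gfun_def q by (simp add: divide_simps power2_eq_square) (simp add: algebra_simps)
 qed
 have D: "(gfun p B pha has_real_derivative (x - B*x powr p - pha)) (at x)" if "x > 0" for x
  using that p by (intro gfun_deriv) auto
 show "1 <= p*B*t powr (p - 1)"
 proof (rule ccontr)
  assume "~ ?thesis"
  hence l: "1 - p*B*t powr (p - 1) > 0" by simp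
  have D2: "((%x. x - B*x powr p - pha) has_real_derivative (1 - p*B*t powr (p - 1))) (at t)"
   using t by (auto intro!: derivative_eq_intros)
  obtain d where d: "d > 0" "!!h. h > 0 ==> h < d ==> t - B*t powr p - pha < (t + h) - B*(t + h) powr p - pha"
   using DERIV_pos_inc_right[OF D2 l] by blast
  obtain z where z: "t < z" "z < t + d/2" "gfun p B pha (t + d/2) - gfun p B pha t = (t + d/2 - t)*(z - B*z powr p - pha)"
   using MVT2[of t "t + d/2" "gfun p B pha" "%x. x - B*x powr p - pha"] D d t by force
  have "z - B*z powr p - pha > 0" using d(2)[of "z - t"] z(1,2) d(1) cr by simp
  hence "gfun p B pha (t + d/2) > gfun p B pha t" using z(3) d(1) mult_pos_pos[of "t + d/2 - t" "z - B*z powr p - pha"] by linarith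
  thus False using mx t d by (smt (verit) half_gt_zero)
 qed
 show "t' = t" if t': "t' > 0" "\<forall>r>0. gfun p B pha r <= gfun p B pha t'"
 proof (rule ccontr)
  assume ne: "t' ~= t"
  have cr': "t' - B*t' powr p - pha = 0"
   by (rule DERIV_local_max[OF D[OF t'(1)] t'(1)]) (use t' in auto)
  define x y where "x = min t t'" and "y = max t t'"
  have xy: "0 < x" "x < y" "x - B*x powr p - pha = 0" "y - B*y powr p - pha = 0" "gfun p B pha x = gfun p B pha y"
   using ne t t' cr cr' mx by (auto simp: x_def y_def min_def max_def intro: antisym)
  obtain z where z: "x < z" "z < y" "gfun p B pha y - gfun p B pha x = (y - x)*(z - B*z powr p - pha)"
   using MVT2[of x y "gfun p B pha" "%x. x - B*x powr p - pha"] D xy by force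
  hence gz: "z - B*z powr p - pha = 0" using xy by simp
  have D2: "((%x. x - B*x powr p - pha) has_real_derivative (1 - p*B*r powr (p - 1))) (at r)" if "r > 0" for r
   using that by (auto intro!: derivative_eq_intros)
  have rolle: "\<exists>xia. a < xia & xia < b & p*B*xia powr (p - 1) = 1"
   if ab: "0 < a" "a < b" "a - B*a powr p - pha = 0" "b - B*b powr p - pha = 0" for a b
  proof -
   obtain xia where "a < xia" "xia < b" "(b - B*b powr p - pha) - (a - B*a powr p - pha) = (b - a)*(1 - p*B*xia powr (p - 1))"
   proof -
    have "\<exists>z>a. z < b & (b - B*b powr p - pha) - (a - B*a powr p - pha) = (b - a)*(1 - p*B*z powr (p - 1))"
     by (rule MVT2[OF ab(2), where f="%x. x - B*x powr p - pha"]) (rule D2, use ab(1) in linarith)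
    thus ?thesis using that by blast
   qed
   thus ?thesis using ab by (intro exI[of _ xia]) auto
  qed
  obtain xia where xia: "x < xia" "xia < z" "p*B*xia powr (p - 1) = 1" using rolle[of x z] xy z gz by auto
  obtain ze where ze: "z < ze" "ze < y" "p*B*ze powr (p - 1) = 1" using rolle[of z y] xy z gz by auto
  have "xia powr (p - 1) < ze powr (p - 1)" using xia ze xy p by (intro powr_less_mono2) auto
  moreover have "p*B > 0" using p B by simp
  ultimately show False using xia(3) ze(3) by (metis mult_less_cancel_left_pos order_less_irrefl)
 qed
qed

lemma not_tendsto_subseq:
 fixes X :: "nat => 'a::metric_space"
 assumes "~ X ---> l"
 obtains e si where "e > 0" "strict_mono (si :: nat => nat)" "!!n. e <= dist (X (si n)) l"
proof -
 obtain e where e: "e > 0" "\<exists>\<^sub>F n in sequentially. e <= dist (X n) l"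
  using assms unfolding tendsto_iff by (auto simp: not_eventually not_less)
 hence "infinite {n. e <= dist (X n) l}"
  by (auto simp: frequently_sequentially infinite_nat_iff_unbounded_le)
 then obtain si :: "nat => nat" where "strict_mono si" "\<forall>n. si n \<in> {n. e <= dist (X n) l}" using infinite_enumerate by blast
 thus ?thesis using that e by blast
qed

text \<open>The first-order condition bounds the maximisers from above once \<open>B n\<close>
  exceeds \<open>Bl/2\<close>. Every accumulation point maximises the limit function, hence equals
  \<open>t0\<close> by uniqueness; the lower bound \<open>ta\<close> keeps accumulation points
  positive.\<close>

lemma gfun_max_continuous:
 fixes B pha t :: "nat => real"
 assumes p: "p > 1" and B: "Bl > 0" "B ---> Bl" and pha: "pha ---> phal"
  and t: "!!n. t n > 0" "!!n r. r > 0 ==> gfun p (B n) (pha n) r <= gfun p (B n) (pha n) (t n)"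
   "!!n. t n - B n*t n powr p = pha n" "!!n. t n >= ta"
  and t0: "t0 > 0" "!!r. r > 0 ==> gfun p Bl phal r <= gfun p Bl phal t0" "t0 - Bl*t0 powr p = phal" and "ta > 0"
 shows "t ---> t0"
proof (rule ccontr)
 assume "~ t ---> t0"
 then obtain e si where e: "e > 0" and si: "strict_mono (si :: nat => nat)" "!!n. e <= abs (t (si n) - t0)"
  using not_tendsto_subseq[of t t0] by (auto simp: dist_real_def)
 have ev: "\<forall>\<^sub>F n in sequentially. B n > Bl/2" "\<forall>\<^sub>F n in sequentially. pha n > phal - 1"
  using order_tendstoD(1)[OF B(2), of "Bl/2"] order_tendstoD(1)[OF pha, of "phal - 1"] B(1) by auto
 define T where "T = max 1 (2*(1 + (1 + abs phal))/Bl) powr (1/(p - 1))"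
 have T1: "T >= 1" unfolding T_def using p by (intro ge_one_powr_ge_zero) auto
 have "\<forall>\<^sub>F n in sequentially. t n <= T"
  using ev
 proof eventually_elim
  case (elim n)
  show ?case
  proof (rule ccontr)
   assume "~ ?thesis"
   hence tn: "t n > T" "t n > 1" using T1 by auto
   have "T powr (p - 1) < t n powr (p - 1)" using tn T1 p by (intro powr_less_mono2) auto
   moreover have "T powr (p - 1) = max 1 (2*(1 + (1 + abs phal))/Bl)" using p by (simp add: T_def powr_powr)
   ultimately have "2*(1 + (1 + abs phal))/Bl < t n powr (p - 1)" by linarith
   hence "(1 + (1 + abs phal)) < Bl/2*t n powr (p - 1)" using B by (simp add: field_simps)
   also have "... <= B n*t n powr (p - 1)" using elim by (intro mult_right_mono) auto
   finally have "(1 + (1 + abs phal))*t n < B n*t n powr (p - 1)*t n" using t(1)[of n] by simp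
   moreover have "t n powr (p - 1)*t n = t n powr p" using t(1)[of n] powr_add[of "t n" "p - 1" 1] by simp
   ultimately have "(1 + (1 + abs phal))*t n < t n - pha n" using t(3)[of n] by (simp add: mult.assoc)
   moreover have "(1 + abs phal)*t n >= (1 + abs phal)*1" using tn by (intro mult_left_mono) auto
   ultimately show False using elim by (simp add: algebra_simps)
  qed
 qed
 then obtain n0 where n0: "!!n. n >= n0 ==> t n <= T" by (auto simp: eventually_sequentially)
 have "\<forall>n. t (si (n + n0)) \<in> {ta..T}"
  using n0 seq_suble[OF si(1)] t(4) by (auto intro: order_trans[OF le_add2])
 then obtain l rh where l: "l \<in> {ta..T}" "strict_mono rh" "((%n. t (si (n + n0))) \<circ> rh) ---> l"
  using compact_Icc[of ta T] unfolding compact_def by metis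
 define nua where "nua n = si (rh n + n0)" for n
 have nua: "strict_mono nua" unfolding nua_def using si(1) l(2) by (auto simp: strict_mono_def)
 have tnua: "(%n. t (nua n)) ---> l" using l(3) by (simp add: comp_def nua_def)
 have l0: "l > 0" using l(1) \<open>ta > 0\<close> by simp
 have Bnua: "(%n. B (nua n)) ---> Bl" and phanua: "(%n. pha (nua n)) ---> phal"
  using LIMSEQ_subseq_LIMSEQ[OF B(2) nua] LIMSEQ_subseq_LIMSEQ[OF pha nua] by (simp_all add: comp_def)
 have g: "(%n. gfun p (B (nua n)) (pha (nua n)) (r n)) ---> gfun p Bl phal rl" if "r ---> rl" "rl > 0" for r rl
  unfolding gfun_def using that Bnua phanua p by (intro tendsto_intros) auto
 have "gfun p Bl phal r <= gfun p Bl phal l" if "r > 0" for r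
  by (rule LIMSEQ_le[OF g[OF tendsto_const that] g[OF tnua l0]]) (use t(2)[OF that] in auto)
 hence "l = t0"
  using gfun_max_props(3)[OF p B(1) t0(1) _ t0(3), of l] t0(2) l0 by auto
 moreover have "e <= abs (l - t0)"
  by (rule LIMSEQ_le_const[of "%n. abs (t (nua n) - t0)"]) (use tnua si(2) in \<open>auto intro!: tendsto_intros simp: nua_def\<close>)
 ultimately show False using e by simp
qed

section \<open>The dual space, the derivative of the energy and its remainder\<close>

context nonlinear
begin

abbreviation Hd :: "('n fn => real) set" where "Hd \<equiv> Hneg s"
abbreviation fnorm :: "('n fn => real) => real" where "fnorm \<equiv> Hneg_norm s"

lemma dual_add: "f \<in> Hd ==> u \<in> H ==> v \<in> H ==> f (%x. u x + v x) = f u + f v"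
 and dual_scale: "f \<in> Hd ==> u \<in> H ==> f (%x. c*u x) = c*f u"
 by (auto simp: Hneg_def)

lemma dual_diff: "f \<in> Hd ==> u \<in> H ==> v \<in> H ==> f (%x. u x - v x) = f u - f v"
 using dual_add[of f u "%x. -1 * v x"] dual_scale[of f v "-1"] H_scale[of v "-1"] by simp

lemma zero_dual: "(%_. 0) \<in> Hd" by (auto simp: Hneg_def intro!: exI[of _ 0])

lemma dual_bound: assumes "f \<in> Hd" "u \<in> H" shows "abs (f u) <= fnorm f*hn u"
proof -
 obtain K where K: "!!u. u \<in> H ==> abs (f u) <= K*hn u" using assms unfolding Hneg_def by blast
 have bdd: "bdd_above {abs (f u) |u. u \<in> H & hn u <= 1}"
 proof (rule bdd_aboveI)
  fix y assume "y \<in> {abs (f u) |u. u \<in> H & hn u <= 1}"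
  then obtain u where u: "y = abs (f u)" "u \<in> H" "hn u <= 1" by blast
  have "K*hn u <= abs K*1" using u hn_nonneg[of u] by (intro mult_mono) auto
  thus "y <= abs K" using K[OF u(2)] u(1) by simp
 qed
 show ?thesis
 proof (cases "hn u = 0")
  case True thus ?thesis using K[OF assms(2)] by simp
 next
  case False
  hence h: "hn u > 0" using hn_nonneg[of u] by linarith
  have "abs (f (%x. (1/hn u)*u x)) <= fnorm f"
   unfolding Hneg_norm_def
   using H_scale[OF assms(2), of "1/hn u"] hn_scale[of "1/hn u" u] h
   by (intro cSup_upper[OF _ bdd] CollectI exI[of _ "%x. (1/hn u)*u x"]) auto
  hence "1/hn u*abs (f u) <= fnorm f" using dual_scale[OF assms, of "1/hn u"] h by (simp only: abs_mult) simp
  thus ?thesis using h by (simp add: field_simps)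
 qed
qed

lemma fnorm_nonneg: assumes "f \<in> Hd" shows "fnorm f >= 0"
proof -
 obtain K where K: "!!u. u \<in> H ==> abs (f u) <= K*hn u" using assms unfolding Hneg_def by blast
 have "0 = abs (f (%x. 0))" using K[OF H_zero] hn_zero by simp
 moreover have "bdd_above {abs (f u) |u. u \<in> H & hn u <= 1}"
 proof (rule bdd_aboveI)
  fix y assume "y \<in> {abs (f u) |u. u \<in> H & hn u <= 1}"
  then obtain u where u: "y = abs (f u)" "u \<in> H" "hn u <= 1" by blast
  have "K*hn u <= abs K*1" using u hn_nonneg[of u] by (intro mult_mono) auto
  thus "y <= abs K" using K[OF u(2)] u(1) by simp
 qed
 ultimately show ?thesis
  unfolding Hneg_norm_def using H_zero hn_zero by (intro cSup_upper2[of 0]) (auto intro!: exI[of _ "%x. 0"])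
qed

lemma dual_AE_cong:
 assumes "f \<in> Hd" "u \<in> H" "v \<in> H" "AE x in L. u x = v x" shows "f u = f v"
proof -
 have "hn (%x. u x - v x) = 0" using assms by (subst hn_eq_0_iff) (auto intro: H_diff)
 thus ?thesis using dual_bound[OF assms(1) H_diff[OF assms(2,3)]] dual_diff[OF assms(1-3)] by simp
qed

definition DI :: "'n fn => ('n fn => real) => 'n fn => 'n fn => real" where
 "DI b f u h = ip u h - Nf b u h - f h"

text \<open>\<open>Rq M\<close> bounds the second-order Taylor remainder of the energy and
  \<open>Lq M\<close> the Lipschitz constant of its derivative, when the norms involved sum to at
  most \<open>M\<close>.\<close>

definition Rq :: "real => real" where "Rq M = 1/2 + Ct/(p + 1)*M powr (p - 1)"
definition Lq :: "real => real" where "Lq M = 1 + 3*p*Sq*M powr (p - 1)"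

lemma Rq_mono: "0 <= M ==> M <= M' ==> Rq M <= Rq M'" and Rq_pos: "Rq M > 0"
 using Ct_pos p_gt_1 by (auto simp: Rq_def add_pos_nonneg intro!: mult_left_mono divide_right_mono powr_mono2)
lemma Lq_mono: "0 <= M ==> M <= M' ==> Lq M <= Lq M'" and Lq_pos: "Lq M > 0"
 using Sq_pos p_gt_1 by (auto simp: Lq_def add_pos_nonneg intro!: mult_left_mono powr_mono2)

lemma DI_add: "coef b ==> f \<in> Hd ==> u \<in> H ==> h \<in> H ==> k \<in> H ==> DI b f u (%x. h x + k x) = DI b f u h + DI b f u k"
 by (simp add: DI_def ip_add_right Nf_add dual_add)
lemma DI_scale: "f \<in> Hd ==> h \<in> H ==> DI b f u (%x. c*h x) = c*DI b f u h"
 by (simp add: DI_def ip_scale_right Nf_scale dual_scale right_diff_distrib)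

lemma I_taylor:
 assumes "coef b" "f \<in> Hd" "u \<in> H" "h \<in> H"
 shows "abs (Ifun s p b f (%x. u x + h x) - Ifun s p b f u - DI b f u h) <= Rq (hn u + hn h)*(hn h)^2"
proof -
 define E where "E = Bf b (%x. u x + h x) - Bf b u - (p + 1)*Nf b u h"
 have E: "abs (E/(p + 1)) <= Ct/(p + 1)*(hn u + hn h) powr (p - 1)*(hn h)^2"
  using Bf_taylor[OF assms(1,3,4)] p_gt_1 by (simp add: E_def abs_divide divide_right_mono)
 have "Ifun s p b f (%x. u x + h x) - Ifun s p b f u - DI b f u h = (hn h)^2/2 - E/(p + 1)"
 proof -
  have q: "(p + 1)*Nf b u h/(p + 1) = Nf b u h" using p_gt_1 by simp
  have "E/(p + 1) = Bf b (%x. u x + h x)/(p + 1) - Bf b u/(p + 1) - Nf b u h"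
   unfolding E_def diff_divide_distrib q ..
  thus ?thesis by (simp add: Ifun_eq DI_def hn_sq_add assms dual_add add_divide_distrib)
 qed
 hence "abs (Ifun s p b f (%x. u x + h x) - Ifun s p b f u - DI b f u h) <= (hn h)^2/2 + abs (E/(p + 1))"
  using abs_triangle_ineq4[of "(hn h)^2/2" "E/(p + 1)"] by simp
 also have "... <= (hn h)^2/2 + Ct/(p + 1)*(hn u + hn h) powr (p - 1)*(hn h)^2" using E by simp
 finally show ?thesis by (simp add: Rq_def algebra_simps)
qed

lemma DI_lip:
 assumes "coef b" "f \<in> Hd" "u \<in> H" "v \<in> H" "h \<in> H"
 shows "abs (DI b f u h - DI b f v h) <= Lq (hn u + hn v)*hn (%x. u x - v x)*hn h"
proof -
 have "DI b f u h - DI b f v h = ip (%x. u x - v x) h - (Nf b u h - Nf b v h)"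
  using assms by (simp add: DI_def ip_diff_left)
 hence "abs (DI b f u h - DI b f v h) <= hn (%x. u x - v x)*hn h + 3*p*Sq*(hn u + hn v) powr (p - 1)*hn (%x. u x - v x)*hn h"
  using ip_CS[OF H_diff[OF assms(3,4)] assms(5)] Nf_lip[OF assms(1,3,4,5)] by linarith
 thus ?thesis by (simp add: Lq_def algebra_simps)
qed

lemma DI_bound:
 assumes "coef b" "f \<in> Hd" "u \<in> H"
 obtains C where "C >= 0" "!!h. h \<in> H ==> abs (DI b f u h) <= C*hn h"
proof
 show "hn u + 3*Sq*hn u powr p + fnorm f >= 0" using hn_nonneg Sq_pos fnorm_nonneg[OF assms(2)] by simp
 show "abs (DI b f u h) <= (hn u + 3*Sq*hn u powr p + fnorm f)*hn h" if "h \<in> H" for h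
  using ip_CS[OF assms(3) that] Nf_bound[OF assms(1,3) that] dual_bound[OF assms(2) that]
  by (simp add: DI_def algebra_simps abs_le_iff)
qed

text \<open>Translates the Frechet condition of the statement into the weak Euler-Lagrange equation.
  A multiple \<open>t h\<close> with small \<open>t\<close> isolates the linear part, since the
  remainder is quadratic in \<open>t\<close>.\<close>

lemma crit_Hs_iff:
 assumes "coef b" "f \<in> Hd"
 shows "crit_Hs s (Ifun s p b f) u \<longleftrightarrow> u \<in> H & (\<forall>h\<in>H. DI b f u h = 0)"
proof (intro iffI conjI ballI)
 assume c: "crit_Hs s (Ifun s p b f) u"
 thus u: "u \<in> H" by (simp add: crit_Hs_def)
 fix h assume h: "h \<in> H"
 show "DI b f u h = 0"
 proof (cases "hn h = 0")
  case True
  obtain C where "!!h. h \<in> H ==> abs (DI b f u h) <= C*hn h" using DI_bound[OF assms u] by metis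
  thus ?thesis using h True by fastforce
 next
  case False
  hence hp: "hn h > 0" using hn_nonneg[of h] by linarith
  have "abs (DI b f u h) <= e*(hn h + Rq (hn u + hn h)*(hn h)^2)" if e: "e > 0" for e
  proof -
   obtain d where d: "d > 0" "!!k. k \<in> H ==> hn k < d ==> abs (Ifun s p b f (%x. u x + k x) - Ifun s p b f u) <= e*hn k"
    using c e unfolding crit_Hs_def by metis
   define t where "t = min (min e 1) (d/(2*hn h))"
   have t: "t > 0" "t <= e" "t <= 1" "t*hn h < d"
   proof -
    show "t > 0" "t <= e" "t <= 1" using e d hp by (auto simp: t_def)
    have "t*hn h <= d/(2*hn h)*hn h" using hp by (intro mult_right_mono) (auto simp: t_def)
    also have "... < d" using d hp by simp
    finally show "t*hn h < d" .
   qed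
   have th: "(%x. t*h x) \<in> H" "hn (%x. t*h x) = t*hn h" using H_scale[OF h] hn_scale t by auto
   have "abs (DI b f u (%x. t*h x)) <= e*(t*hn h) + Rq (hn u + t*hn h)*(t*hn h)^2"
    using I_taylor[OF assms u th(1)] d(2)[OF th(1)] th(2) t(4) by (simp add: abs_le_iff)
   also have "Rq (hn u + t*hn h) <= Rq (hn u + hn h)"
    using t hp hn_nonneg[of u] by (intro Rq_mono) (auto intro: mult_left_le_one_le)
   finally have "t*abs (DI b f u h) <= e*(t*hn h) + Rq (hn u + hn h)*(t*hn h)^2"
    using t DI_scale[OF assms(2) h] by (simp add: abs_mult mult_right_mono)
   hence "t*abs (DI b f u h) <= t*(e*hn h + t*(Rq (hn u + hn h)*(hn h)^2))"
    by (simp add: power2_eq_square algebra_simps)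
   hence "abs (DI b f u h) <= e*hn h + t*(Rq (hn u + hn h)*(hn h)^2)" using t(1) by simp
   also have "... <= e*hn h + e*(Rq (hn u + hn h)*(hn h)^2)"
    using t(2) Rq_pos[of "hn u + hn h"] by (intro add_left_mono mult_right_mono) (auto simp: less_imp_le)
   finally show ?thesis by (simp add: distrib_left)
  qed
  note * = this
  show ?thesis
  proof (rule ccontr)
   assume n: "DI b f u h ~= 0"
   define K where "K = hn h + Rq (hn u + hn h)*(hn h)^2"
   have K: "K > 0" using hp Rq_pos[of "hn u + hn h"] by (simp add: K_def add_pos_nonneg less_imp_le)
   show False using *[of "abs (DI b f u h)/(2*K)"] n K
    unfolding K_def[symmetric] by (simp add: field_simps)
  qed
 qed
next
 assume u: "u \<in> H & (\<forall>h\<in>H. DI b f u h = 0)"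
 show "crit_Hs s (Ifun s p b f) u"
  unfolding crit_Hs_def
 proof (intro conjI allI impI)
  fix e :: real assume e: "e > 0"
  define R where "R = Rq (hn u + 1)"
  have R: "R > 0" by (simp add: R_def Rq_pos)
  show "\<exists>d>0. \<forall>h\<in>H. hn h < d --> abs (Ifun s p b f (%x. u x + h x) - Ifun s p b f u) <= e*hn h"
  proof (intro exI[of _ "min 1 (e/R)"] conjI ballI impI)
   fix h assume h: "h \<in> H" "hn h < min 1 (e/R)"
   have "abs (Ifun s p b f (%x. u x + h x) - Ifun s p b f u) <= Rq (hn u + hn h)*(hn h)^2"
    using I_taylor[OF assms, of u h] u h by simp
   also have "... <= R*(hn h)^2" unfolding R_def using h hn_nonneg[of u] hn_nonneg[of h] by (intro mult_right_mono Rq_mono) auto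
   also have "... = (R*hn h)*hn h" by (simp add: power2_eq_square)
   also have "... <= e*hn h" using h R hn_nonneg[of h] by (intro mult_right_mono) (auto simp: field_simps)
   finally show "abs (Ifun s p b f (%x. u x + h x) - Ifun s p b f u) <= e*hn h" .
  qed (use e R in auto)
 qed (use u in auto)
qed

text \<open>Equal to \<open>1/2 - 1/(p + 1)\<close>, the ratio of energy to squared norm at a
  critical point without forcing term.\<close>

definition kap :: real where "kap = (p - 1)/(2*(p + 1))"
lemma kap_pos: "kap > 0" using p_gt_1 by (simp add: kap_def)

end

section \<open>The reduced functional on the manifold\<close>

locale potential = nonlinear s dd n_type p for s dd and n_type :: "'n::finite itself" and p +
 fixes a :: "real^'n => real"
 assumes a_coef: "coef a" and a_low: "\<exists>c>0. \<forall>x. c <= a x"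
  and a_dec: "\<exists>C. \<forall>x. 1 - a x <= C * om x powr ((p + 1)/2)"
  and a_ne1: "~ (AE x in lborel. a x = 1)"
begin

abbreviation Sg :: "'n fn set" where "Sg \<equiv> Sigma_plus s"
abbreviation I :: "('n fn => real) => 'n fn => real" where "I f \<equiv> Ifun s p a f"
abbreviation J :: "('n fn => real) => 'n fn => real" where "J f \<equiv> Jfun s p a f"
abbreviation Ba :: "'n fn => real" where "Ba \<equiv> Bf a"

text \<open>\<open>tS\<close> is the smallest maximising parameter for zero forcing, attained when
  the power integral equals its bound \<open>Sq\<close>. \<open>tlow\<close> comes from the
  second-order condition with the same bound. A dual norm up to \<open>dS\<close> keeps the energy
  on every ray positive somewhere; the factor 2 leaves room for a strict inequality.\<close>

definition tS :: real where "tS = Sq powr (- 1/(p - 1))"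
definition tlow :: real where "tlow = (1/(p*Sq)) powr (1/(p - 1))"
definition dS :: real where "dS = kap*tS/2"
definition fsm :: "('n fn => real) => bool" where "fsm f \<longleftrightarrow> f \<in> Hd & fnorm f <= dS"

lemma tS_pos: "tS > 0" and tlow_pos: "tlow > 0" and dS_pos: "dS > 0"
 using Sq_pos p_gt_1 kap_pos by (auto simp: tS_def tlow_def dS_def)

lemma SgD: "v \<in> Sg ==> v \<in> H" "v \<in> Sg ==> hn v = 1" by (auto simp: Sigma_plus_def)

lemma Ba_pos_iff: assumes "v \<in> H" shows "Ba v > 0 \<longleftrightarrow> ~ (AE x in L. max (v x) 0 = 0)"
proof -
 have "Ba v = 0 \<longleftrightarrow> (AE x in L. a x*max (v x) 0 powr (p + 1) = 0)"
  unfolding Bf_def using Bf_integrable[OF a_coef assms] coefD(2)[OF a_coef]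
  by (intro integral_nonneg_eq_0_iff_AE) auto
 also have "... \<longleftrightarrow> (AE x in L. max (v x) 0 = 0)"
 proof -
  have "a x ~= 0" for x using a_low by (metis not_le order_less_irrefl)
  thus ?thesis by simp
 qed
 finally show ?thesis using Bf_nonneg[OF a_coef, of v] by linarith
qed

lemma Sg_iff: "v \<in> Sg \<longleftrightarrow> v \<in> H & hn v = 1 & Ba v > 0"
 using Ba_pos_iff by (auto simp: Sigma_plus_def)

lemma Sg_Ba: assumes "v \<in> Sg" shows "Ba v > 0" "Ba v <= Sq"
 using assms Bf_le[OF a_coef, of v] by (auto simp: Sg_iff)

lemma I_gfun: assumes "v \<in> Sg" "f \<in> Hd" "t >= 0" shows "I f (%x. t * v x) = gfun p (Ba v) (f v) t"
 using assms SgD[OF assms(1)] by (simp add: Ifun_eq hn_scale Bf_scale dual_scale gfun_def power_mult_distrib)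

definition tm :: "('n fn => real) => 'n fn => real" where
 "tm f v = (SOME t. t > 0 & (\<forall>r>0. gfun p (Ba v) (f v) r <= gfun p (Ba v) (f v) t) & t - Ba v * t powr p = f v & gfun p (Ba v) (f v) t > 0)"

text \<open>The parameter \<open>B powr (- 1/(p - 1))\<close> is the maximiser for
  \<open>pha = 0\<close>; it serves as a test point for lower bounds on the maximum.\<close>

lemma gfun_at_natural:
 assumes "B > 0" shows "gfun p B pha (B powr (- 1/(p - 1))) = kap*(B powr (- 1/(p - 1)))^2 - B powr (- 1/(p - 1))*pha"
proof -
 let ?t = "B powr (- 1/(p - 1))"
 have "?t powr (p - 1) = B powr (- 1)" using p_gt_1 by (subst powr_powr) simp
 hence "?t powr (p - 1)*B = 1" using assms by (simp add: powr_minus)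
 moreover have "?t powr (p + 1) = ?t powr (p - 1)*?t^2"
  using powr_add[of ?t "p - 1" 2] assms by (simp add: powr_numeral add.commute)
 ultimately have "?t powr (p + 1)*B = ?t^2" by (simp add: mult_ac)
 thus ?thesis unfolding gfun_def using p_gt_1 by (simp add: kap_def field_simps)
qed

lemma tS_le: assumes "B > 0" "B <= Sq" shows "tS <= B powr (- 1/(p - 1))"
 unfolding tS_def using assms p_gt_1 by (intro powr_mono2') auto

lemma tm_props:
 assumes "fsm f" "v \<in> Sg"
 shows "tm f v > 0" "r > 0 ==> gfun p (Ba v) (f v) r <= gfun p (Ba v) (f v) (tm f v)"
  "tm f v - Ba v * tm f v powr p = f v" "gfun p (Ba v) (f v) (tm f v) > 0" "tm f v >= tlow"
proof -
 have f: "f \<in> Hd" "abs (f v) <= dS" using assms dual_bound[of f v] SgD[OF assms(2)] by (auto simp: fsm_def)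
 let ?t = "Ba v powr (- 1/(p - 1))"
 have t: "tS <= ?t" "?t > 0" using tS_le Sg_Ba[OF assms(2)] by auto
 have "kap*tS <= kap*?t" using t kap_pos by simp
 hence "f v < kap*?t" using f dS_pos by (simp add: dS_def abs_le_iff)
 hence "gfun p (Ba v) (f v) ?t > 0"
  using t gfun_at_natural[OF Sg_Ba(1)[OF assms(2)], of "f v"] mult_strict_left_mono[of "f v" "kap*?t" ?t] by (simp add: power2_eq_square mult_ac)
 hence "\<exists>t>0. (\<forall>r>0. gfun p (Ba v) (f v) r <= gfun p (Ba v) (f v) t) & t - Ba v * t powr p = f v & gfun p (Ba v) (f v) t > 0"
  using gfun_max_exists[OF p_gt_1 Sg_Ba(1)[OF assms(2)]] t(2) by blast
 hence *: "tm f v > 0 & (\<forall>r>0. gfun p (Ba v) (f v) r <= gfun p (Ba v) (f v) (tm f v)) & tm f v - Ba v * tm f v powr p = f v & gfun p (Ba v) (f v) (tm f v) > 0"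
  unfolding tm_def by (rule someI_ex)
 thus "tm f v > 0" "r > 0 ==> gfun p (Ba v) (f v) r <= gfun p (Ba v) (f v) (tm f v)"
  "tm f v - Ba v * tm f v powr p = f v" "gfun p (Ba v) (f v) (tm f v) > 0" by auto
 have "1 <= p*Ba v * tm f v powr (p - 1)"
  using gfun_max_props(2)[OF p_gt_1 Sg_Ba(1)[OF assms(2)], of "tm f v" "f v"] * by blast
 also have "... <= p*Sq*tm f v powr (p - 1)" using Sg_Ba[OF assms(2)] p_gt_1 by (intro mult_right_mono mult_left_mono) auto
 finally have "1/(p*Sq) <= tm f v powr (p - 1)" using p_gt_1 Sq_pos by (simp add: field_simps)
 hence "(1/(p*Sq)) powr (1/(p - 1)) <= (tm f v powr (p - 1)) powr (1/(p - 1))"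
  using p_gt_1 Sq_pos by (intro powr_mono2) auto
 thus "tm f v >= tlow" using * p_gt_1 by (simp add: tlow_def powr_powr)
qed

text \<open>The supremum is attained at \<open>tm f v\<close>, so it is a genuine maximum. The last
  formula removes the power integral by the first-order condition and makes the value coercive in
  the parameter.\<close>

lemma J_eq:
 assumes "fsm f" "v \<in> Sg"
 shows "J f v = I f (%x. tm f v * v x)" "J f v = gfun p (Ba v) (f v) (tm f v)"
  "r > 0 ==> I f (%x. r * v x) <= J f v" "J f v > 0"
  "J f v = kap*(tm f v)^2 - p/(p + 1)*tm f v * f v"
proof -
 have f: "f \<in> Hd" using assms by (simp add: fsm_def)
 note t = tm_props[OF assms]
 have "J f v = (SUP r\<in>{0<..}. gfun p (Ba v) (f v) r)"
  unfolding Jfun_def using I_gfun[OF assms(2) f] by (intro SUP_cong) auto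
 also have "... = gfun p (Ba v) (f v) (tm f v)"
  using t by (intro cSup_eq_maximum) auto
 finally show J: "J f v = gfun p (Ba v) (f v) (tm f v)" .
 thus "J f v = I f (%x. tm f v * v x)" "J f v > 0" using I_gfun[OF assms(2) f] t by auto
 show "r > 0 ==> I f (%x. r * v x) <= J f v" using J I_gfun[OF assms(2) f] t(2) by auto
 show "J f v = kap*(tm f v)^2 - p/(p + 1)*tm f v * f v"
  unfolding J kap_def using gfun_max_props(1)[OF p_gt_1 Sg_Ba(1)[OF assms(2)], of "tm f v" "f v"] t by auto
qed

lemma tm_upper: assumes "fsm f" "v \<in> Sg" "J f v <= c" shows "tm f v <= max 1 ((abs c + dS)/kap)"
proof (cases "tm f v <= 1")
 case False
 define t where "t = tm f v"
 have f: "abs (f v) <= dS" using assms dual_bound[of f v] SgD[OF assms(2)] by (auto simp: fsm_def)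
 have "p/(p + 1)*f v <= dS"
 proof -
  have "p/(p + 1)*f v <= p/(p + 1)*dS" using f p_gt_1 by (intro mult_left_mono) (auto simp: abs_le_iff)
  also have "... <= 1*dS" using p_gt_1 dS_pos by (intro mult_right_mono) auto
  finally show ?thesis by simp
 qed
 hence "p/(p + 1)*f v * t <= dS*t" using False by (intro mult_right_mono) (auto simp: t_def)
 hence "kap*t^2 <= c + dS*t" using J_eq(5)[OF assms(1,2)] assms(3) by (simp add: t_def mult_ac)
 also have "... <= (abs c + dS)*t" using False mult_left_mono[of 1 t "abs c"] by (simp add: t_def algebra_simps)
 finally have "kap*t <= abs c + dS" using False by (simp add: t_def power2_eq_square)
 hence "t <= (abs c + dS)/kap" using kap_pos by (simp add: field_simps)
 thus ?thesis by (simp add: t_def)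
qed auto

lemma hn_tendsto:
 assumes "!!n. v n \<in> H" "w \<in> H" "(%n. hn (%x. v n x - w x)) ---> 0"
 shows "(%n. hn (v n)) ---> hn w" "coef b ==> (%n. Bf b (v n)) ---> Bf b w" "f \<in> Hd ==> (%n. f (v n)) ---> f w"
proof -
 show h: "(%n. hn (v n)) ---> hn w"
  by (rule LIM_zero_cancel, rule tendsto_0_le[OF assms(3), of _ 1]) (auto intro!: always_eventually simp: hn_nonneg hn_reverse_triangle assms)
 show "(%n. f (v n)) ---> f w" if "f \<in> Hd"
 proof (rule LIM_zero_cancel, rule tendsto_0_le[OF assms(3), of _ "fnorm f"], intro always_eventually allI)
  show "norm (f (v n) - f w) <= norm (hn (%x. v n x - w x))*fnorm f" for n
   using dual_bound[OF that H_diff[OF assms(1,2)], of n] dual_diff[OF that assms(1,2), of n] by (simp add: hn_nonneg mult.commute)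
 qed
 show "(%n. Bf b (v n)) ---> Bf b w" if b: "coef b"
 proof -
  let ?h = "%n x. v n x - w x"
  have t: "abs (Bf b (v n) - Bf b w - (p + 1)*Nf b w (?h n)) <= Ct*(hn w + hn (?h n)) powr (p - 1)*(hn (?h n))^2" for n
   using Bf_taylor[OF b assms(2) H_diff[OF assms(1,2)], of n] by simp
  have "(%n. Nf b w (?h n)) ---> 0"
   by (rule tendsto_0_le[OF assms(3), of _ "3*Sq*hn w powr p"], intro always_eventually allI)
    (use Nf_bound[OF b assms(2) H_diff[OF assms(1,2)]] in \<open>simp add: hn_nonneg mult_ac\<close>)
  moreover have "(%n. Ct*(hn w + hn (?h n)) powr (p - 1)*(hn (?h n))^2) ---> Ct*(hn w + 0) powr (p - 1)*0^2"
   using assms(3) p_gt_1 hn_nonneg by (intro tendsto_intros tendsto_powr2) (auto intro!: always_eventually)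
  hence g0: "(%n. Ct*(hn w + hn (?h n)) powr (p - 1)*(hn (?h n))^2) ---> 0" by simp
  have "(%n. Bf b (v n) - Bf b w - (p + 1)*Nf b w (?h n)) ---> 0"
   by (rule Lim_null_comparison[OF _ g0]) (use t in \<open>simp add: always_eventually\<close>)
  ultimately have "(%n. (Bf b (v n) - Bf b w - (p + 1)*Nf b w (?h n)) + (p + 1)*Nf b w (?h n)) ---> 0 + (p + 1)*0"
   by (intro tendsto_intros)
  thus ?thesis by (simp add: LIM_zero_iff)
 qed
qed

lemma tm_tendsto:
 assumes "fsm f" "!!n. v n \<in> Sg" "w \<in> Sg" "(%n. hn (%x. v n x - w x)) ---> 0"
 shows "(%n. tm f (v n)) ---> tm f w" "(%n. J f (v n)) ---> J f w"
proof -
 have f: "f \<in> Hd" using assms by (simp add: fsm_def)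
 note l = hn_tendsto[OF SgD(1)[OF assms(2)] SgD(1)[OF assms(3)] assms(4)]
 show t: "(%n. tm f (v n)) ---> tm f w"
  by (rule gfun_max_continuous[OF p_gt_1 Sg_Ba(1)[OF assms(3)] l(2)[OF a_coef] l(3)[OF f], where ta=tlow])
   (use tm_props[OF assms(1,2)] tm_props[OF assms(1,3)] tlow_pos in auto)
 show "(%n. J f (v n)) ---> J f w"
  unfolding J_eq(5)[OF assms(1,2)] J_eq(5)[OF assms(1,3)] using t l(3)[OF f] by (intro tendsto_intros)
qed

text \<open>The derivative of \<open>J f\<close> given by the envelope principle: the dependence of
  the parameter \<open>tm f v\<close> on \<open>v\<close> does not contribute to first
  order.\<close>

definition DJ :: "('n fn => real) => 'n fn => 'n fn => real" where
 "DJ f v h = tm f v * DI a f (%x. tm f v * v x) h"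

text \<open>The maximality in \<open>t\<close> is stationarity in the radial direction. Therefore
  the full derivative at the projected point vanishes as soon as it vanishes on tangent vectors, and
  its Riesz representative is tangent.\<close>

lemma DI_tm_self: assumes "fsm f" "v \<in> Sg" shows "DI a f (%x. tm f v * v x) v = 0"
proof -
 let ?t = "tm f v"
 have f: "f \<in> Hd" using assms by (simp add: fsm_def)
 have "?t*Nf a (%x. ?t * v x) v = Nf a (%x. ?t * v x) (%x. ?t * v x)" by (simp add: Nf_scale)
 also have "... = ?t powr (p + 1)*Ba v" using tm_props(1)[OF assms] by (simp add: Nf_self Bf_scale)
 also have "... = ?t*(?t powr p*Ba v)" using tm_props(1)[OF assms] by (simp add: powr_add)
 finally have "Nf a (%x. ?t * v x) v = ?t powr p*Ba v" using tm_props(1)[OF assms] by simp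
 moreover have "ip (%x. ?t * v x) v = ?t" using SgD[OF assms(2)] hn_sq[of v] by (simp add: ip_scale_left)
 ultimately show ?thesis using tm_props(3)[OF assms] by (simp add: DI_def mult.commute)
qed

text \<open>An envelope argument: \<open>J f w\<close> is attained at \<open>tm f w\<close>, while \<open>J f v\<close> dominates
  the value at that same parameter.\<close>
lemma J_step:
 assumes "fsm f" "v \<in> Sg" "w \<in> Sg" "tm f v <= T" "tm f w <= T"
 shows "J f w - J f v <= DJ f v (%x. w x - v x)
   + (abs (tm f w - tm f v)*(abs (DI a f (%x. tm f v * v x) (%x. w x - v x)) + T*Lq (2*T)*hn (%x. w x - v x))) + Rq (3*T)*T^2*(hn (%x. w x - v x))^2"
proof -
 have f: "f \<in> Hd" using assms by (simp add: fsm_def)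
 note v = SgD[OF assms(2)] and w = SgD[OF assms(3)]
 define t where "t = tm f w"
 define r where "r = tm f v"
 have t: "0 < t" "t <= T" "0 < r" "r <= T" using assms tm_props(1) by (auto simp: t_def r_def)
 define h where "h = (%x. w x - v x)"
 have h: "h \<in> H" "hn h <= 2" using H_diff[OF w(1) v(1)] hn_diff_le[OF w(1) v(1)] v w by (auto simp: h_def)
 have tv: "(%x. t * v x) \<in> H" "hn (%x. t * v x) = t" "(%x. t*h x) \<in> H" "hn (%x. t*h x) = t*hn h"
  using H_scale v h t hn_scale by auto
 have rv: "(%x. r * v x) \<in> H" "hn (%x. r * v x) = r" using H_scale v t hn_scale by auto
 have "J f w - J f v <= I f (%x. t*w x) - I f (%x. t * v x)"
  using J_eq(1)[OF assms(1,3)] J_eq(3)[OF assms(1,2) t(1)] by (simp add: t_def)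
 also have "(%x. t*w x) = (%x. t * v x + t*h x)" by (simp add: h_def algebra_simps)
 also have "I f (%x. t * v x + t*h x) - I f (%x. t * v x) <= DI a f (%x. t * v x) (%x. t*h x) + Rq (t + t*hn h)*(t*hn h)^2"
  using I_taylor[OF a_coef f tv(1,3)] tv by (simp add: abs_le_iff)
 also have "Rq (t + t*hn h)*(t*hn h)^2 <= Rq (3*T)*(T*hn h)^2"
 proof (intro mult_mono Rq_mono power_mono)
  have "t*hn h <= T*2" using t h hn_nonneg[of h] by (intro mult_mono) auto
  thus "t + t*hn h <= 3*T" using t by simp
 qed (use t hn_nonneg[of h] Rq_pos[of "3*T"] in \<open>auto simp: less_imp_le intro: mult_right_mono\<close>)
 also have "DI a f (%x. t * v x) (%x. t*h x) = t*DI a f (%x. t * v x) h" by (rule DI_scale[OF f h(1)])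
 also have "t*DI a f (%x. t * v x) h <= r*DI a f (%x. r * v x) h + abs (t - r)*(abs (DI a f (%x. r * v x) h) + T*Lq (2*T)*hn h)"
 proof -
  have d: "hn (%x. t * v x - r * v x) = abs (t - r)" using hn_scale[of "t - r" v] v by (simp add: left_diff_distrib)
  have "abs (DI a f (%x. t * v x) h - DI a f (%x. r * v x) h) <= Lq (t + r)*abs (t - r)*hn h"
   using DI_lip[OF a_coef f tv(1) rv(1) h(1)] d tv rv by simp
  also have "... <= Lq (2*T)*abs (t - r)*hn h"
   using t hn_nonneg[of h] by (intro mult_right_mono Lq_mono) auto
  finally have q: "abs (DI a f (%x. t * v x) h - DI a f (%x. r * v x) h) <= Lq (2*T)*abs (t - r)*hn h" .
  have "t*DI a f (%x. t * v x) h - r*DI a f (%x. r * v x) h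
    = t*(DI a f (%x. t * v x) h - DI a f (%x. r * v x) h) + (t - r)*DI a f (%x. r * v x) h" by (simp add: algebra_simps)
  also have "... <= T*(Lq (2*T)*abs (t - r)*hn h) + abs (t - r)*abs (DI a f (%x. r * v x) h)"
  proof (rule add_mono)
   have "t*(DI a f (%x. t * v x) h - DI a f (%x. r * v x) h) <= t*abs (DI a f (%x. t * v x) h - DI a f (%x. r * v x) h)"
    using t by (intro mult_left_mono) auto
   also have "... <= T*(Lq (2*T)*abs (t - r)*hn h)" using q t by (intro mult_mono) auto
   finally show "t*(DI a f (%x. t * v x) h - DI a f (%x. r * v x) h) <= T*(Lq (2*T)*abs (t - r)*hn h)" .
   show "(t - r)*DI a f (%x. r * v x) h <= abs (t - r)*abs (DI a f (%x. r * v x) h)" by (metis abs_ge_self abs_mult)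
  qed
  finally show ?thesis by (simp add: algebra_simps)
 qed
 finally show ?thesis by (simp add: h_def r_def t_def DJ_def power_mult_distrib mult_ac)
qed

text \<open>If the condition failed, there would be a sequence on the manifold along which the
  difference quotient stays above \<open>e\<close>. Increases are bounded by \<open>J_step\<close>,
  where continuity of \<open>tm\<close> makes the coefficient tend to 0; decreases are quadratic, by
  comparison at the fixed parameter \<open>tm f v\<close>.\<close>

lemma crit_SigmaI:
 assumes "fsm f" "v \<in> Sg" "!!h. h \<in> H ==> DI a f (%x. tm f v * v x) h = 0"
 shows "crit_Sigma s (J f) v"
 unfolding crit_Sigma_def
proof (intro conjI allI impI assms(2), rule ccontr)
 fix e :: real assume e: "e > 0" and "~ (\<exists>d>0. \<forall>w\<in>Sg. hn (%x. w x - v x) < d --> abs (J f w - J f v) <= e*hn (%x. w x - v x))"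
 hence "\<forall>n. \<exists>w\<in>Sg. hn (%x. w x - v x) < 1/real (Suc n) & abs (J f w - J f v) > e*hn (%x. w x - v x)"
 proof (intro allI)
  fix n :: nat
  have "1/real (Suc n) > 0" by simp
  thus "\<exists>w\<in>Sg. hn (%x. w x - v x) < 1/real (Suc n) & abs (J f w - J f v) > e*hn (%x. w x - v x)"
   using \<open>~ (\<exists>d>0. _ d)\<close> by (meson not_le)
 qed
 then obtain w where w: "!!n. w n \<in> Sg" "!!n. hn (%x. w n x - v x) < 1/real (Suc n)" "!!n. abs (J f (w n) - J f v) > e*hn (%x. w n x - v x)"
  by metis
 have f: "f \<in> Hd" using assms by (simp add: fsm_def)
 have lim: "(%n. hn (%x. w n x - v x)) ---> 0"
  by (rule tendsto_sandwich[OF _ _ tendsto_const LIMSEQ_inverse_real_of_nat])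
   (use w(2) in \<open>auto intro!: always_eventually simp: hn_nonneg inverse_eq_divide less_imp_le\<close>)
 note t = tm_tendsto(1)[OF assms(1) w(1) assms(2) lim]
 obtain T0 where T0: "!!n. tm f (w n) <= T0" using convergent_imp_Bseq[OF convergentI[OF t]] unfolding Bseq_def by (metis abs_le_D1 real_norm_def)
 define T where "T = max T0 (tm f v)"
 have T: "tm f (w n) <= T" "tm f v <= T" for n using T0 by (auto simp: T_def le_max_iff_disj)
 have T0': "T > 0" using tm_props(1)[OF assms(1,2)] T(2) by simp
 define K where "K n = abs (tm f (w n) - tm f v)*(T*Lq (2*T)) + Rq (3*T)*T^2*hn (%x. w n x - v x)" for n
 have up: "J f (w n) - J f v <= K n*hn (%x. w n x - v x)" for n
  using J_step[OF assms(1,2) w(1) T(2) T(1), of n] assms(3)[OF H_diff[OF SgD(1)[OF w(1)] SgD(1)[OF assms(2)]], of n]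
  by (simp add: DJ_def K_def power2_eq_square algebra_simps)
 have lo: "J f v - J f (w n) <= Rq (3*T)*T^2*(hn (%x. w n x - v x))^2" for n
 proof -
  let ?r = "tm f v" let ?h = "%x. w n x - v x"
  have r: "?r > 0" by (rule tm_props(1)[OF assms(1,2)])
  note wn = SgD[OF w(1)[of n]] and vv = SgD[OF assms(2)]
  have h: "?h \<in> H" "hn ?h <= 2" using H_diff[OF wn(1) vv(1)] hn_diff_le[OF wn(1) vv(1)] wn vv by auto
  have m: "(%x. ?r * v x) \<in> H" "hn (%x. ?r * v x) = ?r" "(%x. ?r*?h x) \<in> H" "hn (%x. ?r*?h x) = ?r*hn ?h"
   using H_scale[OF vv(1), of ?r] hn_scale[of ?r v] vv H_scale[OF h(1), of ?r] hn_scale[of ?r ?h] r by auto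
  have e: "(%x. ?r * v x + ?r*?h x) = (%x. ?r*w n x)" by (simp add: algebra_simps)
  have "J f v - J f (w n) <= I f (%x. ?r * v x) - I f (%x. ?r*w n x)"
   using J_eq(1)[OF assms(1,2)] J_eq(3)[OF assms(1) w(1)[of n] r] by simp
  also have "... <= Rq (?r + ?r*hn ?h)*(?r*hn ?h)^2"
   using I_taylor[OF a_coef f m(1,3)] assms(3)[OF m(3)] m unfolding e by (simp add: abs_le_iff)
  also have "... <= Rq (3*T)*(T*hn ?h)^2"
  proof (intro mult_mono Rq_mono power_mono)
   have "?r*hn ?h <= T*2" using T(2) T0' h r hn_nonneg[of ?h] by (intro mult_mono) auto
   thus "?r + ?r*hn ?h <= 3*T" using T(2) by simp
  qed (use T(2) r hn_nonneg[of ?h] Rq_pos[of "3*T"] in \<open>auto simp: less_imp_le intro: mult_right_mono\<close>)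
  finally show ?thesis by (simp add: power_mult_distrib mult_ac)
 qed
 have "K n > e" for n
 proof -
  have h0: "hn (%x. w n x - v x) >= 0" by (rule hn_nonneg)
  have "Rq (3*T)*T^2*(hn (%x. w n x - v x))^2 <= K n*hn (%x. w n x - v x)"
   using h0 Lq_pos[of "2*T"] T0' by (simp add: K_def power2_eq_square distrib_right)
  hence "e*hn (%x. w n x - v x) < K n*hn (%x. w n x - v x)" using w(3)[of n] up[of n] lo[of n] by linarith
  thus ?thesis using h0 by (simp add: mult_less_cancel_right)
 qed
 moreover have "K ---> abs (tm f v - tm f v)*(T*Lq (2*T)) + Rq (3*T)*T^2*0"
  unfolding K_def by (intro tendsto_intros t lim)
 hence "K ---> 0" by simp
 ultimately show False using e LIMSEQ_le_const[of K 0 e] by (meson less_imp_le not_le)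
qed

end

section \<open>The best constant, its maximisers and the ground state energy\<close>

locale setting = potential s dd n_type p a for s dd and n_type :: "'n::finite itself" and p a +
 fixes wst :: "real^'n => real"
 assumes wst: "ground_state s p wst"
begin

abbreviation one :: "'n fn" where "one \<equiv> %_. 1"
abbreviation B1 :: "'n fn => real" where "B1 \<equiv> Bf one"
abbreviation c0 :: real where "c0 \<equiv> Ifun s p one (%_. 0) wst"

text \<open>The best constant for the positive part with constant weight. The whole argument
  measures the loss of compactness by \<open>KK\<close>; the link with the ground state is made in
  \<open>c0_eq\<close>.\<close>

definition KK :: real where "KK = (SUP u\<in>{u\<in>H. hn u = 1}. B1 u)"

lemma wst_H: "wst \<in> H" and wst_pos: "wst x > 0" and wst_crit: "h \<in> H ==> DI one (%_. 0) wst h = 0"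
 using wst crit_Hs_iff[OF coef_one zero_dual] by (auto simp: ground_state_def)

lemma L_not_null: "~ (AE x in L. False)"
 by (subst AE_iff_measurable[OF _ refl]) (auto simp: emeasure_lborel_UNIV)

lemma wst_hn_pos: "hn wst > 0"
proof -
 have "~ (AE x in L. wst x = 0)"
 proof
  assume "AE x in L. wst x = 0"
  hence "AE x in L. False" by eventually_elim (metis wst_pos order_less_irrefl)
  thus False using L_not_null by simp
 qed
 thus ?thesis using hn_eq_0_iff[OF wst_H] hn_nonneg[of wst] by linarith
qed

lemma normalize: assumes "u \<in> H" "hn u > 0" shows "(%x. (1/hn u)*u x) \<in> H" "hn (%x. (1/hn u)*u x) = 1"
 using H_scale[OF assms(1), of "1/hn u"] hn_scale[of "1/hn u" u] assms by auto

lemma KK_bdd: "bdd_above (B1 ` {u\<in>H. hn u = 1})"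
 using Bf_le[OF coef_one] by (intro bdd_aboveI[of _ Sq]) fastforce

lemma B1_le_KK: assumes "u \<in> H" shows "B1 u <= KK*hn u powr (p + 1)"
proof (cases "hn u = 0")
 case True
 thus ?thesis using Bf_le[OF coef_one assms] p_gt_1 by simp
next
 case False
 hence h: "hn u > 0" using hn_nonneg[of u] by linarith
 have "B1 (%x. (1/hn u)*u x) <= KK"
  unfolding KK_def using normalize[OF assms h] by (intro cSUP_upper[OF _ KK_bdd]) auto
 hence "(1/hn u) powr (p + 1)*B1 u <= KK" using h Bf_scale[of "1/hn u" one u] by simp
 thus ?thesis using h by (simp add: powr_divide field_simps)
qed

lemma wst_B1: "B1 wst = (hn wst)^2"
 using wst_crit[OF wst_H] by (simp add: DI_def Nf_self hn_sq)

lemma KK_pos: "KK > 0"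
proof -
 have "0 < (hn wst)^2" using wst_hn_pos by simp
 also have "... <= KK*hn wst powr (p + 1)" using B1_le_KK[OF wst_H] wst_B1 by simp
 finally show ?thesis using wst_hn_pos by (simp add: zero_less_mult_iff)
qed

lemma Ba_le_B1: "u \<in> H ==> Ba u <= B1 u"
 using coefD[OF a_coef] by (intro Bf_mono a_coef coef_one) auto

text \<open>The vanishing alternative of concentration compactness, proved with dyadic averages. If
  all averages at a fine scale were below \<open>M\<close>, the power integral would be small:
  moderate values contribute at most \<open>be/4\<close> times the squared L2 norm, larger ones are
  controlled by a higher power and by the deviation from the average. Hence some cube carries a
  definite mass.\<close>

lemma nonvanishing:
 assumes v: "!!n. v n \<in> H" "!!n. hn (v n) <= 1" and B: "be > 0" "!!n. B1 (v n) >= be"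
 obtains dl where "dl > 0" "!!n. \<exists>x. (LINT y|L. om y*(v n (y + x))^2) >= dl"
proof -
 define q where "q = (p + 1 + crit2 TYPE('n))/2"
 have q: "p + 1 < q" "q < crit2 TYPE('n)" "2 <= q" using p1_subcritical p_gt_1 by (auto simp: q_def)
 obtain K where K: "K > 0" "!!u. u \<in> H ==> integrable L (%x. abs (u x) powr q)"
  "!!u. u \<in> H ==> (LINT x|L. abs (u x) powr q) <= K*hn u powr q" using sobolev[OF q(3,2)] by metis
 \<comment> \<open>The constants \<open>ep\<close>, \<open>k\<close> and \<open>M\<close> make three
   contributions at most \<open>be/4\<close> each: the power \<open>q\<close>, the deviation from
   averages, and the values below \<open>2 M\<close>. Together they stay below
   \<open>be\<close>.\<close>
 define ep where "ep = be/(4*(K + 1))"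
 have ep: "ep > 0" "ep*K <= be/4" using B K by (auto simp: ep_def field_simps)
 define r where "r = q - p - 1"
 have r: "r > 0" using q by (simp add: r_def)
 define Ce where "Ce = (1/ep) powr ((p - 1)/r)"
 have Ce: "Ce >= 0" by (simp add: Ce_def)
 have young: "abs t powr (p + 1) <= ep*abs t powr q + Ce*t^2" for t
 proof (cases "abs t powr r >= 1/ep")
  case True
  have "abs t powr (p + 1)*1 <= abs t powr (p + 1)*(ep*abs t powr r)"
   using True ep by (intro mult_left_mono) (auto simp: field_simps)
  also have "... = ep*abs t powr q" by (simp add: r_def powr_add[symmetric])
  finally show ?thesis using Ce by (simp add: add_increasing2)
 next
  case False
  have "abs t powr (p + 1) = abs t powr (p - 1)*t^2"
   using powr_add[of "abs t" "p - 1" 2] by (simp add: powr_numeral add.commute)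
  also have "abs t powr (p - 1) = (abs t powr r) powr ((p - 1)/r)" using r by (simp add: powr_powr)
  also have "... <= Ce" unfolding Ce_def using False r p_gt_1 by (intro powr_mono2) auto
  finally show ?thesis using ep by (simp add: add_increasing mult_right_mono)
 qed
 define c where "c = real CARD('n) powr dd"
 have "(%k. 4*Ce * c*(2 powr (- 2 * s)) ^ k) ---> 4*Ce * c*0"
  using s_pos by (intro tendsto_intros LIMSEQ_power_zero) (simp add: powr_less_one)
 hence "\<forall>\<^sub>F k in sequentially. 4*Ce * c*(2 powr (- 2 * s)) ^ k < be/4" using B by (intro order_tendstoD(2)) auto
 then obtain k where k: "4*Ce * c*(2 powr (- 2 * s)) ^ k < be/4" by (auto simp: eventually_sequentially)
 define M where "M = (be/4) powr (1/(p - 1))/2"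
 have M: "M > 0" "(2*M) powr (p - 1) = be/4" using B p_gt_1 by (auto simp: M_def powr_powr)
 define dl where "dl = (1 + real CARD('n)) powr - dd*(M^2 * vol k)"
 have "\<exists>x. (LINT y|L. om y*(v n (y + x))^2) >= dl" for n
 proof -
  define u where "u = v n"
  have u: "u \<in> H" "hn u <= 1" "B1 u >= be" using v B by (auto simp: u_def)
  have [measurable]: "u \<in> borel_measurable borel" using u H_meas by auto
  have us: "sqi L u" "integrable L (%x. (u x)^2)" using H_sqi[OF u(1)] by (auto simp: sqiD)
  have hn1: "(hn u)^2 <= 1" using u hn_nonneg[of u] by (simp add: power_le_one)
  have "\<exists>x. abs (avg k u x) > M"
  proof (rule ccontr)
   assume "~ ?thesis"
   hence av: "abs (avg k u x) <= M" for x by (simp add: not_less)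
   have pt: "abs (u x) powr (p + 1) <= be/4*(u x)^2 + (ep*abs (u x) powr q + 4*Ce*(u x - avg k u x)^2)" for x
   proof (cases "abs (u x) <= 2*M")
    case True
    have "abs (u x) powr (p + 1) = abs (u x) powr (p - 1)*(u x)^2"
     using powr_add[of "abs (u x)" "p - 1" 2] by (simp add: powr_numeral add.commute)
    also have "... <= (2*M) powr (p - 1)*(u x)^2" using True p_gt_1 by (intro mult_right_mono powr_mono2) auto
    finally have "abs (u x) powr (p + 1) <= be/4*(u x)^2" using M by simp
    moreover have "0 <= ep*abs (u x) powr q + 4*Ce*(u x - avg k u x)^2" using ep Ce by simp
    ultimately show ?thesis by linarith
   next
    case False
    hence "abs (u x) <= 2*abs (u x - avg k u x)" using av[of x] by (smt (verit))
    hence "abs (u x) <= abs (2*(u x - avg k u x))" by (simp only: abs_mult abs_numeral)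
    hence "(u x)^2 <= (2*(u x - avg k u x))^2" by (rule abs_le_square_iff[THEN iffD1])
    hence "Ce*(u x)^2 <= Ce*(4*(u x - avg k u x)^2)" unfolding power_mult_distrib using Ce by (intro mult_left_mono) auto
    moreover have "0 <= be/4*(u x)^2" using B by simp
    ultimately show ?thesis using young[of "u x"] by simp
   qed
   have i3: "integrable L (%x. (u x - avg k u x)^2)" using avg_L2(1)[OF u(1)] by (rule sqiD)
   have "be <= B1 u" by (rule u(3))
   also have "... <= (LINT x|L. abs (u x) powr (p + 1))"
    unfolding Bf_def using Bf_integrable[OF coef_one u(1)] int_p1[OF u(1)] p_gt_1 by (intro integral_mono) (auto intro: pos_powr_le)
   also have "... <= (LINT x|L. be/4*(u x)^2 + (ep*abs (u x) powr q + 4*Ce*(u x - avg k u x)^2))"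
    using pt us i3 K(2)[OF u(1)] int_p1[OF u(1)] by (intro integral_mono) auto
   also have "... = be/4*(LINT x|L. (u x)^2) + (ep*(LINT x|L. abs (u x) powr q) + 4*Ce*(LINT x|L. (u x - avg k u x)^2))"
    using us i3 K(2)[OF u(1)] by simp
   also have "... <= be/4*1 + (ep*K + 4*Ce*(c*(2 powr (- 2 * s)) ^ k))"
   proof (intro add_mono mult_left_mono)
    show "(LINT x|L. (u x)^2) <= 1" using L2_le_hn[of u] hn1 by linarith
    have "hn u powr q <= 1" using u(2) q hn_nonneg[of u] by (intro powr_le1) auto
    thus "(LINT x|L. abs (u x) powr q) <= K" using K(3)[OF u(1)] mult_left_mono[of "hn u powr q" 1 K] K(1) by linarith
    have "(LINT x|L. (u x - avg k u x)^2) <= real CARD('n) powr dd*2 powr (- 2 * s * k)*1"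
     using df_le_hn[of u] hn1 by (intro order_trans[OF avg_L2(2)[OF u(1)]] mult_left_mono) auto
    thus "(LINT x|L. (u x - avg k u x)^2) <= c*(2 powr (- 2 * s)) ^ k"
     by (simp add: c_def powr_realpow[symmetric] powr_powr)
   qed (use B ep Ce in auto)
   finally show False using ep k B by simp
  qed
  then obtain x where x: "abs (avg k u x) > M" by blast
  let ?Q = "indicator (cube k (ix k x)) :: real^'n => real"
  have Qi: "integrable L ?Q" "(LINT y|L. ?Q y) = vol k" by (rule cube_integral)+
  have Qs: "sqi L (%y. ?Q y*u y)" using us by (intro sqi_mono[OF us(1)]) (auto simp: indicator_def)
  have Qi2: "integrable L (%y. ?Q y*(u y)^2)" using sqiD(2)[OF Qs] by (simp add: power_mult_distrib indicator_sq)
  have "M * vol k < \<bar>\<integral>y. ?Q y*u y \<partial>L\<bar>" using x vol_pos[of k] by (simp add: avg_def cavg_def abs_divide field_simps)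
  also have "... <= (LINT y|L. abs (?Q y*u y))" by (rule integral_abs_bound)
  also have "... <= (LINT y|L. M/2*?Q y + (1/(2*M))*(?Q y*(u y)^2))"
  proof (intro integral_mono integrable_abs cube_int_sqi us)
   show "integrable L (%y. M/2*?Q y + (1/(2*M))*(?Q y*(u y)^2))" using Qi Qi2 by auto
   have "abs t <= M/2 + t^2/(2*M)" for t :: real
   proof -
    have "0 <= (M - abs t)^2" by simp
    hence "2*(M*abs t) <= M*M + t^2" unfolding power2_diff by (simp add: power2_eq_square[of M])
    thus ?thesis using M by (simp add: field_simps)
   qed
   thus "abs (?Q y*u y) <= M/2*?Q y + (1/(2*M))*(?Q y*(u y)^2)" for y by (auto simp: indicator_def)
  qed
  also have "... = M/2 * vol k + (1/(2*M))*(LINT y|L. ?Q y*(u y)^2)" using Qi Qi2 by simp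
  finally have big: "M^2 * vol k <= (LINT y|L. ?Q y*(u y)^2)" using M by (simp add: field_simps power2_eq_square)
  have "dl <= (1 + real CARD('n)) powr - dd*(LINT y|L. ?Q y*(u y)^2)"
   unfolding dl_def using big by (intro mult_left_mono) auto
  also have "... = (LINT y|L. (1 + real CARD('n)) powr - dd*(?Q y*(u y)^2))" by simp
  also have "... <= (LINT y|L. om (y - x)*(u y)^2)"
  proof (intro integral_mono)
   show "integrable L (%y. (1 + real CARD('n)) powr - dd*(?Q y*(u y)^2))" using Qi2 by simp
   show "integrable L (%y. om (y - x)*(u y)^2)"
    by (rule integrable_boundI[OF us(2)]) (auto simp: abs_mult less_imp_le om_pos om_le_1 intro!: mult_left_le_one_le)
   show "(1 + real CARD('n)) powr - dd*(?Q y*(u y)^2) <= om (y - x)*(u y)^2" for y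
   proof (cases "y \<in> cube k (ix k x)")
    case True
    hence "norm (y - x) <= real CARD('n)/2 ^ k" using cube_norm[of k y x] by (simp add: cube_def)
    also have "... <= real CARD('n)" by (simp add: field_simps)
    finally have "(1 + real CARD('n)) powr - dd <= om (y - x)"
     unfolding om_def using dd_pos by (intro powr_mono2') (auto simp: add_pos_nonneg)
    thus ?thesis using True by (auto intro: mult_right_mono)
   qed (simp add: less_imp_le om_pos)
  qed
  also have "... = (LINT y|L. om y*(u (y + x))^2)"
   using integral_lborel_shift(1)[of "%y. om (y - x)*(u y)^2" x] by simp
  finally show ?thesis by (auto simp: u_def)
 qed
 moreover have "dl > 0" using M vol_pos[of k] by (simp add: dl_def)
 ultimately show ?thesis using that by blast
qed

lemma split_powr_strict:
 fixes tha r :: real assumes "0 < tha" "tha < 1" "r > 1" shows "tha powr r + (1 - tha) powr r < 1"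
proof -
 have "x powr r < x" if "0 < x" "x < 1" for x :: real
  using powr_less_mono'[of x 1 r] that assms by simp
 from this[of tha] this[of "1 - tha"] show ?thesis using assms by simp
qed

text \<open>The weighted mass bound excludes a zero weak limit. With \<open>tha\<close> the squared
  norm of the limit, the splittings of the norm and of the power integral give
  \<open>1 \<le> tha powr r + (1 - tha) powr r\<close> with \<open>r = (p + 1)/2 > 1\<close>, which
  forces \<open>tha = 1\<close> and hence strong convergence.\<close>

lemma core_compact:
 assumes u: "!!n. u n \<in> H" "!!n. hn (u n) = 1" and B: "(%n. B1 (u n)) ---> KK"
  and dl: "dl > 0" "!!n. (LINT y|L. om y*(u n y)^2) >= dl"
 obtains pha v where "strict_mono (pha :: nat => nat)" "v \<in> H" "hn v = 1" "B1 v = KK" "(%n. hn (%x. u (pha n) x - v x)) ---> 0"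
proof -
 obtain pha v where pha: "strict_mono pha" "v \<in> H" "hn v <= 1" "AE x in L. (%n. u (pha n) x) ---> v x"
  "(%n. LINT x|L. om x*(u (pha n) x - v x)^2) ---> 0" "!!g. g \<in> H ==> (%n. ip (u (pha n)) g) ---> ip v g"
  by (rule rellich[of u 1]) (use u in auto)
 have v0: "hn v > 0"
 proof (rule ccontr)
  assume "~ ?thesis"
  hence "AE x in L. v x = 0" using hn_eq_0_iff[OF pha(2)] hn_nonneg[of v] by auto
  hence "(LINT x|L. om x*(u (pha n) x - v x)^2) = (LINT x|L. om x*(u (pha n) x)^2)" for n
   using H_meas[OF u(1)] H_meas[OF pha(2)] by (intro integral_cong_AE) auto
  thus False using LIMSEQ_le_const[OF pha(5), of dl] dl by fastforce
 qed
 define tha where "tha = (hn v)^2"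
 have tha: "0 < tha" "tha <= 1" using v0 pha(3) by (auto simp: tha_def power_le_one)
 let ?z = "%n x. u (pha n) x - v x"
 have zH: "?z n \<in> H" for n using H_diff u pha by auto
 have "(%n. (hn (u (pha n)))^2 - 2*ip (u (pha n)) v + (hn v)^2) ---> 1 - 2*ip v v + (hn v)^2"
  unfolding u(2) using pha(6)[OF pha(2)] by (intro tendsto_eq_intros) auto
 hence z2: "(%n. (hn (?z n))^2) ---> 1 - tha"
  by (simp add: hn_sq_diff[OF u(1) pha(2)] tha_def flip: hn_sq)
 define r where "r = (p + 1)/2"
 have r: "r > 1" using p_gt_1 by (simp add: r_def)
 have pw: "x powr (p + 1) = (x^2) powr r" if "x >= 0" for x :: real
  using that powr_powr[of x 2 "(p + 1)/2"] by (cases "x = 0") (auto simp: powr_numeral r_def add_divide_distrib)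
 have "(%n. B1 (u (pha n)) - B1 (?z n)) ---> B1 v"
  by (rule brezis_lieb[OF coef_one, where C=1]) (use u pha in auto)
 moreover have "(%n. B1 (u (pha n))) ---> KK" using LIMSEQ_subseq_LIMSEQ[OF B pha(1)] by (simp add: comp_def)
 ultimately have "(%n. B1 (u (pha n)) - (B1 (u (pha n)) - B1 (?z n))) ---> KK - B1 v" by (intro tendsto_diff)
 hence Bz: "(%n. B1 (?z n)) ---> KK - B1 v" by simp
 have "(%n. KK*((hn (?z n))^2) powr r) ---> KK*(1 - tha) powr r"
  using z2 r by (intro tendsto_intros tendsto_powr2) (auto intro!: always_eventually)
 hence "KK - B1 v <= KK*(1 - tha) powr r"
  by (rule LIMSEQ_le[OF Bz]) (use B1_le_KK[OF zH] in \<open>auto simp: pw hn_nonneg\<close>)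
 moreover have "B1 v <= KK*tha powr r" using B1_le_KK[OF pha(2)] by (simp add: tha_def pw hn_nonneg)
 ultimately have "KK*1 <= KK*(tha powr r + (1 - tha) powr r)" by (simp add: algebra_simps)
 hence "1 <= tha powr r + (1 - tha) powr r" using KK_pos by simp
 hence tha1: "tha = 1" using split_powr_strict[of tha r] tha r by fastforce
 hence hv: "hn v = 1" using hn_nonneg[of v] by (simp add: tha_def power2_eq_1_iff)
 have "(%n. sqrt ((hn (?z n))^2)) ---> sqrt 0" using z2 tha1 by (intro tendsto_real_sqrt) simp
 hence lim: "(%n. hn (?z n)) ---> 0" by (simp add: hn_nonneg)
 have "(%n. B1 (u (pha n))) ---> B1 v" using hn_tendsto(2)[OF u(1) pha(2) lim coef_one] .
 hence "B1 v = KK" using LIMSEQ_unique \<open>(%n. B1 (u (pha n))) ---> KK\<close> by blast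
 thus ?thesis using that[OF pha(1,2) hv _ lim] by blast
qed

text \<open>Recentres a maximising sequence at points where it does not vanish, the form required by
  \<open>core_compact\<close>. The shift \<open>m\<close> drops the terms whose power integral may
  still be small.\<close>

lemma maximizing_translates:
 assumes v: "!!n. v n \<in> H" "!!n. hn (v n) = 1" and B: "(%n. B1 (v n)) ---> KK"
 obtains m y dl where "dl > 0" "!!n. (LINT z|L. om z*(v (n + m) (z + y n))^2) >= dl"
proof -
 have "\<forall>\<^sub>F n in sequentially. B1 (v n) > KK/2" using B KK_pos by (intro order_tendstoD) auto
 then obtain m where m: "!!n. n >= m ==> B1 (v n) > KK/2" by (auto simp: eventually_sequentially)
 obtain dl where dl: "dl > 0" "!!n. \<exists>x. (LINT y|L. om y*(v (n + m) (y + x))^2) >= dl"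
  by (rule nonvanishing[of "%n. v (n + m)" "KK/2"]) (use v m KK_pos in \<open>auto simp: less_imp_le\<close>)
 then obtain y where "!!n. (LINT z|L. om z*(v (n + m) (z + y n))^2) >= dl" by metis
 thus ?thesis using that dl(1) by blast
qed

lemma maximizer_exists: obtains v where "v \<in> H" "hn v = 1" "B1 v = KK"
proof -
 have ne: "{u\<in>H. hn u = 1} ~= {}" using normalize[OF wst_H wst_hn_pos] by blast
 have "\<exists>u. u \<in> H & hn u = 1 & B1 u > KK - 1/real (Suc n)" for n
  using less_cSUP_iff[OF ne KK_bdd, of "KK - 1/real (Suc n)"] unfolding KK_def[symmetric] by auto
 then obtain u where u: "!!n. u n \<in> H" "!!n. hn (u n) = 1" "!!n. B1 (u n) > KK - 1/real (Suc n)" by metis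
 have B: "(%n. B1 (u n)) ---> KK"
 proof (rule tendsto_sandwich)
  show "(%n. KK - 1/real (Suc n)) ---> KK"
   using tendsto_diff[OF tendsto_const LIMSEQ_inverse_real_of_nat, of KK] by (simp add: inverse_eq_divide)
  show "\<forall>\<^sub>F n in sequentially. B1 (u n) <= KK" using B1_le_KK[OF u(1)] u(2) by (simp add: always_eventually)
 qed (use u(3) in \<open>auto intro!: always_eventually less_imp_le\<close>)
 obtain m y dl where y: "dl > 0" "!!n. (LINT z|L. om z*(u (n + m) (z + y n))^2) >= dl"
  by (rule maximizing_translates[OF u(1,2) B]) blast
 show ?thesis
  by (rule core_compact[of "%n z. u (n + m) (z + y n)" dl])
   (use u y that LIMSEQ_ignore_initial_segment[OF B, of m] in \<open>auto simp: shift_H(1) hn_shift Bf_shift\<close>)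
qed

text \<open>Along the line \<open>v + t h\<close> the nonnegative function comparing the optimal
  bound with the power integral vanishes at \<open>t = 0\<close>, so its derivative there is
  0.\<close>

lemma maximizer_EL: assumes "v \<in> H" "hn v = 1" "B1 v = KK" "h \<in> H" shows "KK*ip v h = Nf one v h"
proof -
 define b c where "b = ip v h" and "c = (hn h)^2"
 define F where "F t = KK*(1 + 2*t*b + t^2 * c) powr ((p + 1)/2) - B1 (%x. v x + t*h x)" for t
 have hn2: "(hn (%x. v x + t*h x))^2 = 1 + 2*t*b + t^2 * c" for t
  using hn_sq_add[OF assms(1) H_scale[OF assms(4)], of t] assms(2) by (simp add: b_def c_def ip_scale_right hn_scale power_mult_distrib mult_ac)
 have pw: "x powr (p + 1) = (x^2) powr ((p + 1)/2)" if "x >= 0" for x :: real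
  using that powr_powr[of x 2 "(p + 1)/2"] by (cases "x = 0") (auto simp: powr_numeral add_divide_distrib)
 have F0: "F t >= 0" for t
  using B1_le_KK[OF H_add[OF assms(1) H_scale[OF assms(4), of t]]] by (simp add: F_def pw hn_nonneg hn2)
 have "F 0 = 0" using assms(3) by (simp add: F_def)
 have D1: "((%t. KK*(1 + 2*t*b + t^2 * c) powr ((p + 1)/2)) has_real_derivative KK*((p + 1)/2*(2*b))) (at 0)"
  by (auto intro!: derivative_eq_intros)
 have D2: "((%t. B1 (%x. v x + t*h x)) has_real_derivative (p + 1)*Nf one v h) (at 0)"
  unfolding has_field_derivative_iff
 proof -
  have "((%t. (B1 (%x. v x + t*h x) - B1 v)/t - (p + 1)*Nf one v h) \<longlongrightarrow> 0) (at 0)"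
  proof (rule Lim_null_comparison)
   show "((%t. Ct*(1 + abs t*hn h) powr (p - 1)*(abs t*(hn h)^2)) \<longlongrightarrow> 0) (at 0)"
    using hn_nonneg[of h] by (intro tendsto_eq_intros refl | simp add: add_nonneg_eq_0_iff)+
   show "\<forall>\<^sub>F t in at 0. norm ((B1 (%x. v x + t*h x) - B1 v)/t - (p + 1)*Nf one v h) <= Ct*(1 + abs t*hn h) powr (p - 1)*(abs t*(hn h)^2)"
   proof (rule eventually_at_filter[THEN iffD2], intro always_eventually allI impI)
    fix t :: real assume t: "t ~= 0"
    have "abs (B1 (%x. v x + t*h x) - B1 v - (p + 1)*(t*Nf one v h)) <= Ct*(1 + abs t*hn h) powr (p - 1)*(abs t*hn h)^2"
     using Bf_taylor[OF coef_one assms(1) H_scale[OF assms(4), of t]] assms(2) by (simp add: hn_scale Nf_scale)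
    hence "abs (t*((B1 (%x. v x + t*h x) - B1 v)/t - (p + 1)*Nf one v h)) <= abs t*(Ct*(1 + abs t*hn h) powr (p - 1)*(abs t*(hn h)^2))"
    proof -
     have "t*((B1 (%x. v x + t*h x) - B1 v)/t - (p + 1)*Nf one v h) = B1 (%x. v x + t*h x) - B1 v - (p + 1)*(t*Nf one v h)"
      using t by (simp only: right_diff_distrib nonzero_mult_div_cancel_left times_divide_eq_right) (simp add: mult_ac flip: right_diff_distrib)
     thus ?thesis using \<open>abs (_) <= Ct * (1 + abs t * hn h) powr (p - 1) * (abs t * hn h)^2\<close>
      by (simp add: power2_eq_square mult_ac)
    qed
    thus "norm ((B1 (%x. v x + t*h x) - B1 v)/t - (p + 1)*Nf one v h) <= Ct*(1 + abs t*hn h) powr (p - 1)*(abs t*(hn h)^2)"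
     using t unfolding abs_mult by simp
   qed
  qed
  thus "((%t. (B1 (%x. v x + t*h x) - B1 (%x. v x + 0*h x))/(t - 0)) \<longlongrightarrow> (p + 1)*Nf one v h) (at 0)"
   by (simp add: LIM_zero_iff)
 qed
 have "(F has_real_derivative KK*((p + 1)/2*(2*b)) - (p + 1)*Nf one v h) (at 0)"
  unfolding F_def by (rule DERIV_diff[OF D1 D2])
 hence "KK*((p + 1)/2*(2*b)) - (p + 1)*Nf one v h = 0"
  by (rule DERIV_local_min[of _ _ _ 1]) (use F0 \<open>F 0 = 0\<close> in auto)
 hence "(p + 1)*(KK*b - Nf one v h) = 0" by (simp add: algebra_simps)
 thus ?thesis using p_gt_1 by (simp add: b_def)
qed

text \<open>The norm of a ground state: multiplying a normalised maximiser by \<open>tK\<close>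
  balances the two sides of the Euler-Lagrange equation.\<close>

definition tK :: real where "tK = KK powr (- 1/(p - 1))"
lemma tK_pos: "tK > 0" using KK_pos by (simp add: tK_def)
lemma tK_powr: "tK powr (p - 1)*KK = 1"
proof -
 have "tK powr (p - 1) = KK powr (- 1)" unfolding tK_def using p_gt_1 by (subst powr_powr) simp
 thus ?thesis using KK_pos by (simp add: powr_minus)
qed

lemma c0_kap: "c0 = kap*(hn wst)^2"
 using p_gt_1 by (simp add: Ifun_eq wst_B1 kap_def field_simps)

lemma hn_ge_tK: assumes "u \<in> H" "hn u > 0" "(hn u)^2 <= B1 u" shows "tK <= hn u"
proof -
 have e: "hn u powr (p + 1) = hn u powr (p - 1)*(hn u)^2"
  using powr_add[of "hn u" "p - 1" 2] assms by (simp add: powr_numeral add.commute)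
 have "(hn u)^2 <= (KK*hn u powr (p - 1))*(hn u)^2" using assms(3) B1_le_KK[OF assms(1)] by (simp add: e)
 hence "1 <= KK*hn u powr (p - 1)" using assms(2) by simp
 hence "KK*tK powr (p - 1) <= KK*hn u powr (p - 1)" using tK_powr by (simp add: mult.commute)
 hence "tK powr (p - 1) <= hn u powr (p - 1)" using KK_pos by simp
 thus ?thesis using powr_less_mono2[of "p - 1" "hn u" tK] p_gt_1 assms(2) by (metis not_le diff_gt_0_iff_gt less_imp_le)
qed

text \<open>Identifies the least-energy definition with the variational one. The equation forces the
  norm of the ground state to be at least \<open>tK\<close>, and the scaled maximiser is a
  competitor with exactly this norm.\<close>

lemma c0_eq: "c0 = kap*tK^2"
proof (rule antisym)
 have "tK <= hn wst" by (rule hn_ge_tK[OF wst_H wst_hn_pos]) (simp add: wst_B1)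
 thus "kap*tK^2 <= c0" unfolding c0_kap using kap_pos tK_pos by (intro mult_left_mono power_mono) auto
 obtain v where v: "v \<in> H" "hn v = 1" "B1 v = KK" by (rule maximizer_exists)
 let ?u = "%x. tK * v x"
 have u: "?u \<in> H" "hn ?u = tK" using H_scale[OF v(1)] hn_scale[of tK v] v tK_pos by auto
 have "DI one (%_. 0) ?u h = 0" if "h \<in> H" for h
 proof -
  have "Nf one ?u h = tK powr p*Nf one v h"
  proof -
   have "max (tK * v x) 0 = tK*max (v x) 0" for x using tK_pos by (simp add: max_def mult_le_0_iff)
   hence "one x*max (tK * v x) 0 powr p*h x = tK powr p*(one x*max (v x) 0 powr p*h x)" for x
    using tK_pos by (simp add: powr_mult)
   hence "Nf one ?u h = (LINT x|L. tK powr p*(one x*max (v x) 0 powr p*h x))" unfolding Nf_def by presburger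
   thus ?thesis by (simp add: Nf_def)
  qed
  moreover have "tK powr p = tK powr (p - 1)*tK" using powr_add[of tK "p - 1" 1] tK_pos by simp
  ultimately show ?thesis using tK_powr maximizer_EL[OF v that]
   by (simp add: DI_def ip_scale_left) (metis mult.assoc mult.commute mult_1 tK_powr)
 qed
 hence "crit_Hs s (Ifun s p one (%_. 0)) ?u" using crit_Hs_iff[OF coef_one zero_dual] u by blast
 moreover have "~ (AE x in L. ?u x = 0)" using hn_eq_0_iff[OF u(1)] u tK_pos by simp
 ultimately have "c0 <= Ifun s p one (%_. 0) ?u" using wst by (auto simp: ground_state_def)
 also have "... = kap*tK^2"
 proof -
  have "tK powr (p + 1) = tK powr (p - 1)*tK^2" using powr_add[of tK "p - 1" 2] tK_pos by (simp add: powr_numeral add.commute)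
  hence "B1 ?u = tK^2" using Bf_scale[of tK one v] tK_pos v tK_powr by (simp add: mult.commute mult.left_commute)
  thus ?thesis using p_gt_1 u(2) by (simp add: Ifun_eq kap_def field_simps)
 qed
 finally show "c0 <= kap*tK^2" .
qed

lemma hn_wst: "hn wst = tK"
 using c0_eq c0_kap kap_pos tK_pos wst_hn_pos by (simp add: power2_eq_iff)

text \<open>Taking the positive part keeps the power integral and does not increase the norm, so
  optimality forces equal norms; by \<open>ip_pp_le\<close> the negative part then has norm
  0.\<close>

lemma maximizer_nonneg: assumes "v \<in> H" "hn v = 1" "B1 v = KK" shows "AE x in L. v x = max (v x) 0"
proof -
 have "B1 (pp v) = B1 v" by (simp add: Bf_def)
 hence "KK <= KK*hn (pp v) powr (p + 1)" using B1_le_KK[OF pp_H[OF assms(1)]] assms by simp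
 hence "1 <= hn (pp v) powr (p + 1)" using KK_pos by simp
 hence ge: "1 <= hn (pp v)"
 proof -
  have "hn (pp v) powr (p + 1) < 1 powr (p + 1)" if "hn (pp v) < 1"
   using that p_gt_1 hn_nonneg by (intro powr_less_mono2) auto
  thus ?thesis using \<open>1 <= hn (pp v) powr (p + 1)\<close> by fastforce
 qed
 have "(hn (%x. v x - max (v x) 0))^2 = 1 - 2*ip v (pp v) + (hn (pp v))^2"
  using hn_sq_diff[OF assms(1) pp_H[OF assms(1)]] assms by simp
 also have "... <= 1 - (hn (pp v))\<^sup>2" using ip_pp_le[OF assms(1)] by simp
 also have "... <= 0" using ge by (simp add: one_le_power)
 finally have "hn (%x. v x - max (v x) 0) = 0" by simp
 thus ?thesis using hn_eq_0_iff[OF H_diff[OF assms(1) pp_H[OF assms(1)]]] by (auto elim: AE_mp)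
qed

section \<open>Strict positivity of supersolutions and maximisers\<close>

lemma H_product_bound:
 assumes "e \<in> H" "v \<in> H" "pha \<in> borel_measurable borel" "!!x. abs (pha x) <= abs (e x)"
  "!!x y. abs (pha x - pha y) <= abs (e x - e y) + k*abs (v x - v y)" "k >= 0"
 shows "pha \<in> H"
proof -
 have [measurable]: "e \<in> borel_measurable borel" "v \<in> borel_measurable borel" using assms H_meas by auto
 have ab: "sqi LL (%z. abs (df w z))" if "w \<in> H" for w
  using sqi_mono[OF H_sqi_df[OF that], of "%z. abs (df w z)"] df_measurable[OF H_meas[OF that]] by auto
 have "sqi LL (df pha)"
 proof (rule sqi_mono[OF sqi_add[OF ab[OF assms(1)] sqi_scale[OF ab[OF assms(2)], of k]]])
  show "df pha \<in> borel_measurable LL" using assms(3) by (rule df_measurable)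
  fix z
  have "abs (df pha z) <= (abs (e (fst z) - e (snd z)) + k*abs (v (fst z) - v (snd z)))/norm (fst z - snd z) powr (dd/2)"
   using assms(5) by (simp add: df_def abs_divide divide_right_mono)
  also have "... = abs (df e z) + k*abs (df v z)" by (simp add: df_def abs_divide add_divide_distrib)
  finally show "abs (df pha z) <= abs (abs (df e z) + k*abs (df v z))" using assms(6) by simp
 qed
 thus ?thesis
  using assms(3,4) by (auto simp: H_iff intro!: sqi_mono[OF H_sqi[OF assms(1)]])
qed

text \<open>Testing the equation of a nonnegative supersolution with \<open>(1 - k v)\<^sub>+\<close> times a cutoff, whose limit is supported on the zero set,
  leaves only the nonlocal interaction between the zero set and its complement.\<close>
lemma supersolution_positive:
 assumes v: "v \<in> H" "!!x. v x >= 0" "hn v > 0" and ss: "!!pha. pha \<in> H ==> (!!x. pha x >= 0) ==> ip v pha >= 0"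
 shows "AE x in L. v x > 0"
proof -
 have [measurable]: "v \<in> borel_measurable borel" "wst \<in> borel_measurable borel" using v wst_H H_meas by auto
 define e where "e x = min (wst x) 1" for x
 have e: "e x > 0" "e x <= 1" for x using wst_pos[of x] by (auto simp: e_def)
 have eH: "e \<in> H"
  using contraction(1)[OF wst_H, of e] wst_pos by (force simp: e_def[abs_def] min_def abs_if)
 have [measurable]: "e \<in> borel_measurable borel" using eH H_meas by auto
 define g where "g k x = max (1 - real k * v x) 0" for k :: nat and x
 have g: "0 <= g k x" "g k x <= 1" "abs (g k x - g k y) <= real k*abs (v x - v y)" for k x y
 proof -
  have "abs ((1 - real k * v x) - (1 - real k * v y)) = real k*abs (v x - v y)" by (simp flip: right_diff_distrib add: abs_mult abs_minus_commute)
  thus "abs (g k x - g k y) <= real k*abs (v x - v y)" unfolding g_def by linarith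
 qed (use v(2)[of x] in \<open>auto simp: g_def\<close>)
 define pha where "pha k x = g k x*e x" for k x
 have [measurable]: "pha k \<in> borel_measurable borel" for k unfolding pha_def g_def by measurable
 have phaH: "pha k \<in> H" for k
 proof (rule H_product_bound[OF eH v(1)])
  show "abs (pha k x) <= abs (e x)" for x using g[of k x] e[of x] by (simp add: pha_def abs_mult mult_left_le_one_le)
  show "abs (pha k x - pha k y) <= abs (e x - e y) + real k*abs (v x - v y)" for x y
  proof -
   have "pha k x - pha k y = g k x*(e x - e y) + (g k x - g k y)*e y" by (simp add: pha_def algebra_simps)
   also have "abs (...) <= g k x*abs (e x - e y) + abs (g k x - g k y)*e y"
    using g(1)[of k x] e(1)[of y] by (intro order_trans[OF abs_triangle_ineq]) (simp add: abs_mult)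
   also have "... <= 1*abs (e x - e y) + (real k*abs (v x - v y))*1"
    using g[of k x] g(3)[of k x y] e[of y] by (intro add_mono mult_mono) auto
   finally show ?thesis by simp
  qed
 qed auto
 define E where "E = {x. v x = 0}"
 have [measurable]: "E \<in> sets borel" unfolding E_def by measurable
 define psa where "psa x = indicator E x*e x" for x
 have [measurable]: "psa \<in> borel_measurable borel" unfolding psa_def by measurable
 have lim: "(%k. pha k x) ---> psa x" for x
 proof (cases "v x = 0")
  case True thus ?thesis by (simp add: pha_def g_def psa_def E_def)
 next
  case False
  hence vx: "v x > 0" using v(2)[of x] by simp
  obtain k0 :: nat where k0: "1/v x < real k0" using reals_Archimedean2 by blast
  have "pha k x = 0" if "k >= k0" for k
  proof -
   have "1/v x <= real k" using k0 that by linarith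
   hence "1 <= real k * v x" using vx by (simp add: field_simps)
   thus ?thesis by (simp add: pha_def g_def)
  qed
  hence "(%k. pha k x) ---> 0" by (intro tendsto_eventually) (auto simp: eventually_sequentially)
  thus ?thesis using False by (simp add: psa_def E_def)
 qed
 define P where "P z = abs (df v z)*abs (df e z)" for z
 have Pi: "integrable LL P"
  unfolding P_def using sqi_mult_integrable[OF H_sqi_df[OF v(1)] H_sqi_df[OF eH]] by (simp flip: abs_mult)
 have [measurable]: "df v \<in> borel_measurable LL" "df e \<in> borel_measurable LL" "df psa \<in> borel_measurable LL" "!!k. df (pha k) \<in> borel_measurable LL"
  by (auto intro!: df_measurable)
 \<comment> \<open>Where \<open>v\<close> is larger the factor \<open>g k\<close> is smaller, so the
   variation of \<open>g k\<close> has the good sign and only that of \<open>e\<close> remains. This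
   integrable upper bound, uniform in \<open>k\<close>, permits Fatou's lemma although the norms of
   \<open>pha k\<close> may blow up.\<close>
 have Pge: "df v z*df (pha k) z <= P z" for k z
 proof -
  let ?x = "fst z" and ?y = "snd z"
  have one_side: "(v x - v y)*(pha k x - pha k y) <= abs (v x - v y)*abs (e x - e y)" if "v x >= v y" for x y
  proof -
   have "g k x <= g k y" using that mult_left_mono[of "v y" "v x" "real k"] by (auto simp: g_def)
   hence "(g k x - g k y)*e y <= 0" using e(1)[of y] by (intro mult_nonpos_nonneg) auto
   moreover have "pha k x - pha k y = g k x*(e x - e y) + (g k x - g k y)*e y" by (simp add: pha_def algebra_simps)
   moreover have "g k x*(e x - e y) <= abs (e x - e y)"
    using g(1,2)[of k x] mult_left_le_one_le[of "abs (e x - e y)" "g k x"] mult_left_mono[OF abs_ge_self[of "e x - e y"] g(1)[of k x]] by linarith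
   ultimately have "pha k x - pha k y <= abs (e x - e y)" by linarith
   hence "(v x - v y)*(pha k x - pha k y) <= (v x - v y)*abs (e x - e y)" using that by (intro mult_left_mono) auto
   thus ?thesis using that by simp
  qed
  have "(v ?x - v ?y)*(pha k ?x - pha k ?y) <= abs (v ?x - v ?y)*abs (e ?x - e ?y)"
   using one_side[of ?y ?x] one_side[of ?x ?y] by (cases "v ?x >= v ?y") (auto simp: algebra_simps abs_minus_commute)
  thus ?thesis
   by (simp add: df_def P_def abs_divide divide_right_mono)
 qed
 define Q where "Q z = - (df v z*df psa z)" for z
 have [measurable]: "Q \<in> borel_measurable LL" "P \<in> borel_measurable LL" unfolding Q_def P_def by measurable
 have Q0: "Q z >= 0" for z
 proof -
  have "(v x - v y)*(psa x - psa y) <= 0" for x y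
   using v(2)[of x] v(2)[of y] e(1)[of x] e(1)[of y] by (auto simp: psa_def E_def indicator_def mult_le_0_iff)
  thus ?thesis by (simp add: Q_def df_def divide_le_0_iff mult_nonneg_nonneg)
 qed
 have vpha: "(%k. LINT x|L. v x*pha k x) ---> 0"
 proof -
  have "(%k. LINT x|L. v x*pha k x) ---> (LINT x|L. 0)"
  proof (rule integral_dominated_convergence[where w="%x. v x*e x"])
   show "integrable L (%x. v x*e x)" by (intro sqi_mult_integrable H_sqi v eH)
   have z: "v x*psa x = 0" for x by (simp add: psa_def E_def indicator_def)
   have "(%k. v x*pha k x) ---> v x*psa x" for x by (intro tendsto_mult tendsto_const lim)
   thus "AE x in L. (%k. v x*pha k x) ---> 0" unfolding z by simp
   show "AE x in L. norm (v x*pha k x) <= v x*e x" for k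
    using v(2) g e by (auto intro!: AE_I2 mult_left_mono simp: pha_def abs_mult less_imp_le mult_left_le_one_le)
  qed auto
  thus ?thesis by simp
 qed
 have Gk: "(\<integral>\<^sup>+z. ennreal (P z - df v z*df (pha k) z) \<partial>LL) <= ennreal ((LINT z|LL. P z) + (LINT x|L. v x*pha k x))" for k
 proof -
  have i: "integrable LL (%z. df v z*df (pha k) z)" by (intro sqi_mult_integrable H_sqi_df v phaH)
  have "0 <= ip v (pha k)" using g e by (intro ss phaH) (simp add: pha_def less_imp_le)
  hence "- (LINT z|LL. df v z*df (pha k) z) <= (LINT x|L. v x*pha k x)" by (simp add: ip_def)
  hence "(LINT z|LL. P z - df v z*df (pha k) z) <= (LINT z|LL. P z) + (LINT x|L. v x*pha k x)" using Pi i by simp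
  moreover have "(\<integral>\<^sup>+z. ennreal (P z - df v z*df (pha k) z) \<partial>LL) = ennreal (LINT z|LL. P z - df v z*df (pha k) z)"
   using Pge Pi i by (intro nn_integral_eq_integral) auto
  ultimately show ?thesis by (simp add: ennreal_leI)
 qed
 have "(\<integral>\<^sup>+z. ennreal (P z + Q z) \<partial>LL) = (\<integral>\<^sup>+z. liminf (%k. ennreal (P z - df v z*df (pha k) z)) \<partial>LL)"
 proof (intro nn_integral_cong)
  fix z
  have "(%k. df (pha k) z) ---> df psa z" unfolding df_def divide_inverse by (intro tendsto_intros lim)
  hence "(%k. ennreal (P z - df v z*df (pha k) z)) ---> ennreal (P z + Q z)"
   unfolding Q_def by (intro tendsto_ennrealI) (auto intro!: tendsto_eq_intros)
  thus "ennreal (P z + Q z) = liminf (%k. ennreal (P z - df v z*df (pha k) z))" by (intro lim_imp_Liminf[symmetric]) auto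
 qed
 also have "... <= liminf (%k. \<integral>\<^sup>+z. ennreal (P z - df v z*df (pha k) z) \<partial>LL)" by (intro nn_integral_liminf) auto
 also have "... <= liminf (%k. ennreal ((LINT z|LL. P z) + (LINT x|L. v x*pha k x)))"
  by (intro Liminf_mono always_eventually allI Gk)
 also have "... = ennreal (LINT z|LL. P z)"
 proof -
  have "(%k. ennreal ((LINT z|LL. P z) + (LINT x|L. v x*pha k x))) ---> ennreal ((LINT z|LL. P z) + 0)"
   by (intro tendsto_ennrealI tendsto_intros vpha)
  thus ?thesis by (simp add: lim_imp_Liminf)
 qed
 also have "... = (\<integral>\<^sup>+z. ennreal (P z) \<partial>LL)" using Pi by (subst nn_integral_eq_integral) (auto simp: P_def)
 finally have "(\<integral>\<^sup>+z. ennreal (P z) \<partial>LL) + (\<integral>\<^sup>+z. ennreal (Q z) \<partial>LL) <= (\<integral>\<^sup>+z. ennreal (P z) \<partial>LL)"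
  using Q0 by (subst nn_integral_add[symmetric]) (auto simp: P_def ennreal_plus)
 moreover have "(\<integral>\<^sup>+z. ennreal (P z) \<partial>LL) < \<infinity>" using Pi by (subst nn_integral_eq_integral) (auto simp: P_def)
 ultimately have "(\<integral>\<^sup>+z. ennreal (Q z) \<partial>LL) = 0"
  using ennreal_add_left_cancel_le[of "\<integral>\<^sup>+z. ennreal (P z) \<partial>LL" "\<integral>\<^sup>+z. ennreal (Q z) \<partial>LL" 0] by auto
 hence "AE z in LL. ennreal (Q z) = 0" by (subst (asm) nn_integral_0_iff_AE) auto
 hence aeQ: "AE z in LL. Q z = 0" by eventually_elim (simp add: antisym Q0)
 \<comment> \<open>The limit integrand \<open>Q\<close> is strictly positive between the zero set
   and its complement, yet it vanishes almost everywhere; one of the two sets must therefore be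
   null.\<close>
 have "E \<times> (- E) \<in> null_sets LL"
 proof -
  have "AE z in LL. z \<notin> E \<times> (- E)"
   using aeQ
  proof eventually_elim
   case (elim z)
   show ?case
   proof
    assume "z \<in> E \<times> (- E)"
    then obtain x y where z: "z = (x, y)" "v x = 0" "v y > 0" "x ~= y" using v(2) by (auto simp: E_def less_le)
    have "Q z = v y*e x/(norm (x - y) powr (dd/2)*norm (x - y) powr (dd/2))"
     using z by (simp add: Q_def df_def psa_def E_def indicator_def)
    moreover have "... > 0" using z e(1)[of x] by simp
    ultimately show False using elim by linarith
   qed
  qed
  moreover have "E \<times> (- E) \<in> sets LL" by measurable
  ultimately show ?thesis by (subst (asm) AE_iff_null) (auto simp: space_pair_measure)
 qed
 hence "emeasure L E*emeasure L (- E) = 0"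
  using lborel.emeasure_pair_measure_Times[of E L "- E"] by (simp add: null_sets_def)
 hence "emeasure L E = 0 \<or> emeasure L (- E) = 0" by simp
 thus ?thesis
 proof
  assume "emeasure L E = 0"
  hence "AE x in L. x \<notin> E" by (intro AE_not_in) (simp add: null_sets_def)
  thus ?thesis using v(2) by (auto simp: E_def less_le elim!: AE_mp)
 next
  assume "emeasure L (- E) = 0"
  hence "AE x in L. x \<notin> - E" by (intro AE_not_in) (simp add: null_sets_def)
  hence "AE x in L. v x = 0" by (simp add: E_def)
  thus ?thesis using hn_eq_0_iff[OF v(1)] v(3) by simp
 qed
qed

lemma maximizer_positive: assumes "v \<in> H" "hn v = 1" "B1 v = KK" shows "AE x in L. v x > 0"
proof -
 have m: "pp v \<in> H" "AE x in L. v x = pp v x" using pp_H[OF assms(1)] maximizer_nonneg[OF assms] by auto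
 have "hn (pp v) = 1" using hn_AE_cong[OF assms(1) H_meas[OF m(1)] m(2)] assms(2) by simp
 have "AE x in L. pp v x > 0"
 proof (rule supersolution_positive[OF m(1)])
  fix pha assume pha: "pha \<in> H" "!!x. pha x >= 0"
  have "KK*ip (pp v) pha = KK*ip v pha" using ip_AE_cong[OF assms(1) H_meas[OF m(1)] m(2) pha(1)] by simp
  also have "... = Nf one v pha" by (rule maximizer_EL[OF assms pha(1)])
  also have "... >= 0" unfolding Nf_def using pha(2) by (intro Bochner_Integration.integral_nonneg) auto
  finally show "ip (pp v) pha >= 0" using KK_pos by (simp add: zero_le_mult_iff)
 qed (use \<open>hn (pp v) = 1\<close> in auto)
 thus ?thesis by eventually_elim (auto simp: max_def split: if_splits)
qed

text \<open>Equality would make \<open>v\<close> a maximiser, hence positive, with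
  \<open>(1 - a) * v powr (p + 1)\<close> vanishing almost everywhere; then \<open>a\<close> would
  be 1 almost everywhere.\<close>

lemma Ba_less_KK: assumes "v \<in> H" "hn v = 1" shows "Ba v < KK"
proof (rule ccontr)
 assume "~ ?thesis"
 hence eq: "B1 v = KK" "Ba v = B1 v" using Ba_le_B1[OF assms(1)] B1_le_KK[OF assms(1)] assms(2) by auto
 have i: "integrable L (%x. one x*max (v x) 0 powr (p + 1))" "integrable L (%x. a x*max (v x) 0 powr (p + 1))"
  using Bf_integrable[OF coef_one assms(1)] Bf_integrable[OF a_coef assms(1)] by auto
 have "(LINT x|L. one x*max (v x) 0 powr (p + 1) - a x*max (v x) 0 powr (p + 1)) = 0"
  using eq(2) i by (simp add: Bf_def)
 moreover have "0 <= one x*max (v x) 0 powr (p + 1) - a x*max (v x) 0 powr (p + 1)" for x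
  using coefD(3)[OF a_coef, of x] by (simp add: mult_left_le_one_le coefD(2)[OF a_coef])
 ultimately have "AE x in L. one x*max (v x) 0 powr (p + 1) - a x*max (v x) 0 powr (p + 1) = 0"
  using i by (subst (asm) integral_nonneg_eq_0_iff_AE) auto
 hence "AE x in L. a x = 1"
  using maximizer_positive[OF assms eq(1)] by eventually_elim (auto simp: max_def split: if_splits)
 thus False using a_ne1 by simp
qed

subsection \<open>Barycentres\<close>

text \<open>A bounded continuous replacement for \<open>x / norm x\<close>, asymptotic to the unit
  direction at infinity. Boundedness makes the barycentre defined and Lipschitz on bounded sets of
  \<open>H\<close>.\<close>

definition dirv :: "real^'n => real^'n" where "dirv x = x /\<^sub>R (1 + norm x)"

lemma dirv_meas[measurable]: "dirv \<in> borel_measurable borel" unfolding dirv_def by measurable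

definition bary :: "'n fn => real^'n" where
 "bary v = (LINT x|L. (v x)^2 *\<^sub>R dirv x)"

lemma bary_dir: "norm (dirv x) <= 1"
 using norm_ge_zero[of x] by (simp add: dirv_def inverse_eq_divide divide_le_eq not_less)

lemma bary_integrable: assumes "v \<in> H" shows "integrable L (%x. (v x)^2 *\<^sub>R dirv x)"
proof (rule Bochner_Integration.integrable_bound[OF sqiD(2)[OF H_sqi[OF assms]]])
 have [measurable]: "v \<in> borel_measurable borel" using assms H_meas by auto
 show "(%x. (v x)^2 *\<^sub>R dirv x) \<in> borel_measurable L" by measurable
 show "AE x in L. norm ((v x)^2 *\<^sub>R dirv x) <= norm ((v x)^2)"
  by (intro AE_I2) (simp add: mult_left_le bary_dir)
qed

lemma sq_diff_L1:
 assumes "v \<in> H" "w \<in> H"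
 shows "integrable L (%x. \<bar>(v x)\<^sup>2 - (w x)\<^sup>2\<bar>)"
  "(LINT x|L. \<bar>(v x)\<^sup>2 - (w x)\<^sup>2\<bar>) <= hn (%x. v x - w x)*(1 + (hn v + hn w)^2)"
proof -
 have i: "integrable L (%x. (v x)^2)" "integrable L (%x. (w x)^2)" using assms by (auto intro: sqiD H_sqi)
 thus ii: "integrable L (%x. \<bar>(v x)\<^sup>2 - (w x)\<^sup>2\<bar>)" by auto
 define d where "d = hn (%x. v x - w x)"
 have d0: "d >= 0" by (simp add: d_def hn_nonneg)
 show "(LINT x|L. \<bar>(v x)\<^sup>2 - (w x)\<^sup>2\<bar>) <= hn (%x. v x - w x)*(1 + (hn v + hn w)^2)"
 proof (cases "d = 0")
  case True
  hence "AE x in L. \<bar>(v x)\<^sup>2 - (w x)\<^sup>2\<bar> = 0"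
   using hn_eq_0_iff[OF H_diff[OF assms]] by (auto simp: d_def elim!: AE_mp)
  hence "(LINT x|L. \<bar>(v x)\<^sup>2 - (w x)\<^sup>2\<bar>) = 0" by (rule integral_eq_zero_AE)
  thus ?thesis using True by (simp add: d_def)
 next
  case False
  hence dp: "d > 0" using d0 by simp
  have i2: "integrable L (%x. (v x - w x)^2)" "integrable L (%x. (v x + w x)^2)"
   using sqiD(2)[OF H_sqi[OF H_diff[OF assms]]] sqiD(2)[OF H_sqi[OF H_add[OF assms]]] by auto
  have "\<bar>(v x)\<^sup>2 - (w x)\<^sup>2\<bar> <= (1/d)*(v x - w x)^2 + d*(v x + w x)^2" for x
  proof -
   have e: "(v x)^2 - (w x)\<^sup>2 = (v x - w x)*(v x + w x)" by (simp add: power2_eq_square algebra_simps)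
   have "0 <= (abs (v x - w x) - d*abs (v x + w x))^2" by simp
   hence "2*(d*(abs (v x - w x)*abs (v x + w x))) <= (v x - w x)^2 + d^2*(v x + w x)^2"
    by (simp add: power2_diff power_mult_distrib mult_ac)
   moreover have "0 <= d*(abs (v x - w x)*abs (v x + w x))" using d0 by simp
   ultimately have "d*(abs (v x - w x)*abs (v x + w x)) <= (v x - w x)^2 + d^2*(v x + w x)^2" by linarith
   thus ?thesis unfolding e abs_mult using dp by (simp add: field_simps power2_eq_square)
  qed
  hence "(LINT x|L. \<bar>(v x)\<^sup>2 - (w x)\<^sup>2\<bar>) <= (LINT x|L. (1/d)*(v x - w x)^2 + d*(v x + w x)^2)"
   using ii i2 by (intro integral_mono) auto
  also have "... = (1/d)*(LINT x|L. (v x - w x)^2) + d*(LINT x|L. (v x + w x)^2)" using i2 by simp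
  also have "... <= (1/d)*d^2 + d*(hn v + hn w)^2"
  proof (intro add_mono mult_left_mono)
   show "(LINT x|L. (v x - w x)^2) <= d^2" using L2_le_hn[of "%x. v x - w x"] by (simp add: d_def)
   show "(LINT x|L. (v x + w x)^2) <= (hn v + hn w)^2"
    using L2_le_hn[of "%x. v x + w x"] power_mono[OF hn_triangle[OF assms] hn_nonneg, of 2] by linarith
  qed (use dp in auto)
  finally show ?thesis using dp by (simp add: d_def[symmetric] power2_eq_square distrib_left)
 qed
qed

lemma bary_lip:
 assumes "v \<in> H" "w \<in> H" shows "norm (bary v - bary w) <= hn (%x. v x - w x)*(1 + (hn v + hn w)^2)"
proof -
 have "bary v - bary w = (LINT x|L. ((v x)^2 - (w x)\<^sup>2) *\<^sub>R dirv x)"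
  unfolding bary_def using bary_integrable assms by (simp add: scaleR_left_diff_distrib)
 also have "norm ... <= (LINT x|L. norm (((v x)^2 - (w x)\<^sup>2) *\<^sub>R dirv x))" by (rule integral_norm_bound)
 also have "... <= (LINT x|L. \<bar>(v x)\<^sup>2 - (w x)\<^sup>2\<bar>)"
 proof (intro integral_mono' sq_diff_L1 assms)
  show "norm (((v x)^2 - (w x)\<^sup>2) *\<^sub>R dirv x) <= \<bar>(v x)\<^sup>2 - (w x)\<^sup>2\<bar>" for x
   unfolding norm_scaleR real_norm_def[symmetric] using bary_dir[of x] by (simp add: mult_left_le)
 qed auto
 finally show ?thesis using sq_diff_L1(2)[OF assms] by linarith
qed

lemma bary_inner: assumes "v \<in> H" shows "bary v \<bullet> e = (LINT x|L. (v x)^2*(dirv x \<bullet> e))"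
 unfolding bary_def using bary_integrable[OF assms] by (subst integral_inner_left[symmetric]) auto

lemma dir_tendsto:
 fixes x :: "real^'n" and y :: "nat => real^'n"
 assumes "filterlim (%n. norm (y n)) at_top sequentially"
 shows "(%n. dirv (x + y n) \<bullet> (y n /\<^sub>R norm (y n))) ---> 1"
proof -
 have inv: "(%n. inverse (norm (y n))) ---> 0" using tendsto_inverse_0_at_top[OF assms] .
 have ev: "\<forall>\<^sub>F n in sequentially. norm (y n) > 2*norm x + 1" using assms by (auto simp: filterlim_at_top_dense)
 have "\<forall>\<^sub>F n in sequentially. norm (dirv (x + y n) \<bullet> (y n /\<^sub>R norm (y n)) - 1) <= 4*(1 + 2*norm x)*inverse (norm (y n))"
  using ev
 proof eventually_elim
  case (elim n)
  define r where "r = norm (y n)"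
  define q where "q = 1 + norm (x + y n)"
  define e where "e = y n /\<^sub>R r"
  have r: "r > 2*norm x + 1" "r > 0" using elim norm_ge_zero[of x] unfolding r_def by linarith+
  have ne: "norm e = 1" using r by (simp add: e_def r_def)
  have ye: "y n \<bullet> e = r" using r by (simp add: e_def r_def dot_square_norm power2_eq_square)
  have q1: "r - norm x <= q" "q <= 1 + norm x + r" unfolding q_def r_def using norm_triangle_ineq[of x "y n"] norm_triangle_ineq2[of "y n" "- x"] by (auto simp: add.commute)
  have q0: "q >= r/2" "q > 0" using q1(1) r by linarith+
  have xe: "\<bar>x \<bullet> e\<bar> <= norm x" using Cauchy_Schwarz_ineq2[of x e] ne by simp
  have "((x + y n) /\<^sub>R q) \<bullet> e - 1 = (x \<bullet> e + r - q)/q" using q0 ye by (simp add: inner_add_left field_simps)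
  moreover have "\<bar>x \<bullet> e + r - q\<bar> <= 1 + 2*norm x" using xe q1 by linarith
  ultimately have "\<bar>((x + y n) /\<^sub>R q) \<bullet> e - 1\<bar> <= (1 + 2*norm x)/q" using q0 by (simp add: abs_divide divide_right_mono)
  also have "... <= (1 + 2*norm x)/(r/2)" using q0 r by (intro divide_left_mono) auto
  also have "... <= 4*(1 + 2*norm x)*inverse r" using r by (simp add: field_simps)
  finally show ?case by (simp add: q_def e_def r_def dirv_def)
 qed
 moreover have "(%n. 4*(1 + 2*norm x)*inverse (norm (y n))) ---> 0" using tendsto_mult_right_zero[OF inv] .
 ultimately have "(%n. dirv (x + y n) \<bullet> (y n /\<^sub>R norm (y n)) - 1) ---> 0" by (rule Lim_null_comparison)
 thus ?thesis by (simp add: LIM_zero_iff)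
qed

text \<open>After translating back, the direction field seen by a fixed profile converges pointwise
  to the direction of \<open>y n\<close>, so the component of the barycentre in that direction tends
  to the L2 mass of the profile.\<close>

lemma bary_far:
 assumes u: "!!n. u n \<in> H" and v: "v \<in> H" and lim: "(%n. hn (%x. u n x - v x)) ---> 0"
  and y: "filterlim (%n. norm (y n)) at_top sequentially"
 shows "(%n. bary (%x. u n (x - y n)) \<bullet> (y n /\<^sub>R norm (y n))) ---> (LINT x|L. (v x)^2)"
proof -
 have [measurable]: "u n \<in> borel_measurable borel" "v \<in> borel_measurable borel" for n using u v H_meas by auto
 let ?rh = "%n x. dirv (x + y n) \<bullet> (y n /\<^sub>R norm (y n))"
 have rh: "abs (?rh n x) <= 1" for n x
 proof -
  have "abs (?rh n x) <= norm (dirv (x + y n))*norm (y n /\<^sub>R norm (y n))" by (rule Cauchy_Schwarz_ineq2)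
  also have "... <= 1*1" using bary_dir[of "x + y n"] by (intro mult_mono) (auto simp: inverse_eq_divide)
  finally show ?thesis by simp
 qed
 have sh: "(%x. u n (x - y n)) \<in> H" for n using shift_H(1)[OF u, of n "- y n"] by simp
 have e: "bary (%x. u n (x - y n)) \<bullet> (y n /\<^sub>R norm (y n)) = (LINT x|L. (u n x)^2*?rh n x)" for n
 proof -
  have "bary (%x. u n (x - y n)) \<bullet> (y n /\<^sub>R norm (y n)) = (LINT x|L. (u n (x - y n))^2*(dirv x \<bullet> (y n /\<^sub>R norm (y n))))"
   by (rule bary_inner[OF sh])
  also have "... = (LINT x|L. (u n (x + y n - y n))^2*(dirv (x + y n) \<bullet> (y n /\<^sub>R norm (y n))))"
   by (rule integral_lborel_shift(1)[symmetric, where f="%x. (u n (x - y n))^2*(dirv x \<bullet> (y n /\<^sub>R norm (y n)))"]) measurable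
  finally show ?thesis by simp
 qed
 have iv: "integrable L (%x. (v x)^2)" "!!n. integrable L (%x. (u n x)^2)" using u v by (auto intro: sqiD H_sqi)
 have irh: "integrable L (%x. (g x)^2*?rh n x)" if "integrable L (%x. (g x)^2)" "g \<in> borel_measurable borel" for g n
  using that rh by (intro integrable_boundI[OF that(1)]) (auto simp: abs_mult intro!: mult_left_le)
 have "(%n. LINT x|L. (v x)^2*?rh n x) ---> (LINT x|L. (v x)^2*1)"
 proof (rule integral_dominated_convergence[where w="%x. (v x)^2"])
  show "AE x in L. (%n. (v x)^2*?rh n x) ---> (v x)^2*1" by (intro AE_I2 tendsto_mult tendsto_const dir_tendsto y)
  show "AE x in L. norm ((v x)^2*?rh n x) <= (v x)^2" for n using rh by (auto simp: abs_mult intro!: AE_I2 mult_left_le)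
 qed (use iv in auto)
 moreover have "(%n. (LINT x|L. (u n x)^2*?rh n x) - (LINT x|L. (v x)^2*?rh n x)) ---> 0"
 proof (rule Lim_null_comparison)
  have "(%n. hn (%x. u n x - v x)*(1 + (hn (u n) + hn v)^2)) ---> 0*(1 + (hn v + hn v)^2)"
   by (intro tendsto_intros lim hn_tendsto(1)[OF u v lim])
  thus "(%n. hn (%x. u n x - v x)*(1 + (hn (u n) + hn v)^2)) ---> 0" by simp
  show "\<forall>\<^sub>F n in sequentially. norm ((LINT x|L. (u n x)^2*?rh n x) - (LINT x|L. (v x)^2*?rh n x)) <= hn (%x. u n x - v x)*(1 + (hn (u n) + hn v)^2)"
  proof (intro always_eventually allI)
   fix n
   have "(LINT x|L. (u n x)^2*?rh n x) - (LINT x|L. (v x)^2*?rh n x) = (LINT x|L. ((u n x)^2 - (v x)\<^sup>2)*?rh n x)"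
    using irh[OF iv(2)[of n], of n] irh[OF iv(1), of n] by (simp add: left_diff_distrib)
   also have "abs (...) <= (LINT x|L. \<bar>((u n x)^2 - (v x)\<^sup>2)*?rh n x\<bar>)" by (rule integral_abs_bound)
   also have "... <= (LINT x|L. \<bar>(u n x)\<^sup>2 - (v x)\<^sup>2\<bar>)"
    using rh by (intro integral_mono' sq_diff_L1 u v) (auto simp: abs_mult intro!: mult_left_le)
   finally show "norm ((LINT x|L. (u n x)^2*?rh n x) - (LINT x|L. (v x)^2*?rh n x)) <= hn (%x. u n x - v x)*(1 + (hn (u n) + hn v)^2)"
    using sq_diff_L1(2)[OF u v, of n] by simp
  qed
 qed
 ultimately have "(%n. ((LINT x|L. (u n x)^2*?rh n x) - (LINT x|L. (v x)^2*?rh n x)) + (LINT x|L. (v x)^2*?rh n x)) ---> 0 + (LINT x|L. (v x)^2*1)"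
  by (intro tendsto_add)
 thus ?thesis unfolding e by simp
qed

lemma L2_pos: assumes "v \<in> H" "hn v > 0" shows "(LINT x|L. (v x)^2) > 0"
proof -
 have "(LINT x|L. (v x)^2) ~= 0"
  using integral_nonneg_eq_0_iff_AE[OF sqiD(2)[OF H_sqi[OF assms(1)]]] hn_eq_0_iff[OF assms(1)] assms(2) by auto
 moreover have "(LINT x|L. (v x)^2) >= 0" by simp
 ultimately show ?thesis by linarith
qed

lemma om_shift: "om (z + y) >= (1 + norm y) powr - dd * om z"
proof -
 have "1 + norm (z + y) <= (1 + norm y)*(1 + norm z)"

 proof -
  have "0 <= norm y*norm z" by simp
  moreover have "(1 + norm y)*(1 + norm z) = 1 + norm z + norm y + norm y*norm z" by (simp add: algebra_simps)
  ultimately show ?thesis using norm_triangle_ineq[of z y] by linarith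
 qed
 hence "((1 + norm y)*(1 + norm z)) powr - dd <= (1 + norm (z + y)) powr - dd"
  using dd_pos by (intro powr_mono2') (auto simp: add_pos_nonneg)
 thus ?thesis by (simp add: om_def powr_mult)
qed

text \<open>A sequence with vanishing barycentre and power integrals tending to \<open>KK\<close> is
  recentred at points \<open>y n\<close>. If these escape, the barycentre acquires a positive
  component along \<open>y n\<close>. Otherwise a subsequence converges strongly without
  translation, and its limit would attain \<open>KK\<close> with the weight
  \<open>a\<close>.\<close>

lemma bary_nonzero: obtains nua where "nua > 0" "!!v. v \<in> Sg ==> Ba v > KK - nua ==> bary v ~= 0"
proof (rule ccontr)
 assume no: "~ thesis"
 have "\<exists>v. v \<in> Sg & Ba v > KK - 1/real (Suc n) & bary v = 0" for n
  using no that[of "1/real (Suc n)"] by fastforce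
 then obtain v where v: "!!n. v n \<in> Sg" "!!n. Ba (v n) > KK - 1/real (Suc n)" "!!n. bary (v n) = 0" by metis
 note vH = SgD[OF v(1)]
 have le: "Ba (v n) <= B1 (v n)" "B1 (v n) <= KK" for n using Ba_le_B1[OF vH(1)] B1_le_KK[OF vH(1)] vH(2) by auto
 have low: "(%n. KK - 1/real (Suc n)) ---> KK"
  using tendsto_diff[OF tendsto_const LIMSEQ_inverse_real_of_nat, of KK] by (simp add: inverse_eq_divide)
 have "KK - 1/real (Suc n) <= B1 (v n)" "KK - 1/real (Suc n) <= Ba (v n)" "Ba (v n) <= KK" for n
  using v(2)[of n] le[of n] by linarith+
 hence BB: "(%n. B1 (v n)) ---> KK" "(%n. Ba (v n)) ---> KK"
  using tendsto_sandwich[OF always_eventually always_eventually low tendsto_const[of KK], of "%n. B1 (v n)"]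
   tendsto_sandwich[OF always_eventually always_eventually low tendsto_const[of KK], of "%n. Ba (v n)"] le(2) by blast+
 obtain m y dl where y: "dl > 0" "!!n. (LINT z|L. om z*(v (n + m) (z + y n))^2) >= dl"
  by (rule maximizing_translates[OF vH BB(1)]) blast
 have B1m: "(%n. B1 (v (si n + m))) ---> KK" "(%n. Ba (v (si n + m))) ---> KK" if "strict_mono si" for si
  using LIMSEQ_subseq_LIMSEQ[OF LIMSEQ_ignore_initial_segment[OF BB(1), of m] that]
   LIMSEQ_subseq_LIMSEQ[OF LIMSEQ_ignore_initial_segment[OF BB(2), of m] that] by (simp_all add: comp_def)
 show False
 proof (cases "filterlim (%n. norm (y n)) at_top sequentially")
  case True
  obtain pha w where w: "strict_mono pha" "w \<in> H" "hn w = 1" "(%n. hn (%x. v (pha n + m) (x + y (pha n)) - w x)) ---> 0"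
   by (rule core_compact[of "%n z. v (n + m) (z + y n)" dl])
    (use vH y LIMSEQ_ignore_initial_segment[OF BB(1), of m] in \<open>auto simp: shift_H(1) hn_shift Bf_shift\<close>)
  have yf: "filterlim (%n. norm (y (pha n))) at_top sequentially"
   using filterlim_compose[OF True filterlim_subseq[OF w(1)]] .
  have "(%n. bary (%x. v (pha n + m) (x - y (pha n) + y (pha n))) \<bullet> (y (pha n) /\<^sub>R norm (y (pha n)))) ---> (LINT x|L. (w x)^2)"
   by (rule bary_far[OF _ w(2) w(4) yf]) (simp add: shift_H(1) vH)
  hence "(%n. 0 :: real) ---> (LINT x|L. (w x)^2)" by (simp add: v(3))
  hence "(LINT x|L. (w x)^2) = 0" by (simp add: LIMSEQ_const_iff)
  thus False using L2_pos[OF w(2)] w(3) by simp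
 next
  case False
  then obtain R where "\<exists>\<^sub>F n in sequentially. norm (y n) < R"
   by (auto simp: filterlim_at_top not_eventually not_le)
  hence "infinite {n. norm (y n) < R}" by (auto simp: frequently_sequentially infinite_nat_iff_unbounded_le)
  then obtain si :: "nat => nat" where si: "strict_mono si" "!!n. norm (y (si n)) < R" using infinite_enumerate by blast
  define u where "u n = v (si n + m)" for n
  have uH: "u n \<in> H" "hn (u n) = 1" for n using vH by (auto simp: u_def)
  have [measurable]: "u n \<in> borel_measurable borel" for n using uH H_meas by auto
  have nv: "(LINT z|L. om z*(u n z)^2) >= (1 + R) powr - dd*dl" for n
  proof -
   have R0: "R > 0" using si(2)[of 0] norm_ge_zero[of "y (si 0)"] by linarith
   have ii: "integrable L (%z. om z*(g z)^2)" if "g \<in> H" for g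
    using H_meas[OF that] by (intro integrable_boundI[OF sqiD(2)[OF H_sqi[OF that]]]) (auto simp: abs_mult less_imp_le om_pos om_le_1 intro!: mult_left_le_one_le)
   have sH: "(%z. u n (z + y (si n))) \<in> H" by (rule shift_H(1)[OF uH(1)])
   have "(1 + R) powr - dd*dl <= (1 + R) powr - dd*(LINT z|L. om z*(u n (z + y (si n)))^2)"
    using y(2)[of "si n"] by (intro mult_left_mono) (auto simp: u_def)
   also have "... = (LINT z|L. (1 + R) powr - dd*(om z*(u n (z + y (si n)))^2))" by simp
   also have "... <= (LINT z|L. om (z + y (si n))*(u n (z + y (si n)))^2)"
   proof (intro integral_mono integrable_mult_right ii sH)
    show "integrable L (%z. om (z + y (si n))*(u n (z + y (si n)))^2)"
     using ii[OF uH(1)[of n]] by (subst integral_lborel_shift(2)[of "%z. om z*(u n z)^2"]) auto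
    have "(1 + R) powr - dd <= (1 + norm (y (si n))) powr - dd"
     using si(2)[of n] dd_pos by (intro powr_mono2') (auto simp: add_pos_nonneg)
    hence "(1 + R) powr - dd * om z <= om (z + y (si n))" for z
     using om_shift[of "y (si n)" z] om_pos[of z] by (smt (verit) mult_right_mono)
    thus "(1 + R) powr - dd*(om z*(u n (z + y (si n)))^2) <= om (z + y (si n))*(u n (z + y (si n)))^2" for z
     by (simp add: mult_right_mono flip: mult.assoc)
   qed
   also have "... = (LINT z|L. om z*(u n z)^2)" by (rule integral_lborel_shift(1)[of "%z. om z*(u n z)^2"]) measurable
   finally show ?thesis .
  qed
  have "1 + R > 0" using si(2)[of 0] norm_ge_zero[of "y (si 0)"] by linarith
  hence pos: "(1 + R) powr - dd*dl > 0" using y(1) by simp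
  obtain pha w where w: "strict_mono pha" "w \<in> H" "hn w = 1" "(%n. hn (%x. u (pha n) x - w x)) ---> 0"
   by (rule core_compact[of u, OF uH _ pos nv]) (use B1m(1)[OF si(1)] in \<open>auto simp: u_def\<close>)
  have "(%n. Ba (u (pha n))) ---> Ba w" by (rule hn_tendsto(2)[OF uH(1) w(2,4) a_coef])
  moreover have "(%n. Ba (u (pha n))) ---> KK" using LIMSEQ_subseq_LIMSEQ[OF B1m(2)[OF si(1)] w(1)] by (simp add: comp_def u_def)
  ultimately have "Ba w = KK" by (rule LIMSEQ_unique)
  thus False using Ba_less_KK[OF w(2,3)] by simp
 qed
qed

end

context setting
begin

subsection \<open>A lower bound for nonnegative supersolutions\<close>

text \<open>A compactly supported barrier. Its kink at the unit sphere is convex, so only an upper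
  bound for its second differences is available, which is what a subsolution requires.\<close>

definition bump :: "'n fn" where "bump x = max (1 - (norm x)\<^sup>2) 0"
definition Ck :: real where "Ck = 2 + 2*(LINT h|L. min ((norm h)^2) 1/norm h powr dd)"

lemma ball_indicator_integrable:
 "integrable L (indicator (ball z r) :: _ => real)" "integrable L (indicator (cball z r) :: _ => real)"
 using emeasure_bounded_finite[of "ball z r"] emeasure_bounded_finite[of "cball z r"]
 by (auto intro!: integrable_real_indicator simp: less_top)

lemma bump_bounds: "0 <= bump x" "bump x <= 1" "norm x >= 1 ==> bump x = 0"
 by (auto simp: bump_def max_def)

lemma bump_meas[measurable]: "bump \<in> borel_measurable borel" unfolding bump_def by measurable

text \<open>Writing \<open>bump z\<close> as \<open>max 1 ((norm z)^2)\<close> minus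
  \<open>(norm z)^2\<close> exhibits a convex function minus a quadratic: the convex part
  contributes at most 0 and the quadratic exactly \<open>2 * (norm h)^2\<close>.\<close>

lemma bump_second_difference: "2*bump x - bump (x + h) - bump (x - h) <= 2*min ((norm h)^2) 1"
proof -
 define m :: "real^'n => real" where "m z = max 1 ((norm z)^2)" for z
 have e: "bump z = m z - (norm z)\<^sup>2" for z by (simp add: bump_def m_def max_def)
 have m: "1 <= m z" "(norm z)^2 <= m z" "m z = 1 \<or> m z = (norm z)^2" for z by (auto simp: m_def max_def)
 have par: "(norm (x + h))^2 + (norm (x - h))^2 = 2*(norm x)^2 + 2*(norm h)^2"
  unfolding power2_norm_eq_inner by (simp add: algebra_simps inner_commute)
 have "2*m x <= m (x + h) + m (x - h)"
  using m(3)[of x] m(1,2)[of "x + h"] m(1,2)[of "x - h"] par zero_le_power2[of "norm h"] by (elim disjE) linarith+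
 hence "2*bump x - bump (x + h) - bump (x - h) <= 2*(norm h)^2" unfolding e using par by (smt (verit))
 moreover have "2*bump x - bump (x + h) - bump (x - h) <= 2" using bump_bounds(1)[of "x + h"] bump_bounds(1)[of "x - h"] bump_bounds(2)[of x] by linarith
 ultimately show ?thesis by (simp add: min_def)
qed

lemma bump_lip: "abs (bump x - bump y) <= 2*norm (x - y)"
proof -
 have *: "bump x - bump y <= 2*norm (x - y)" for x y
 proof (cases "norm x < 1")
  case False thus ?thesis using bump_bounds(3)[of x] bump_bounds(1)[of y] norm_ge_zero[of "x - y"] by linarith
 next
  case True
  show ?thesis
  proof (cases "norm y < 1")
   case False
   have "bump x = (1 - norm x)*(1 + norm x)"
   proof -
    have "(norm x)^2 <= 1" using True by (simp add: power_le_one)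
    thus ?thesis by (simp add: bump_def max_def power2_eq_square algebra_simps)
   qed
   also have "... <= (1 - norm x)*2" using True by (intro mult_left_mono) auto
   also have "... <= 2*norm (x - y)" using False norm_triangle_ineq2[of y x] by (simp add: norm_minus_commute)
   finally show ?thesis using False bump_bounds[of y] by simp
  next
   case y: True
   have "bump x - bump y <= (norm y)^2 - (norm x)\<^sup>2"
    using power_le_one[of "norm x" 2] power_le_one[of "norm y" 2] y True by (simp add: bump_def max_def)
   also have "... = (norm y - norm x)*(norm y + norm x)" by (simp add: power2_eq_square algebra_simps)
   also have "... <= norm (x - y)*2"
   proof -
    have "(norm y - norm x)*(norm y + norm x) <= norm (x - y)*(norm y + norm x)"
     using norm_triangle_ineq2[of y x] by (intro mult_right_mono) (auto simp: norm_minus_commute)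
    also have "... <= norm (x - y)*2" using y True by (intro mult_left_mono) auto
    finally show ?thesis .
   qed
   finally show ?thesis by simp
  qed
 qed
 show ?thesis using *[of x y] *[of y x] by (simp add: norm_minus_commute abs_le_iff)
qed

lemma H_of_differences:
 assumes g: "sqi L g" and b: "!!h. (\<integral>\<^sup>+x. ennreal ((g x - g (x + h))^2) \<partial>L) <= ennreal (C*min ((norm h)^2) 1)" and "C >= 0"
 shows "g \<in> H"
proof -
 have [measurable]: "g \<in> borel_measurable borel" using g by (simp add: sqi_def)
 have [measurable]: "df g \<in> borel_measurable LL" by (rule df_measurable) simp
 have m: "(%z. (fst z, fst z + snd z)) \<in> LL \<rightarrow>\<^sub>M LL" by measurable
 have d: "distr LL LL (%z. (fst z, fst z + snd z)) = LL" using distr_shear[where 'a="real^'n"] by (simp add: case_prod_unfold)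
 have e: "(df g (x, x + h))^2 = (g x - g (x + h))^2*(1/norm h powr dd)" for x h
  by (simp add: df_def power_divide power2_eq_square[of "_ powr _"] powr_add[symmetric])
 have "(\<integral>\<^sup>+z. ennreal ((df g z)^2) \<partial>LL) = (\<integral>\<^sup>+z. ennreal ((df g (fst z, fst z + snd z))^2) \<partial>LL)"
  by (subst d[symmetric], subst nn_integral_distr[OF m]) auto
 also have "... = (\<integral>\<^sup>+h. \<integral>\<^sup>+x. ennreal ((df g (x, x + h))^2) \<partial>L \<partial>L)"
 proof -
  have [measurable]: "(%z. ennreal ((df g (fst z, fst z + snd z))^2)) \<in> borel_measurable LL"
   using measurable_compose[OF m, of "%z. ennreal ((df g z)^2)"] by simp
  show ?thesis
   by (subst lborel_pair.nn_integral_snd[symmetric]) auto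
 qed
 also have "... = (\<integral>\<^sup>+h. (\<integral>\<^sup>+x. ennreal ((g x - g (x + h))^2) \<partial>L)*ennreal (1/norm h powr dd) \<partial>L)"
  unfolding e by (intro nn_integral_cong, subst nn_integral_multc[symmetric]) (auto simp: ennreal_mult' simp del: times_divide_eq_right intro!: nn_integral_cong)
 also have "... <= (\<integral>\<^sup>+h. ennreal (C*min ((norm h)^2) 1)*ennreal (1/norm h powr dd) \<partial>L)"
  by (intro nn_integral_mono mult_right_mono b) auto
 also have "... = (\<integral>\<^sup>+h. ennreal (C*(min ((norm h)^2) 1/norm h powr dd)) \<partial>L)"
  using \<open>C >= 0\<close> by (intro nn_integral_cong) (simp add: ennreal_mult[symmetric])
 also have "... < \<infinity>"
  using \<open>C >= 0\<close> integrable_mult_right[OF kernel_integrable, of C] by (subst nn_integral_eq_integral) auto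
 finally have "integrable LL (%z. (df g z)^2)" by (intro integrableI_nonneg) auto
 thus ?thesis using g by (simp add: H_iff sqi_def)
qed

lemma bump_integrable: "integrable L bump" "sqi L bump"
proof -
 have fin: "integrable L (indicator (cball 0 1) :: _ => real)" by (rule ball_indicator_integrable)
 show b: "integrable L bump"
  by (rule integrable_boundI[OF fin]) (use bump_bounds in \<open>auto simp: indicator_def not_le less_imp_le\<close>)
 have "(bump x)^2 <= bump x" for x using bump_bounds[of x] by (simp add: power2_eq_square mult_left_le_one_le)
 hence "integrable L (%x. (bump x)^2)" by (intro integrable_boundI[OF b]) auto
 thus "sqi L bump" by (simp add: sqi_def)
qed

lemma bump_H: "bump \<in> H"
proof -
 define V where "V = measure L (cball 0 1 :: (real^'n) set)"
 have fin: "integrable L (indicator (cball c 1) :: _ => real)" for c :: "real^'n" by (rule ball_indicator_integrable)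
 show ?thesis
 proof (rule H_of_differences[OF bump_integrable(2), of "8*V"])
  fix h :: "real^'n"
  have "(bump x - bump (x + h))^2 <= 4*min ((norm h)^2) 1*(indicator (cball 0 1) x + indicator (cball 0 1) (x + h))" for x
  proof (cases "norm x <= 1 \<or> norm (x + h) <= 1")
   case False thus ?thesis using bump_bounds(3)[of x] bump_bounds(3)[of "x + h"] by simp
  next
   case True
   have "abs (bump x - bump (x + h)) <= 2*norm h" using bump_lip[of x "x + h"] by simp
   hence "(bump x - bump (x + h))^2 <= (2*norm h)^2" by (metis abs_le_square_iff abs_of_nonneg mult_nonneg_nonneg norm_ge_zero zero_le_numeral)
   moreover have "abs (bump x - bump (x + h)) <= 1" using bump_bounds[of x] bump_bounds[of "x + h"] by (simp add: abs_le_iff)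
   hence "(bump x - bump (x + h))^2 <= 1" by (simp add: abs_square_le_1)
   ultimately have "(bump x - bump (x + h))^2 <= 4*min ((norm h)^2) 1" by (simp add: min_def power_mult_distrib)
   moreover have "1 <= (indicator (cball 0 1) x + indicator (cball 0 1) (x + h) :: real)" using True by (auto simp: indicator_def)
   hence "4*min ((norm h)^2) 1*1 <= 4*min ((norm h)^2) 1*(indicator (cball 0 1) x + indicator (cball 0 1) (x + h))"
    by (intro mult_left_mono) auto
   ultimately show ?thesis by linarith
  qed
  hence "(\<integral>\<^sup>+x. ennreal ((bump x - bump (x + h))^2) \<partial>L) <= (\<integral>\<^sup>+x. ennreal (4*min ((norm h)^2) 1*(indicator (cball 0 1) x + indicator (cball 0 1) (x + h))) \<partial>L)"
   by (intro nn_integral_mono ennreal_leI)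
  also have "... = ennreal (LINT x|L. 4*min ((norm h)^2) 1*(indicator (cball 0 1) x + indicator (cball 0 1) (x + h)))"
  proof (intro nn_integral_eq_integral integrable_mult_right Bochner_Integration.integrable_add)
   show "integrable L (indicator (cball 0 1) :: _ => real)" by (rule fin)
   thus "integrable L (%x. indicator (cball 0 1) (x + h) :: real)"
    using integral_lborel_shift(2)[of "indicator (cball 0 1) :: real^'n => real" h] by simp
  qed auto
  also have "(LINT x|L. 4*min ((norm h)^2) 1*(indicator (cball 0 1) x + indicator (cball 0 1) (x + h))) = 8*V*min ((norm h)^2) 1"
  proof -
   have i: "integrable L (indicator (cball 0 1) :: real^'n => real)" by (rule fin)
   have i2: "integrable L (%x. indicator (cball 0 1) (x + h) :: real)" "(LINT x|L. indicator (cball 0 1) (x + h)) = V"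
    using integral_lborel_shift[of "indicator (cball 0 1) :: real^'n => real" h] i by (auto simp: V_def)
   show ?thesis using i i2 by (simp add: V_def)
  qed
  finally show "(\<integral>\<^sup>+x. ennreal ((bump x - bump (x + h))^2) \<partial>L) <= ennreal (8*V*min ((norm h)^2) 1)" .
 qed (simp add: V_def)
qed

text \<open>The weak form of an upper bound \<open>Ck\<close> for the operator applied to the
  barrier. After the shear, a translation in \<open>x\<close> moves all differences onto the
  barrier, where they form a second difference; integrating against the kernel over \<open>h\<close>
  gives the constant.\<close>

lemma ip_bump_le:
 assumes pha: "pha \<in> H" "!!x. pha x >= 0" "integrable L pha"
 shows "ip (%x. bump (x - x0)) pha <= Ck*(LINT x|L. pha x)"
proof -
 define b where "b x = bump (x - x0)" for x
 have bH: "b \<in> H" unfolding b_def[abs_def] using shift_H(1)[OF bump_H, of "- x0"] by simp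
 have [measurable]: "pha \<in> borel_measurable borel" "b \<in> borel_measurable borel" using pha bH H_meas by auto
 have b1: "0 <= b x" "b x <= 1" for x using bump_bounds by (auto simp: b_def)
 have sd: "2*b x - b (x + h) - b (x - h) <= 2*min ((norm h)^2) 1" for x h
  using bump_second_difference[of "x - x0" h] by (simp add: b_def algebra_simps)
 define \<Phi> where "\<Phi> = (LINT x|L. pha x)"
 have \<Phi>0: "\<Phi> >= 0" unfolding \<Phi>_def using pha(2) by simp
 have i0: "integrable LL (%z. df b z*df pha z)" by (intro sqi_mult_integrable H_sqi_df bH pha)
 define F where "F h x = (b x - b (x + h))*(pha x - pha (x + h))/norm h powr dd" for h x
 have e: "df b (x, x + h)*df pha (x, x + h) = F h x" for x h by (simp add: df_def F_def powr_add[symmetric])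
 have i1: "integrable LL (%z. F (snd z) (fst z))" "(LINT z|LL. df b z*df pha z) = (LINT z|LL. F (snd z) (fst z))"
  using integral_LL_shear[OF i0] by (simp_all add: e)
 have i2: "integrable L (%h. LINT x|L. F h x)" "(LINT z|LL. F (snd z) (fst z)) = (\<integral>h. \<integral>x. F h x \<partial>L \<partial>L)"
  using lborel_pair.integrable_snd[of "%x h. F h x"] lborel_pair.integral_snd[of "%x h. F h x"] i1(1)
  by (simp_all add: case_prod_unfold)
 have inner: "(LINT x|L. F h x) <= 2*(min ((norm h)^2) 1/norm h powr dd)*\<Phi>" for h
 proof -
  have sb: "sqi L b" "sqi L pha" "sqi L (%x. b (x + h))" "sqi L (%x. pha (x + h))" "sqi L (%x. b (x - h))"
   using H_sqi bH pha(1) shift_H(1)[OF bH, of h] shift_H(1)[OF pha(1), of h] shift_H(1)[OF bH, of "- h"] by auto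
  have s1: "(LINT x|L. b (x + h)*pha (x + h)) = (LINT x|L. b x*pha x)" by (rule integral_lborel_shift(1)[of "%x. b x*pha x"]) measurable
  have s2: "(LINT x|L. b x*pha (x + h)) = (LINT x|L. b (x - h)*pha x)"
   using integral_lborel_shift(1)[of "%x. b (x - h)*pha x" h] by simp
  have "(LINT x|L. (b x - b (x + h))*(pha x - pha (x + h))) = (LINT x|L. b x*pha x - b x*pha (x + h) - b (x + h)*pha x + b (x + h)*pha (x + h))"
   by (simp add: algebra_simps)
  also have "... = (LINT x|L. b x*pha x) - (LINT x|L. b x*pha (x + h)) - (LINT x|L. b (x + h)*pha x) + (LINT x|L. b (x + h)*pha (x + h))"
   using sb by (simp add: sqi_mult_integrable)
  also have "... = (LINT x|L. 2*(b x*pha x) - b (x + h)*pha x - b (x - h)*pha x)"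
   unfolding s1 s2 using sb by (simp add: sqi_mult_integrable)
  also have "... <= (LINT x|L. 2*min ((norm h)^2) 1*pha x)"
  proof (intro integral_mono)
   show "integrable L (%x. 2*(b x*pha x) - b (x + h)*pha x - b (x - h)*pha x)" using sb by (simp add: sqi_mult_integrable)
   show "integrable L (%x. 2*min ((norm h)^2) 1*pha x)" using pha(3) by simp
   show "2*(b x*pha x) - b (x + h)*pha x - b (x - h)*pha x <= 2*min ((norm h)^2) 1*pha x" for x
    using mult_right_mono[OF sd[of x h] pha(2)[of x]] by (simp add: left_diff_distrib)
  qed
  also have "... = 2*min ((norm h)^2) 1*\<Phi>" by (simp add: \<Phi>_def)
  finally have "(LINT x|L. (b x - b (x + h))*(pha x - pha (x + h)))/norm h powr dd <= 2*min ((norm h)^2) 1*\<Phi>/norm h powr dd"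
   by (intro divide_right_mono) auto
  thus ?thesis by (simp add: F_def)
 qed
 have "(\<integral>h. \<integral>x. F h x \<partial>L \<partial>L) <= (LINT h|L. 2*(min ((norm h)^2) 1/norm h powr dd)*\<Phi>)"
  by (intro integral_mono i2(1) integrable_mult_left integrable_mult_right kernel_integrable inner)
 also have "... = (Ck - 2)*\<Phi>" by (simp only: integral_mult_left_zero integral_mult_right_zero Ck_def) simp
 finally have "(LINT z|LL. df b z*df pha z) <= (Ck - 2)*\<Phi>" using i1 i2 by simp
 moreover have "(LINT x|L. b x*pha x) <= \<Phi>"
  unfolding \<Phi>_def using b1 pha by (intro integral_mono sqi_mult_integrable H_sqi bH) (auto simp: mult_left_le_one_le)
 ultimately have "ip b pha <= (Ck - 2)*\<Phi> + \<Phi>" by (simp add: ip_def)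
 thus ?thesis using \<Phi>0 by (simp add: b_def[abs_def] \<Phi>_def[symmetric] algebra_simps)
qed

lemma Ck_pos: "Ck > 0"
proof -
 have "0 <= (LINT h|L. min ((norm h)^2) 1/norm h powr dd)" by (intro Bochner_Integration.integral_nonneg) auto
 thus ?thesis unfolding Ck_def by linarith
qed

text \<open>A nonlocal barrier argument. The mass of \<open>u\<close> near \<open>z0\<close> acts
  through the kernel as a positive source near \<open>x0\<close>. Testing with the positive part of
  \<open>ep * b - u\<close>, whose support lies in the unit ball at \<open>x0\<close>, shows that
  this part vanishes.\<close>

lemma supersolution_bump:
 assumes u: "u \<in> H" "!!x. u x >= 0" and ss: "!!pha. pha \<in> H ==> (!!x. pha x >= 0) ==> ip u pha >= 0"
  and far: "norm (x0 - z0) >= 2"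
 shows "AE x in L. u x >= (2 + norm z0) powr - dd*(LINT y|L. indicator (ball z0 1) y*u y)/Ck * om x0*bump (x - x0)"
proof -
 have [measurable]: "u \<in> borel_measurable borel" using u H_meas by auto
 define ka where "ka = (LINT y|L. indicator (ball z0 1) y*u y)"
 \<comment> \<open>A lower bound for the kernel between the two unit balls: for such
   \<open>x\<close>, \<open>y\<close> the distance is at most
   \<open>(2 + norm z0) * (1 + norm x0)\<close>.\<close>
 define c1 where "c1 = (2 + norm z0) powr - dd * om x0"
 have c1: "c1 > 0" using om_pos[of x0] norm_ge_zero[of z0] unfolding c1_def by (intro mult_pos_pos) (auto simp: add_pos_nonneg add_nonneg_eq_0_iff)
 \<comment> \<open>The largest height for which the bound \<open>ep * Ck\<close> for the operator on
   the barrier does not exceed the source strength \<open>c1 * ka\<close>.\<close>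
 define ep where "ep = c1 * ka/Ck"
 have ballfin: "integrable L (indicator (ball z0 1) :: _ => real)" by (rule ball_indicator_integrable)
 have Eu: "integrable L (%y. indicator (ball z0 1) y*u y)"
  by (rule sqi_mult_integrable[OF _ H_sqi[OF u(1)]]) (use ballfin in \<open>auto simp: sqi_def indicator_sq\<close>)
 have ka0: "ka >= 0" unfolding ka_def using u(2) by (intro Bochner_Integration.integral_nonneg) (auto simp: indicator_def)
 have ep0: "ep >= 0" using c1 ka0 Ck_pos by (simp add: ep_def)
 define b where "b x = bump (x - x0)" for x
 have bH: "b \<in> H" unfolding b_def[abs_def] using shift_H(1)[OF bump_H, of "- x0"] by simp
 have b0: "0 <= b x" for x by (simp add: b_def bump_bounds)
 have bi: "integrable L b" unfolding b_def using integral_lborel_shift(2)[of bump "- x0"] bump_integrable(1) by simp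
 have [measurable]: "b \<in> borel_measurable borel" using bH H_meas by auto
 define g where "g x = ep*b x - u x" for x
 have gH: "g \<in> H" unfolding g_def[abs_def] by (intro H_diff H_scale bH u)
 have [measurable]: "g \<in> borel_measurable borel" using gH H_meas by auto
 define pha where "pha = pp g"
 have phaH: "pha \<in> H" unfolding pha_def by (rule pp_H[OF gH])
 have [measurable]: "pha \<in> borel_measurable borel" using phaH H_meas by auto
 have pha0: "pha x >= 0" "pha x <= ep*b x" for x using b0[of x] u(2)[of x] ep0 by (auto simp: pha_def g_def)
 have phai: "integrable L pha" by (rule integrable_boundI[OF integrable_mult_right[OF bi, of ep]]) (use pha0 in auto)
 have phasup: "pha x = 0" if "norm (x - x0) >= 1" for x
  using pha0[of x] bump_bounds(3)[of "x - x0"] that by (simp add: b_def)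
 have cross: "df g z*df pha z >= c1*(pha (fst z)*(indicator (ball z0 1) (snd z)*u (snd z)))" for z
 proof -
  obtain x y where z: "z = (x, y)" by fastforce
  let ?n = "norm (x - y) powr dd"
  have e: "df g z*df pha z = (g x - g y)*(pha x - pha y)/?n" by (simp add: z df_def powr_add[symmetric])
  have prod: "(g x - g y)*(pha x - pha y) >= pha x*max (- g y) 0"
  proof -
   have "(s - t)*(max s 0 - max t 0) = (max s 0 - max t 0)^2 + max s 0*max (- t) 0 + max t 0*max (- s) 0" for s t :: real
    by (auto simp: max_def power2_eq_square algebra_simps)
   moreover have "0 <= (pha x - pha y)^2 + pha y*max (- g x) 0" using pha0(1)[of y] by simp
   ultimately show ?thesis unfolding pha_def by (smt (verit))
  qed
  show ?thesis
  proof (cases "y \<in> ball z0 1 & norm (x - x0) < 1")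
   case False
   hence "c1*(pha x*(indicator (ball z0 1) y*u y)) = 0" using phasup[of x] by (auto simp: indicator_def)
   moreover have "0 <= df g z*df pha z"
   proof -
    have "0 <= pha x*max (- g y) 0" using pha0(1)[of x] by simp
    thus ?thesis unfolding e using prod by (intro divide_nonneg_nonneg) auto
   qed
   ultimately show ?thesis unfolding z fst_conv snd_conv by linarith
  next
   case True
   hence yz: "norm (y - z0) < 1" by (simp add: dist_norm norm_minus_commute)
   have n: "norm (x0 - z0) <= norm (x0 - x) + norm (x - y) + norm (y - z0)"
    using norm_triangle_ineq[of "x0 - x" "x - y"] norm_triangle_ineq[of "x0 - x + (x - y)" "y - z0"] by simp
   hence xy: "norm (x - y) > 0" using far True yz norm_minus_commute[of x0 x] by linarith
   have yx0: "norm (y - x0) >= 1"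
    using far yz norm_triangle_ineq[of "x0 - y" "y - z0"] by (simp add: norm_minus_commute)
   hence gy: "max (- g y) 0 = u y" using bump_bounds(3)[of "y - x0"] u(2)[of y] by (simp add: g_def b_def)
   have "norm (x - y) <= norm (x - x0) + norm x0 + norm z0 + norm (z0 - y)"
    using norm_triangle_ineq[of "x - x0" "x0 - y"] norm_triangle_ineq4[of x0 z0] norm_triangle_ineq[of "x0 - z0" "z0 - y"] by simp
   also have "... <= (2 + norm z0)*(1 + norm x0)"

   proof -
    have "(2 + norm z0)*(1 + norm x0) = 2 + 2*norm x0 + norm z0 + norm z0*norm x0" by (simp add: algebra_simps)
    moreover have "0 <= norm z0*norm x0" by simp
    moreover have "norm (z0 - y) < 1" using yz by (simp add: norm_minus_commute)
    ultimately show ?thesis using True norm_ge_zero[of x0] by linarith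
   qed
   finally have "((2 + norm z0)*(1 + norm x0)) powr - dd <= norm (x - y) powr - dd"
    using xy dd_pos by (intro powr_mono2') auto
   hence "c1 <= 1/?n" by (simp add: c1_def om_def powr_mult powr_minus_divide)
   hence "c1*(pha x*u y) <= (1/?n)*(pha x*u y)" using pha0(1)[of x] u(2)[of y] by (intro mult_right_mono) auto
   also have "... <= df g z*df pha z" unfolding e using prod gy by (simp add: divide_right_mono)
   finally show ?thesis using True by (simp add: z)
  qed
 qed
 have i0: "integrable LL (%z. df g z*df pha z)" by (intro sqi_mult_integrable H_sqi_df gH phaH)
 have i1: "integrable LL (%z. c1*(pha (fst z)*(indicator (ball z0 1) (snd z)*u (snd z))))"
 proof (rule integrable_boundI[OF i0])
  have [measurable]: "fst \<in> LL \<rightarrow>\<^sub>M borel" "snd \<in> LL \<rightarrow>\<^sub>M borel"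
   using measurable_fst[of L L] measurable_snd[of L L] by (simp_all add: measurable_lborel1)
  have [measurable]: "ball z0 1 \<in> sets borel" by simp
  have "(%y. indicator (ball z0 1) y*u y) \<in> borel_measurable borel" by measurable
  from measurable_compose[OF \<open>snd \<in> LL \<rightarrow>\<^sub>M borel\<close> this]
  have m1: "(%z. indicator (ball z0 1) (snd z)*u (snd z)) \<in> borel_measurable LL" .
  have m2: "(%z. pha (fst z)) \<in> borel_measurable LL"
   by (rule measurable_compose[OF \<open>fst \<in> LL \<rightarrow>\<^sub>M borel\<close>]) measurable
  show "(%z. c1*(pha (fst z)*(indicator (ball z0 1) (snd z)*u (snd z)))) \<in> borel_measurable LL"
   by (rule borel_measurable_times[OF borel_measurable_const borel_measurable_times[OF m2 m1]])
  show "abs (c1*(pha (fst z)*(indicator (ball z0 1) (snd z)*u (snd z)))) <= df g z*df pha z" for z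
   using cross[of z] pha0(1)[of "fst z"] u(2)[of "snd z"] c1 by (simp add: abs_mult)
 qed
 have "c1*(ka*(LINT x|L. pha x)) = (LINT z|LL. c1*(pha (fst z)*(indicator (ball z0 1) (snd z)*u (snd z))))"
  using lborel_pair.integral_fst'[OF i1] by (simp add: ka_def mult.commute)
 also have "... <= (LINT z|LL. df g z*df pha z)" by (intro integral_mono i0 i1 cross)
 finally have low: "c1*(ka*(LINT x|L. pha x)) <= (LINT z|LL. df g z*df pha z)" .
 have "ip g pha = (LINT x|L. (pha x)^2) + (LINT z|LL. df g z*df pha z)"
 proof -
  have "g x*pha x = (pha x)^2" for x by (simp add: pha_def max_def power2_eq_square)
  thus ?thesis by (simp add: ip_def)
 qed
 hence gl: "ip g pha >= (LINT x|L. (pha x)^2) + c1*(ka*(LINT x|L. pha x))" using low by simp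
 have "0 <= ip u pha" by (rule ss[OF phaH pha0(1)])
 also have "ip u pha = ep*ip b pha - ip g pha"
  using ip_diff_left[OF H_scale[OF bH, of ep] u(1) phaH] by (simp add: g_def[abs_def] ip_scale_left)
 also have "... <= ep*(Ck*(LINT x|L. pha x)) - ((LINT x|L. (pha x)^2) + c1*(ka*(LINT x|L. pha x)))"
  using ip_bump_le[OF phaH pha0(1) phai, of x0] gl ep0 by (intro diff_mono mult_left_mono) (auto simp: b_def[abs_def])
 also have "... = - (LINT x|L. (pha x)^2)" using Ck_pos by (simp add: ep_def)
 finally have "(LINT x|L. (pha x)^2) = 0" by (simp add: antisym)
 hence "AE x in L. pha x = 0" using integral_nonneg_eq_0_iff_AE[OF sqiD(2)[OF H_sqi[OF phaH]]] by simp
 thus ?thesis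
  by eventually_elim (auto simp: pha_def g_def ep_def c1_def b_def ka_def max_def mult_ac split: if_splits)
qed

text \<open>The barrier inequality holds almost everywhere for each centre; countably many dense
  centres keep the exceptional set null, and every point is within \<open>1/2\<close> of one of
  them. The source must be at distance 3 from the point, so two sources at mutual distance 6 are
  used.\<close>

lemma supersolution_lower_bound:
 assumes u: "u \<in> H" "!!x. u x >= 0" "hn u > 0" and ss: "!!pha. pha \<in> H ==> (!!x. pha x >= 0) ==> ip u pha >= 0"
 obtains ep where "ep > 0" "AE x in L. u x >= ep * om x"
proof -
 have [measurable]: "u \<in> borel_measurable borel" using u H_meas by auto
 define ka where "ka z = (LINT y|L. indicator (ball z 1) y*u y)" for z
 have pos: "AE x in L. u x > 0" by (rule supersolution_positive[OF u ss])
 have ka: "ka z > 0" for z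
 proof -
  have ballfin: "integrable L (indicator (ball z 1) :: _ => real)" by (rule ball_indicator_integrable)
  have Eu: "integrable L (%y. indicator (ball z 1) y*u y)"
   by (rule sqi_mult_integrable[OF _ H_sqi[OF u(1)]]) (use ballfin in \<open>auto simp: sqi_def indicator_sq\<close>)
  have nn: "0 <= indicator (ball z 1) y*u y" for y using u(2) by (auto simp: indicator_def)
  have "ka z ~= 0"
  proof
   assume "ka z = 0"
   hence "AE y in L. indicator (ball z 1) y*u y = 0"
    unfolding ka_def using integral_nonneg_eq_0_iff_AE[OF Eu] nn by simp
   hence "AE y in L. y \<notin> ball z 1" using pos by eventually_elim (auto simp: indicator_def)
   hence "emeasure L (ball z 1) = 0" using AE_iff_null_sets[of "ball z 1" L] by (auto simp: null_sets_def)
   thus False using unit_ball_vol_pos[of "real CARD('n)"] by (simp add: emeasure_ball)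
  qed
  moreover have "ka z >= 0" unfolding ka_def using nn by (intro Bochner_Integration.integral_nonneg) auto
  ultimately show ?thesis by simp
 qed
 define c where "c z = (2 + norm z) powr - dd * ka z/Ck*((3/4)*(3/2) powr - dd)" for z
 have c: "c z > 0" for z
 proof -
  have "2 + norm z > 0" using norm_ge_zero[of z] by linarith
  hence "(2 + norm z) powr - dd > 0" by simp
  thus ?thesis unfolding c_def using ka[of z] Ck_pos by (intro mult_pos_pos divide_pos_pos) auto
 qed
 obtain D :: "(real^'n) set" where D: "countable D" "!!X. open X ==> X ~= {} ==> \<exists>d\<in>D. d \<in> X"
  by (rule countable_dense_setE) blast
 have near: "AE x in L. norm (x - z) >= 3 --> u x >= c z * om x" for z
 proof -
  have "AE x in L. \<forall>x0\<in>D. norm (x0 - z) >= 2 --> u x >= (2 + norm z) powr - dd * ka z/Ck * om x0*bump (x - x0)"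
   using D(1) supersolution_bump[OF u(1,2) ss] unfolding ka_def[symmetric] by (subst AE_ball_countable) auto
  thus ?thesis
  proof eventually_elim
   case (elim x)
   show ?case
   proof
    assume x: "norm (x - z) >= 3"
    obtain x0 where x0: "x0 \<in> D" "norm (x0 - x) < 1/2"
     using D(2)[of "ball x (1/2)"] by (auto simp: dist_norm norm_minus_commute)
    have "norm (x0 - z) >= 2" using x x0 norm_triangle_ineq[of "x - x0" "x0 - z"] by (simp add: norm_minus_commute)
    hence ux: "u x >= (2 + norm z) powr - dd * ka z/Ck * om x0*bump (x - x0)" using elim x0 by blast
    have "(norm (x - x0))^2 <= (1/2)^2" using x0 by (intro power_mono) (auto simp: norm_minus_commute)
    hence b: "bump (x - x0) >= 3/4" by (simp add: bump_def power2_eq_square)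
    have o: "om x0 >= (3/2) powr - dd * om x"
    proof -
     have "(3/2) powr - dd <= (1 + norm (x0 - x)) powr - dd" using x0 dd_pos by (intro powr_mono2') (auto simp: add_pos_nonneg)
     hence "(3/2) powr - dd * om x <= (1 + norm (x0 - x)) powr - dd * om x" using om_pos[of x] by (intro mult_right_mono) auto
     thus ?thesis using om_shift[of "x0 - x" x] by simp
    qed
    have "c z * om x = (2 + norm z) powr - dd * ka z/Ck*(((3/2) powr - dd * om x)*(3/4))" by (simp add: c_def)
    also have "... <= (2 + norm z) powr - dd * ka z/Ck*(om x0*bump (x - x0))"
     using o b ka[of z] Ck_pos om_pos[of x] om_pos[of x0] by (intro mult_left_mono mult_mono) auto
    finally show "u x >= c z * om x" using ux by (simp add: mult.assoc)
   qed
  qed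
 qed
 define e :: "real^'n" where "e = (SOME v. norm v = 1)"
 have e: "norm e = 1" unfolding e_def by (rule someI_ex) (metis vector_choose_size zero_le_one)
 have "AE x in L. u x >= min (c 0) (c (6 *\<^sub>R e)) * om x"
  using near[of 0] near[of "6 *\<^sub>R e"]
 proof eventually_elim
  case (elim x)
  have "norm (x - 0) >= 3 \<or> norm (x - 6 *\<^sub>R e) >= 3"
   using norm_triangle_ineq[of x "6 *\<^sub>R e - x"] e by (simp add: norm_minus_commute) linarith
  hence "u x >= c 0 * om x \<or> u x >= c (6 *\<^sub>R e) * om x" using elim by auto
  moreover have "min (c 0) (c (6 *\<^sub>R e)) * om x <= c 0 * om x" "min (c 0) (c (6 *\<^sub>R e)) * om x <= c (6 *\<^sub>R e) * om x"
   using om_pos[of x] by (auto intro!: mult_right_mono simp: less_imp_le)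
  ultimately show ?case by linarith
 qed
 thus ?thesis using that[of "min (c 0) (c (6 *\<^sub>R e))"] c by simp
qed

end

section \<open>The interaction of two nonnegative numbers under the power\<close>

lemma powr_taylor2_lower:
 fixes t p :: real assumes "p > 1" "t >= 0"
 shows "(1 + t) powr (p + 1) >= 1 + (p + 1)*t + p*(p + 1)/2*t^2"
proof -
 have D: "((%x. (1 + x) powr (p + 1) - 1 - (p + 1)*x - p*(p + 1)/2*x^2) has_real_derivative ((p + 1)*((1 + x) powr p - 1 - p*x))) (at x)"
  if "x >= 0" for x
  using that by (auto intro!: derivative_eq_intros simp: algebra_simps)
 have "(%x. (1 + x) powr (p + 1) - 1 - (p + 1)*x - p*(p + 1)/2*x^2) 0 <= (%x. (1 + x) powr (p + 1) - 1 - (p + 1)*x - p*(p + 1)/2*x^2) t"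
 proof (rule DERIV_nonneg_imp_nondecreasing[OF assms(2), where f="%x. (1 + x) powr (p + 1) - 1 - (p + 1)*x - p*(p + 1)/2*x^2"])
  fix x :: real assume x: "0 <= x" "x <= t"
  have "(1 + x) powr p - 1 - p*x >= 0" using bernoulli_powr[of p "1 + x"] assms x by simp
  thus "\<exists>y. ((%x. (1 + x) powr (p + 1) - 1 - (p + 1)*x - p*(p + 1)/2*x^2) has_real_derivative y) (at x) & 0 <= y"
   using D[OF x(1)] assms by (intro exI[of _ "(p + 1)*((1 + x) powr p - 1 - p*x)"]) auto
 qed
 thus ?thesis by simp
qed

text \<open>The excess of the power of a sum over the separate powers and the term linear in
  \<open>B\<close>. For \<open>A\<close> the local minimiser that linear term is accounted for by
  its equation, so \<open>Gf\<close> is the true energy gain. It is not symmetric in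
  \<open>A\<close> and \<open>B\<close>.\<close>

definition Gf :: "real => real => real => real" where
 "Gf p A B = (A + B) powr (p + 1) - A powr (p + 1) - B powr (p + 1) - (p + 1)*A powr p*B"

text \<open>By homogeneity the larger argument may be taken to be 1. If \<open>B\<close> is the
  smaller one, the quadratic Taylor term gives the bound. If \<open>A\<close> is, the surplus
  \<open>(p + 1) * (t - t powr p)\<close> gives a linear bound for \<open>t \<le> 1/2\<close>, and
  the quadratic term does so for larger \<open>t\<close>.\<close>

lemma Gf_lower:
 fixes p :: real assumes p: "p > 1"
 obtains c where "c > 0" "!!A B. 0 <= A ==> A <= B ==> Gf p A B >= c*(A*B powr p)"
  "!!A B. 0 <= B ==> B <= A ==> Gf p A B >= c*(A powr (p - 1)*B^2)"
proof -
 \<comment> \<open>The quadratic Taylor coefficient, reduced by 1 to absorb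
   \<open>t powr (p + 1) \<le> t^2\<close> on the unit interval; positive because
   \<open>p > 1\<close>.\<close>
 define k where "k = p*(p + 1)/2 - 1"
 have k: "k > 0" using p mult_strict_mono[of 1 p 1 "p + 1"] by (simp add: k_def) (smt (verit) mult_less_cancel_left2 mult_less_cancel_right1)
 define e where "e = (p + 1)*(1 - (1/2) powr (p - 1))"
 have h: "(1/2::real) powr (p - 1) < 1" using p powr_less_mono2[of "p - 1" "1/2" 1] by simp
 have e: "e > 0" using p h by (simp add: e_def)
 define c where "c = min (k/2) e"
 have c: "c > 0" "c <= k" "c <= k/2" "c <= e" using k e by (auto simp: c_def)
 have scal: "Gf p (l*A) (l*B) = l powr (p + 1)*Gf p A B" if "l > 0" "A >= 0" "B >= 0" for l A B
 proof -
  have "(l*A + l*B) powr (p + 1) = l powr (p + 1)*(A + B) powr (p + 1)" by (simp add: powr_mult flip: distrib_left)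
  moreover have "(l*A) powr p*(l*B) = l powr (p + 1)*(A powr p*B)" using that by (simp add: powr_mult powr_add)
  ultimately show ?thesis by (simp add: Gf_def powr_mult mult.assoc right_diff_distrib)
 qed
 have low: "(1 + t) powr (p + 1) - 1 - (p + 1)*t - t powr (p + 1) >= k*t^2" if t: "0 <= t" "t <= 1" for t :: real
 proof -
  have "t powr (p + 1) <= t powr 2" using t p by (intro powr_mono') auto
  hence "t powr (p + 1) <= t^2" using t by (simp add: powr_numeral)
  thus ?thesis using powr_taylor2_lower[OF p t(1)] by (simp add: k_def algebra_simps)
 qed
 have 2: "Gf p A B >= c*(A powr (p - 1)*B^2)" if AB: "0 <= B" "B <= A" for A B
 proof (cases "A = 0")
  case True thus ?thesis using AB p by (simp add: Gf_def)
 next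
  case False
  hence A: "A > 0" using AB by simp
  define t where "t = B/A"
  have t: "0 <= t" "t <= 1" "B = A*t" using AB A by (auto simp: t_def)
  have "Gf p A B = A powr (p + 1)*Gf p 1 t" using scal[of A 1 t] A t by simp
  also have "... >= A powr (p + 1)*(c*t^2)"
  proof (intro mult_left_mono)
   have "c*t^2 <= k*t^2" using c by (intro mult_right_mono) auto
   thus "c*t^2 <= Gf p 1 t" using low[OF t(1,2)] by (simp add: Gf_def)
  qed auto
  also have "A powr (p + 1)*(c*t^2) = c*(A powr (p - 1)*B^2)"
   using A powr_add[of A "p - 1" 2] by (simp add: t(3) power_mult_distrib powr_numeral add.commute mult_ac)
  finally show ?thesis .
 qed
 have 1: "Gf p A B >= c*(A*B powr p)" if AB: "0 <= A" "A <= B" for A B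
 proof (cases "B = 0")
  case True thus ?thesis using AB p by (simp add: Gf_def)
 next
  case False
  hence B: "B > 0" using AB by simp
  define t where "t = A/B"
  have t: "0 <= t" "t <= 1" "A = B*t" using AB B by (auto simp: t_def)
  have "Gf p A B = B powr (p + 1)*Gf p t 1" using scal[of B t 1] B t by simp
  also have "... >= B powr (p + 1)*(c*t)"
  proof (intro mult_left_mono)
   have G: "Gf p t 1 = ((1 + t) powr (p + 1) - 1 - (p + 1)*t - t powr (p + 1)) + (p + 1)*(t - t powr p)"
    by (simp add: Gf_def algebra_simps)
   have tp: "t powr p = t*t powr (p - 1)" using t powr_add[of t 1 "p - 1"] by (cases "t = 0") auto
   have nn: "t - t powr p >= 0" using t p powr_le1[of "p - 1" t] mult_left_mono[of "t powr (p - 1)" 1 t] by (simp add: tp)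
   show "c*t <= Gf p t 1"
   proof (cases "t <= 1/2")
    case True
    have "t powr (p - 1) <= (1/2) powr (p - 1)" using True t p by (intro powr_mono2) auto
    hence "t*(1 - (1/2) powr (p - 1)) <= t*(1 - t powr (p - 1))" using t by (intro mult_left_mono) auto
    hence "(p + 1)*(t*(1 - (1/2) powr (p - 1))) <= (p + 1)*(t - t powr p)" using p by (intro mult_left_mono) (auto simp: tp algebra_simps)
    moreover have "c*t <= e*t" using c t by (intro mult_right_mono) auto
    moreover have "0 <= k*t^2" using k by simp
    ultimately show ?thesis using low[OF t(1,2)] unfolding G e_def by (simp add: mult_ac)
   next
    case False
    have "c*t <= k/2*t" using c t by (intro mult_right_mono) auto
    also have "... <= k*t^2" using False k t mult_left_mono[of "1/2" t "k*t"] by (simp add: power2_eq_square mult_ac)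
    finally show ?thesis using low[OF t(1,2)] nn p unfolding G by (smt (verit) mult_nonneg_nonneg)
   qed
  qed auto
  also have "B powr (p + 1)*(c*t) = c*(A*B powr p)" using B by (simp add: t(3) powr_add mult_ac)
  finally show ?thesis .
 qed
 show ?thesis using that[OF c(1) 1 2] .
qed

lemma Gf_nonneg: assumes "p > 1" "A >= 0" "B >= 0" shows "Gf p A B >= 0"
proof -
 obtain c where c: "c > 0" "!!A B. 0 <= A ==> A <= B ==> Gf p A B >= c*(A*B powr p)"
  "!!A B. 0 <= B ==> B <= A ==> Gf p A B >= c*(A powr (p - 1)*B^2)" using Gf_lower[OF assms(1)] by metis
 have "0 <= c*(A*B powr p)" "0 <= c*(A powr (p - 1)*B^2)" using c(1) assms by auto
 thus ?thesis using c(2)[of A B] c(3)[of B A] assms by (meson linear order_trans)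
qed

context setting
begin

subsection \<open>Weighted energy estimate for the ground state\<close>

definition et :: "'n fn" where "et x = (1 + norm x) powr (- dd/2)"

lemma et_sq: "(et x)^2 = om x" by (simp add: et_def om_def power2_eq_square powr_add[symmetric])
lemma et_pos: "et x > 0" using norm_ge_zero[of x] by (simp add: et_def add_nonneg_eq_0_iff)
lemma et_le_1: "et x <= 1"
 using et_sq[of x] om_le_1[of x] et_pos[of x] by (metis abs_of_pos abs_square_le_1)
lemma et_meas[measurable]: "et \<in> borel_measurable borel" unfolding et_def by measurable

lemma et_diff_near: assumes "norm h <= 1" shows "(et x - et (x + h))^2 <= (dd*2 powr (dd/2 + 1))^2 * om x*(norm h)^2"
proof -
 define m where "m = dd/2"
 have m: "m > 0" using dd_pos by (simp add: m_def)
 have key: "abs (s powr - m - t powr - m) <= m*(r powr (- m - 1))*abs (s - t)" if "r > 0" "r <= s" "r <= t" for r s t :: real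
 proof -
  have *: "s powr - m - t powr - m <= m*(r powr (- m - 1))*(t - s)" if st: "r <= s" "s < t" for s t
  proof -
   have "\<exists>z>s. z < t & t powr - m - s powr - m = (t - s)*(- m*z powr (- m - 1))"
    using st \<open>r > 0\<close> by (intro MVT2) (auto intro!: derivative_eq_intros)
   then obtain z where z: "s < z" "z < t" "t powr - m - s powr - m = (t - s)*(- m*z powr (- m - 1))" by blast
   have "z powr (- m - 1) <= r powr (- m - 1)" using z st \<open>r > 0\<close> m by (intro powr_mono2') auto
   hence "(t - s)*(m*z powr (- m - 1)) <= (t - s)*(m*r powr (- m - 1))" using st m by (intro mult_left_mono) auto
   thus ?thesis using z(3) by (simp add: mult_ac)
  qed
  have mono: "t powr - m <= s powr - m" if "r <= s" "s <= t" for s t using that \<open>r > 0\<close> m by (intro powr_mono2') auto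
  consider "s = t" | "s < t" | "t < s" by linarith
  thus ?thesis using *[of s t] *[of t s] mono[of s t] mono[of t s] that by cases auto
 qed
 define A B where "A = 1 + norm x" and "B = 1 + norm (x + h)"
 have AB: "A >= 1" "B >= 1" "abs (A - B) <= norm h"
  unfolding A_def B_def using norm_triangle_ineq3[of x "x + h"] by auto
 have "A/2 <= B" using AB assms by (simp add: abs_le_iff)
 hence "abs (A powr - m - B powr - m) <= m*((A/2) powr (- m - 1))*abs (A - B)" using AB by (intro key) auto
 also have "... <= m*((A/2) powr (- m - 1))*norm h" using AB m by (intro mult_left_mono) auto
 also have "(A/2) powr (- m - 1) <= 2 powr (m + 1)*A powr - m"
 proof -
  have "(A/2) powr (- m - 1) = 2 powr (m + 1)*A powr (- m - 1)"
   using AB powr_minus_divide[of 2 "m + 1"] by (simp add: powr_divide)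
  also have "... <= 2 powr (m + 1)*A powr - m" using AB by (intro mult_left_mono powr_mono) auto
  finally show ?thesis .
 qed
 finally have "abs (et x - et (x + h)) <= m*(2 powr (m + 1)*et x)*norm h"
  using m by (simp add: A_def B_def et_def m_def mult_left_mono mult_right_mono)
 also have "... <= dd*2 powr (dd/2 + 1)*et x*norm h" using dd_pos et_pos[of x] by (intro mult_right_mono) (auto simp: m_def)
 finally have "(et x - et (x + h))^2 <= (dd*2 powr (dd/2 + 1)*et x*norm h)^2" by (metis abs_ge_zero power2_abs power_mono)
 thus ?thesis by (simp add: power_mult_distrib et_sq mult_ac)
qed

text \<open>At least one of \<open>x + h\<close> and \<open>h\<close> has half the norm of
  \<open>x\<close>, so the corresponding factor is at most \<open>2 powr dd * om x\<close>.\<close>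

lemma om_convolution: "om (x + h) * om h <= 2 powr dd * om x*(om (x + h) + om h)"
proof -
 have n: "norm x <= norm (x + h) + norm h" using norm_triangle_ineq4[of "x + h" h] by simp
 have *: "om z <= 2 powr dd * om x" if "1 + norm x <= 2*(1 + norm z)" for z
 proof -
  have "(2*(1 + norm z)) powr - dd <= (1 + norm x) powr - dd" using that dd_pos by (intro powr_mono2') (auto simp: add_pos_nonneg)
  hence "2 powr - dd * om z <= om x" by (simp only: om_def powr_mult)
  hence "2 powr dd*(2 powr - dd * om z) <= 2 powr dd * om x" by (intro mult_left_mono) auto
  thus ?thesis by (simp add: mult.assoc[symmetric] powr_add[symmetric])
 qed
 show ?thesis
 proof (cases "norm h <= norm (x + h)")
  case True
  have "om (x + h) * om h <= (2 powr dd * om x) * om h" using *[of "x + h"] n True om_pos[of h] by (intro mult_right_mono) auto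
  thus ?thesis using om_pos[of x] om_pos[of "x + h"] by (simp add: distrib_left add_increasing)
 next
  case False
  have "om h * om (x + h) <= (2 powr dd * om x) * om (x + h)" using *[of h] n False om_pos[of "x + h"] by (intro mult_right_mono) auto
  moreover have "0 <= (2 powr dd * om x) * om h" using om_pos[of x] om_pos[of h] by simp
  ultimately show ?thesis unfolding distrib_left mult.commute[of "om (x + h)" "om h"] by linarith
 qed
qed

definition COm :: real where
 "COm = (dd*2 powr (dd/2 + 1))^2*(LINT h|L. min ((norm h)^2) 1/norm h powr dd) + 2 powr dd*2*(LINT h|L. om h) + 4*2 powr dd*2 powr dd*(LINT h|L. om h)"

lemma COm_nonneg: "COm >= 0"
 unfolding COm_def by (intro add_nonneg_nonneg mult_nonneg_nonneg Bochner_Integration.integral_nonneg) (auto simp: less_imp_le om_pos)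

text \<open>The energy density of \<open>et\<close>, the square root of \<open>om\<close>, is
  controlled by \<open>om\<close> itself. Near \<open>x\<close> this is a gradient bound; far away
  it reflects that the weight decays at the same rate as the kernel, a property preserved by
  convolution.\<close>

lemma et_energy: "(\<integral>\<^sup>+y. ennreal ((df et (x, y))^2) \<partial>L) <= ennreal (COm * om x)"
proof -
 define K where "K = (dd*2 powr (dd/2 + 1))^2"
 define g where "g h = K * om x*(min ((norm h)^2) 1/norm h powr dd) + 2 powr dd*2 * om x * om h + 2*2 powr dd*(2 powr dd * om x*(om (x + h) + om h))" for h :: "real^'n"
 have [measurable]: "df et \<in> borel_measurable LL" by (rule df_measurable) measurable
 have oi: "integrable L (%h. om (x + h))" "(LINT h|L. om (x + h)) = (LINT h|L. om h)"
  using integral_lborel_shift[of om x] om_integrable by (auto simp: add.commute)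
 have gi: "integrable L g" unfolding g_def by (intro Bochner_Integration.integrable_add integrable_mult_right kernel_integrable om_integrable oi)
 have pt: "(df et (x, x + h))^2 <= g h" for h
 proof -
  have e: "(df et (x, x + h))^2 = (et x - et (x + h))^2/norm h powr dd"
   by (simp add: df_def power_divide power2_eq_square[of "_ powr _"] powr_add[symmetric])
  have n1: "0 <= 2 powr dd*2 * om x * om h" "0 <= 2*2 powr dd*(2 powr dd * om x*(om (x + h) + om h))"
   "0 <= K * om x*(min ((norm h)^2) 1/norm h powr dd)"
   using om_pos[of x] om_pos[of h] om_pos[of "x + h"] by (auto simp: K_def)
  show ?thesis
  proof (cases "norm h <= 1")
   case True
   have "(et x - et (x + h))^2/norm h powr dd <= K * om x*(norm h)^2/norm h powr dd"
    unfolding K_def by (intro divide_right_mono et_diff_near True) auto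
   also have "... = K * om x*(min ((norm h)^2) 1/norm h powr dd)" using True by (simp add: min_def power_le_one)
   finally show ?thesis unfolding e g_def using n1 by linarith
  next
   case False
   have nh: "1/norm h powr dd <= 2 powr dd * om h"
   proof -
    have "(1 + norm h) powr dd <= (2*norm h) powr dd" using False dd_pos by (intro powr_mono2) auto
    moreover have "norm h powr dd > 0" "(1 + norm h) powr dd > 0" using False by (auto simp: add_nonneg_eq_0_iff)
    ultimately show ?thesis by (simp add: om_def powr_minus powr_mult field_simps)
   qed
   have "(et x - et (x + h))^2 <= 2 * om x + 2 * om (x + h)"
    using zero_le_power2[of "et x + et (x + h)"] by (simp add: power2_sum power2_diff et_sq)
   hence "(et x - et (x + h))^2*(1/norm h powr dd) <= (2 * om x + 2 * om (x + h))*(2 powr dd * om h)"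
    using nh om_pos[of x] om_pos[of "x + h"] by (intro mult_mono) auto
   also have "... = 2 powr dd*2 * om x * om h + 2*2 powr dd*(om (x + h) * om h)" by (simp add: algebra_simps)
   also have "... <= 2 powr dd*2 * om x * om h + 2*2 powr dd*(2 powr dd * om x*(om (x + h) + om h))"
    using om_convolution[of x h] by (intro add_left_mono mult_left_mono) auto
   finally show ?thesis unfolding e g_def using n1 by simp
  qed
 qed
 have "(\<integral>\<^sup>+y. ennreal ((df et (x, y))^2) \<partial>L) = (\<integral>\<^sup>+h. ennreal ((df et (x, h + x))^2) \<partial>L)"
  by (rule nn_integral_lborel_shift[symmetric, where f="%y. ennreal ((df et (x, y))^2)"]) (simp add: df_def)
 also have "... <= (\<integral>\<^sup>+h. ennreal (g h) \<partial>L)" using pt by (intro nn_integral_mono ennreal_leI) (simp add: add.commute)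
 also have "... = ennreal (LINT h|L. g h)" using gi pt by (intro nn_integral_eq_integral) (auto intro: order_trans[OF zero_le_power2])
 also have "(LINT h|L. g h) = COm * om x"
 proof -
  have "(LINT h|L. g h) = K * om x*(LINT h|L. min ((norm h)^2) 1/norm h powr dd) + 2 powr dd*2 * om x*(LINT h|L. om h)
   + 2*2 powr dd*(2 powr dd * om x*((LINT h|L. om (x + h)) + (LINT h|L. om h)))"
   unfolding g_def
   by (subst Bochner_Integration.integral_add; (intro Bochner_Integration.integrable_add integrable_mult_right kernel_integrable om_integrable oi)?)+
     (simp only: integral_mult_right_zero Bochner_Integration.integral_add[OF oi(1) om_integrable])
  thus ?thesis unfolding COm_def K_def[symmetric] oi by (simp add: algebra_simps)
 qed
 finally show ?thesis .
qed

text \<open>In the product rule the difference of the weight falls on \<open>w\<close> and is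
  square-integrable by \<open>et_energy\<close>. Applying the argument to \<open>et\<close> twice
  covers \<open>om\<close>.\<close>

lemma et_mult:
 assumes "w \<in> H"
 shows "integrable LL (%z. (w (fst z))^2*(df et z)^2)" "(LINT z|LL. (w (fst z))^2*(df et z)^2) <= COm*(LINT x|L. om x*(w x)^2)"
  "(%x. et x*w x) \<in> H" "(%x. om x*w x) \<in> H"
proof -
 have [measurable]: "w \<in> borel_measurable borel" using assms H_meas by auto
 have m[measurable]: "df et \<in> borel_measurable LL" "fst \<in> LL \<rightarrow>\<^sub>M borel" "snd \<in> LL \<rightarrow>\<^sub>M borel"
  using measurable_fst[of L L] measurable_snd[of L L] by (auto simp: measurable_lborel1 intro!: df_measurable)
 have oi: "integrable L (%x. om x*(w x)^2)"
  by (intro integrable_boundI[OF sqiD(2)[OF H_sqi[OF assms]]]) (auto simp: abs_mult less_imp_le om_pos om_le_1 intro!: mult_left_le_one_le)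
 have on: "0 <= (LINT x|L. om x*(w x)^2)" by (intro Bochner_Integration.integral_nonneg) (simp add: less_imp_le om_pos)
 have "(\<integral>\<^sup>+z. ennreal ((w (fst z))^2*(df et z)^2) \<partial>LL) = (\<integral>\<^sup>+x. \<integral>\<^sup>+y. ennreal ((w x)^2)*ennreal ((df et (x, y))^2) \<partial>L \<partial>L)"
  by (subst lborel.nn_integral_fst[symmetric]) (auto simp: ennreal_mult)
 also have "... = (\<integral>\<^sup>+x. ennreal ((w x)^2)*(\<integral>\<^sup>+y. ennreal ((df et (x, y))^2) \<partial>L) \<partial>L)"
  by (intro nn_integral_cong nn_integral_cmult) (simp add: df_def)
 also have "... <= (\<integral>\<^sup>+x. ennreal ((w x)^2)*ennreal (COm * om x) \<partial>L)" by (intro nn_integral_mono mult_left_mono et_energy) auto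
 also have "... = (\<integral>\<^sup>+x. ennreal (COm*(om x*(w x)^2)) \<partial>L)"
  using COm_nonneg om_pos by (intro nn_integral_cong) (simp add: ennreal_mult[symmetric] less_imp_le mult_ac)
 also have "... = ennreal (COm*(LINT x|L. om x*(w x)^2))"
  using oi COm_nonneg om_pos by (subst nn_integral_eq_integral) (auto simp: less_imp_le)
 finally have *: "(\<integral>\<^sup>+z. ennreal ((w (fst z))^2*(df et z)^2) \<partial>LL) <= ennreal (COm*(LINT x|L. om x*(w x)^2))" .
 show i: "integrable LL (%z. (w (fst z))^2*(df et z)^2)"
  using * by (intro integrableI_nonneg) (auto simp: le_less_trans)
 have "ennreal (LINT z|LL. (w (fst z))^2*(df et z)^2) <= ennreal (COm*(LINT x|L. om x*(w x)^2))"
  using * i by (simp add: nn_integral_eq_integral)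
 thus "(LINT z|LL. (w (fst z))^2*(df et z)^2) <= COm*(LINT x|L. om x*(w x)^2)"
  using COm_nonneg on by (simp add: ennreal_le_iff)
 have sq1: "sqi LL (%z. w (fst z)*df et z)" using i by (simp add: sqi_def power_mult_distrib)
 have ab: "sqi LL (%z. abs (F z))" if "sqi LL F" for F using that borel_measurable_abs[of F LL] by (auto simp: sqi_def)
 show etH: "(%x. et x*w x) \<in> H"
 proof -
  have "sqi LL (df (%x. et x*w x))"
  proof (rule sqi_mono[OF sqi_add[OF ab[OF H_sqi_df[OF assms]] ab[OF sq1]]])
   show "df (%x. et x*w x) \<in> borel_measurable LL" by (rule df_measurable) measurable
   fix z
   have "df (%x. et x*w x) z = et (snd z)*df w z + w (fst z)*df et z" by (simp add: df_def add_divide_distrib[symmetric] algebra_simps)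
   also have "abs (...) <= abs (et (snd z)*df w z) + abs (w (fst z)*df et z)" by (rule abs_triangle_ineq)
   also have "abs (et (snd z)*df w z) <= abs (df w z)" using et_pos[of "snd z"] et_le_1[of "snd z"] by (simp add: abs_mult mult_left_le_one_le)
   finally show "abs (df (%x. et x*w x) z) <= abs (abs (df w z) + abs (w (fst z)*df et z))" by simp
  qed
  moreover have "sqi L (%x. et x*w x)"
   by (rule sqi_mono[OF H_sqi[OF assms]]) (auto simp: abs_mult et_pos less_imp_le et_le_1 intro!: mult_left_le_one_le)
  ultimately show ?thesis by (simp add: H_iff)
 qed
 have "sqi LL (df (%x. om x*w x))"
 proof (rule sqi_mono[OF sqi_add[OF ab[OF H_sqi_df[OF etH]] ab[OF sq1]]])
  show "df (%x. om x*w x) \<in> borel_measurable LL" by (rule df_measurable) measurable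
  fix z
  have "df (%x. om x*w x) z = et (snd z)*df (%x. et x*w x) z + et (fst z)*(w (fst z)*df et z)"
   by (simp add: df_def add_divide_distrib[symmetric] algebra_simps power2_eq_square flip: et_sq)
  also have "abs (...) <= abs (et (snd z)*df (%x. et x*w x) z) + abs (et (fst z)*(w (fst z)*df et z))" by (rule abs_triangle_ineq)
  also have "... <= abs (df (%x. et x*w x) z) + abs (w (fst z)*df et z)"
   unfolding abs_mult[of "et _"] using et_pos et_le_1 by (intro add_mono) (auto intro!: mult_left_le_one_le simp: less_imp_le)
  finally show "abs (df (%x. om x*w x) z) <= abs (abs (df (%x. et x*w x) z) + abs (w (fst z)*df et z))" by simp
 qed
 moreover have "sqi L (%x. om x*w x)"
  by (rule sqi_mono[OF H_sqi[OF assms]]) (auto simp: abs_mult om_pos less_imp_le om_le_1 intro!: mult_left_le_one_le)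
 ultimately show "(%x. om x*w x) \<in> H" by (simp add: H_iff)
qed

text \<open>Rests on \<open>(et x * w x - et y * w y)^2 = (w x - w y) * (om x * w x - om y * w y) +
  w x * w y * (et x - et y)^2\<close>. The first term is the equation tested with
  \<open>om w\<close>; the last is symmetrised by Young's inequality and bounded by
  \<open>et_energy\<close>.\<close>

lemma caccioppoli:
 assumes w: "w \<in> H"
 shows "(hn (%x. et x*w x))^2 <= ip w (%x. om x*w x) + COm*(LINT x|L. om x*(w x)^2)"
proof -
 have [measurable]: "w \<in> borel_measurable borel" using assms H_meas by auto
 let ?E = "%x. et x*w x" and ?O = "%x. om x*w x"
 note E = et_mult[OF w]
 have [measurable]: "df et \<in> borel_measurable LL" "fst \<in> LL \<rightarrow>\<^sub>M borel" "snd \<in> LL \<rightarrow>\<^sub>M borel"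
  using measurable_fst[of L L] measurable_snd[of L L] by (auto simp: measurable_lborel1 intro!: df_measurable)
 have sw: "integrable LL (%z. (w (snd z))^2*(df et z)^2)" "(LINT z|LL. (w (snd z))^2*(df et z)^2) = (LINT z|LL. (w (fst z))^2*(df et z)^2)"
 proof -
  have s: "(df et (y, x))^2 = (df et (x, y))^2" for x y
   by (simp add: df_def norm_minus_commute[of y x] power_divide power2_commute[of "et y" "et x"])
  have e: "(%(x, y). (%z. (w (fst z))^2*(df et z)^2) (y, x)) = (%z. (w (snd z))^2*(df et z)^2)"
   by (rule ext, clarify, simp only: split fst_conv snd_conv, subst s, rule refl)
  show "integrable LL (%z. (w (snd z))^2*(df et z)^2)" using lborel_pair.integrable_product_swap[OF E(1)] unfolding e .
  show "(LINT z|LL. (w (snd z))^2*(df et z)^2) = (LINT z|LL. (w (fst z))^2*(df et z)^2)"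
   using lborel_pair.integral_product_swap[of "%z. (w (fst z))^2*(df et z)^2"] borel_measurable_integrable[OF E(1)] unfolding e by simp
 qed
 have pt: "(df ?E z)^2 <= df w z*df ?O z + (1/2)*((w (fst z))^2*(df et z)^2) + (1/2)*((w (snd z))^2*(df et z)^2)" for z
 proof -
  obtain x y where z: "z = (x, y)" by fastforce
  let ?n = "norm (x - y) powr (dd/2)*norm (x - y) powr (dd/2)"
  have id: "(et x*w x - et y*w y)^2 = (w x - w y)*(om x*w x - om y*w y) + w x*w y*(et x - et y)^2"
   by (simp add: power2_eq_square algebra_simps flip: et_sq)
  have "w x*w y <= (1/2)*(w x)^2 + (1/2)*(w y)^2" using zero_le_power2[of "w x - w y"] by (simp add: power2_diff)
  hence "w x*w y*(et x - et y)^2 <= ((1/2)*(w x)^2 + (1/2)*(w y)^2)*(et x - et y)^2" by (rule mult_right_mono) simp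
  hence "(et x*w x - et y*w y)^2/?n <= ((w x - w y)*(om x*w x - om y*w y) + ((1/2)*(w x)^2 + (1/2)*(w y)^2)*(et x - et y)^2)/?n"
   unfolding id by (intro divide_right_mono) auto
  moreover have "df w z*df ?O z = (w x - w y)*(om x*w x - om y*w y)/?n" by (simp add: z df_def)
  moreover have "(df et z)^2 = (et x - et y)^2/?n" "(df ?E z)^2 = (et x*w x - et y*w y)^2/?n"
   by (simp_all add: z df_def power_divide power2_eq_square[of "_ powr _"])
  ultimately show ?thesis by (simp add: z add_divide_distrib distrib_right)
 qed
 have i1: "integrable LL (%z. df w z*df ?O z)" by (intro sqi_mult_integrable H_sqi_df w E(4))
 have "(LINT z|LL. (df ?E z)^2) <= (LINT z|LL. df w z*df ?O z + (1/2)*((w (fst z))^2*(df et z)^2) + (1/2)*((w (snd z))^2*(df et z)^2))"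
  using i1 E(1) sw(1) pt by (intro integral_mono sqiD H_sqi_df E(3)) auto
 also have "... = (LINT z|LL. df w z*df ?O z) + (LINT z|LL. (w (fst z))^2*(df et z)^2)"
  using i1 E(1) sw by simp
 also have "... <= (LINT z|LL. df w z*df ?O z) + COm*(LINT x|L. om x*(w x)^2)" using E(2) by simp
 finally have "(LINT z|LL. (df ?E z)^2) <= (LINT z|LL. df w z*df ?O z) + COm*(LINT x|L. om x*(w x)^2)" .
 moreover have "(LINT x|L. (?E x)^2) = (LINT x|L. w x*?O x)"
  by (simp add: power_mult_distrib et_sq) (simp add: power2_eq_square mult_ac)
 ultimately show ?thesis by (simp add: hn_sq_eq ip_def)
qed

end

section \<open>Translated ground states: loss caused by the weight against interaction\<close>

context setting
begin

definition wy :: "real^'n => 'n fn" where "wy y = (%x. wst (x - y))"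

lemma wy_shift: "wy y = (%x. wst (x + (- y)))" by (simp add: wy_def)

lemma wy_pos: "wy y x > 0" by (simp add: wy_def wst_pos)

lemma wy_H: "wy y \<in> H" and hn_wy: "hn (wy y) = tK"
 unfolding wy_shift using shift_H(1)[OF wst_H, of "- y"] hn_shift[OF wst_H, of "- y"] hn_wst by (simp_all only:)

lemma wy_meas[measurable]: "wy y \<in> borel_measurable borel" using H_meas wy_H by auto

lemma integral_wy:
 fixes F :: "real^'n => real => real"
 assumes "(%x. F x (wy y x)) \<in> borel_measurable borel"
 shows "(LINT x|L. F x (wy y x)) = (LINT x|L. F (x + y) (wst x))"
 using integral_lborel_shift(1)[OF assms, of y] by (simp add: wy_def)

lemma ip_wy: assumes "h \<in> H" shows "ip (wy y) h = Nf one (wy y) h"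
proof -
 have k: "(%x. h (x + y)) \<in> H" using shift_H(1)[OF assms] by auto
 have [measurable]: "h \<in> borel_measurable borel" using assms H_meas by auto
 have "ip (wy y) h = ip wst (%x. h (x + y))" using shift_H(2)[OF wst_H k, of "- y"] by (simp add: wy_def)
 also have "... = Nf one wst (%x. h (x + y))" using wst_crit[OF k] by (simp add: DI_def)
 also have "... = Nf one (wy y) h" unfolding Nf_def
  using integral_wy[of "%x t. 1*max t 0 powr p*h x" y] by simp
 finally show ?thesis .
qed

lemma B1_wy: "B1 (wy y) = tK^2" using ip_wy[OF wy_H, of y y] by (simp add: hn_sq[symmetric] hn_wy Nf_self)

lemma wst_p1: "integrable L (%x. wst x powr (p + 1))" and wy_p1: "integrable L (%x. wy y x powr (p + 1))" "(LINT x|L. wy y x powr (p + 1)) = tK^2"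
 using int_p1[OF wst_H] int_p1[OF wy_H, of y] B1_wy[of y] wst_pos wy_pos by (auto simp: less_imp_le Bf_def max_absorb1)

lemma tendsto_at_infinity_seq:
 fixes X :: "real^'n => real"
 assumes "!!y. filterlim (%n::nat. norm (y n)) at_top sequentially ==> (%n. X (y n)) ---> 0" "e > 0"
 obtains R where "!!y. norm y >= R ==> abs (X y) < e"
proof (rule ccontr)
 assume "~ thesis"
 hence "\<forall>n::nat. \<exists>y. norm y >= real n & ~ abs (X y) < e" using that by blast
 then obtain y where y: "!!n. norm (y n) >= real n" "!!n. ~ abs (X (y n)) < e" by metis
 have "filterlim (%n. norm (y n)) at_top sequentially"
  by (rule filterlim_at_top_mono[OF filterlim_real_sequentially]) (simp add: y)
 from tendstoD[OF assms(1)[OF this] assms(2)] y(2) show False by (auto simp: eventually_sequentially)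
qed

lemma wst_weight_vanish:
 fixes g :: "nat => 'n fn"
 assumes "!!n. g n \<in> borel_measurable borel" "!!n x. abs (g n x) <= 1" "!!x. (%n. g n x) ---> 0"
 shows "(%n. LINT x|L. g n x*wst x powr (p + 1)) ---> 0"
proof -
 have [measurable]: "wst \<in> borel_measurable borel" "!!n. g n \<in> borel_measurable borel" using H_meas wst_H assms by auto
 have "(%n. LINT x|L. g n x*wst x powr (p + 1)) ---> (LINT x|L. 0)"
 proof (rule integral_dominated_convergence[where w="%x. wst x powr (p + 1)"])
  show "AE x in L. (%n. g n x*wst x powr (p + 1)) ---> 0" using assms(3) by (auto intro!: tendsto_mult_left_zero)
  show "AE x in L. norm (g n x*wst x powr (p + 1)) <= wst x powr (p + 1)" for n
   using assms(2) by (auto simp: abs_mult intro!: mult_left_le_one_le)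
 qed (auto simp: wst_p1)
 thus ?thesis by simp
qed

lemma om_tendsto: assumes "filterlim (%n. norm (y n)) at_top sequentially" shows "(%n. om (x + y n)) ---> 0"
proof -
 have "filterlim (%n. - norm x + norm (y n)) at_top sequentially"
  using assms by (intro filterlim_tendsto_add_at_top[OF tendsto_const])
 hence "filterlim (%n. norm (x + y n)) at_top sequentially"
  by (rule filterlim_at_top_mono) (use norm_triangle_ineq4[of "x + y _" x] in \<open>auto simp: algebra_simps intro!: always_eventually\<close>)
 hence "filterlim (%n. 1 + norm (x + y n)) at_top sequentially" by (intro filterlim_tendsto_add_at_top[OF tendsto_const])
 thus ?thesis unfolding om_def using dd_pos by (intro tendsto_neg_powr) auto
qed

text \<open>\<open>mdef y\<close> is the loss in the power integral caused by the weight
  \<open>a\<close>. \<open>wtail y\<close> is the part of the power integral of the translate that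
  lies nearer to the origin than half of \<open>y\<close>; it measures how little of the ground
  state is left there.\<close>

definition mdef :: "real^'n => real" where "mdef y = (LINT x|L. (1 - a x)*wy y x powr (p + 1))"
definition wtail :: "real^'n => real" where "wtail y = (LINT x|L. indicator {x. norm x < norm y/2} x*wy y x powr (p + 1))"

lemma a_meas[measurable]: "a \<in> borel_measurable borel" using a_coef by (simp add: coefD)

lemma mdef_vanish: assumes "filterlim (%n. norm (y n)) at_top sequentially" shows "(%n. mdef (y n)) ---> 0"
proof -
 obtain C where C: "!!x. 1 - a x <= C * om x powr ((p + 1)/2)" using a_dec by blast
 have "(%n. LINT x|L. (1 - a (x + y n))*wst x powr (p + 1)) ---> 0"
 proof (rule wst_weight_vanish)
  show "abs (1 - a (x + y n)) <= 1" for n x using coefD(2,3)[OF a_coef, of "x + y n"] by simp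
  show "(%n. 1 - a (x + y n)) ---> 0" for x
  proof (rule tendsto_sandwich[of "%_. 0" _ _ "%n. C * om (x + y n) powr ((p + 1)/2)"])
   show "(%n. C * om (x + y n) powr ((p + 1)/2)) ---> 0"
    using p_gt_1 om_pos by (intro tendsto_mult_right_zero tendsto_zero_powrI[OF om_tendsto[OF assms] tendsto_const]) (auto simp: less_imp_le)
  qed (use C coefD(3)[OF a_coef] in auto)
 qed measurable
 moreover have "mdef (y n) = (LINT x|L. (1 - a (x + y n))*wst x powr (p + 1))" for n
  unfolding mdef_def using integral_wy[of "%x t. (1 - a x)*t powr (p + 1)" "y n"] by simp
 ultimately show ?thesis by simp
qed

lemma wtail_vanish: assumes "filterlim (%n. norm (y n)) at_top sequentially" shows "(%n. wtail (y n)) ---> 0"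
proof -
 have "(%n. LINT x|L. indicator {x. norm x < norm (y n)/2} (x + y n)*wst x powr (p + 1)) ---> 0"
 proof (rule wst_weight_vanish)
  show "(%n. indicator {x. norm x < norm (y n)/2} (x + y n) :: real) ---> 0" for x
  proof (rule tendsto_eventually)
   have "eventually (%n. norm (y n) >= 2*norm x) sequentially" using assms by (simp add: filterlim_at_top)
   thus "eventually (%n. indicator {x. norm x < norm (y n)/2} (x + y n) = (0::real)) sequentially"
   proof eventually_elim
    case (elim n)
    thus ?case using norm_triangle_ineq4[of "x + y n" x] by (auto simp: indicator_def)
   qed
  qed
 qed (auto simp: indicator_def)
 moreover have "wtail (y n) = (LINT x|L. indicator {x. norm x < norm (y n)/2} (x + y n)*wst x powr (p + 1))" for n
  unfolding wtail_def using integral_wy[of "%x t. indicator {x. norm x < norm (y n)/2} x*t powr (p + 1)" "y n"] by simp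
 ultimately show ?thesis by simp
qed

text \<open>Allows the factor \<open>w powr (p - 1)\<close> to act as a small potential on a set
  where \<open>w\<close> has little mass. With \<open>k\<close> the normalised \<open>g\<close>,
  points with \<open>w\<close> below \<open>tha * abs (k x)\<close> are covered by the Sobolev
  inequality for \<open>k\<close>, the others by the mass of \<open>w\<close>.\<close>

lemma small_product:
 assumes "etaa > 0"
 obtains dl where "dl > 0" "!!w g S. w \<in> H ==> (!!x. w x >= 0) ==> g \<in> H ==> hn g > 0 ==> S \<in> sets borel ==> (LINT x|L. indicator S x*w x powr (p + 1)) <= dl ==>
   (LINT x|L. indicator S x*(w x powr (p - 1)*(g x)^2)) <= etaa*(hn g)^2"
proof -
 \<comment> \<open>Makes the Sobolev contribution equal to \<open>etaa/2\<close>; the mass bound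
   \<open>etaa * tha^2/2\<close> chosen at the end gives the other half.\<close>
 define tha where "tha = (etaa/(2*Sq)) powr (1/(p - 1))"
 have tha: "tha > 0" "tha powr (p - 1)*Sq = etaa/2" using assms Sq_pos p_gt_1 by (auto simp: tha_def powr_powr)
 have "(LINT x|L. indicator S x*(w x powr (p - 1)*(g x)^2)) <= etaa*(hn g)^2"
  if w: "w \<in> H" "!!x. w x >= 0" and g: "g \<in> H" "hn g > 0" and S: "S \<in> sets borel" and d: "(LINT x|L. indicator S x*w x powr (p + 1)) <= etaa*tha^2/2" for w g S
 proof -
  define t where "t = hn g"
  define k where "k = (%x. (1/t)*g x)"
  have t: "t > 0" using g by (simp add: t_def)
  have k: "k \<in> H" "hn k = 1" using normalize[OF g] by (auto simp: k_def t_def)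
  have [measurable]: "w \<in> borel_measurable borel" "k \<in> borel_measurable borel" "g \<in> borel_measurable borel" "S \<in> sets borel" using H_meas w k g S by auto
  have wi: "integrable L (%x. indicator S x*w x powr (p + 1))"
   by (rule integrable_boundI[OF int_p1[OF w(1)]]) (auto simp: indicator_def w(2))
  have pt: "indicator S x*(w x powr (p - 1)*(g x)^2) <= t^2*(tha powr (p - 1)*abs (k x) powr (p + 1) + (1/tha^2)*(indicator S x*w x powr (p + 1)))" for x
  proof (cases "x \<in> S")
   case True
   have gx: "(g x)^2 = t^2*(k x)^2" using t by (simp add: k_def power_mult_distrib power_divide)
   have "w x powr (p - 1)*(k x)^2 <= tha powr (p - 1)*abs (k x) powr (p + 1) + (1/tha^2)*w x powr (p + 1)"
   proof (cases "w x <= tha*abs (k x)")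
    case True
    have "w x powr (p - 1)*(k x)^2 <= (tha*abs (k x)) powr (p - 1)*(k x)^2" using True w p_gt_1 by (intro mult_right_mono powr_mono2) auto
    also have "... = tha powr (p - 1)*abs (k x) powr (p + 1)"
    proof (cases "k x = 0")
     case False thus ?thesis using powr_add[of "abs (k x)" "p - 1" 2] tha by (simp add: powr_mult powr_numeral add.commute)
    qed auto
    finally show ?thesis by (simp add: add_increasing2)
   next
    case False
    hence wx: "w x > 0" using tha w by (smt (verit) abs_ge_zero mult_nonneg_nonneg)
    have "abs (k x) <= w x/tha" using False tha by (simp add: field_simps)
    hence "(k x)^2 <= (w x/tha)^2" by (metis abs_ge_zero power2_abs power_mono)
    hence "w x powr (p - 1)*(k x)^2 <= w x powr (p - 1)*(w x/tha)^2" by (intro mult_left_mono) auto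
    also have "... = (1/tha^2)*w x powr (p + 1)" using powr_add[of "w x" "p - 1" 2] wx by (simp add: power_divide powr_numeral add.commute)
    finally show ?thesis by (simp add: add_increasing)
   qed
   hence "t^2*(w x powr (p - 1)*(k x)^2) <= t^2*(tha powr (p - 1)*abs (k x) powr (p + 1) + (1/tha^2)*w x powr (p + 1))" by (intro mult_left_mono) auto
   thus ?thesis using True by (simp add: gx mult_ac)
  qed auto
  have ri: "integrable L (%x. t^2*(tha powr (p - 1)*abs (k x) powr (p + 1) + (1/tha^2)*(indicator S x*w x powr (p + 1))))"
   by (intro integrable_mult_right Bochner_Integration.integrable_add int_p1 k wi)
  have "(LINT x|L. indicator S x*(w x powr (p - 1)*(g x)^2)) <= (LINT x|L. t^2*(tha powr (p - 1)*abs (k x) powr (p + 1) + (1/tha^2)*(indicator S x*w x powr (p + 1))))"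
  proof (rule integral_mono[OF integrable_boundI[OF ri] ri])
   show "abs (indicator S x*(w x powr (p - 1)*(g x)^2)) <= t^2*(tha powr (p - 1)*abs (k x) powr (p + 1) + (1/tha^2)*(indicator S x*w x powr (p + 1)))" for x
    using pt[of x] by (simp add: abs_mult)
  qed (use pt in auto)
  also have "... = t^2*(tha powr (p - 1)*(LINT x|L. abs (k x) powr (p + 1)) + (1/tha^2)*(LINT x|L. indicator S x*w x powr (p + 1)))"
   using int_p1[OF k(1)] wi by (simp only: integral_mult_right_zero Bochner_Integration.integral_add integrable_mult_right)
  also have "... <= t^2*(tha powr (p - 1)*Sq + (1/tha^2)*(etaa*tha^2/2))"
   using le_p1[OF k(1)] k(2) d by (intro mult_left_mono add_mono) auto
  also have "... = etaa*t^2" using tha by simp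
  finally show ?thesis by (simp add: t_def)
 qed
 thus thesis using assms tha by (intro that[of "etaa*tha^2/2"]) auto
qed

text \<open>The nonlinear term of the Caccioppoli inequality is absorbed into the left-hand side
  near the origin by \<open>small_product\<close>, whose constant turns it into half the energy;
  away from the origin the weight is comparable with \<open>om y\<close>. In the weighted L2 term,
  values above 1 are dominated by the nonlinear term, so only small values of \<open>wy y\<close>
  remain.\<close>

lemma weighted_energy_wy:
 obtains C R where "C > 0" "!!y. norm y >= R ==> (hn (%x. et x*wy y x))^2 <= C*(om y + (LINT x|L. indicator {x. wy y x <= 1} x*(om x*(wy y x)^2)))"
proof -
 have Kp: "1 + COm > 0" using COm_nonneg by simp
 obtain dl where dl: "dl > 0" "!!w g S. w \<in> H ==> (!!x. w x >= 0) ==> g \<in> H ==> hn g > 0 ==> S \<in> sets borel ==> (LINT x|L. indicator S x*w x powr (p + 1)) <= dl ==>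
   (LINT x|L. indicator S x*(w x powr (p - 1)*(g x)^2)) <= (1/(2*(1 + COm)))*(hn g)^2"
  using small_product[of "1/(2*(1 + COm))"] Kp by auto
 obtain R where R: "!!y. norm y >= R ==> abs (wtail y) < dl" using tendsto_at_infinity_seq[of wtail dl] wtail_vanish dl by blast
 define C where "C = 2*((1 + COm)*2 powr dd*tK^2 + COm)"
 have "(hn (%x. et x*wy y x))^2 <= (C + 1)*(om y + (LINT x|L. indicator {x. wy y x <= 1} x*(om x*(wy y x)^2)))" if y: "norm y >= R" for y
 proof -
  define w where "w = wy y"
  have w: "w \<in> H" "!!x. w x > 0" unfolding w_def using wy_H wy_pos by auto
  have [measurable]: "w \<in> borel_measurable borel" using H_meas w by auto
  have wi: "integrable L (%x. w x powr (p + 1))" "(LINT x|L. w x powr (p + 1)) = tK^2" using wy_p1 by (auto simp: w_def)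
  note E = et_mult(3,4)[OF w(1)]
  let ?S = "{x. norm x < norm y/2}"
  define E where "E = (hn (%x. et x*w x))^2"
  define Z where "Z = (LINT x|L. om x*w x powr (p + 1))"
  define Y where "Y = (LINT x|L. om x*(w x)^2)"
  define Y1 where "Y1 = (LINT x|L. indicator {x. w x <= 1} x*(om x*(w x)^2))"
  have sqw: "w x powr (p - 1)*(et x*w x)^2 = om x*w x powr (p + 1)" for x
   using powr_add[of "w x" "p - 1" 2] w(2)[of x] by (simp add: power_mult_distrib et_sq powr_numeral add.commute)
  have Ep: "hn (%x. et x*w x) > 0"
  proof (rule ccontr)
   assume "~ ?thesis"
   hence "AE x in L. et x*w x = 0" using hn_eq_0_iff[OF E(1)] hn_nonneg[of "%x. et x*w x"] by auto
   hence "AE x in L. False" by eventually_elim (use w et_pos in \<open>auto simp: less_le\<close>)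
   thus False using L_not_null by simp
  qed
  have Zi: "integrable L (%x. om x*w x powr (p + 1))"
   by (rule integrable_boundI[OF wi(1)]) (auto simp: abs_mult om_pos less_imp_le om_le_1 intro!: mult_left_le_one_le)
  have "Z = ip w (%x. om x*w x)"
   unfolding Z_def w_def ip_wy[OF E(2)[unfolded w_def]] Nf_def
  proof (intro Bochner_Integration.integral_cong refl)
   fix x show "om x*wy y x powr (p + 1) = 1*max (wy y x) 0 powr p*(om x*wy y x)"
    using wy_pos[of y x] powr_add[of "wy y x" p 1] by (simp add: max_def)
  qed
  hence ca: "E <= Z + COm*Y" using caccioppoli[OF w(1)] by (simp add: E_def Y_def)
  have Z1: "Z <= (1/(2*(1 + COm)))*E + 2 powr dd * om y*tK^2"
  proof -
   have A: "integrable L (%x. indicator ?S x*(om x*w x powr (p + 1)))" by (rule integrable_boundI[OF Zi]) (auto simp: indicator_def om_pos less_imp_le)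
   have "(LINT x|L. indicator ?S x*(w x powr (p - 1)*(et x*w x)^2)) <= (1/(2*(1 + COm)))*E"
    unfolding E_def using R[OF y] w E Ep by (intro dl) (auto simp: wtail_def w_def less_imp_le abs_less_iff)
   hence B: "(LINT x|L. indicator ?S x*(om x*w x powr (p + 1))) <= (1/(2*(1 + COm)))*E" unfolding sqw .
   have far: "om x <= 2 powr dd * om y" if "~ norm x < norm y/2" for x
   proof -
    have "(2*(1 + norm x)) powr - dd <= (1 + norm y) powr - dd" using that dd_pos by (intro powr_mono2') (auto simp: add_pos_nonneg)
    hence "2 powr - dd * om x <= om y" by (simp only: om_def powr_mult)
    hence "2 powr dd*(2 powr - dd * om x) <= 2 powr dd * om y" by (intro mult_left_mono) auto
    thus ?thesis by (simp add: mult.assoc[symmetric] powr_add[symmetric])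
   qed
   have "Z <= (LINT x|L. indicator ?S x*(om x*w x powr (p + 1)) + (2 powr dd * om y)*w x powr (p + 1))"
    unfolding Z_def
   proof (rule integral_mono)
    show "om x*w x powr (p + 1) <= indicator ?S x*(om x*w x powr (p + 1)) + (2 powr dd * om y)*w x powr (p + 1)" for x
     using far[of x] om_pos[of y] om_pos[of x] by (cases "norm x < norm y/2") (auto simp: indicator_def intro!: mult_right_mono)
   qed (use Zi A wi in auto)
   also have "... = (LINT x|L. indicator ?S x*(om x*w x powr (p + 1))) + (2 powr dd * om y)*tK^2" using A wi by simp
   finally show ?thesis using B by linarith
  qed
  have oi: "integrable L (%x. om x*(w x)^2)"
   by (intro integrable_boundI[OF sqiD(2)[OF H_sqi[OF w(1)]]]) (auto simp: abs_mult less_imp_le om_pos om_le_1 intro!: mult_left_le_one_le)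
  have oi1: "integrable L (%x. indicator {x. w x <= 1} x*(om x*(w x)^2))"
   by (rule integrable_boundI[OF oi]) (auto simp: indicator_def om_pos less_imp_le)
  have "Y <= (LINT x|L. indicator {x. w x <= 1} x*(om x*(w x)^2) + om x*w x powr (p + 1))"
   unfolding Y_def
  proof (rule integral_mono)
   fix x
   show "om x*(w x)^2 <= indicator {x. w x <= 1} x*(om x*(w x)^2) + om x*w x powr (p + 1)"
   proof (cases "w x <= 1")
    case False
    have "w x powr 2 <= w x powr (p + 1)" using False p_gt_1 by (intro powr_mono) auto
    thus ?thesis using False om_pos[of x] w(2)[of x] by (simp add: powr_numeral)
   qed (use om_pos[of x] in auto)
  qed (use oi oi1 Zi in auto)
  also have "... = Y1 + Z" using oi1 Zi by (simp add: Y1_def Z_def)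
  finally have "COm*Y <= COm*(Y1 + Z)" using COm_nonneg by (intro mult_left_mono)
  hence "E <= (1 + COm)*Z + COm*Y1" using ca by (simp add: algebra_simps)
  also have "(1 + COm)*Z <= (1 + COm)*((1/(2*(1 + COm)))*E + 2 powr dd * om y*tK^2)" using Z1 Kp by (intro mult_left_mono) auto
  also have "... = E/2 + (1 + COm)*2 powr dd*tK^2 * om y"
  proof -
   have "(1 + COm)*((1/(2*(1 + COm)))*E) = E/2" using Kp by (simp only: mult.assoc[symmetric]) (simp add: divide_simps)
   thus ?thesis unfolding distrib_left by (simp only: mult_ac)
  qed
  finally have EE: "E <= 2*((1 + COm)*2 powr dd*tK^2 * om y) + 2*(COm*Y1)" by linarith
  have Y1: "Y1 >= 0" unfolding Y1_def by (intro Bochner_Integration.integral_nonneg) (simp add: less_imp_le om_pos)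
  have "0 <= (1 + COm)*2 powr dd*tK^2*Y1" "0 <= COm * om y" using Y1 Kp COm_nonneg om_pos[of y] by auto
  hence "E <= (C + 1)*(om y + Y1)" using EE om_pos[of y] Y1 unfolding C_def by (simp add: algebra_simps)
  thus ?thesis by (simp add: E_def Y1_def w_def)
 qed
 moreover have "C + 1 > 0" using Kp COm_nonneg by (simp add: C_def add_nonneg_pos)
 ultimately show thesis using that by blast
qed

text \<open>The derivative in \<open>A\<close> is nonnegative by Bernoulli's inequality. This
  permits replacing the local minimiser by its lower barrier \<open>ep * om\<close> in the
  interaction.\<close>

lemma Gf_mono: assumes "0 <= A'" "A' <= A" "0 <= B" shows "Gf p A' B <= Gf p A B"
proof (cases "A' = A \<or> A' = 0")
 case True
 thus ?thesis using Gf_nonneg[OF p_gt_1, of A B] assms p_gt_1 by (auto simp: Gf_def)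
next
 case False
 hence A: "0 < A'" "A' <= A" using assms by auto
 show ?thesis
 proof (rule DERIV_nonneg_imp_nondecreasing[OF A(2)])
  fix x assume x: "A' <= x" "x <= A"
  hence xp: "x > 0" using A by simp
  have "(1 + B/x) powr p >= 1 + p*(B/x)" using bernoulli_powr[of p "1 + B/x"] p_gt_1 xp assms by simp
  hence "x powr p*(1 + B/x) powr p >= x powr p*(1 + p*(B/x))" by (intro mult_left_mono) auto
  moreover have "x powr p*(1 + B/x) powr p = (x + B) powr p" using xp assms by (simp add: powr_mult[symmetric] distrib_left)
  moreover have "x powr p/x = x powr (p - 1)" using xp by (simp add: powr_diff)
  hence "x powr p*(1 + p*(B/x)) = x powr p + p*x powr (p - 1)*B" by (simp add: distrib_left flip: \<open>x powr p / x = x powr (p - 1)\<close>)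
  ultimately have "(p + 1)*((x + B) powr p - x powr p - p*x powr (p - 1)*B) >= 0" using p_gt_1 by (intro mult_nonneg_nonneg) auto
  moreover have "(((%A. Gf p A B) has_real_derivative ((p + 1)*((x + B) powr p - x powr p - p*x powr (p - 1)*B))) (at x))"
   unfolding Gf_def using xp assms
   by (auto intro!: derivative_eq_intros simp: algebra_simps)
  ultimately show "\<exists>y. ((%A. Gf p A B) has_real_derivative y) (at x) & 0 <= y" by blast
 qed
qed

definition Xe :: "'n fn => real^'n => real" where "Xe u y = (LINT x|L. a x*Gf p (u x) (wy y x))"

lemma pw_integrable:
 assumes "u \<in> H" "v \<in> H" "!!x. u x >= 0" "!!x. v x >= 0"
 shows "integrable L (%x. u x powr (p + 1))" "integrable L (%x. u x powr p * v x)" "integrable L (%x. Gf p (u x) (v x))"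
proof -
 have [measurable]: "u \<in> borel_measurable borel" "v \<in> borel_measurable borel" using assms H_meas by auto
 have 1: "integrable L (%x. g x powr (p + 1))" if "g \<in> H" "!!x. g x >= 0" for g using int_p1[OF that(1)] that(2) by simp
 show "integrable L (%x. u x powr (p + 1))" using 1 assms by simp
 show 2: "integrable L (%x. u x powr p * v x)"
  using bi(1)[OF assms(1,2), of p 1] p_gt_1 assms(3,4) by simp
 show "integrable L (%x. Gf p (u x) (v x))" unfolding Gf_def
  using 1[OF H_add[OF assms(1,2)]] 1[OF assms(1)] 1[OF assms(2)] integrable_mult_right[OF 2, of "p + 1"] assms
  by (auto simp: mult.assoc intro!: Bochner_Integration.integrable_diff)
qed

lemma a_integrable: "integrable L g ==> integrable L (%x. a x*g x)" for g :: "'n fn"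
 by (rule integrable_boundI[where g="%x. abs (g x)"]) (auto simp: abs_mult coefD[OF a_coef] intro!: mult_left_le_one_le)

lemma Xe_integrable: assumes "u \<in> H" "!!x. u x >= 0" shows "integrable L (%x. a x*Gf p (u x) (wy y x))"
 using assms wy_H[of y] wy_pos[of y] by (intro a_integrable pw_integrable) (auto simp: less_imp_le)

text \<open>The first bound comes from the bulk of the translate, using
  \<open>om y * om (x - y) \<le> om x\<close> for the barrier. The second comes from the points
  where the translate is at most 1; the exponent \<open>max 2 p\<close> is one for which both
  regimes of \<open>Gf_lower\<close> give it.\<close>

lemma Xe_lower:
 assumes u: "u \<in> H" "!!x. u x >= 0" and ep: "ep > 0" "AE x in L. u x >= ep * om x"
 obtains c where "c > 0" "!!y. Xe u y >= c * om y"
  "!!y. Xe u y >= c*(LINT x|L. indicator {x. wy y x <= 1} x*(om x*wy y x powr max 2 p))"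
proof -
 obtain ca where ca: "ca > 0" "!!x. ca <= a x" using a_low by blast
 obtain c where c: "c > 0" "!!A B. 0 <= A ==> A <= B ==> Gf p A B >= c*(A*B powr p)"
  "!!A B. 0 <= B ==> B <= A ==> Gf p A B >= c*(A powr (p - 1)*B^2)" using Gf_lower[OF p_gt_1] by metis
 have [measurable]: "wst \<in> borel_measurable borel" "u \<in> borel_measurable borel" using H_meas wst_H u by auto
 have low: "Xe u y >= ca*(LINT x|L. q x)" if q: "q \<in> borel_measurable borel" "!!x. 0 <= q x" "!!x. q x <= Gf p (ep * om x) (wy y x)" for q y
 proof -
  have i: "AE x in L. ca*q x <= a x*Gf p (u x) (wy y x)" using ep(2)
  proof eventually_elim
   case (elim x)
   have "q x <= Gf p (u x) (wy y x)" using q(3)[of x] Gf_mono[of "ep * om x" "u x" "wy y x"] elim ep om_pos[of x] wy_pos[of y x] by (simp add: less_imp_le)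
   thus ?case using ca q(2)[of x] coefD(2)[OF a_coef, of x] by (intro mult_mono) auto
  qed
  have qi: "integrable L (%x. ca*q x)"
   using i ca q(1,2) by (intro Bochner_Integration.integrable_bound[OF Xe_integrable[OF u, of y]]) (auto elim!: eventually_mono)
  have "(LINT x|L. ca*q x) <= Xe u y" unfolding Xe_def by (intro integral_mono_AE qi Xe_integrable u i)
  thus ?thesis by simp
 qed
 \<comment> \<open>A fixed positive integrable profile below the gain in both regimes, once the
   factor \<open>om y\<close> has been taken out; its integral is the constant of the first
   bound.\<close>
 define g where "g = (%z. min (ep * om z*wst z powr p) (wst z powr (p + 1)))"
 have gm[measurable]: "g \<in> borel_measurable borel" unfolding g_def by measurable
 have gp: "g z > 0" for z using ep om_pos[of z] wst_pos[of z] by (simp add: g_def)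
 have "abs (g x) <= wst x powr (p + 1)" for x using gp[of x] by (simp add: g_def)
 hence "integrable L g" by (intro integrable_boundI[OF wst_p1]) auto
 hence gI: "(LINT z|L. g z) > 0"
 proof -
  have "(LINT z|L. g z) ~= 0"
  proof
   assume "(LINT z|L. g z) = 0"
   hence "AE z in L. g z = 0" using \<open>integrable L g\<close> gp by (subst (asm) integral_nonneg_eq_0_iff_AE) (auto simp: less_imp_le)
   hence "AE z in L. False" by eventually_elim (use gp in \<open>auto simp: less_le\<close>)
   thus False using L_not_null by simp
  qed
  moreover have "(LINT z|L. g z) >= 0" using gp by (intro Bochner_Integration.integral_nonneg) (simp add: less_imp_le)
  ultimately show ?thesis by simp
 qed
 have A: "Xe u y >= ca * c*(LINT z|L. g z) * om y" for y
 proof -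
  have "Xe u y >= ca*(LINT x|L. c * om y*g (x - y))"
  proof (rule low)
   fix x
   have os: "om y * om (x - y) <= om x" using om_shift[of y "x - y"] by (simp add: om_def[of y])
   define A where "A = ep * om y * om (x - y)"
   define B where "B = wy y x"
   have AB: "A > 0" "B > 0" "A <= ep * om x" using ep om_pos wy_pos os by (auto simp: A_def B_def mult.assoc)
   have "c * om y*g (x - y) <= Gf p A B"
   proof (cases "A <= B")
    case True
    have "c * om y*g (x - y) <= c * om y*(ep * om (x - y)*B powr p)" using c om_pos[of y] by (intro mult_left_mono) (auto simp: g_def B_def wy_def)
    also have "... = c*(A*B powr p)" by (simp add: A_def mult_ac)
    finally show ?thesis using c(2)[of A B] AB True by simp
   next
    case False
    have "c * om y*g (x - y) <= c*1*B powr (p + 1)" using c om_pos[of y] om_le_1[of y] gp[of "x - y"]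
     by (intro mult_mono) (auto simp: g_def B_def wy_def less_imp_le)
    also have "B powr (p + 1) = B powr (p - 1)*B^2" using powr_add[of B "p - 1" 2] AB by (simp add: powr_numeral add.commute)
    also have "c*1*(B powr (p - 1)*B^2) <= c*(A powr (p - 1)*B^2)"
     using False AB c p_gt_1 by (auto intro!: mult_left_mono mult_right_mono powr_mono2)
    finally show ?thesis using c(3)[of B A] AB False by simp
   qed
   also have "... <= Gf p (ep * om x) B" using AB by (intro Gf_mono) auto
   finally show "c * om y*g (x - y) <= Gf p (ep * om x) (wy y x)" by (simp add: B_def)
   show "0 <= c * om y*g (x - y)" using c om_pos[of y] gp[of "x - y"] by simp
  qed measurable
  also have "(LINT x|L. c * om y*g (x - y)) = c * om y*(LINT z|L. g z)" using integral_lborel_shift(1)[of g "- y"] gm by simp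
  finally show ?thesis by (simp add: mult_ac)
 qed
 define r where "r = max 2 p"
 define k where "k = c*min ep (min (ep powr (p - 1)) (ep powr 1))"
 have k: "k > 0" using c ep by (simp add: k_def)
 have B: "Xe u y >= ca * k*(LINT x|L. indicator {x. wy y x <= 1} x*(om x*wy y x powr r))" for y
 proof -
  have "Xe u y >= ca*(LINT x|L. k*(indicator {x. wy y x <= 1} x*(om x*wy y x powr r)))"
  proof (rule low)
   fix x
   define A where "A = ep * om x"
   define B where "B = wy y x"
   have AB: "A > 0" "B > 0" using ep om_pos wy_pos by (auto simp: A_def B_def)
   show "k*(indicator {x. wy y x <= 1} x*(om x*wy y x powr r)) <= Gf p (ep * om x) (wy y x)"
   proof (cases "B <= 1")
    case True
    have "k*(om x*B powr r) <= Gf p A B"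
    proof (cases "A <= B")
     case True
     have "k*(om x*B powr r) <= (c*ep)*(om x*B powr p)"
      using c ep om_pos[of x] AB \<open>B <= 1\<close> by (intro mult_mono powr_mono') (auto simp: k_def r_def less_imp_le)
     also have "... = c*(A*B powr p)" by (simp add: A_def mult_ac)
     finally show ?thesis using c(2)[of A B] AB True by simp
    next
     case False
     have ob: "om x*B powr r*min ep (min (ep powr (p - 1)) (ep powr 1)) <= A powr (p - 1)*B^2"
     proof (cases "p <= 2")
      case True
      have "om x powr 1 <= om x powr (p - 1)" using True om_pos om_le_1 p_gt_1 by (intro powr_mono') (auto simp: less_imp_le)
      hence "om x*B powr r*min ep (min (ep powr (p - 1)) (ep powr 1)) <= om x powr (p - 1)*B^2*ep powr (p - 1)"
       using True AB om_pos[of x] ep by (intro mult_mono) (auto simp: r_def powr_numeral)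
      also have "... = A powr (p - 1)*B^2" using om_pos[of x] ep by (simp add: A_def powr_mult mult_ac)
      finally show ?thesis .
     next
      case p2: False
      have "B powr p = B powr (p - 2)*B^2" using powr_add[of B "p - 2" 2] AB by (simp add: powr_numeral)
      also have "... <= A powr (p - 2)*B^2" using False AB p2 by (intro mult_right_mono powr_mono2) auto
      finally have "om x*B powr r*min ep (min (ep powr (p - 1)) (ep powr 1)) <= om x*(A powr (p - 2)*B^2)*ep powr 1"
       using p2 AB om_pos[of x] ep by (intro mult_mono mult_left_mono) (auto simp: r_def max_def)
      also have "... = (A powr 1*A powr (p - 2))*B^2" using ep AB by (simp add: A_def mult_ac)
      also have "... = A powr (p - 1)*B^2" by (simp only: powr_add[symmetric]) simp
      finally show ?thesis .
     qed
     have "k*(om x*B powr r) = c*(om x*B powr r*min ep (min (ep powr (p - 1)) (ep powr 1)))" by (simp add: k_def mult_ac)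
     also have "... <= c*(A powr (p - 1)*B^2)" using ob c by (intro mult_left_mono) auto
     finally show ?thesis using c(3)[of B A] AB False by simp
    qed
    thus ?thesis using True by (simp add: A_def B_def)
   next
    case False
    thus ?thesis using Gf_nonneg[OF p_gt_1, of A B] AB by (simp add: A_def B_def)
   qed
   show "0 <= k*(indicator {x. wy y x <= 1} x*(om x*wy y x powr r))" using k om_pos[of x] by simp
  qed measurable
  thus ?thesis by (simp add: mult_ac)
 qed
 define C where "C = min (ca * c*(LINT z|L. g z)) (ca * k)"
 have "C * om y <= Xe u y" for y
 proof -
  have "C * om y <= (ca * c*(LINT z|L. g z)) * om y" using om_pos[of y] by (intro mult_right_mono) (auto simp: C_def)
  thus ?thesis using A[of y] by linarith
 qed
 moreover have "C*(LINT x|L. indicator {x. wy y x <= 1} x*(om x*wy y x powr r)) <= Xe u y" for y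
 proof -
  have "C*(LINT x|L. indicator {x. wy y x <= 1} x*(om x*wy y x powr r)) <= (ca * k)*(LINT x|L. indicator {x. wy y x <= 1} x*(om x*wy y x powr r))"
   by (intro mult_right_mono Bochner_Integration.integral_nonneg) (auto simp: C_def less_imp_le om_pos)
  thus ?thesis using B[of y] by linarith
 qed
 moreover have "C > 0" using ca c k gI by (simp add: C_def)
 ultimately show thesis using that by (simp add: r_def)
qed

text \<open>For a small interaction \<open>X\<close> the weighted energy is at most
  \<open>K * X powr (2/r)\<close>. The decay of \<open>1 - a\<close> bounds the loss by the
  \<open>p + 1\<close> power integral of \<open>et * wy y\<close>, hence by
  \<open>G * X powr ((p + 1)/r)\<close>, which is superlinear. For \<open>X\<close> above the
  threshold \<open>dl\<close> it suffices that the loss tends to 0 at infinity.\<close>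

lemma interaction_dominates:
 assumes u: "u \<in> H" "!!x. u x >= 0" and ep: "ep > 0" "AE x in L. u x >= ep * om x"
 obtains R where "!!y. norm y >= R ==> Xe u y > 0 & mdef y <= Xe u y/2"
proof -
 define r where "r = max 2 p"
 have r: "r >= 2" "r < p + 1" using p_gt_1 by (auto simp: r_def)
 obtain c where c: "c > 0" "!!y. Xe u y >= c * om y" "!!y. Xe u y >= c*(LINT x|L. indicator {x. wy y x <= 1} x*(om x*wy y x powr r))"
  by (rule Xe_lower[OF u ep, folded r_def]) blast
 obtain C R where C: "C > 0" "!!y. norm y >= R ==> (hn (%x. et x*wy y x))^2 <= C*(om y + (LINT x|L. indicator {x. wy y x <= 1} x*(om x*(wy y x)^2)))"
  by (rule weighted_energy_wy) blast
 obtain D0 where D0: "!!x. 1 - a x <= D0 * om x powr ((p + 1)/2)" using a_dec by blast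
 define D where "D = max D0 0"
 define M where "M = (LINT x|L. om x)"
 have M: "M >= 0" unfolding M_def by (intro Bochner_Integration.integral_nonneg) (simp add: om_pos less_imp_le)
 define K where "K = C*(1/c + (M + 1/c))"
 define G where "G = D*Sq*K powr ((p + 1)/2)"
 have K: "K > 0" using C c M by (simp add: K_def add_pos_nonneg)
 have G: "G >= 0" using Sq_pos by (simp add: G_def D_def)
 define q where "q = (p + 1)/r - 1"
 have q: "q > 0" using r by (simp add: q_def)
 define dl where "dl = min 1 ((1/(2*(G + 1))) powr (1/q))"
 have dl: "dl > 0" "dl <= 1" using G by (auto simp: dl_def)
 obtain R2 where R2: "!!y. norm y >= R2 ==> abs (mdef y) < dl/2"
  by (rule tendsto_at_infinity_seq[of mdef "dl/2", OF mdef_vanish]) (use dl in auto)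
 have "Xe u y > 0 & mdef y <= Xe u y/2" if y: "norm y >= max R R2" for y
 proof
  define X where "X = Xe u y"
  have X: "X > 0" using c(2)[of y] mult_pos_pos[OF c(1) om_pos[of y]] by (simp add: X_def)
  thus "Xe u y > 0" by (simp add: X_def)
  show "mdef y <= Xe u y/2"
  proof (cases "X <= dl")
   case False
   thus ?thesis using R2[of y] y by (simp add: X_def abs_less_iff)
  next
   case True
   define w where "w = wy y"
   have w: "w \<in> H" "!!x. w x > 0" unfolding w_def using wy_H wy_pos by auto
   have [measurable]: "w \<in> borel_measurable borel" using H_meas w by auto
   define T where "T = (LINT x|L. indicator {x. w x <= 1} x*(om x*w x powr r))"
   define Y1 where "Y1 = (LINT x|L. indicator {x. w x <= 1} x*(om x*(w x)^2))"
   \<comment> \<open>The splitting level for the small values of \<open>w\<close>: it balances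
     \<open>l^2\<close> times the integral of \<open>om\<close> against
     \<open>l powr (2 - r)\<close> times a quantity of order \<open>X\<close>, both giving
     \<open>X powr (2/r)\<close>.\<close>
   define l where "l = X powr (1/r)"
   have l: "l > 0" "l^2 = X powr (2/r)" "l powr (2 - r)*X = X powr (2/r)"
   proof -
    show "l > 0" using X by (simp add: l_def)
    have "l powr 2 = X powr (2/r)" by (simp add: l_def powr_powr)
    thus "l^2 = X powr (2/r)" using \<open>l > 0\<close> by (simp add: powr_numeral)
    have "l powr (2 - r)*X powr 1 = X powr (2/r)" unfolding l_def powr_powr powr_add[symmetric] using r by (simp add: field_simps)
    thus "l powr (2 - r)*X = X powr (2/r)" using X by simp
   qed
   have Ti: "integrable L (%x. indicator {x. w x <= 1} x*(om x*w x powr r))"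
    by (rule integrable_boundI[OF om_integrable]) (use om_pos w r in \<open>auto simp: indicator_def abs_mult less_imp_le intro!: mult_right_le_one_le powr_le1\<close>)
   have Yi: "integrable L (%x. indicator {x. w x <= 1} x*(om x*(w x)^2))"
    by (rule integrable_boundI[OF om_integrable]) (use om_pos w r in \<open>auto simp: indicator_def abs_mult less_imp_le intro!: mult_right_le_one_le power_le_one\<close>)
   have T: "T <= X/c" using c(1) c(3)[of y] by (simp add: T_def X_def w_def field_simps)
   have "Y1 <= (LINT x|L. l^2 * om x + l powr (2 - r)*(indicator {x. w x <= 1} x*(om x*w x powr r)))"
    unfolding Y1_def
   proof (rule integral_mono)
    fix x
    have o: "om x > 0" by (rule om_pos)
    show "indicator {x. w x <= 1} x*(om x*(w x)^2) <= l^2 * om x + l powr (2 - r)*(indicator {x. w x <= 1} x*(om x*w x powr r))"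
    proof (cases "w x <= 1 & l < w x")
     case True
     have "(w x)^2 = w x powr (2 - r)*w x powr r" using w(2)[of x] by (simp add: powr_add[symmetric] powr_numeral)
     also have "... <= l powr (2 - r)*w x powr r" using True l r by (intro mult_right_mono powr_mono2') auto
     finally have "om x*(w x)^2 <= om x*(l powr (2 - r)*w x powr r)" using o by (intro mult_left_mono) auto
     thus ?thesis using True o by (simp add: mult_ac add_increasing)
    next
     case False
     have "indicator {x. w x <= 1} x*(om x*(w x)^2) <= l^2 * om x"
      using False o w(2)[of x] by (auto simp: indicator_def mult.commute intro!: power_mono)
     thus ?thesis using o by (simp add: add_increasing2)
    qed
   qed (use Ti Yi om_integrable in auto)
   also have "... = l^2*M + l powr (2 - r)*T" using Ti om_integrable by (simp add: M_def T_def)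
   also have "... <= l^2*M + l powr (2 - r)*(X/c)" using T by (intro add_left_mono mult_left_mono) auto
   also have "... = (M + 1/c)*X powr (2/r)" using l by (simp add: field_simps)
   finally have Y1: "Y1 <= (M + 1/c)*X powr (2/r)" .
   have "X powr 1 <= X powr (2/r)" using X True dl r by (intro powr_mono') auto
   hence oy: "om y <= (1/c)*X powr (2/r)" using c(1) c(2)[of y] X by (simp add: X_def field_simps)
   define E where "E = hn (%x. et x*w x)"
   have "E^2 <= C*(om y + Y1)" using C(2)[of y] y by (simp add: E_def w_def Y1_def)
   also have "... <= C*((1/c)*X powr (2/r) + (M + 1/c)*X powr (2/r))" using Y1 oy C by (intro mult_left_mono add_mono) auto
   also have "... = K*X powr (2/r)" by (simp add: K_def algebra_simps)
   finally have E2: "E^2 <= K*X powr (2/r)" .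
   have E0: "E >= 0" using hn_nonneg by (simp add: E_def)
   have "E powr (p + 1) = (E^2) powr ((p + 1)/2)" using E0 by (cases "E = 0") (auto simp: powr_powr add_divide_distrib simp flip: powr_numeral)
   also have "... <= (K*X powr (2/r)) powr ((p + 1)/2)" using E2 p_gt_1 by (intro powr_mono2) auto
   also have "... = K powr ((p + 1)/2)*X powr ((p + 1)/r)"
   proof -
    have "2/r*((p + 1)/2) = (p + 1)/r" using r by (simp add: field_simps)
    thus ?thesis using K X by (simp only: powr_mult powr_powr)
   qed
   finally have EP: "E powr (p + 1) <= K powr ((p + 1)/2)*X powr ((p + 1)/r)" .
   have etp: "om x powr ((p + 1)/2)*w x powr (p + 1) = abs (et x*w x) powr (p + 1)" for x
    using w(2)[of x] et_pos[of x] by (simp add: et_sq[symmetric] powr_mult powr_powr abs_mult add_divide_distrib flip: powr_numeral)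
   note eH = et_mult(3)[OF w(1)]
   have "mdef y <= (LINT x|L. D*abs (et x*w x) powr (p + 1))"
    unfolding mdef_def
   proof (rule integral_mono)
    fix x
    have "1 - a x <= D * om x powr ((p + 1)/2)" using D0[of x] by (rule order_trans) (auto simp: D_def intro!: mult_right_mono)
    hence "(1 - a x)*w x powr (p + 1) <= D * om x powr ((p + 1)/2)*w x powr (p + 1)" by (intro mult_right_mono) auto
    thus "(1 - a x)*wy y x powr (p + 1) <= D*abs (et x*w x) powr (p + 1)" unfolding etp[symmetric] by (simp add: w_def mult.assoc)
    show "integrable L (%x. (1 - a x)*wy y x powr (p + 1))"
     by (rule integrable_boundI[OF wy_p1(1)[of y]]) (auto simp: abs_mult coefD[OF a_coef] intro!: mult_left_le_one_le)
   qed (use int_p1[OF eH] in auto)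
   also have "... = D*(LINT x|L. abs (et x*w x) powr (p + 1))" by simp
   also have "... <= D*(Sq*E powr (p + 1))" using le_p1[OF eH] by (intro mult_left_mono) (auto simp: D_def E_def)
   also have "... <= D*(Sq*(K powr ((p + 1)/2)*X powr ((p + 1)/r)))" using EP Sq_pos by (intro mult_left_mono) (auto simp: D_def)
   also have "... = G*X powr q*X"
    using powr_add[of X q 1] X by (simp add: G_def q_def)
   also have "... <= (1/2)*X"
   proof -
    have "X powr q <= dl powr q" using True X q by (intro powr_mono2) auto
    also have "... <= ((1/(2*(G + 1))) powr (1/q)) powr q" using dl q by (intro powr_mono2) (auto simp: dl_def)
    also have "... = 1/(2*(G + 1))" using q G by (simp add: powr_powr)
    finally have "G*X powr q <= G*(1/(2*(G + 1)))" using G by (intro mult_left_mono) auto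
    also have "... <= 1/2" using G by (simp add: field_simps)
    finally show ?thesis using X by (intro mult_right_mono) auto
   qed
   finally show ?thesis by (simp add: X_def)
  qed
 qed
 thus thesis using that by blast
qed

end

section \<open>Energy and barycentre of the sum of minimiser and translate\<close>

context setting
begin

text \<open>Testing the equation with the negative part removes the nonlinear term, and the
  remaining terms have opposite signs because \<open>f\<close> is nonnegative.\<close>

lemma crit_nonneg:
 assumes "f \<in> Hd" "nonneg_dual s f" "u \<in> H" "\<forall>h\<in>H. DI a f u h = 0"
 shows "AE x in L. u x = max (u x) 0"
proof -
 let ?h = "pp (%x. - u x)"
 have h: "?h \<in> H" using pp_H[OF H_minus[OF assms(3)]] .
 have "Nf a u ?h = (LINT x|L. 0)" unfolding Nf_def by (intro Bochner_Integration.integral_cong refl) (auto simp: max_def)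
 hence "ip u ?h = f ?h" using assms(4)[rule_format, OF h] by (simp add: DI_def)
 moreover have "f ?h >= 0" using assms(2) h by (simp add: nonneg_dual_def)
 moreover have "- ip u ?h >= (hn ?h)^2" using ip_pp_le[OF H_minus[OF assms(3)]] ip_scale_left[of "-1" u ?h] by simp
 ultimately have "(hn ?h)^2 <= 0" by linarith
 hence "AE x in L. ?h x = 0" using hn_eq_0_iff[OF h] by simp
 thus ?thesis by eventually_elim (auto simp: max_def split: if_splits)
qed

text \<open>Passes to a representative that is nonnegative at every point, as required by the
  pointwise inequalities for \<open>Gf\<close>.\<close>

lemma crit_pp:
 assumes "f \<in> Hd" "u \<in> H" "AE x in L. u x = max (u x) 0"
 shows "h \<in> H ==> DI a f (pp u) h = DI a f u h" "I f (pp u) = I f u" "hn (pp u) = hn u"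
proof -
 have m: "pp u \<in> borel_measurable borel" using H_meas pp_H assms by auto
 show h: "hn (pp u) = hn u" using hn_AE_cong[OF assms(2) m assms(3)] by simp
 show "h \<in> H ==> DI a f (pp u) h = DI a f u h" using ip_AE_cong[OF assms(2) m assms(3)] by (simp add: DI_def Nf_def)
 have "f (pp u) = f u" using dual_AE_cong[OF assms(1,2) pp_H[OF assms(2)] assms(3)] by simp
 thus "I f (pp u) = I f u" by (simp add: Ifun_eq h Bf_def)
qed

lemma crit_energy:
 assumes "f \<in> Hd" "u \<in> H" "\<forall>h\<in>H. DI a f u h = 0"
 shows "Ba u = (hn u)^2 - f u" "I f u = kap*(hn u)^2 - p/(p + 1)*f u"
proof -
 show B: "Ba u = (hn u)^2 - f u" using assms(3)[rule_format, OF assms(2)] by (simp add: DI_def Nf_self hn_sq)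
 show "I f u = kap*(hn u)^2 - p/(p + 1)*f u" unfolding Ifun_eq B kap_def using p_gt_1 by (simp add: divide_simps) (simp add: algebra_simps)
qed

text \<open>Convexity on the segment to 0, where the energy vanishes, would lower a positive energy
  at a rate linear in \<open>t\<close>, whereas at a critical point it changes only
  quadratically.\<close>

lemma locmin_energy:
 assumes f: "f \<in> Hd" and u: "u \<in> Hball s r" "\<forall>h\<in>H. DI a f u h = 0" and r: "r > 0"
  and sc: "strictly_convex_on_Hs s (Hball s r) (I f)"
 shows "I f u <= 0"
proof (rule ccontr)
 assume "~ ?thesis"
 hence pos: "I f u > 0" by simp
 have uH: "u \<in> H" using u by (simp add: Hball_def)
 have ne: "~ (AE x in L. 0 = u x)"
 proof
  assume "AE x in L. 0 = u x"
  hence z: "AE x in L. u x = 0" by eventually_elim simp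
  hence "hn u = 0" using hn_eq_0_iff[OF uH] by simp
  thus False using pos crit_energy[OF f uH u(2)] Bf_nonneg[OF a_coef, of u] dual_bound[OF f uH] by simp
 qed
 have z: "(%x::real^'n. 0) \<in> Hball s r" using r by (simp add: Hball_def H_zero hn_zero)
 have I0: "I f (%x. 0) = 0" using dual_scale[OF f H_zero, of 0] by (simp add: Ifun_eq hn_zero Bf_def)
 define K where "K = Rq (2*hn u)*(hn u)^2"
 have K: "K >= 0" using Rq_pos[of "2*hn u"] by (simp add: K_def)
 have key: "I f u <= K*t" if t: "0 < t" "t < 1" for t
 proof -
  have "I f (%x. t*0 + (1 - t)*u x) < t*I f (%x. 0) + (1 - t)*I f u"
   using sc[unfolded strictly_convex_on_Hs_def, rule_format, OF z u(1) ne] t by blast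
  moreover have e: "(%x. t*0 + (1 - t)*u x) = (%x. u x + (- t)*u x)" by (auto simp: algebra_simps)
  moreover have "abs (I f (%x. u x + (- t)*u x) - I f u - DI a f u (%x. (- t)*u x)) <= Rq (hn u + hn (%x. (- t)*u x))*(hn (%x. (- t)*u x))^2"
   by (rule I_taylor[OF a_coef f uH H_scale[OF uH]])
  moreover have "DI a f u (%x. (- t)*u x) = 0" using u(2) H_scale[OF uH] by blast
  moreover have "Rq (hn u + hn (%x. (- t)*u x))*(hn (%x. (- t)*u x))^2 <= K*t*t"
  proof -
   have "hn u + hn (%x. (- t)*u x) <= 2*hn u" using t hn_nonneg[of u] unfolding hn_scale by (simp add: mult_left_le_one_le)
   hence "Rq (hn u + hn (%x. (- t)*u x)) <= Rq (2*hn u)" using hn_nonneg by (intro Rq_mono) (auto intro: add_nonneg_nonneg)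
   hence "Rq (hn u + hn (%x. (- t)*u x))*(hn (%x. (- t)*u x))^2 <= Rq (2*hn u)*(hn (%x. (- t)*u x))^2" by (intro mult_right_mono) auto
   also have "... = K*t*t" unfolding hn_scale K_def by (simp add: power2_eq_square abs_mult)
   finally show ?thesis .
  qed
  ultimately have "t*I f u <= t*(K*t)" using I0 unfolding e by (simp add: algebra_simps abs_le_iff)
  thus ?thesis using t by simp
 qed
 define t where "t = min (1/2) (I f u/(2*(K + 1)))"
 have "t > 0" "t < 1" "t <= I f u/(2*(K + 1))" using pos K by (auto simp: t_def)
 hence "K*t <= K*(I f u/(2*(K + 1)))" "I f u <= K*t" using key[of t] mult_left_mono[of t "I f u/(2*(K + 1))" K] K by blast+
 moreover have "K*(I f u/(2*(K + 1))) < I f u" using K pos by (simp add: field_simps add_nonneg_pos)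
 ultimately show False by linarith
qed

text \<open>\<open>P\<close>, \<open>Q\<close>, \<open>R\<close> stand for squared norm, weighted
  power integral and dual value of a function of arbitrary norm, the second summand correcting the
  normalisation in \<open>gfun\<close>. The function is not critical along its ray; its slope at
  parameter 1 is \<open>e\<close>. With curvature at least \<open>2 * g\<close>, the maximum exceeds
  the value at 1 by at most \<open>e^2/(4*g)\<close>.\<close>

lemma fiber_upper:
 fixes P Q R e ta g :: real
 assumes "P = Q + R + e" "ta > 0" "g > 0" "Q * kap - R/2 - e/2 >= g" "Q >= 0"
 shows "gfun p Q R ta + ta^2*(P - 1)/2 <= P/2 - Q/(p + 1) - R + e^2/(4*g)"
proof -
 have "ta*(ta powr p - p*ta + p - 1)/(p + 1) >= 0" using bernoulli_powr[of p ta] assms(2) p_gt_1 by (intro divide_nonneg_nonneg mult_nonneg_nonneg) (auto simp: algebra_simps)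
 moreover have "(ta powr (p + 1) - 1)/(p + 1) - (ta^2 - 1)/2 = kap*(ta - 1)^2 + ta*(ta powr p - p*ta + p - 1)/(p + 1)"
  unfolding kap_def using p_gt_1 assms(2) powr_add[of ta p 1] by (simp add: divide_simps power2_eq_square) (simp add: algebra_simps)
 ultimately have "(ta powr (p + 1) - 1)/(p + 1) - (ta^2 - 1)/2 >= kap*(ta - 1)^2" by linarith
 hence 1: "Q*((ta powr (p + 1) - 1)/(p + 1) - (ta^2 - 1)/2) >= Q*(kap*(ta - 1)^2)" using assms(5) by (rule mult_left_mono)
 have 2: "(Q * kap - R/2 - e/2)*(ta - 1)^2 >= g*(ta - 1)^2" using assms(4) by (intro mult_right_mono) auto
 have "0 <= (2*g*(ta - 1) - e)^2/(4*g)" using assms(3) by simp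
 also have "... = g*(ta - 1)^2 - e*(ta - 1) + e^2/(4*g)" using assms(3) by (simp add: divide_simps power2_eq_square) (simp add: algebra_simps)
 finally have 3: "e*(ta - 1) - g*(ta - 1)^2 <= e^2/(4*g)" by linarith
 have "gfun p Q R ta + ta^2*(P - 1)/2 - (P/2 - Q/(p + 1) - R)
  = - (Q*((ta powr (p + 1) - 1)/(p + 1) - (ta^2 - 1)/2)) + R/2*(ta - 1)^2 + e*(ta - 1) + e/2*(ta - 1)^2"
  unfolding assms(1) gfun_def using p_gt_1 by (simp add: divide_simps power2_eq_square) (simp add: algebra_simps)
 also have "... <= - (Q * kap - R/2 - e/2)*(ta - 1)^2 + e*(ta - 1)" using 1 by (simp add: algebra_simps)
 also have "... <= e^2/(4*g)" using 2 3 by linarith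
 finally show ?thesis by linarith
qed

text \<open>The cross terms are controlled by the gain only where \<open>A \<le> B\<close>;
  elsewhere a multiple of \<open>A powr (p + 1)\<close> is left over. The free parameter
  \<open>lam\<close> is optimised after integration and yields an estimate of square-root
  type.\<close>

lemma split_interaction:
 obtains K where "K > 0" "!!A B lam. A >= 0 ==> B >= 0 ==> lam > 0 ==> A powr p*B <= K*(1 + lam)*Gf p A B + A powr (p + 1)/lam"
  "!!A B lam. A >= 0 ==> B >= 0 ==> lam > 0 ==> B powr p*A <= K*(1 + lam)*Gf p A B + A powr (p + 1)/lam"
proof -
 obtain c where c: "c > 0" "!!A B. 0 <= A ==> A <= B ==> Gf p A B >= c*(A*B powr p)"
  "!!A B. 0 <= B ==> B <= A ==> Gf p A B >= c*(A powr (p - 1)*B^2)" using Gf_lower[OF p_gt_1] by metis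
 have "A powr p*B <= (1/c)*(1 + lam)*Gf p A B + A powr (p + 1)/lam & B powr p*A <= (1/c)*(1 + lam)*Gf p A B + A powr (p + 1)/lam"
  if "A >= 0" "B >= 0" "lam > 0" for A B lam :: real
 proof (cases "A = 0 \<or> B = 0")
  case True
  thus ?thesis using Gf_nonneg[OF p_gt_1 that(1,2)] c that by auto
 next
  case ne: False
  have G: "Gf p A B >= 0" by (rule Gf_nonneg[OF p_gt_1 that(1,2)])
  have split: "x powr p*y = x powr (p - 1)*(x*y)" if "x > 0" for x y :: real using powr_add[of x "p - 1" 1] that by simp
  have mono: "x powr p*y <= y powr p*x" if "0 < x" "x <= y" for x y :: real
  proof -
   have "x powr (p - 1)*(x*y) <= y powr (p - 1)*(x*y)" using that p_gt_1 by (intro mult_right_mono powr_mono2) auto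
   thus ?thesis using that split[of x y] split[of y x] by (simp only: mult.commute[of y x])
  qed
  show ?thesis
  proof (cases "A <= B")
   case True
   have "B powr p*A <= (1/c)*Gf p A B" using c(1) c(2)[OF that(1) True] by (simp add: field_simps)
   also have "... <= (1/c)*(1 + lam)*Gf p A B" using G c that by (intro mult_right_mono) (auto simp: divide_right_mono)
   also have "... <= (1/c)*(1 + lam)*Gf p A B + A powr (p + 1)/lam" using that by simp
   finally show ?thesis using mono[of A B] True ne that by auto
  next
   case False
   have "A powr (p - 1)*(A*B) <= A powr (p - 1)*(lam*B^2 + A^2/lam)"
   proof (rule mult_left_mono)
    have "0 <= (lam*B - A)^2/lam" using that by simp
    also have "... = lam*B^2 - 2*(A*B) + A^2/lam" using that by (simp add: power2_eq_square field_simps)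
    finally show "A*B <= lam*B^2 + A^2/lam" using mult_nonneg_nonneg[OF that(1,2)] by linarith
   qed simp
   also have "... = lam*(A powr (p - 1)*B^2) + A powr (p + 1)/lam"
    using powr_add[of A "p - 1" 2] False that ne by (simp add: powr_numeral distrib_left add.commute)
   also have "lam*(A powr (p - 1)*B^2) <= lam*((1/c)*Gf p A B)" using c(1) c(3)[OF that(2)] False that by (intro mult_left_mono) (auto simp: field_simps)
   also have "... <= (1/c)*(1 + lam)*Gf p A B" using G c by (simp add: field_simps)
   finally have "A powr p*B <= (1/c)*(1 + lam)*Gf p A B + A powr (p + 1)/lam" using split[of A B] ne that by simp
   thus ?thesis using mono[of B A] False ne that by linarith
  qed
 qed
 thus thesis using c by (intro that[of "1/c"]) auto
qed

lemma Xe_expand: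
 assumes u: "u \<in> H" "!!x. u x >= 0"
 shows "Ba (%x. u x + wy y x) = Ba u + (tK^2 - mdef y) + (p + 1)*Nf a u (wy y) + Xe u y"
  "0 <= mdef y" "0 <= Nf a u (wy y)" "Ba (wy y) = tK^2 - mdef y"
proof -
 have w0: "wy y x >= 0" for x using wy_pos[of y x] by simp
 have [measurable]: "u \<in> borel_measurable borel" using u H_meas by auto
 note i = a_integrable[OF pw_integrable(1)[OF u(1) wy_H[of y] u(2) w0]] a_integrable[OF pw_integrable(1)[OF wy_H[of y] u(1) w0 u(2)]]
  a_integrable[OF pw_integrable(2)[OF u(1) wy_H[of y] u(2) w0]] Xe_integrable[OF u, of y]
 have wa: "(LINT x|L. a x*wy y x powr (p + 1)) = tK^2 - mdef y"
  unfolding mdef_def wy_p1(2)[of y, symmetric]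
 proof (subst Bochner_Integration.integral_diff[symmetric])
  show "integrable L (%x. (1 - a x)*wy y x powr (p + 1))"
   by (rule integrable_boundI[OF wy_p1(1)[of y]]) (auto simp: abs_mult coefD[OF a_coef] intro!: mult_left_le_one_le)
 qed (auto simp: wy_p1 left_diff_distrib)
 thus "Ba (wy y) = tK^2 - mdef y" using w0 by (simp add: Bf_def max_absorb1)
 have "Ba (%x. u x + wy y x) = (LINT x|L. a x*u x powr (p + 1) + a x*wy y x powr (p + 1) + (p + 1)*(a x*(u x powr p*wy y x)) + a x*Gf p (u x) (wy y x))"
  unfolding Bf_def using u(2) w0 by (intro Bochner_Integration.integral_cong refl) (simp add: Gf_def max_absorb1 add_nonneg_nonneg algebra_simps)
 also have "... = (LINT x|L. a x*u x powr (p + 1)) + (LINT x|L. a x*wy y x powr (p + 1)) + (p + 1)*(LINT x|L. a x*(u x powr p*wy y x)) + Xe u y"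
  unfolding Xe_def using i by simp
 finally show "Ba (%x. u x + wy y x) = Ba u + (tK^2 - mdef y) + (p + 1)*Nf a u (wy y) + Xe u y"
  unfolding wa Bf_def Nf_def using u(2) by (simp add: max_absorb1 mult.assoc)
 show "0 <= mdef y" unfolding mdef_def using coefD(3)[OF a_coef] by (intro Bochner_Integration.integral_nonneg) auto
 show "0 <= Nf a u (wy y)" unfolding Nf_def using coefD(2)[OF a_coef] w0 by (intro Bochner_Integration.integral_nonneg) auto
qed

text \<open>The essential outcome is that squares of the cross terms are at most
  \<open>C * hn u\<close> times the interaction. The quadratic error in \<open>fiber_upper\<close>
  is thus a small fraction of the gain when \<open>u\<close> is small.\<close>

lemma interaction_bounds:
 obtains C where "C > 0" "!!u y. u \<in> H ==> (!!x. u x >= 0) ==> hn u <= 1 ==> Xe u y > 0 ==> Xe u y <= C*hn u & Nf a u (wy y) <= C*hn u &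
   ip u (wy y) <= C*hn u & (ip u (wy y))^2 <= C*hn u*Xe u y & (Nf a u (wy y))^2 <= C*hn u*Xe u y"
proof -
 obtain ca where ca: "ca > 0" "!!x. ca <= a x" using a_low by blast
 obtain K where K: "K > 0" "!!A B lam. A >= 0 ==> B >= 0 ==> lam > 0 ==> A powr p*B <= K*(1 + lam)*Gf p A B + A powr (p + 1)/lam"
  "!!A B lam. A >= 0 ==> B >= 0 ==> lam > 0 ==> B powr p*A <= K*(1 + lam)*Gf p A B + A powr (p + 1)/lam" by (rule split_interaction) blast
 define X1 where "X1 = (p + 1)*(3*Sq*tK powr p) + Ct*(tK + 1) powr (p - 1)"
 define k where "k = K/ca"
 define M where "M = k + k + 1"
 define C where "C = X1 + 3*Sq*tK + tK + 2*(k^2*X1 + (k + 1)^2*Sq) + 1"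
 have k: "k > 0" using K ca by (simp add: k_def)
 have X1: "X1 >= 0" using Sq_pos Ct_pos p_gt_1 by (simp add: X1_def)
 show thesis
 proof (rule that[of C])
  show "C > 0" using X1 Sq_pos tK_pos k by (simp add: C_def add_nonneg_pos)
  fix u y assume u: "u \<in> H" "!!x. u x >= 0" "hn u <= 1" and Xp: "Xe u y > 0"
  define X where "X = Xe u y"
  define t where "t = hn u"
  define w where "w = wy y"
  have X: "X > 0" using Xp by (simp add: X_def)
  have t: "0 <= t" "t <= 1" using u hn_nonneg by (auto simp: t_def)
  have w: "w \<in> H" "!!x. w x >= 0" "hn w = tK" using wy_H wy_pos[of y] hn_wy by (auto simp: w_def less_imp_le)
  note E = Xe_expand[OF u(1,2), of y, folded w_def X_def]
  have [measurable]: "u \<in> borel_measurable borel" "w \<in> borel_measurable borel" using u w H_meas by auto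
  have t2: "t^2 <= t" using t by (simp add: power2_eq_square mult_left_le_one_le)
  have tp: "t powr p <= t" "t powr (p + 1) <= t" using powr_mono'[of 1 p t] powr_mono'[of 1 "p + 1" t] t p_gt_1 by auto
  have b1: "X <= X1*t"
  proof -
   have "Ba (%x. w x + u x) - Ba w - (p + 1)*Nf a w u <= Ct*(hn w + hn u) powr (p - 1)*(hn u)^2" using Bf_taylor[OF a_coef w(1) u(1)] by (simp add: abs_le_iff)
   also have "... <= Ct*(tK + 1) powr (p - 1)*t" unfolding w(3) t_def[symmetric]
    using Ct_pos t t2 tK_pos p_gt_1 by (intro mult_mono powr_mono2) auto
   finally have "Ba (%x. u x + w x) <= Ba w + (p + 1)*Nf a w u + Ct*(tK + 1) powr (p - 1)*t" by (simp add: add.commute)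
   moreover have "(p + 1)*Nf a w u <= (p + 1)*(3*Sq*(tK powr p*t))" using Nf_bound[OF a_coef w(1) u(1)] p_gt_1 by (intro mult_left_mono) (auto simp: w(3) t_def abs_le_iff)
   moreover have "Ba u >= 0" "(p + 1)*Nf a u w >= 0" using Bf_nonneg[OF a_coef] E(3) p_gt_1 by auto
   ultimately show ?thesis using E(1,4) by (simp add: X1_def algebra_simps)
  qed
  have b2: "Nf a u w <= 3*Sq*tK*t"
  proof -
   have "Nf a u w <= 3*Sq*(t powr p*tK)" using Nf_bound[OF a_coef u(1) w(1)] by (simp add: w(3) t_def abs_le_iff)
   also have "... <= 3*Sq*(t*tK)" using tp tK_pos Sq_pos by (intro mult_left_mono mult_right_mono) auto
   finally show ?thesis by (simp add: mult_ac)
  qed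
  have b3: "ip u w <= tK*t" using ip_CS[OF u(1) w(1)] by (simp add: w(3) t_def abs_le_iff mult.commute)
  define U where "U = (LINT x|L. u x powr (p + 1))"
  have Ui: "integrable L (%x. u x powr (p + 1))" using pw_integrable(1)[OF u(1) w(1) u(2) w(2)] .
  have U: "0 <= U" "U <= Sq*t"
  proof -
   show "0 <= U" unfolding U_def by (intro Bochner_Integration.integral_nonneg) auto
   have "U <= Sq*t powr (p + 1)" using le_p1[OF u(1)] u(2) by (simp add: U_def t_def)
   also have "... <= Sq*t" using tp Sq_pos by (intro mult_left_mono) auto
   finally show "U <= Sq*t" .
  qed
  have b4: "(LINT x|L. h x) <= k*(1 + lam)*X + U/lam"
   if h: "integrable L h" "!!x. h x <= K*(1 + lam)*Gf p (u x) (w x) + u x powr (p + 1)/lam" and lam: "lam > 0" for h lam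
  proof -
   have "(LINT x|L. h x) <= (LINT x|L. k*(1 + lam)*(a x*Gf p (u x) (w x)) + (1/lam)*u x powr (p + 1))"
   proof (rule integral_mono[OF h(1)])
    fix x
    have G: "Gf p (u x) (w x) >= 0" using Gf_nonneg[OF p_gt_1] u(2) w(2) by auto
    have "K*(1 + lam)*Gf p (u x) (w x) = k*(1 + lam)*(ca*Gf p (u x) (w x))" using ca by (simp add: k_def)
    also have "... <= k*(1 + lam)*(a x*Gf p (u x) (w x))" using k lam ca(2)[of x] G by (intro mult_left_mono mult_right_mono) auto
    finally show "h x <= k*(1 + lam)*(a x*Gf p (u x) (w x)) + (1/lam)*u x powr (p + 1)" using h(2)[of x] by simp
   qed (use Ui Xe_integrable[OF u(1,2), of y] in \<open>auto simp: w_def\<close>)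
   also have "... = k*(1 + lam)*X + U/lam" unfolding X_def Xe_def U_def using Ui Xe_integrable[OF u(1,2), of y] by (simp add: w_def)
   finally show ?thesis .
  qed
  have b5: "(LINT x|L. h x)^2 <= C*t*X"
   if h: "integrable L h" "!!x. 0 <= h x" "!!x lam. lam > 0 ==> h x <= K*(1 + lam)*Gf p (u x) (w x) + u x powr (p + 1)/lam" for h
  proof -
   define r where "r = sqrt ((Sq*t)*X)"
   have "(LINT x|L. h x) <= k*X + (k + 1)*r"
   proof (cases "t = 0")
    case True
    have "AE x in L. u x = 0" using True hn_eq_0_iff[OF u(1)] by (simp add: t_def)
    hence "AE x in L. a x*Gf p (u x) (w x) = 0" by eventually_elim (use p_gt_1 in \<open>simp add: Gf_def\<close>)
    hence "X = 0" unfolding X_def Xe_def w_def by (rule integral_eq_zero_AE)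
    thus ?thesis using X by simp
   next
    case False
    \<comment> \<open>Balances \<open>lam * X\<close> with \<open>(Sq * t)/lam\<close>, so that both
      equal \<open>r = sqrt ((Sq * t) * X)\<close>.\<close>
    define lam where "lam = sqrt ((Sq*t)/X)"
    have l: "lam > 0" using False t X Sq_pos by (simp add: lam_def)
    have lX: "lam*X = r" "(Sq*t)/lam = r"
    proof -
     have "lam*X = sqrt ((Sq*t)/X) * sqrt (X^2)" using X by (simp add: lam_def)
     also have "... = r" unfolding real_sqrt_mult[symmetric] r_def using X by (simp add: power2_eq_square)
     finally show lr: "lam*X = r" .
     have "lam*r = lam^2*X" using lr by (simp add: power2_eq_square)
     also have "... = Sq*t" using X t Sq_pos by (simp add: lam_def)
     finally show "(Sq*t)/lam = r" using l by (simp add: field_simps)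
    qed
    have "(LINT x|L. h x) <= k*(1 + lam)*X + U/lam" using h l by (intro b4) auto
    also have "U/lam <= (Sq*t)/lam" using U l by (intro divide_right_mono) auto
    also have "k*(1 + lam)*X + (Sq*t)/lam = k*X + (k + 1)*r" unfolding lX(2) using lX(1) by (simp add: algebra_simps)
    finally show ?thesis by simp
   qed
   hence "(LINT x|L. h x)^2 <= (k*X + (k + 1)*r)^2" using h(2) by (intro power_mono Bochner_Integration.integral_nonneg) auto
   also have "... <= 2*((k*X)^2 + ((k + 1)*r)^2)" using zero_le_power2[of "k*X - (k + 1)*r"] by (simp add: power2_sum power2_diff)
   also have "... = 2*(k^2*X*X + (k + 1)^2*(Sq*t*X))" using X t Sq_pos by (simp add: r_def power_mult_distrib power2_eq_square[of X])
   also have "... <= 2*(k^2*(X1*t)*X + (k + 1)^2*(Sq*t*X))" using b1 X by (intro mult_left_mono add_right_mono mult_right_mono) auto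
   also have "... = 2*(k^2*X1 + (k + 1)^2*Sq)*(t*X)" by (simp add: algebra_simps)
   also have "... <= C*(t*X)" using X1 Sq_pos tK_pos t X by (intro mult_right_mono) (auto simp: C_def)
   finally show ?thesis by simp
  qed
  have i1: "(LINT x|L. w x powr p*u x) = ip u w" unfolding ip_commute[of u] w_def ip_wy[OF u(1)] Nf_def using wy_pos[of y] by (simp add: max_absorb1 less_imp_le)
  have c1: "(ip u w)^2 <= C*t*X" unfolding i1[symmetric] using pw_integrable(2)[OF w(1) u(1) w(2) u(2)] u(2) w(2) K(3) by (intro b5) auto
  have i2: "Nf a u w = (LINT x|L. a x*(u x powr p*w x))" unfolding Nf_def using u(2) by (simp add: max_absorb1 mult.assoc)
  have c2: "(Nf a u w)^2 <= C*t*X" unfolding i2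
  proof (rule b5)
   show "integrable L (%x. a x*(u x powr p*w x))" by (intro a_integrable pw_integrable u w)
   fix x :: "real^'n" and lam :: real assume that: "lam > 0"
   show "a x*(u x powr p*w x) <= K*(1 + lam)*Gf p (u x) (w x) + u x powr (p + 1)/lam"
   proof -
    have "a x*(u x powr p*w x) <= u x powr p*w x" using coefD(2,3)[OF a_coef, of x] u(2) w(2) by (intro mult_left_le_one_le) auto
    also have "... <= K*(1 + lam)*Gf p (u x) (w x) + u x powr (p + 1)/lam" using K(2) u(2) w(2) that by auto
    finally show ?thesis .
   qed
  qed (use coefD(2)[OF a_coef] w in auto)
  have le: "z <= C*t" if "z <= z'*t" "z' <= C" for z z' using that t by (meson mult_right_mono order_trans)
  have "X1 <= C" "3*Sq*tK <= C" "tK <= C" using X1 Sq_pos tK_pos k by (auto simp: C_def add_nonneg_nonneg)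
  thus "Xe u y <= C*hn u & Nf a u (wy y) <= C*hn u &
   ip u (wy y) <= C*hn u & (ip u (wy y))^2 <= C*hn u*Xe u y & (Nf a u (wy y))^2 <= C*hn u*Xe u y"
   using le[OF b1] le[OF b2] le[OF b3] c1 c2 by (simp add: w_def t_def X_def)
 qed
qed

definition nz :: "'n fn => 'n fn" where "nz g = (%x. (1/hn g)*g x)"

text \<open>At parameter 1 the energy of the sum is exactly
  \<open>I f u + c0 - (X - m)/(p + 1)\<close>. The loss satisfies \<open>m \<le> X/2\<close>, and
  passing to the maximum along the ray costs at most \<open>X/(4*(p + 1))\<close>, so a strict gain
  remains.\<close>

lemma energy_estimate:
 obtains d where "d > 0" "!!f u y. fsm f ==> nonneg_dual s f ==> u \<in> H ==> (!!x. u x >= 0) ==> \<forall>h\<in>H. DI a f u h = 0 ==> hn u <= d ==>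
   Xe u y > 0 ==> mdef y <= Xe u y/2 ==> nz (%x. u x + wy y x) \<in> Sg & hn (%x. u x + wy y x) > 0 & J f (nz (%x. u x + wy y x)) < I f u + c0"
proof -
 obtain C where C: "C > 0" and Cb: "!!u y. u \<in> H ==> (!!x. u x >= 0) ==> hn u <= 1 ==> Xe u y > 0 ==> Xe u y <= C*hn u & Nf a u (wy y) <= C*hn u &
   ip u (wy y) <= C*hn u & (ip u (wy y))^2 <= C*hn u*Xe u y & (Nf a u (wy y))^2 <= C*hn u*Xe u y" by (rule interaction_bounds) blast
 define W where "W = tK^2"
 define E where "E = 3*(2 + p^2)*C"
 define G where "G = kap*C + (1 + C)/2 + C/2"
 \<comment> \<open>The \<open>G\<close> bound keeps half of the curvature \<open>kap * W\<close>
   after perturbation by \<open>u\<close>; the \<open>E\<close> bound makes the ray error at most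
   half of the guaranteed gain.\<close>
 define d where "d = min 1 (min (kap*W/(2*G)) (kap*W/(2*(p + 1)*E)))"
 have W: "W > 0" using tK_pos by (simp add: W_def)
 have EG: "E > 0" "G > 0" using C kap_pos p_gt_1 by (auto simp: E_def G_def add_pos_pos)
 have d: "d > 0" "d <= 1" using W EG kap_pos p_gt_1 by (auto simp: d_def)
 have dE: "E*d <= kap*W/(2*(p + 1))" "G*d <= kap*W/2"
 proof -
  have "E*d <= E*(kap*W/(2*(p + 1)*E))" using EG by (intro mult_left_mono) (auto simp: d_def)
  thus "E*d <= kap*W/(2*(p + 1))" using EG by simp
  have "G*d <= G*(kap*W/(2*G))" using EG by (intro mult_left_mono) (auto simp: d_def)
  thus "G*d <= kap*W/2" using EG by simp
 qed
 have "nz (%x. u x + wy y x) \<in> Sg & hn (%x. u x + wy y x) > 0 & J f (nz (%x. u x + wy y x)) < I f u + c0"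
  if f: "fsm f" "nonneg_dual s f" and u: "u \<in> H" "!!x. u x >= 0" and cr: "\<forall>h\<in>H. DI a f u h = 0" and ud: "hn u <= d" and X0: "Xe u y > 0" and m: "mdef y <= Xe u y/2" for f u y
 proof -
  define t where "t = hn u"
  define w where "w = wy y"
  define X where "X = Xe u y"
  define m where "m = mdef y"
  define al where "al = Nf a u w"
  define be where "be = ip u w"
  define g where "g = (%x. u x + w x)"
  define P where "P = (hn g)^2"
  define Q where "Q = Ba g"
  define R where "R = f g"
  define e where "e = be - p*al - X + m"
  have fH: "f \<in> Hd" using f by (simp add: fsm_def)
  have t: "0 <= t" "t <= d" "t <= 1" using ud d hn_nonneg by (auto simp: t_def)
  have w: "w \<in> H" "hn w = tK" using wy_H hn_wy by (auto simp: w_def)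
  have g: "g \<in> H" using H_add[OF u(1) w(1)] by (simp add: g_def)
  have b: "X <= C*t" "al <= C*t" "be <= C*t" "be^2 <= C*t*X" "al^2 <= C*t*X"
   using Cb[OF u _ X0] t by (auto simp: X_def al_def be_def t_def w_def)
  note ex = Xe_expand[OF u, of y, folded w_def X_def m_def al_def g_def]
  note ce = crit_energy[OF fH u(1) cr]
  \<comment> \<open>The equation of \<open>u\<close>, tested with the translate, expresses the
    forcing on \<open>w\<close> through the two cross terms.\<close>
  have fw: "f w = be - al" using cr[rule_format, OF w(1)] by (simp add: DI_def al_def be_def)
  have fw0: "f w >= 0" using f(2) w(1) wy_pos[of y] by (auto simp: nonneg_dual_def w_def less_imp_le)
  have mX: "0 <= m" "m <= X/2" "X > 0" "0 <= al" "0 <= be" using m X0 ex fw fw0 by (auto simp: m_def X_def al_def)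
  have Pe: "P = t^2 + 2*be + W" unfolding P_def g_def hn_sq_add[OF u(1) w(1)] by (simp add: t_def be_def w W_def)
  have Re: "R = f u + (be - al)" using dual_add[OF fH u(1) w(1)] fw by (simp add: R_def g_def)
  have Qe: "Q = Ba u + (W - m) + (p + 1)*al + X" using ex(1) by (simp add: Q_def W_def g_def al_def)
  have Be: "Ba u = t^2 - f u" using ce(1) by (simp add: t_def)
  have PQR: "P = Q + R + e" unfolding Pe Qe Re Be e_def by (simp add: algebra_simps)
  have Bu: "Ba u >= 0" by (rule Bf_nonneg[OF a_coef])
  have Ql: "Q >= W - C*t"
  proof -
   have "(p + 1)*al >= 0" using mX p_gt_1 by simp
   thus ?thesis using Qe Bu mX b(1) by linarith
  qed
  have Gt: "G*t <= kap*W/2" using mult_left_mono[OF t(2), of G] EG dE by linarith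
  have kCt: "kap*(C*t) <= kap*(W/2)"
  proof -
   have "0 <= ((1 + C)/2 + C/2)*t" using C t by simp
   moreover have "G*t = kap*(C*t) + ((1 + C)/2 + C/2)*t" by (simp add: G_def algebra_simps)
   ultimately show ?thesis using Gt by simp
  qed
  hence "C*t <= W/2" using kap_pos by simp
  hence Q0: "Q > 0" using Ql W by linarith
  have el: "e <= C*t" unfolding e_def using b(3) mX p_gt_1 mult_nonneg_nonneg[of p al] by linarith
  have t2: "t^2 <= t" using t by (simp add: power2_eq_square mult_left_le_one_le)
  have "R <= (1 + C)*t" using Re Be Bu t2 b(3) mX by (simp add: algebra_simps)
  hence lowg: "Q * kap - R/2 - e/2 >= kap*W/2"
  proof -
   have "kap*Q >= kap*(W - C*t)" using Ql kap_pos by (intro mult_left_mono) auto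
   moreover have "kap*(W - C*t) = kap*W - G*t + ((1 + C)*t)/2 + (C*t)/2" by (simp add: G_def algebra_simps add_divide_distrib)
   ultimately show ?thesis using \<open>R <= (1 + C) * t\<close> el Gt by (simp only: mult.commute[of Q])
  qed
  have e2: "e^2 <= E*t*X"
  proof -
   have sq3: "(r1 + r2 + r3)^2 <= 3*(r1^2 + r2^2 + r3^2)" for r1 r2 r3 :: real
    using zero_le_power2[of "r1 - r2"] zero_le_power2[of "r1 - r3"] zero_le_power2[of "r2 - r3"] by (simp add: power2_eq_square algebra_simps)
   have "e = be + (- p*al) + (m - X)" by (simp add: e_def)
   hence "e^2 <= 3*(be^2 + (- p*al)^2 + (m - X)^2)" by (metis sq3)
   also have "(m - X)^2 <= X^2" using mX by (intro abs_le_square_iff[THEN iffD1]) auto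
   also have "X^2 <= C*t*X" using b(1) mX by (simp add: power2_eq_square mult_right_mono)
   also have "(- p*al)^2 = p^2*al^2" by (simp add: power_mult_distrib)
   also have "p^2*al^2 <= p^2*(C*t*X)" using b(5) by (intro mult_left_mono) auto
   finally have "e^2 <= 3*(be^2 + p^2*(C*t*X) + C*t*X)" by simp
   thus ?thesis using b(4) by (simp add: E_def algebra_simps)
  qed
  define rh where "rh = hn g"
  have rh: "rh > 0"
  proof (rule ccontr)
   assume "~ ?thesis"
   hence "hn g = 0" using hn_nonneg[of g] by (simp add: rh_def)
   thus False using Bf_le[OF a_coef g] Q0 p_gt_1 by (simp add: Q_def)
  qed
  define v where "v = nz g"
  have v: "v = (%x. (1/rh)*g x)" by (simp add: v_def nz_def rh_def)
  have vS: "v \<in> Sg" unfolding Sg_iff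
  proof (intro conjI)
   show "v \<in> H" "hn v = 1" using normalize[OF g] rh by (auto simp: v rh_def)
   show "Ba v > 0" unfolding v using rh Q0 by (subst Bf_scale) (auto simp: Q_def)
  qed
  define ta where "ta = tm f v/rh"
  have ta: "ta > 0" using tm_props(1)[OF f(1) vS] rh by (simp add: ta_def)
  have "J f v = I f (%x. tm f v * v x)" by (rule J_eq(1)[OF f(1) vS])
  also have "(%x. tm f v * v x) = (%x. ta*g x)" by (simp add: ta_def v)
  also have "I f (%x. ta*g x) = gfun p Q R ta + ta^2*(P - 1)/2"
   unfolding Ifun_eq hn_scale gfun_def using ta dual_scale[OF fH g] by (simp add: Bf_scale P_def Q_def R_def power_mult_distrib algebra_simps diff_divide_distrib)
  also have "... <= P/2 - Q/(p + 1) - R + e^2/(4*(kap*W/2))" using PQR ta kap_pos W lowg Q0 by (intro fiber_upper) auto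
  also have "P/2 - Q/(p + 1) - R = I f u + c0 - (X - m)/(p + 1)"
   unfolding c0_eq W_def[symmetric] ce(2) t_def[symmetric] Pe Qe Re Be kap_def using p_gt_1 by (simp add: divide_simps) (simp add: algebra_simps)
  also have "e^2/(4*(kap*W/2)) <= X/(4*(p + 1))"
  proof -
   have "E*t <= kap*W/(2*(p + 1))" using mult_left_mono[OF t(2), of E] EG dE by linarith
   hence "E*t*X <= kap*W/(2*(p + 1))*X" using mX by (intro mult_right_mono) auto
   hence "e^2 <= kap*W/(2*(p + 1))*X" using e2 by linarith
   hence "e^2/(4*(kap*W/2)) <= (kap*W/(2*(p + 1))*X)/(4*(kap*W/2))" using kap_pos W by (intro divide_right_mono) auto
   also have "... = X/(4*(p + 1))" using kap_pos W p_gt_1 by (simp add: divide_simps)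
   finally show ?thesis .
  qed
  also have "I f u + c0 - (X - m)/(p + 1) + X/(4*(p + 1)) < I f u + c0"
  proof -
   have "X/(4*(p + 1)) = (X/4)/(p + 1)" by simp
   also have "... < (X - m)/(p + 1)" using mX p_gt_1 by (intro divide_strict_right_mono) auto
   finally show ?thesis by linarith
  qed
  finally show ?thesis using vS rh by (simp add: v_def g_def w_def rh_def)
 qed
 thus thesis using d that by blast
qed

text \<open>If the power integral of \<open>v\<close> stays below some \<open>k < KK\<close>, its
  natural parameter is at least \<open>t1 > tK\<close>, and evaluating the ray there already gives
  energy at least \<open>c0\<close>. Thus energy below \<open>c0\<close> forces the regime of
  \<open>bary_nonzero\<close>.\<close>

lemma low_energy_bary:
 obtains d where "d > 0" "!!f v. fsm f ==> fnorm f <= d ==> v \<in> Sg ==> J f v < c0 ==> bary v ~= 0"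
proof -
 obtain nua0 where nua0: "nua0 > 0" "!!v. v \<in> Sg ==> Ba v > KK - nua0 ==> bary v ~= 0" by (rule bary_nonzero) blast
 define k where "k = max (KK - nua0) (KK/2)"
 have k: "0 < k" "k < KK" "KK - nua0 <= k" using KK_pos nua0 by (auto simp: k_def)
 define t1 where "t1 = k powr (- 1/(p - 1))"
 have t1: "t1 > tK" unfolding t1_def tK_def using k p_gt_1 by (intro powr_less_mono2_neg) auto
 \<comment> \<open>Calibrated so that \<open>t1 * (kap * t1 - d)\<close> is exactly
   \<open>c0\<close>.\<close>
 define d where "d = kap*(t1^2 - tK\<^sup>2)/t1"
 have t2: "t1^2 > tK^2" using t1 tK_pos by (intro power_strict_mono) auto
 have d: "d > 0" "t1*d = kap*(t1^2 - tK\<^sup>2)" using t1 tK_pos t2 kap_pos by (auto simp: d_def)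
 show thesis
 proof (rule that[OF d(1)])
  fix f v assume f: "fsm f" "fnorm f <= d" and v: "v \<in> Sg" and J: "J f v < c0"
  have "Ba v > KK - nua0"
  proof (rule ccontr)
   assume "~ ?thesis"
   hence Bk: "0 < Ba v" "Ba v <= k" using Sg_Ba[OF v] k by auto
   define t where "t = Ba v powr (- 1/(p - 1))"
   have t: "t >= t1" "t > 0" using Bk p_gt_1 by (auto simp: t_def t1_def intro!: powr_mono2')
   have "gfun p (Ba v) (f v) t = kap*t^2 - t*f v" unfolding t_def by (rule gfun_at_natural[OF Bk(1)])
   moreover have "gfun p (Ba v) (f v) t <= J f v" using J_eq(2)[OF f(1) v] tm_props(2)[OF f(1) v t(2)] by simp
   moreover have "t*f v <= t*d" using dual_bound[of f v] SgD[OF v] f t by (intro mult_left_mono) (auto simp: fsm_def abs_le_iff)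
   moreover have "t*(kap*t - d) >= t1*(kap*t1 - d)"
   proof -
    have "kap*t1 - d >= 0"
    proof -
     have "t1*(kap*t1 - d) = kap*tK^2" using d(2) by (simp add: algebra_simps power2_eq_square)
     also have "... >= 0" using kap_pos by simp
     finally show ?thesis using t1 tK_pos by (simp add: zero_le_mult_iff)
    qed
    moreover have "kap*t1 <= kap*t" using t kap_pos by (intro mult_left_mono) auto
    ultimately show ?thesis using t t1 tK_pos by (intro mult_mono) auto
   qed
   moreover have "t1*(kap*t1 - d) = c0" unfolding c0_eq using d(2) by (simp add: algebra_simps power2_eq_square)
   moreover have "t*(kap*t - d) = kap*t^2 - t*d" by (simp add: power2_eq_square algebra_simps)
   ultimately show False using J by linarith
  qed
  thus "bary v ~= 0" using nua0 v by blast
 qed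
qed

text \<open>For large \<open>y\<close> the barycentre of the translate has component close to its L2
  mass \<open>l\<close> in the direction of \<open>y\<close>; the Lipschitz bound limits the change
  caused by \<open>u\<close> to \<open>l/4\<close>, and normalisation only rescales.\<close>

lemma bary_direction:
 obtains d R where "d > 0" "!!u y. u \<in> H ==> hn u <= d ==> norm y >= R ==> y ~= 0 ==> hn (%x. u x + wy y x) > 0 ==> bary (nz (%x. u x + wy y x)) \<bullet> y > 0"
proof -
 define l where "l = (LINT x|L. (wst x)^2)"
 have l: "l > 0" unfolding l_def by (rule L2_pos[OF wst_H wst_hn_pos])
 have "(%n. bary (wy (y n)) \<bullet> (y n /\<^sub>R norm (y n)) - l) ---> 0" if "filterlim (%n. norm (y n)) at_top sequentially" for y
  using bary_far[of "%_. wst" wst y] wst_H that by (simp add: hn_zero l_def wy_def LIM_zero_iff)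
 then obtain R where R: "!!y. norm y >= R ==> \<bar>bary (wy y) \<bullet> (y /\<^sub>R norm y) - l\<bar> < l/2"
  by (rule tendsto_at_infinity_seq[where X="%y. bary (wy y) \<bullet> (y /\<^sub>R norm y) - l" and e="l/2"]) (use l in auto)
 define D where "D = 1 + (1 + 2*tK)^2"
 define d where "d = min 1 (l/(4*D))"
 have D: "D > 0" by (simp add: D_def add_pos_nonneg)
 have d: "d > 0" "d <= 1" "d*D <= l/4"
 proof -
  show "d > 0" "d <= 1" using l D by (auto simp: d_def)
  have "d*D <= l/(4*D)*D" using D by (intro mult_right_mono) (auto simp: d_def)
  thus "d*D <= l/4" using D by simp
 qed
 show thesis
 proof (rule that[OF d(1)])
  fix u y assume u: "u \<in> H" "hn u <= d" and y: "norm y >= R" "y ~= 0" and h: "hn (%x. u x + wy y x) > 0"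
  let ?g = "%x. u x + wy y x" and ?e = "y /\<^sub>R norm y"
  have g: "?g \<in> H" using H_add[OF u(1) wy_H] .
  have "norm (bary ?g - bary (wy y)) <= hn (%x. ?g x - wy y x)*(1 + (hn ?g + hn (wy y))^2)" by (rule bary_lip[OF g wy_H])
  also have "... = hn u*(1 + (hn ?g + tK)^2)" by (simp add: hn_wy)
  also have "... <= d*D" unfolding D_def
   using u hn_triangle[OF u(1) wy_H[of y]] d tK_pos hn_nonneg by (intro mult_mono add_left_mono power_mono) (auto simp: hn_wy intro: add_nonneg_nonneg)
  finally have 1: "norm (bary ?g - bary (wy y)) <= l/4" using d by linarith
  have "\<bar>(bary ?g - bary (wy y)) \<bullet> ?e\<bar> <= norm (bary ?g - bary (wy y))*norm ?e" by (rule Cauchy_Schwarz_ineq2)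
  also have "norm ?e = 1" using y by simp
  finally have "\<bar>bary ?g \<bullet> ?e - bary (wy y) \<bullet> ?e\<bar> <= norm (bary ?g - bary (wy y))" by (simp only: inner_diff_left mult_1_right)
  hence "bary ?g \<bullet> ?e > 0" using 1 R[OF y(1)] l by linarith
  hence "bary ?g \<bullet> y > 0" using y by (simp add: zero_less_mult_iff)
  moreover have "bary (nz ?g) = (1/hn ?g)^2 *\<^sub>R bary ?g" by (simp add: bary_def nz_def power_mult_distrib power_divide integral_scaleR_right[symmetric] del: integral_scaleR_right)
  ultimately show "bary (nz ?g) \<bullet> y > 0" using h by simp
 qed
qed

end

section \<open>Riesz representation and continuity of translations\<close>

context setting
begin

abbreviation dn :: "'n fn => 'n fn => real" where "dn v w \<equiv> hn (%x. v x - w x)"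

lemma ip_tendsto:
 assumes "!!n. v n \<in> H" "w \<in> H" "(%n. dn (v n) w) ---> 0" "h \<in> H"
 shows "(%n. ip (v n) h) ---> ip w h"
proof -
 have "(%n. ip (v n) h - ip w h) ---> 0"
 proof (rule tendsto_rabs_zero_cancel[OF tendsto_sandwich[OF _ _ tendsto_const]])
  show "(%n. dn (v n) w*hn h) ---> 0" using tendsto_mult_right[OF assms(3), of "hn h"] by simp
  show "\<forall>\<^sub>F n in sequentially. abs (ip (v n) h - ip w h) <= dn (v n) w*hn h"
   using ip_CS[OF H_diff[OF assms(1,2)] assms(4)] ip_diff_left[OF assms(1,2,4)] by auto
 qed auto
 thus ?thesis by (simp add: LIM_zero_iff)
qed

lemma quadratic_nonneg_linear:
 fixes A B :: real assumes "!!t. 0 <= t*A + t^2*B" shows "A = 0"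
proof (rule ccontr)
 assume A: "A ~= 0"
 define D where "D = abs B + 1"
 have D: "D > 0" "B <= D" by (auto simp: D_def)
 have "0 <= - A/(2*D)*A + (- A/(2*D))^2*B" by (rule assms)
 also have "... <= - A/(2*D)*A + (- A/(2*D))^2*D" using D by (intro add_left_mono mult_left_mono) auto
 also have "... = - (A^2/(4*D))" using D by (simp add: power2_eq_square field_simps)
 also have "... < 0" using A D by simp
 finally show False by simp
qed

text \<open>The direct method: minimise \<open>(hn h)^2/2 - pha h\<close>. The parallelogram law
  makes minimising sequences Cauchy, and stationarity of the limit is the representation. The result
  is a function, determined only up to null sets.\<close>

lemma riesz:
 assumes add: "!!h k. h \<in> H ==> k \<in> H ==> pha (%x. h x + k x) = pha h + pha k" and sc: "!!h c. h \<in> H ==> pha (%x. c*h x) = c*pha h"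
  and bd: "!!h. h \<in> H ==> abs (pha h) <= M*hn h"
 shows "\<exists>g\<in>H. \<forall>h\<in>H. ip g h = pha h"
proof -
 define E where "E h = (hn h)^2/2 - pha h" for h
 have low: "E h >= - M\<^sup>2/2" if "h \<in> H" for h
  using bd[OF that] zero_le_power2[of "hn h - M"] unfolding E_def by (simp add: power2_diff abs_le_iff algebra_simps)
 define m where "m = Inf (E ` H)"
 have bb: "bdd_below (E ` H)" using low by (intro bdd_belowI[of _ "- M\<^sup>2/2"]) auto
 have mle: "m <= E h" if "h \<in> H" for h unfolding m_def using bb that by (intro cINF_lower) auto
 have "\<exists>h\<in>H. E h < m + 1/real (Suc n)" for n
  using cINF_less_iff[of H E "m + 1/real (Suc n)"] bb H_zero by (auto simp: m_def)
 then obtain g where g: "!!n. g n \<in> H" "!!n. E (g n) < m + 1/real (Suc n)" by metis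
 have par: "(dn v w)^2 <= 4*(E v - m) + 4*(E w - m)" if "v \<in> H" "w \<in> H" for v w
 proof -
  let ?k = "%x. (1/2)*(v x + w x)"
  have "E ?k >= m" using that by (intro mle H_scale H_add)
  moreover have "E ?k = (hn (%x. v x + w x))^2/8 - (pha v + pha w)/2"
   unfolding E_def sc[OF H_add[OF that]] hn_scale add[OF that] by (simp add: power_divide)
  ultimately show ?thesis unfolding hn_sq_diff[OF that] E_def using hn_sq_add[OF that] by (simp add: field_simps)
 qed
 obtain G where G: "G \<in> H" "(%n. dn (g n) G) ---> 0"
 proof (rule H_complete[OF g(1)])
  fix e :: real assume e: "e > 0"
  obtain n0 where n0: "8/e^2 < real (Suc n0)" using reals_Archimedean2[of "8/e^2"] by (metis less_Suc_eq_le less_le_trans of_nat_less_iff order_less_imp_le lessI of_nat_le_iff)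
  have "dn (g n) (g k) <= e" if "n >= n0" "k >= n0" for n k
  proof -
   have s: "1/real (Suc j) <= e^2/8" if "j >= n0" for j
   proof -
    have "8/e^2 <= real (Suc j)" using n0 that by (meson Suc_le_mono le_trans less_imp_le of_nat_le_iff order_trans)
    thus ?thesis using e by (simp add: field_simps)
   qed
   have "(dn (g n) (g k))^2 <= 4*(E (g n) - m) + 4*(E (g k) - m)" by (rule par[OF g(1) g(1)])
   also have "... <= e^2"
   proof -
    have "E (g j) <= m + e^2/8" if "j >= n0" for j by (rule order_trans[OF less_imp_le[OF g(2)] add_left_mono[OF s[OF that]]])
    from this[OF that(1)] this[OF that(2)] show ?thesis by (simp add: field_simps)
   qed
   finally show ?thesis by (rule power2_le_imp_le) (use e in simp)
  qed
  thus "\<exists>n0. \<forall>n\<ge>n0. \<forall>m\<ge>n0. dn (g n) (g m) <= e" by blast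
 qed
 have "ip G h = pha h" if h: "h \<in> H" for h
 proof -
  have "0 <= t*(ip G h - pha h) + t^2*((hn h)^2/2)" for t
  proof (rule LIMSEQ_le[OF _ _ exI[of _ 0]])
   have "(%n. t*(ip (g n) h - pha h) + t^2*((hn h)^2/2)) ---> t*(ip G h - pha h) + t^2*((hn h)^2/2)"
    by (intro tendsto_intros ip_tendsto g G h)
   thus "(%n. t*(ip (g n) h - pha h) + t^2*((hn h)^2/2)) ---> t*(ip G h - pha h) + t^2*((hn h)^2/2)" .
   show "(%n. - (1/real (Suc n))) ---> 0" using tendsto_minus[OF LIMSEQ_Suc[OF lim_1_over_n]] by simp
   show "\<forall>n\<ge>0. - (1/real (Suc n)) <= t*(ip (g n) h - pha h) + t^2*((hn h)^2/2)"
   proof (intro allI impI)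
    fix n :: nat
    note th = H_scale[OF h, of t]
    have "m <= E (%x. g n x + t*h x)" by (intro mle H_add g th)
    also have "... = E (g n) + (t*(ip (g n) h - pha h) + t^2*((hn h)^2/2))"
     unfolding E_def hn_sq_add[OF g(1) th] add[OF g(1) th] sc[OF h] ip_scale_right hn_scale by (simp add: power_mult_distrib algebra_simps add_divide_distrib)
    finally show "- (1/real (Suc n)) <= t*(ip (g n) h - pha h) + t^2*((hn h)^2/2)" using g(2)[of n] by linarith
   qed
  qed
  hence "ip G h - pha h = 0" by (rule quadratic_nonneg_linear)
  thus ?thesis by simp
 qed
 thus ?thesis using G by blast
qed

text \<open>Convergence can fail only where \<open>x + l\<close> lies on a hyperplane of the dyadic
  grid of scale \<open>k\<close>, and countably many hyperplanes form a null set.\<close>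

lemma cube_indicator_tendsto:
 assumes "y ---> l"
 shows "AE x in L. (%n. indicator (cube k z) (x + y n) :: real) ---> indicator (cube k z) (x + l)"
proof -
 have "AE x in L. \<forall>i. \<forall>j::int. x $ i ~= of_int j/2 ^ k - l $ i"
 proof (subst AE_all_countable, intro allI, subst AE_all_countable, intro allI)
  fix i :: 'n and j :: int
  have "{x :: real^'n. x $ i = of_int j/2 ^ k - l $ i} \<in> null_sets lebesgue"
   using negligible_hyperplane[of "axis i (1::real)" "of_int j/2 ^ k - l $ i"] by (simp add: negligible_iff_null_sets inner_axis' axis_eq_0_iff)
  hence "AE x in lebesgue. x $ i ~= of_int j/2 ^ k - l $ i" by (auto intro: AE_I')
  thus "AE x in L. x $ i ~= of_int j/2 ^ k - l $ i" by (simp add: AE_completion_iff)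
 qed
 thus ?thesis
 proof eventually_elim
  case (elim x)
  have "eventually (%n. ix k (x + y n) = ix k (x + l)) sequentially"
   unfolding ix_def vec_eq_iff vec_lambda_beta
  proof (rule eventually_all_finite)
   fix i
   have lim: "(%n. 2 ^ k*(x + y n) $ i) ---> 2 ^ k*(x + l) $ i" by (intro tendsto_intros assms)
   have ni: "2 ^ k*(x + l) $ i ~= of_int j" for j using elim[rule_format, of i j] by (auto simp: field_simps)
   let ?j = "\<lfloor>2 ^ k*(x + l) $ i\<rfloor>"
   have "of_int ?j < 2 ^ k*(x + l) $ i" "2 ^ k*(x + l) $ i < of_int ?j + 1" using ni[of ?j]
    by (metis less_eq_real_def of_int_floor_le) (rule real_of_int_floor_add_one_gt)
   from order_tendstoD(1)[OF lim this(1)] order_tendstoD(2)[OF lim this(2)]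
   show "eventually (%n. \<lfloor>2 ^ k*(x + y n) $ i\<rfloor> = ?j) sequentially" by eventually_elim (auto simp: floor_eq_iff)
  qed
  thus ?case by (intro tendsto_eventually) (auto elim!: eventually_mono simp: cube_def indicator_def)
 qed
qed

lemma H_zero_of_averages: assumes "h \<in> H" "!!k z. cavg k h z = 0" shows "AE x in L. h x = 0"
proof -
 have "(LINT x|L. (h x)^2) <= real CARD('n) powr dd*2 powr (- 2 * s * real k)*(LINT z|LL. (df h z)^2)" for k :: nat
  using avg_L2(2)[OF assms(1), of k] by (simp add: avg_def assms(2))
 moreover have "(%k. real CARD('n) powr dd*2 powr (- 2 * s * real k)*(LINT z|LL. (df h z)^2)) ---> 0"
 proof -
  have "(%k. (2 powr (- 2 * s)) ^ k) ---> (0::real)" using s_pos by (intro LIMSEQ_power_zero) (simp add: powr_less_one)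
  hence "(%k. 2 powr (- 2 * s * real k)) ---> (0::real)" by (simp add: powr_power mult_ac)
  thus ?thesis by (intro tendsto_mult_left_zero tendsto_mult_right_zero)
 qed
 ultimately have "(LINT x|L. (h x)^2) <= 0" by (intro LIMSEQ_le_const) auto
 hence "(LINT x|L. (h x)^2) = 0" by (intro antisym) auto
 thus ?thesis using sqiD(2)[OF H_sqi[OF assms(1)]] by (subst (asm) integral_nonneg_eq_0_iff_AE) auto
qed

text \<open>A weak limit of the translates has the same averages over all dyadic cubes as
  \<open>wy l\<close>, hence equals it. All norms are \<open>tK\<close>, so weak convergence is
  strong.\<close>

lemma wy_tendsto: assumes y: "y ---> l" shows "(%n. dn (wy (y n)) (wy l)) ---> 0"
proof (rule ccontr)
 assume "~ ?thesis"
 then obtain e si where e: "e > 0" "strict_mono (si :: nat => nat)" "!!n. e <= dist (dn (wy (y (si n))) (wy l)) 0" by (rule not_tendsto_subseq) blast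
 obtain pha v where pha: "strict_mono (pha :: nat => nat)" "v \<in> H" "AE x in L. (%n. wy (y (si (pha n))) x) ---> v x" "!!g. g \<in> H ==> (%n. ip (wy (y (si (pha n)))) g) ---> ip v g"
  by (rule rellich[of "%n. wy (y (si n))" tK]) (use wy_H hn_wy in auto)
 define t where "t n = y (si (pha n))" for n
 have t: "t ---> l" unfolding t_def using LIMSEQ_subseq_LIMSEQ[OF y strict_mono_o[OF e(2) pha(1)]] by (simp add: o_def)
 have [measurable]: "wst \<in> borel_measurable borel" using H_meas wst_H by auto
 have cv: "cavg k (%x. v x - wy l x) z = 0" for k z
 proof -
  let ?Q = "indicator (cube k z) :: _ => real"
  have qs: "sqi L ?Q" using cube_integral(1)[of k z] by (simp add: sqi_def indicator_sq)
  have 1: "(%n. LINT x|L. wy (t n) x*?Q x) ---> (LINT x|L. v x*?Q x)"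
  proof (rule weak_sqi[OF H_sqi[OF wy_H] _ H_sqi[OF pha(2)] qs, where C="tK^2"])
   show "AE x in L. (%n. wy (t n) x) ---> v x" using pha(3) by (simp add: t_def)
   show "(LINT x|L. (wy (t n) x)^2) <= tK^2" for n using L2_le_hn[of "wy (t n)"] by (simp add: hn_wy)
  qed
  have sh: "(LINT x|L. wy r x*?Q x) = (LINT x|L. wst x*?Q (x + r))" for r using integral_wy[of "%x w. w*?Q x" r] by simp
  obtain M where M: "!!n. norm (t n) <= M" using convergent_imp_Bseq[of t] t by (auto simp: convergent_def Bseq_def)
  obtain r where r: "cube k z \<subseteq> cball 0 r"
  proof (cases "cube k z = {}")
   case False
   then obtain q where "q \<in> cube k z" by blast
   hence "norm x <= norm q + real CARD('n)/2 ^ k" if "x \<in> cube k z" for x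
    using cube_norm[of k x q] that norm_triangle_ineq2[of x q] by (auto simp: cube_def)
   thus ?thesis using that by (auto simp: subset_iff)
  qed (use that in auto)
  have 2: "(%n. LINT x|L. wst x*?Q (x + t n)) ---> (LINT x|L. wst x*?Q (x + l))"
  proof (rule integral_dominated_convergence[where w="%x. wst x*indicator (cball 0 (r + M)) x"])
   show "integrable L (%x. wst x*indicator (cball 0 (r + M)) x)"
    using ball_indicator_integrable(2) by (intro sqi_mult_integrable[OF H_sqi[OF wst_H]]) (simp add: sqi_def indicator_sq)
   show "AE x in L. (%n. wst x*?Q (x + t n)) ---> wst x*?Q (x + l)"
    using cube_indicator_tendsto[OF t, of k z] by eventually_elim (intro tendsto_intros)
   show "AE x in L. norm (wst x*?Q (x + t n)) <= wst x*indicator (cball 0 (r + M)) x" for n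
   proof (rule AE_I2)
    fix x
    have "norm x <= r + M" if "x + t n \<in> cube k z" using that r M[of n] norm_triangle_ineq4[of "x + t n" "t n"] by (auto simp: subset_iff)
    thus "norm (wst x*?Q (x + t n)) <= wst x*indicator (cball 0 (r + M)) x" using wst_pos[of x] by (auto simp: indicator_def less_imp_le)
   qed
  qed (auto simp: measurable_compose[OF _ borel_measurable_indicator])
  have "(LINT x|L. v x*?Q x) = (LINT x|L. wy l x*?Q x)" using LIMSEQ_unique[OF 1] 2 unfolding sh by blast
  thus ?thesis using cavg_diff[OF H_sqi[OF pha(2)] H_sqi[OF wy_H], of k l z] by (simp add: cavg_def mult.commute)
 qed
 have vl: "AE x in L. v x = wy l x" using H_zero_of_averages[OF H_diff[OF pha(2) wy_H] cv] by eventually_elim simp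
 have "ip v (wy l) = tK^2" using ip_AE_cong[OF pha(2) wy_meas vl wy_H, of l] by (simp add: hn_sq[symmetric] hn_wy)
 hence "(%n. tK^2 - 2*ip (wy (t n)) (wy l) + tK^2) ---> tK^2 - 2*tK^2 + tK^2" using pha(4)[OF wy_H, of l] unfolding t_def by (intro tendsto_intros) simp
 hence "(%n. (dn (wy (t n)) (wy l))^2) ---> 0" unfolding hn_sq_diff[OF wy_H wy_H] hn_wy by simp
 hence "(%n. dn (wy (t n)) (wy l)) ---> 0" using tendsto_real_sqrt hn_nonneg by fastforce
 from tendstoD[OF this e(1)] e(3) show False unfolding t_def by (auto simp: eventually_sequentially) (metis le_refl not_le)
qed

end

section \<open>The Palais-Smale condition and quadratic control of the reduced functional\<close>

lemma (in setting) scaled_tendsto: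
 assumes g: "!!n. g n \<in> H" "G \<in> H" "(%n. dn (g n) G) ---> 0" and c: "c ---> l"
 shows "(%n. dn (%x. c n*g n x) (%x. l*G x)) ---> 0"
proof (rule tendsto_sandwich[OF _ _ tendsto_const])
 show "(%n. abs (c n)*dn (g n) G + abs (c n - l)*hn G) ---> 0"
  using tendsto_add[OF tendsto_mult[OF tendsto_rabs[OF c] g(3)] tendsto_mult_right[OF tendsto_rabs_zero[OF LIM_zero[OF c]], of "hn G"]] by simp
 have "dn (%x. c n*g n x) (%x. l*G x) <= abs (c n)*dn (g n) G + abs (c n - l)*hn G" for n
 proof -
  have "(%x. c n*(g n x - G x) + (c n - l)*G x) = (%x. c n*g n x - l*G x)" by (auto simp: algebra_simps)
  thus ?thesis using hn_triangle[OF H_scale[OF H_diff[OF g(1)[of n] g(2)], of "c n"] H_scale[OF g(2), of "c n - l"], unfolded hn_scale] by simp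
 qed
 thus "\<forall>\<^sub>F n in sequentially. dn (%x. c n*g n x) (%x. l*G x) <= abs (c n)*dn (g n) G + abs (c n - l)*hn G" by simp
qed (simp add: hn_nonneg)

text \<open>Collects what compactness and topology need for one fixed \<open>f\<close>.
  \<open>lowest\<close> prices any weak limit at no less than \<open>I f u\<close>;
  \<open>bary0\<close> puts the sublevel into the domain of a map avoiding the origin;
  \<open>family\<close> is the sphere of test functions, whose barycentres point outwards.\<close>

locale perturbed = setting s dd n_type p a wst for s dd and n_type :: "'n::finite itself" and p a wst +
 fixes f :: "'n fn => real" and u :: "'n fn" and R :: real
 assumes fs: "fsm f" and f_small: "fnorm f <= tlow*(p - 1)/(2*p)"
  and u_H: "u \<in> H" and u_crit: "\<forall>h\<in>H. DI a f u h = 0"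
  and lowest: "!!u'. u' \<in> H ==> \<forall>h\<in>H. DI a f u' h = 0 ==> I f u <= I f u'"
  and bary0: "!!v. v \<in> Sg ==> J f v < I f u + c0 ==> bary v ~= 0"
  and R_pos: "R > 0"
  and family: "!!y. norm y = R ==> nz (%x. u x + wy y x) \<in> Sg & hn (%x. u x + wy y x) > 0 &
   J f (nz (%x. u x + wy y x)) < I f u + c0 & bary (nz (%x. u x + wy y x)) \<bullet> y > 0"
begin

abbreviation Uf :: "'n fn => 'n fn" where "Uf v \<equiv> (%x. tm f v * v x)"

lemma f_Hd: "f \<in> Hd" and fnorm_dS: "fnorm f <= dS" using fs by (auto simp: fsm_def)

lemma Uf_H: "v \<in> Sg ==> Uf v \<in> H" "v \<in> Sg ==> hn (Uf v) = tm f v"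
 using SgD[of v] tm_props(1)[OF fs, of v] by (auto simp: hn_scale intro!: H_scale)

lemma Ba_low: assumes "v \<in> Sg" "tm f v <= T" shows "Ba v >= 1/(p*T powr (p - 1))"
proof -
 note t = tm_props[OF fs assms(1)]
 have "1 <= p*Ba v * tm f v powr (p - 1)" using gfun_max_props(2)[OF p_gt_1 Sg_Ba(1)[OF assms(1)] t(1) _ t(3)] t(2) by blast
 also have "... <= p*Ba v * T powr (p - 1)" using assms(2) t(1) p_gt_1 Sg_Ba(1)[OF assms(1)] by (intro mult_left_mono powr_mono2) auto
 finally show ?thesis using t(1) assms(2) p_gt_1 by (simp add: field_simps)
qed

text \<open>The abstract functional is expressed through its own critical point,
  \<open>f h = ip u h - Nf a u h\<close>, so its behaviour on sequences tending to 0 reduces to an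
  inner product and an integral against a fixed function.\<close>

lemma f_weak:
 assumes z: "!!n. z n \<in> H" "!!n. hn (z n) <= C" "AE x in L. (%n. z n x) ---> 0" and w: "(%n. ip (z n) u) ---> 0"
 shows "(%n. f (z n)) ---> 0"
proof -
 have [measurable]: "u \<in> borel_measurable borel" "!!n. z n \<in> borel_measurable borel" using u_H z(1) H_meas by auto
 have N: "(%n. LINT x|L. a x*max (u x) 0 powr p*z n x) ---> 0"
 proof (rule small_plus_dominated(3)[where e="%n x. abs (z n x) powr (p + 1)" and C="Sq*C powr (p + 1)"])
  show "AE x in L. (%n. a x*max (u x) 0 powr p*z n x) ---> 0" using z(3) by eventually_elim (rule tendsto_mult_right_zero)
  show "(LINT x|L. abs (z n x) powr (p + 1)) <= Sq*C powr (p + 1)" for n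
   using order_trans[OF le_p1[OF z(1)] mult_left_mono[OF powr_mono2[OF _ hn_nonneg z(2)]]] p_gt_1 Sq_pos by simp
  fix ep :: real assume ep: "ep > 0"
  define M where "M = (1/ep) powr (1/p)"
  have M: "M > 0" "(1/M) powr p = ep" using ep p_gt_1 by (auto simp: M_def powr_divide powr_powr)
  have "abs (a x*max (u x) 0 powr p*z n x) <= ep*abs (z n x) powr (p + 1) + M*abs (u x) powr (p + 1)" for n x
  proof -
   have "abs (a x*max (u x) 0 powr p*z n x) = a x*(max (u x) 0 powr p*abs (z n x))" using coefD(2)[OF a_coef, of x] by (simp add: abs_mult)
   also have "... <= 1*(abs (u x) powr p*abs (z n x))" using coefD(2,3)[OF a_coef, of x] pos_powr_le[of p "u x"] p_gt_1 by (intro mult_mono) auto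
   also have "... <= M*abs (u x) powr (p + 1) + (1/M) powr p*abs (z n x) powr (p + 1)" using powr_mult_split[of p M "abs (u x)" "abs (z n x)"] M p_gt_1 by simp
   finally show ?thesis unfolding M(2) by simp
  qed
  thus "\<exists>psa. integrable L psa & (\<forall>n x. abs (a x*max (u x) 0 powr p*z n x) <= ep*abs (z n x) powr (p + 1) + psa x)"
   using int_p1[OF u_H] by (intro exI[of _ "%x. M*abs (u x) powr (p + 1)"]) auto
 qed (use z int_p1 in auto)
 moreover have "f (z n) = ip (z n) u - Nf a u (z n)" for n using u_crit[rule_format, OF z(1)[of n]] by (simp add: DI_def ip_commute)
 ultimately show ?thesis using tendsto_diff[OF w N] by (simp add: Nf_def)
qed

lemma one_minus_a_integrable: "integrable L (%x. 1 - a x)"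
proof -
 obtain C where C: "!!x. 1 - a x <= C * om x powr ((p + 1)/2)" using a_dec by blast
 show ?thesis
 proof (rule integrable_boundI[OF integrable_mult_right[OF om_integrable, of "abs C"]])
  show "abs (1 - a x) <= abs C * om x" for x
  proof -
   have "om x powr ((p + 1)/2) <= om x powr 1" using p_gt_1 om_pos[of x] om_le_1[of x] by (intro powr_mono') auto
   hence "C * om x powr ((p + 1)/2) <= abs C * om x" using om_pos[of x] by (intro mult_mono) auto
   thus ?thesis using C[of x] coefD(3)[OF a_coef, of x] by simp
  qed
 qed simp
qed

text \<open>The remainder \<open>Z\<close> after subtracting the weak limit \<open>u'\<close>
  satisfies asymptotically the equation with constant weight: its squared norm and its power
  integral have the same limit \<open>l\<close>. Energy bookkeeping gives \<open>l < tK^2\<close>,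
  while a positive \<open>l\<close> would have to be at least \<open>tK^2\<close>; so
  \<open>l = 0\<close> and convergence is strong.\<close>

lemma palais_smale:
 assumes v: "!!n. v n \<in> Sg" and J: "(%n. J f (v n)) ---> c" "c < I f u + c0"
  and e: "e ---> 0" "!!n h. h \<in> H ==> abs (DI a f (Uf (v n)) h) <= e n*hn h"
 obtains pha w where "strict_mono (pha :: nat => nat)" "w \<in> Sg" "(%n. dn (v (pha n)) w) ---> 0" "\<forall>h\<in>H. DI a f (Uf w) h = 0" "J f w = c"
proof -
 obtain M where M: "!!n. J f (v n) <= M" using convergent_imp_Bseq[of "%n. J f (v n)"] J(1) by (auto simp: convergent_def Bseq_def abs_le_iff)
 define T where "T = max 1 ((abs M + dS)/kap)"
 have tT: "tm f (v n) <= T" for n unfolding T_def using tm_upper[OF fs v M] .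
 obtain pha u' where pha: "strict_mono (pha :: nat => nat)" and u': "u' \<in> H" "AE x in L. (%n. Uf (v (pha n)) x) ---> u' x" "!!g. g \<in> H ==> (%n. ip (Uf (v (pha n))) g) ---> ip u' g"
  by (rule rellich[of "%n. Uf (v n)" T]) (use Uf_H v tT in auto)
 define Y where "Y n = Uf (v (pha n))" for n
 define t where "t n = tm f (v (pha n))" for n
 define Z where "Z n = (%x. Y n x - u' x)" for n
 have Y: "Y n \<in> H" "hn (Y n) = t n" "t n <= T" "t n >= tlow" "t n > 0" for n
  using Uf_H[OF v] tT tm_props(1,5)[OF fs v] by (auto simp: Y_def t_def)
 have Z: "Z n \<in> H" for n unfolding Z_def by (intro H_diff Y u')
 have aeY: "AE x in L. (%n. Y n x) ---> u' x" and ipY: "!!g. g \<in> H ==> (%n. ip (Y n) g) ---> ip u' g" using u' by (auto simp: Y_def)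
 have epha: "(%n. e (pha n)) ---> 0" using LIMSEQ_subseq_LIMSEQ[OF e(1) pha] by (simp add: o_def)
 have cr: "\<forall>h\<in>H. DI a f u' h = 0"
 proof
  fix h assume h: "h \<in> H"
  have "(%n. DI a f (Y n) h) ---> DI a f u' h" unfolding DI_def
   using Y by (intro tendsto_intros ipY h Nf_weak[OF a_coef _ _ u'(1) aeY h, of T]) auto
  moreover have "(%n. DI a f (Y n) h) ---> 0"
   by (rule tendsto_rabs_zero_cancel[OF tendsto_sandwich[OF _ _ tendsto_const tendsto_mult_left_zero[OF epha, of "hn h"]]]) (use e(2)[OF h] in \<open>auto simp: Y_def\<close>)
  ultimately show "DI a f u' h = 0" by (rule LIMSEQ_unique)
 qed
 note ce = crit_energy[OF f_Hd u'(1) cr]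
 have hZ: "(%n. (hn (Z n))^2 - (t n)\<^sup>2) ---> - (hn u')\<^sup>2"
 proof -
  have "(%n. (hn u')^2 - 2*ip (Y n) u') ---> (hn u')^2 - 2*ip u' u'" by (intro tendsto_intros ipY u')
  thus ?thesis unfolding Z_def hn_sq_diff[OF Y(1) u'(1)] Y(2) by (simp add: hn_sq)
 qed
 have aeZ: "AE x in L. (%n. Z n x) ---> 0" using aeY by eventually_elim (simp add: Z_def LIM_zero)
 have Zb: "hn (Z n) <= T + hn u'" for n using hn_diff_le[OF Y(1) u'(1), of n] Y(2,3)[of n] by (simp add: Z_def)
 have "(%n. ip (Z n) u) ---> 0" unfolding Z_def ip_diff_left[OF Y(1) u'(1) u_H] using LIM_zero[OF ipY[OF u_H]] .
 hence "(%n. f (Z n)) ---> 0" by (rule f_weak[OF Z Zb aeZ])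
 hence fY: "(%n. f (Y n)) ---> f u'" unfolding Z_def dual_diff[OF f_Hd Y(1) u'(1)] by (simp add: LIM_zero_iff)
 have self: "(t n)^2 - Ba (Y n) - f (Y n) = 0" for n
 proof -
  have "DI a f (Y n) (Y n) = 0" using DI_scale[OF f_Hd SgD(1)[OF v], of a "Y n" "t n" "pha n"] DI_tm_self[OF fs v, of "pha n"] by (simp add: Y_def t_def)
  thus ?thesis by (simp add: DI_def Nf_self hn_sq[symmetric] Y(2))
 qed
 have BL: "(%n. Ba (Y n) - Ba (Z n)) ---> Ba u'" unfolding Z_def by (rule brezis_lieb[OF a_coef _ _ u'(1) aeY, of T]) (use Y in auto)
 have df: "(%n. B1 (Z n) - Ba (Z n)) ---> 0" by (rule coef_defect_vanish[OF a_coef one_minus_a_integrable Z Zb aeZ])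
 have "(%n. ((hn (Z n))^2 - (t n)\<^sup>2) + (Ba (Y n) - Ba (Z n)) + f (Y n) - (B1 (Z n) - Ba (Z n))) ---> - (hn u')\<^sup>2 + Ba u' + f u' - 0"
  by (intro tendsto_intros hZ BL fY df)
 moreover have "((hn (Z n))^2 - (t n)\<^sup>2) + (Ba (Y n) - Ba (Z n)) + f (Y n) - (B1 (Z n) - Ba (Z n)) = (hn (Z n))^2 - B1 (Z n)" for n using self[of n] by linarith
 ultimately have ZB: "(%n. (hn (Z n))^2 - B1 (Z n)) ---> 0" using ce(1) by simp
 have Jpha: "(%n. J f (v (pha n))) ---> c" using LIMSEQ_subseq_LIMSEQ[OF J(1) pha] by (simp add: o_def)
 \<comment> \<open>The energy left after the weak limit, divided by \<open>kap\<close>; the level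
   condition and \<open>lowest\<close> bound it by \<open>tK^2\<close>.\<close>
 define l where "l = (c - I f u')/kap"
 have Zl: "(%n. (hn (Z n))^2) ---> l"
 proof -
  have "(%n. (J f (v (pha n)) + p/(p + 1)*f (Y n))/kap + ((hn (Z n))^2 - (t n)\<^sup>2)) ---> (c + p/(p + 1)*f u')/kap + - (hn u')\<^sup>2"
   using kap_pos by (intro tendsto_intros Jpha fY hZ) auto
  moreover have "(J f (v (pha n)) + p/(p + 1)*f (Y n))/kap + ((hn (Z n))^2 - (t n)\<^sup>2) = (hn (Z n))^2" for n
   using kap_pos dual_scale[OF f_Hd SgD(1)[OF v], of "t n" "pha n"] unfolding J_eq(5)[OF fs v] by (simp add: Y_def t_def)
  moreover have "(c + p/(p + 1)*f u')/kap + - (hn u')\<^sup>2 = l" unfolding l_def ce(2) using kap_pos by (simp add: field_simps)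
  ultimately show ?thesis by simp
 qed
 have l0: "l >= 0" using Zl by (rule LIMSEQ_le_const) auto
 have lt: "l < tK^2" using lowest[OF u'(1) cr] J(2) kap_pos unfolding l_def c0_eq by (simp add: field_simps)
 have "l = 0"
 proof (rule ccontr)
  assume "l ~= 0"
  hence l: "l > 0" using l0 by simp
  have "(%n. B1 (Z n)) ---> l" using tendsto_diff[OF Zl ZB] by simp
  moreover have "(%n. KK*((hn (Z n))^2) powr ((p + 1)/2)) ---> KK*l powr ((p + 1)/2)" using l by (intro tendsto_intros Zl) auto
  moreover have "B1 (Z n) <= KK*((hn (Z n))^2) powr ((p + 1)/2)" for n
  proof -
   have "((hn (Z n))^2) powr ((p + 1)/2) = hn (Z n) powr (p + 1)"
    using hn_nonneg[of "Z n"] by (cases "hn (Z n) = 0") (auto simp: powr_powr add_divide_distrib simp flip: powr_numeral)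
   thus ?thesis using B1_le_KK[OF Z] by simp
  qed
  ultimately have "l <= KK*l powr ((p + 1)/2)" by (intro LIMSEQ_le) auto
  also have "... = l*(KK*l powr ((p - 1)/2))" using powr_add[of l "(p - 1)/2" 1] l by (simp add: field_simps)
  also have "... < l*(KK*tK powr (p - 1))"
  proof -
   have "l powr ((p - 1)/2) < (tK^2) powr ((p - 1)/2)" using l lt p_gt_1 by (intro powr_less_mono2) auto
   also have "... = tK powr (p - 1)" using tK_pos by (simp add: powr_powr diff_divide_distrib flip: powr_numeral)
   finally show ?thesis using l KK_pos by simp
  qed
  also have "... = l" using tK_powr by (simp add: mult.commute)
  finally show False by simp
 qed
 hence "(%n. sqrt ((hn (Z n))^2)) ---> sqrt 0" using Zl by (intro tendsto_real_sqrt) simp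
 hence Z0: "(%n. dn (Y n) u') ---> 0" using hn_nonneg by (simp add: Z_def)
 have tlim: "t ---> hn u'" using hn_tendsto(1)[OF Y(1) u'(1) Z0] by (simp add: Y(2))
 \<comment> \<open>The uniform lower bound on the parameters shows that the strong limit is not
   zero, so it can be normalised.\<close>
 have hu: "hn u' >= tlow" using tlim by (rule LIMSEQ_le_const) (use Y in auto)
 hence hp: "hn u' > 0" using tlow_pos by linarith
 define w where "w = (%x. (1/hn u')*u' x)"
 have w: "w \<in> H" "hn w = 1" using normalize[OF u'(1) hp] by (auto simp: w_def)
 have vY: "v (pha n) = (%x. (1/t n)*Y n x)" for n using Y(5)[of n] by (auto simp: Y_def t_def)
 have vw: "(%n. dn (v (pha n)) w) ---> 0" unfolding vY w_def using hp by (intro scaled_tendsto Y u' Z0 tendsto_intros tlim) auto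
 have "(%n. Ba (v (pha n))) ---> Ba w" by (rule hn_tendsto(2)[OF SgD(1)[OF v] w(1) vw a_coef])
 hence "Ba w >= 1/(p*T powr (p - 1))" by (rule LIMSEQ_le_const) (use Ba_low[OF v tT] in blast)
 moreover have "1/(p*T powr (p - 1)) > 0" using p_gt_1 by (simp add: T_def)
 ultimately have "Ba w > 0" by linarith
 hence wS: "w \<in> Sg" using w by (simp add: Sg_iff)
 note tt = tm_tendsto[OF fs v wS vw]
 have tw: "tm f w = hn u'" using LIMSEQ_unique[OF tt(1)] tlim by (simp add: t_def[abs_def])
 have "Uf w = u'" using hp unfolding tw by (simp add: w_def)
 thus thesis using that[OF pha wS vw] cr LIMSEQ_unique[OF tt(2) Jpha] by simp
qed

text \<open>Quantifies the implicit function \<open>tm\<close>. Bernoulli's inequality linearises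
  the power in the first-order condition, and the smallness of \<open>f\<close> makes its slope at
  least \<open>(p + 1)/2\<close>, above the slope 1 of the linear term; the difference
  \<open>(p - 1)/2\<close> is the modulus.\<close>

lemma tm_one_sided:
 assumes v: "v \<in> Sg" "w \<in> Sg" "tm f v <= tm f w"
 shows "(p - 1)/2*(tm f w - tm f v) <= abs (f v - f w) + abs (Ba v - Ba w)*tm f w powr p"
proof -
 define t where "t = tm f v"
 define r where "r = tm f w"
 note tv = tm_props[OF fs v(1), folded t_def] and tw = tm_props[OF fs v(2), folded r_def]
 have tr: "t <= r" using v(3) by (simp add: t_def r_def)
 have "f v <= fnorm f" using dual_bound[OF f_Hd, of v] SgD[OF v(1)] by (simp add: abs_le_iff)
 hence "f v * (2*p) <= fnorm f*(2*p)" using p_gt_1 by (intro mult_right_mono) auto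
 also have "... <= tlow*(p - 1)" using f_small p_gt_1 by (simp add: field_simps)
 also have "... <= t*(p - 1)" using tv(5) p_gt_1 by (intro mult_right_mono) auto
 finally have fv: "f v * (2*p) <= t*(p - 1)" .
 have Bt: "Ba v * t powr p = t - f v" using tv(3) by simp
 have "(r/t) powr p >= 1 + p*(r/t - 1)" using tv(1) tw(1) p_gt_1 by (intro bernoulli_powr) auto
 hence "Ba v * t powr p*(r/t) powr p >= Ba v * t powr p*(1 + p*(r/t - 1))" using Sg_Ba(1)[OF v(1)] by (intro mult_left_mono) auto
 moreover have "t powr p*(r/t) powr p = r powr p" using tv(1) tw(1) by (simp add: powr_divide)
 ultimately have "Ba v * r powr p >= (t - f v)*(1 + p*(r/t - 1))" unfolding Bt[symmetric] by (simp add: mult.assoc)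
 also have "(t - f v)*(1 + p*(r/t - 1)) = (t - f v) + (p*(t - f v)/t)*(r - t)" using tv(1) by (simp add: field_simps)
 finally have 1: "Ba v * r powr p >= (t - f v) + (p*(t - f v)/t)*(r - t)" .
 have "p*(t - f v)/t >= (p + 1)/2" using fv tv(1) by (simp add: field_simps)
 hence 2: "(p*(t - f v)/t)*(r - t) >= (p + 1)/2*(r - t)" using tr by (intro mult_right_mono) auto
 have "(Ba v - Ba w)*r powr p <= abs (Ba v - Ba w)*r powr p" by (intro mult_right_mono) auto
 hence "Ba v * r powr p <= r - f w + abs (Ba v - Ba w)*r powr p" using tw(3) by (simp add: left_diff_distrib)
 hence "(t - f v) + (p + 1)/2*(r - t) <= r - f w + abs (Ba v - Ba w)*r powr p" using 1 2 by linarith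
 moreover have "(p + 1)/2*(r - t) = (p - 1)/2*(r - t) + (r - t)" by (simp add: field_simps)
 ultimately show ?thesis unfolding t_def[symmetric] r_def[symmetric] by linarith
qed

lemma DI_Uf_bound: assumes "v \<in> Sg" "tm f v <= T" "h \<in> H" shows "abs (DI a f (Uf v) h) <= (T + 3*Sq*T powr p + dS)*hn h"
proof -
 note U = Uf_H[OF assms(1)]
 have T: "0 < tm f v" using tm_props(1)[OF fs assms(1)] .
 have "abs (ip (Uf v) h) <= T*hn h" using order_trans[OF ip_CS[OF U(1) assms(3)] mult_right_mono[OF _ hn_nonneg]] U(2) assms(2) by simp
 moreover have "abs (Nf a (Uf v) h) <= 3*Sq*T powr p*hn h"
 proof -
  have "3*Sq*(hn (Uf v) powr p*hn h) <= 3*Sq*(T powr p*hn h)" using Sq_pos assms(2) T p_gt_1 U(2) hn_nonneg by (intro mult_left_mono mult_right_mono powr_mono2) auto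
  thus ?thesis using Nf_bound[OF a_coef U(1) assms(3)] by simp
 qed
 moreover have "abs (f h) <= dS*hn h" using order_trans[OF dual_bound[OF f_Hd assms(3)] mult_right_mono[OF fnorm_dS hn_nonneg]] .
 ultimately show ?thesis unfolding DI_def by (simp add: algebra_simps abs_le_iff)
qed

text \<open>A quadratic upper bound uniform on a sublevel set, with a radius \<open>rh\<close>
  within which the unit sphere does not leave the manifold. At the new point no energy bound is
  known yet, so its parameter is bounded through the power integral instead.\<close>

lemma J_quadratic:
 obtains C rh T where "C > 0" "rh > 0" "T >= 1" "!!v. v \<in> Sg ==> J f v <= c1 ==> tm f v <= T"
  "!!v w. v \<in> Sg ==> J f v <= c1 ==> w \<in> H ==> hn w = 1 ==> dn w v <= rh ==> w \<in> Sg & J f w <= J f v + DJ f v (%x. w x - v x) + C*(dn w v)^2"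
proof -
 define T1 where "T1 = max 1 ((abs c1 + dS)/kap)"
 define be where "be = 1/(p*T1 powr (p - 1))"
 define Kb where "Kb = (p + 1)*(3*Sq) + Ct*3 powr (p - 1)*2"
 \<comment> \<open>\<open>be\<close> bounds the power integral from below on the sublevel and
   \<open>Kb\<close> is its Lipschitz constant, so within \<open>rh\<close> at least
   \<open>be/2\<close> remains.\<close>
 define rh where "rh = be/(2*Kb)"
 define T where "T = max T1 ((2*(1 + dS)/be) powr (1/(p - 1)))"
 define Lt where "Lt = 2/(p - 1)*(dS + Kb*T powr p)"
 define D where "D = T + 3*Sq*T powr p + dS"
 define C where "C = Lt*(D + T*Lq (2*T)) + Rq (3*T)*T^2"
 have T1: "T1 >= 1" "T1 <= T" "T >= 1" by (auto simp: T1_def T_def)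
 have pos: "be > 0" "Kb > 0" "rh > 0" using p_gt_1 T1 Sq_pos Ct_pos by (auto simp: be_def Kb_def rh_def add_pos_pos)
 have Lt: "Lt > 0" using p_gt_1 dS_pos pos by (simp add: Lt_def add_pos_nonneg)
 have D: "D > 0" using T1 Sq_pos dS_pos by (simp add: D_def add_pos_nonneg)
 have C: "C > 0" using Lt D T1 Lq_pos[of "2*T"] Rq_pos[of "3*T"] by (simp add: C_def add_pos_pos)
 have tv: "tm f v <= T" if "v \<in> Sg" "J f v <= c1" for v using tm_upper[OF fs that] T1 by (simp add: T1_def)
 have main: "w \<in> Sg & J f w <= J f v + DJ f v (%x. w x - v x) + C*(dn w v)^2"
  if v: "v \<in> Sg" "J f v <= c1" and w: "w \<in> H" "hn w = 1" and r: "dn w v <= rh" for v w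
 proof -
  define d where "d = dn w v"
  define k where "k = (%x. w x - v x)"
  note vH = SgD[OF v(1)]
  have k: "k \<in> H" "hn k = d" "(%x. v x + k x) = w" unfolding k_def d_def using H_diff[OF w(1) vH(1)] by auto
  have d: "0 <= d" "d <= 2" using hn_nonneg hn_diff_le[OF w(1) vH(1)] by (auto simp: d_def w vH)
  have Bd: "abs (Ba v - Ba w) <= Kb*d"
  proof -
   have 1: "abs (Ba w - Ba v - (p + 1)*Nf a v k) <= Ct*(1 + d) powr (p - 1)*d^2" using Bf_taylor[OF a_coef vH(1) k(1)] by (simp add: k vH)
   have "Ct*(1 + d) powr (p - 1)*d^2 <= Ct*3 powr (p - 1)*(2*d)" using Ct_pos d p_gt_1 by (intro mult_mono powr_mono2) (auto simp: power2_eq_square mult_right_mono)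
   moreover have "(p + 1)*abs (Nf a v k) <= (p + 1)*(3*Sq*d)" using Nf_bound[OF a_coef vH(1) k(1)] p_gt_1 by (intro mult_left_mono) (auto simp: k vH)
   moreover have "abs ((p + 1)*Nf a v k) = (p + 1)*abs (Nf a v k)" using p_gt_1 by (simp add: abs_mult)
   moreover have "Kb*d = (p + 1)*(3*Sq*d) + Ct*3 powr (p - 1)*(2*d)" by (simp add: Kb_def algebra_simps)
   ultimately show ?thesis using 1 by (smt (verit))
  qed
  have Bv: "Ba v >= be" unfolding be_def using tm_upper[OF fs v] by (intro Ba_low[OF v(1)]) (simp add: T1_def)
  have "Kb*d <= Kb*rh" using r pos by (intro mult_left_mono) (auto simp: d_def)
  also have "... = be/2" using pos by (simp add: rh_def)
  finally have Bw: "Ba w >= be/2" using Bd Bv by linarith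
  have wS: "w \<in> Sg" unfolding Sg_iff using w Bw pos by simp
  note tw = tm_props[OF fs wS]
  have twT: "tm f w <= T"
  proof (cases "tm f w <= 1")
   case False
   define r where "r = tm f w"
   have r: "r > 1" using False by (simp add: r_def)
   have fw: "- f w <= dS" using dual_bound[OF f_Hd w(1)] fnorm_dS w by (simp add: abs_le_iff)
   have "Ba w*r powr p <= r + dS" using tw(3) fw by (simp add: r_def)
   also have "... <= r*(1 + dS)" using r dS_pos by (simp add: algebra_simps)
   also have "Ba w*r powr p = r*(Ba w*r powr (p - 1))" using powr_add[of r "p - 1" 1] r by simp
   finally have "Ba w*r powr (p - 1) <= 1 + dS" using r by simp
   moreover have "be/2*r powr (p - 1) <= Ba w*r powr (p - 1)" using Bw by (intro mult_right_mono) auto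
   ultimately have "r powr (p - 1) <= 2*(1 + dS)/be" using pos by (simp add: field_simps)
   hence "(r powr (p - 1)) powr (1/(p - 1)) <= (2*(1 + dS)/be) powr (1/(p - 1))" using p_gt_1 by (intro powr_mono2) auto
   thus ?thesis using r p_gt_1 by (simp add: powr_powr r_def T_def)
  qed (use T1 in simp)
  have fd: "abs (f v - f w) <= dS*d"
   using order_trans[OF dual_bound[OF f_Hd k(1)] mult_right_mono[OF fnorm_dS]] dual_diff[OF f_Hd w(1) vH(1)] d k by (simp add: k_def abs_minus_commute)
  have lip: "abs (tm f w - tm f v) <= Lt*d"
  proof -
   have "(p - 1)/2*abs (tm f w - tm f v) <= dS*d + Kb*d*T powr p"
   proof -
    have B: "abs (Ba v - Ba w)*r powr p <= Kb*d*T powr p" if "0 < r" "r <= T" for r using Bd that p_gt_1 pos d by (intro mult_mono powr_mono2) auto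
    show ?thesis
    proof (cases "tm f v <= tm f w")
     case True
     show ?thesis using tm_one_sided[OF v(1) wS True] B[OF tw(1) twT] fd True by simp
    next
     case False
     show ?thesis using tm_one_sided[OF wS v(1)] B[OF tm_props(1)[OF fs v(1)] tv[OF v]] fd False by (simp add: abs_minus_commute)
    qed
   qed
   hence "abs (tm f w - tm f v) <= 2/(p - 1)*(dS*d + Kb*d*T powr p)" using p_gt_1 by (simp add: field_simps)
   thus ?thesis by (simp add: Lt_def algebra_simps)
  qed
  have "J f w - J f v <= DJ f v k + abs (tm f w - tm f v)*(abs (DI a f (Uf v) k) + T*Lq (2*T)*d) + Rq (3*T)*T^2*d^2"
   using J_step[OF fs v(1) wS tv[OF v] twT] by (simp add: k_def d_def)
  also have "abs (tm f w - tm f v)*(abs (DI a f (Uf v) k) + T*Lq (2*T)*d) <= (Lt*d)*(D*d + T*Lq (2*T)*d)"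
   using lip DI_Uf_bound[OF v(1) tv[OF v] k(1)] Lt d T1 Lq_pos[of "2*T"] by (intro mult_mono add_right_mono) (auto simp: D_def k)
  also have "DJ f v k + (Lt*d)*(D*d + T*Lq (2*T)*d) + Rq (3*T)*T^2*d^2 = DJ f v k + C*d^2" by (simp add: C_def power2_eq_square algebra_simps)
  finally show ?thesis using wS by (simp add: k_def d_def)
 qed
 show thesis by (rule that[OF C pos(3) T1(3) tv main])
qed

end

section \<open>Gradient descent on the manifold and the topological argument\<close>

context perturbed
begin

text \<open>The gradient of the energy at the projected point, tangent to the sphere at
  \<open>v\<close> by \<open>DI_tm_self\<close>. The choice fixes one representative.\<close>

definition gr :: "'n fn => 'n fn" where "gr v = (SOME g. g \<in> H & (\<forall>h\<in>H. ip g h = DI a f (Uf v) h))"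

text \<open>One explicit Euler step of the gradient flow, followed by normalisation. Iterating it
  replaces the flow, so no differential equation has to be solved; partial steps with smaller
  \<open>tha\<close> provide the homotopies.\<close>

definition st :: "real => 'n fn => 'n fn" where "st tha v = nz (%x. v x + (- tha)*gr v x)"

lemma gr: assumes "v \<in> Sg" shows "gr v \<in> H" "h \<in> H ==> ip (gr v) h = DI a f (Uf v) h"
proof -
 obtain C where C: "!!h. h \<in> H ==> abs (DI a f (Uf v) h) <= C*hn h" using DI_bound[OF a_coef f_Hd Uf_H(1)[OF assms]] by blast
 have "\<exists>g. g \<in> H & (\<forall>h\<in>H. ip g h = DI a f (Uf v) h)"
  using riesz[of "DI a f (Uf v)" C, OF DI_add[OF a_coef f_Hd Uf_H(1)[OF assms]] DI_scale[OF f_Hd] C] by blast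
 from someI_ex[OF this] show "gr v \<in> H" "h \<in> H ==> ip (gr v) h = DI a f (Uf v) h" by (auto simp: gr_def)
qed

lemma ip_gr_self: assumes "v \<in> Sg" shows "ip (gr v) v = 0"
 using gr(2)[OF assms SgD(1)[OF assms]] DI_tm_self[OF fs assms] by simp

lemma gr_step: assumes "v \<in> Sg"
 shows "(%x. v x + (- tha)*gr v x) \<in> H" "(hn (%x. v x + (- tha)*gr v x))^2 = 1 + tha^2*(hn (gr v))^2" "hn (%x. v x + (- tha)*gr v x) >= 1"
proof -
 note v = SgD[OF assms] and g = gr(1)[OF assms]
 show "(%x. v x + (- tha)*gr v x) \<in> H" by (rule H_add[OF v(1) H_scale[OF g]])
 show q: "(hn (%x. v x + (- tha)*gr v x))^2 = 1 + tha^2*(hn (gr v))^2"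
  unfolding hn_sq_add[OF v(1) H_scale[OF g]] hn_scale ip_scale_right using ip_gr_self[OF assms] by (simp add: v ip_commute[of v] power_mult_distrib)
 show "hn (%x. v x + (- tha)*gr v x) >= 1"
 proof (rule power2_le_imp_le[OF _ hn_nonneg])
  show "1^2 <= (hn (%x. v x + (- tha)*gr v x))^2" unfolding q by simp
 qed
qed

text \<open>Tangency makes the norm before normalisation \<open>sqrt (1 + (tha * g)^2)\<close>, so
  the step has length at most \<open>tha * g\<close>. The first-order decrease is at least
  \<open>tlow * tha * g^2/2\<close>, and half of it absorbs the quadratic error when
  \<open>C * tha \<le> tlow/4\<close>.\<close>

lemma descent:
 obtains ta ka where "ta > 0" "ka > 0" "!!v tha. v \<in> Sg ==> J f v <= c1 ==> 0 <= tha ==> tha <= ta ==> st tha v \<in> Sg & J f (st tha v) <= J f v - ka*tha*(hn (gr v))^2"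
proof -
 obtain C rh T where C: "C > 0" and rh: "rh > 0" and T: "T >= 1" "!!v. v \<in> Sg ==> J f v <= c1 ==> tm f v <= T"
  and step: "!!v w. v \<in> Sg ==> J f v <= c1 ==> w \<in> H ==> hn w = 1 ==> dn w v <= rh ==> w \<in> Sg & J f w <= J f v + DJ f v (%x. w x - v x) + C*(dn w v)^2"
  by (rule J_quadratic[of c1]) blast
 define D where "D = T + 3*Sq*T powr p + dS"
 have D: "D > 0" using T Sq_pos dS_pos by (simp add: D_def add_pos_nonneg)
 define ta where "ta = min (min rh 1/D) (tlow/(4*C))"
 have ta: "ta > 0" "ta*D <= min rh 1" "C*ta <= tlow/4"
 proof -
  show "ta > 0" using D C rh tlow_pos by (simp add: ta_def)
  have "ta*D <= (min rh 1/D)*D" using D by (intro mult_right_mono) (auto simp: ta_def)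
  thus "ta*D <= min rh 1" using D by simp
  have "C*ta <= C*(tlow/(4*C))" using C by (intro mult_left_mono) (auto simp: ta_def)
  thus "C*ta <= tlow/4" using C by simp
 qed
 have "st tha v \<in> Sg & J f (st tha v) <= J f v - (tlow/4)*tha*(hn (gr v))^2" if v: "v \<in> Sg" "J f v <= c1" and tha: "0 <= tha" "tha <= ta" for v tha
 proof -
  define X where "X = (%x. v x + (- tha)*gr v x)"
  define q where "q = hn X"
  define g where "g = hn (gr v)"
  note vH = SgD[OF v(1)] and gH = gr(1)[OF v(1)]
  note gs = gr_step[OF v(1), of tha, folded X_def, folded q_def g_def]
  have g0: "g >= 0" using hn_nonneg by (simp add: g_def)
  have gD: "g <= D"
  proof (cases "g = 0")
   case False
   have "g^2 = DI a f (Uf v) (gr v)" unfolding g_def hn_sq gr(2)[OF v(1) gH] ..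
   also have "... <= D*g" using DI_Uf_bound[OF v(1) T(2)[OF v] gH] by (simp add: D_def g_def abs_le_iff)
   finally show ?thesis using False g0 by (simp add: power2_eq_square)
  qed (use D in simp)
  have "tha*g <= ta*D" using tha gD g0 ta by (intro mult_mono) auto
  hence tg: "tha*g <= rh" "tha*g <= 1" "0 <= tha*g" using ta(2) tha g0 by auto
  have qle: "q <= 1 + (tha*g)^2/2"
  proof (rule power2_le_imp_le)
   show "q^2 <= (1 + (tha*g)^2/2)^2" unfolding gs(2) by (simp add: power2_sum power_mult_distrib)
  qed simp
  have "(tha*g)^2 <= 1" using tg by (simp add: power_le_one)
  hence q: "1 <= q" "q <= 2" using gs(3) qle by auto
  define w where "w = st tha v"
  have w: "w = (%x. (1/q)*X x)" by (simp add: w_def st_def nz_def X_def q_def)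
  have wH: "w \<in> H" "hn w = 1" using normalize[of X] gs(1) q by (auto simp: w q_def)
  have ipw: "ip h w = (1/q)*(ip h v - tha*ip h (gr v))" if "h \<in> H" for h
   unfolding w ip_scale_right X_def ip_add_right[OF vH(1) H_scale[OF gH] that] by simp
  have "ip w v = 1/q" using ipw[OF vH(1)] ip_gr_self[OF v(1)] by (simp add: ip_commute[of w] ip_commute[of v "gr v"] vH flip: hn_sq)
  hence "(dn w v)^2 = 2 - 2/q" unfolding hn_sq_diff[OF wH(1) vH(1)] by (simp add: wH vH)
  also have "... <= (tha*g)^2"
  proof -
   have "2 - 2/q = 2*(q - 1)/q" using q by (simp add: field_simps)
   also have "... <= 2*(q - 1)/1" using q by (intro divide_left_mono) auto
   finally show ?thesis using qle by simp
  qed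
  finally have d2: "(dn w v)^2 <= (tha*g)^2" .
  have "dn w v <= tha*g" by (rule power2_le_imp_le[OF d2 tg(3)])
  hence st: "w \<in> Sg" "J f w <= J f v + DJ f v (%x. w x - v x) + C*(dn w v)^2" using step[OF v wH] tg by auto
  have "DI a f (Uf v) (%x. w x - v x) = - tha*g^2/q"
   unfolding gr(2)[OF v(1) H_diff[OF wH(1) vH(1)], symmetric] ip_diff_right[OF wH(1) vH(1) gH] ipw[OF gH] using ip_gr_self[OF v(1)] by (simp add: g_def hn_sq)
  hence "DJ f v (%x. w x - v x) = - (tm f v * (tha*g^2)/q)" by (simp add: DJ_def)
  also have "... <= - (tlow*(tha*g^2)/2)"
  proof -
   have "tlow*(tha*g^2)/2 <= tm f v * (tha*g^2)/q" using q tm_props(1,5)[OF fs v(1)] tha tlow_pos by (intro frac_le mult_right_mono) auto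
   thus ?thesis by simp
  qed
  finally have 1: "DJ f v (%x. w x - v x) <= - (tlow*(tha*g^2)/2)" .
  have "C*(dn w v)^2 <= C*(tha*g)^2" using d2 C by (intro mult_left_mono) auto
  also have "... = (C*tha)*(tha*g^2)" by (simp add: power2_eq_square mult_ac)
  also have "... <= (tlow/4)*(tha*g^2)"
  proof (rule mult_right_mono)
   show "C*tha <= tlow/4" using ta(3) mult_left_mono[OF tha(2), of C] C by linarith
  qed (use tha in simp)
  finally have "J f w <= J f v - (tlow/4)*(tha*g^2)" using 1 st(2) by linarith
  thus ?thesis using st(1) by (simp add: w_def g_def mult.assoc)
 qed
 thus thesis using that[of ta "tlow/4"] ta(1) tlow_pos by simp
qed

lemma nz_tendsto:
 assumes "!!n. g n \<in> H" "G \<in> H" "(%n. dn (g n) G) ---> 0" "hn G > 0"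
 shows "(%n. dn (nz (g n)) (nz G)) ---> 0"
 unfolding nz_def using assms by (intro scaled_tendsto tendsto_intros hn_tendsto(1)) auto

lemma sum_tendsto:
 assumes "!!n. g n \<in> H" "G \<in> H" "(%n. dn (g n) G) ---> 0" "!!n. k n \<in> H" "K \<in> H" "(%n. dn (k n) K) ---> 0"
 shows "(%n. dn (%x. g n x + k n x) (%x. G x + K x)) ---> 0"
proof (rule tendsto_sandwich[OF _ _ tendsto_const])
 show "(%n. dn (g n) G + dn (k n) K) ---> 0" using tendsto_add[OF assms(3,6)] by simp
 have "dn (%x. g n x + k n x) (%x. G x + K x) <= dn (g n) G + dn (k n) K" for n
  using hn_triangle[OF H_diff[OF assms(1)[of n] assms(2)] H_diff[OF assms(4)[of n] assms(5)]] by (simp add: algebra_simps)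
 thus "\<forall>\<^sub>F n in sequentially. dn (%x. g n x + k n x) (%x. G x + K x) <= dn (g n) G + dn (k n) K" by simp
qed (simp add: hn_nonneg)

lemma gr_tendsto:
 assumes v: "!!n. v n \<in> Sg" "w \<in> Sg" "(%n. dn (v n) w) ---> 0"
 shows "(%n. dn (gr (v n)) (gr w)) ---> 0"
proof -
 note tl = tm_tendsto(1)[OF fs v]
 have U: "(%n. dn (Uf (v n)) (Uf w)) ---> 0" using v SgD by (intro scaled_tendsto tl) auto
 obtain M where M: "!!n. tm f (v n) <= M" using convergent_imp_Bseq[of "%n. tm f (v n)"] tl by (auto simp: convergent_def Bseq_def abs_le_iff)
 have b: "dn (gr (v n)) (gr w) <= Lq (M + tm f w)*dn (Uf (v n)) (Uf w)" for n
 proof -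
  define k where "k = (%x. gr (v n) x - gr w x)"
  have k: "k \<in> H" unfolding k_def by (intro H_diff gr v)
  have "(hn k)^2 = ip (gr (v n)) k - ip (gr w) k" unfolding hn_sq using ip_diff_left[OF gr(1)[OF v(1)[of n]] gr(1)[OF v(2)] k] by (simp add: k_def)
  also have "... <= Lq (tm f (v n) + tm f w)*dn (Uf (v n)) (Uf w)*hn k"
   using DI_lip[OF a_coef f_Hd Uf_H(1)[OF v(1)[of n]] Uf_H(1)[OF v(2)] k] gr(2)[OF v(1)[of n] k] gr(2)[OF v(2) k] by (simp add: Uf_H v abs_le_iff)
  also have "... <= Lq (M + tm f w)*dn (Uf (v n)) (Uf w)*hn k"
   using M[of n] tm_props(1)[OF fs v(1)[of n]] tm_props(1)[OF fs v(2)] hn_nonneg by (intro mult_right_mono Lq_mono) auto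
  finally have "hn k*hn k <= (Lq (M + tm f w)*dn (Uf (v n)) (Uf w))*hn k" by (simp add: power2_eq_square)
  thus ?thesis using hn_nonneg[of k] hn_nonneg Lq_pos[of "M + tm f w"] unfolding k_def[symmetric] by (cases "hn k = 0") (auto simp: less_imp_le)
 qed
 show ?thesis
  by (rule tendsto_sandwich[OF _ _ tendsto_const tendsto_mult_right_zero[OF U, of "Lq (M + tm f w)"]]) (use b hn_nonneg in auto)
qed

lemma st_tendsto:
 assumes v: "!!n. v n \<in> Sg" "w \<in> Sg" "(%n. dn (v n) w) ---> 0" "tha ---> t"
 shows "(%n. dn (st (tha n) (v n)) (st t w)) ---> 0"
 unfolding st_def
proof (intro nz_tendsto sum_tendsto scaled_tendsto gr_tendsto v tendsto_minus gr_step(1) gr(1) H_scale SgD(1))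
 show "hn (%x. w x + - t*gr w x) > 0" using gr_step(3)[OF v(2), of t] by linarith
qed

lemma st_0: "v \<in> Sg ==> st 0 v = v" by (simp add: st_def nz_def SgD)

lemma bary_tendsto:
 assumes "!!n. v n \<in> Sg" "w \<in> Sg" "(%n. dn (v n) w) ---> 0" shows "(%n. bary (v n)) ---> bary w"
proof (rule Lim_null_comparison[THEN LIM_zero_cancel])
 show "\<forall>\<^sub>F n in sequentially. norm (bary (v n) - bary w) <= dn (v n) w*5"
  using bary_lip[OF SgD(1)[OF assms(1)] SgD(1)[OF assms(2)]] by (intro always_eventually) (simp add: SgD(2)[OF assms(1)] SgD(2)[OF assms(2)])
 show "(%n. dn (v n) w*5) ---> 0" by (rule tendsto_mult_left_zero[OF assms(3)])
qed

abbreviation crit :: "'n fn => bool" where "crit v \<equiv> v \<in> Sg & (\<forall>h\<in>H. DI a f (Uf v) h = 0) & J f v < I f u + c0"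

text \<open>The maximal energy on the test sphere fixes a sublevel strictly below the compactness
  threshold, and descent stays inside it. With a single critical point every orbit converges in
  energy to the same value \<open>cm\<close>, and a compactness argument makes the number of steps
  uniform over the sphere.\<close>

lemma two_critical_points: "\<exists>v1 v2. crit v1 & crit v2 & ~ (AE x in L. v1 x = v2 x)"
proof (rule ccontr)
 assume no: "~ ?thesis"
 define ga where "ga y = nz (%x. u x + wy y x)" for y
 let ?K = "sphere (0 :: real^'n) R"
 have gaS: "ga y \<in> Sg" "J f (ga y) < I f u + c0" "bary (ga y) \<bullet> y > 0" if "y \<in> ?K" for y using family[of y] that by (auto simp: ga_def)
 have gat: "(%n. dn (ga (y n)) (ga l)) ---> 0" if "y ---> l" "l \<in> ?K" for y l
  unfolding ga_def using family[of l] that u_H wy_H by (intro nz_tendsto sum_tendsto wy_tendsto H_add) (auto simp: hn_zero)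
 have "continuous_on ?K (%y. J f (ga y))" unfolding continuous_on_sequentially
 proof (intro allI ballI impI)
  fix y l assume l: "l \<in> ?K" and y: "(\<forall>n. y n \<in> ?K) & y ---> l"
  show "((%y. J f (ga y)) \<circ> y) ---> J f (ga l)" using tm_tendsto(2)[OF fs gaS(1) gaS(1)[OF l] gat[OF _ l]] y by (auto simp: o_def)
 qed
 moreover obtain y0 :: "real^'n" where y0: "y0 \<in> ?K" using vector_choose_size[of R] R_pos by (auto simp: less_imp_le)
 ultimately obtain ym where ym: "ym \<in> ?K" "!!y. y \<in> ?K ==> J f (ga y) <= J f (ga ym)" using continuous_attains_sup[of ?K "%y. J f (ga y)"] by auto
 define c1 where "c1 = J f (ga ym)"
 define A where "A = {v \<in> Sg. J f v <= c1}"
 have c1: "c1 < I f u + c0" using gaS(2)[OF ym(1)] by (simp add: c1_def)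
 have gaA: "ga y \<in> A" if "y \<in> ?K" for y using gaS(1)[OF that] ym(2)[OF that] by (simp add: A_def c1_def)
 obtain ta ka where ta: "ta > 0" "ka > 0" and desc: "!!v tha. v \<in> Sg ==> J f v <= c1 ==> 0 <= tha ==> tha <= ta ==> st tha v \<in> Sg & J f (st tha v) <= J f v - ka*tha*(hn (gr v))^2"
  by (rule descent[of c1]) blast
 have stA: "st tha v \<in> A" "J f (st tha v) <= J f v" if "v \<in> A" "0 <= tha" "tha <= ta" for tha v
 proof -
  have "ka*tha*(hn (gr v))^2 >= 0" using ta that by simp
  thus "st tha v \<in> A" "J f (st tha v) <= J f v" using desc[of v tha] that by (auto simp: A_def)
 qed
 define S where "S n = (st ta ^^ n)" for n
 have SS: "S (Suc n) v = st ta (S n v)" for n v by (simp add: S_def)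
 have SA: "S n v \<in> A" if "v \<in> A" for n v using that ta stA by (induction n) (auto simp: S_def)
 have dec: "decseq (%n. J f (S n v))" if "v \<in> A" for v using stA(2)[OF SA[OF that]] ta by (auto simp: decseq_Suc_iff SS)
 \<comment> \<open>If a full descent step does not lower the energies in the limit, the gradients
   tend to 0 and the Palais-Smale condition applies.\<close>
 have ps: "\<exists>pha w. strict_mono (pha :: nat => nat) & crit w & (%n. dn (v (pha n)) w) ---> 0 & J f w = c"
  if v: "!!n. v n \<in> A" and J: "(%n. J f (v n)) ---> c" and J2: "(%n. J f (st ta (v n))) ---> c" for v c
 proof -
  have "c <= c1" using J by (rule LIMSEQ_le_const2) (use v in \<open>auto simp: A_def\<close>)
  hence cc: "c < I f u + c0" using c1 by simp
  have "(%n. (hn (gr (v n)))^2) ---> 0"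
  proof (rule tendsto_sandwich[OF _ _ tendsto_const])
   show "(%n. (J f (v n) - J f (st ta (v n)))/(ka*ta)) ---> 0" using tendsto_divide[OF tendsto_diff[OF J J2] tendsto_const, of "ka*ta"] ta by simp
   have "(hn (gr (v n)))^2 <= (J f (v n) - J f (st ta (v n)))/(ka*ta)" for n using desc[of "v n" ta] v[of n] ta by (simp add: A_def field_simps)
   thus "\<forall>\<^sub>F n in sequentially. (hn (gr (v n)))^2 <= (J f (v n) - J f (st ta (v n)))/(ka*ta)" by simp
  qed simp
  hence e: "(%n. hn (gr (v n))) ---> 0" using tendsto_real_sqrt[of "%n. (hn (gr (v n)))^2" 0] hn_nonneg by simp
  have vS: "v n \<in> Sg" for n using v by (simp add: A_def)
  have dib: "abs (DI a f (Uf (v n)) h) <= hn (gr (v n))*hn h" if "h \<in> H" for n h using ip_CS[OF gr(1)[OF vS] that] gr(2)[OF vS that] by simp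
  show ?thesis by (rule palais_smale[OF vS J cc e dib]) (use cc in blast)+
 qed
 have orb: "\<exists>w. crit w & (%n. J f (S n v)) ---> J f w" if v: "v \<in> A" for v
 proof -
  have "J f (S n v) >= 0" for n using J_eq(4)[OF fs, of "S n v"] SA[OF v, of n] by (simp add: A_def)
  then obtain c where c: "(%n. J f (S n v)) ---> c" using decseq_convergent[OF dec[OF v], of 0] by blast
  show ?thesis using ps[OF SA[OF v] c] LIMSEQ_Suc[OF c] c unfolding SS by blast
 qed
 obtain w0 where w0: "crit w0" using orb[OF gaA[OF y0]] by blast
 have uq: "dn w w0 = 0" "J f w = J f w0" if "crit w" for w
 proof -
  have "AE x in L. w x = w0 x" using no that w0 by blast
  hence "AE x in L. w x - w0 x = 0" by eventually_elim simp
  thus d: "dn w w0 = 0" using hn_eq_0_iff[OF H_diff] SgD that w0 by blast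
  have "(%n::nat. J f w) ---> J f w0" using that w0 d by (intro tm_tendsto(2)[OF fs]) auto
  thus "J f w = J f w0" by (simp add: LIMSEQ_const_iff)
 qed
 define cm where "cm = J f w0"
 have lim: "(%n. J f (S n v)) ---> cm" and cml: "cm <= J f v" if v: "v \<in> A" for v
 proof -
  show l: "(%n. J f (S n v)) ---> cm" using orb[OF v] uq(2) by (auto simp: cm_def)
  show "cm <= J f v" using decseq_ge[OF dec[OF v] l, of 0] by (simp add: S_def)
 qed
 have b0: "bary w0 ~= 0" using w0 bary0 by blast
 \<comment> \<open>On the unit sphere of \<open>H\<close> the barycentre has Lipschitz constant
   \<open>1 + (1 + 1)^2 = 5\<close>, so distance below \<open>etaa\<close> keeps barycentres within
   \<open>norm (bary w0)\<close> of \<open>bary w0\<close>.\<close>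
 define etaa where "etaa = norm (bary w0)/5"
 have etaa: "etaa > 0" using b0 by (simp add: etaa_def)
 obtain ep where ep: "ep > 0" "!!v. v \<in> A ==> J f v < cm + ep ==> dn v w0 < etaa"
 proof (rule ccontr)
  assume nt: "~ thesis"
  have "\<exists>v. v \<in> A & J f v < cm + 1/real (Suc n) & ~ dn v w0 < etaa" for n using nt that[of "1/real (Suc n)"] by auto
  then obtain v where v: "!!n. v n \<in> A" "!!n. J f (v n) < cm + 1/real (Suc n)" "!!n. ~ dn (v n) w0 < etaa" by metis
  have up: "(%n. cm + 1/real (Suc n)) ---> cm" using tendsto_add[OF tendsto_const LIMSEQ_Suc[OF lim_1_over_n], of cm] by simp
  have J: "(%n. J f (v n)) ---> cm" by (rule tendsto_sandwich[OF _ _ tendsto_const up]) (use cml[OF v(1)] less_imp_le[OF v(2)] in \<open>auto intro!: always_eventually\<close>)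
  have J2: "(%n. J f (st ta (v n))) ---> cm" by (rule tendsto_sandwich[OF _ _ tendsto_const J]) (use cml stA v ta in auto)
  obtain pha w where w: "crit w" "(%n. dn (v (pha n)) w) ---> 0" using ps[OF v(1) J J2] by blast
  have vH: "v n \<in> H" for n using v(1)[of n] SgD by (auto simp: A_def)
  obtain n where "dn (v (pha n)) w < etaa" using order_tendstoD(2)[OF w(2) etaa] by (auto simp: eventually_sequentially)
  thus False using v(3)[of "pha n"] hn_diff_triangle[OF vH[of "pha n"] SgD(1) SgD(1), of w w0] w w0 uq(1)[OF w(1)] by auto
 qed
 have St: "(%k. dn (S n (v k)) (S n w)) ---> 0" if "!!k. v k \<in> A" "w \<in> A" "(%k. dn (v k) w) ---> 0" for n v w
 proof (induction n)
  case (Suc n)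
  show ?case unfolding SS using Suc SA that by (intro st_tendsto) (auto simp: A_def)
 qed (simp add: S_def that)
 \<comment> \<open>As in Dini's theorem: energies decrease in the number of steps and each iterate
   depends continuously on the starting point, so the sphere reaches the small sublevel after
   finitely many steps.\<close>
 have "\<exists>n. \<forall>y\<in>?K. J f (S n (ga y)) < cm + ep"
 proof (rule ccontr)
  assume "~ ?thesis"
  then obtain y where y: "!!n. y n \<in> ?K" "!!n. ~ J f (S n (ga (y n))) < cm + ep" by metis
  obtain l si where l: "l \<in> ?K" "strict_mono (si :: nat => nat)" "(y \<circ> si) ---> l"
   using compact_sphere[of 0 R, unfolded compact_def, rule_format, of y] y by blast
  have "cm + ep <= J f (S m (ga l))" for m
  proof (rule LIMSEQ_le_const)
   show "(%n. J f (S m (ga (y (si n))))) ---> J f (S m (ga l))"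
    using SA[OF gaA] y(1) l by (intro tm_tendsto(2)[OF fs] St gaA gat) (auto simp: A_def o_def)
   show "\<exists>N. \<forall>n\<ge>N. cm + ep <= J f (S m (ga (y (si n))))"
   proof (intro exI[of _ m] allI impI)
    fix n assume "n >= m"
    hence "m <= si n" using seq_suble[OF l(2), of n] by simp
    from decseqD[OF dec[OF gaA[OF y(1)]] this] y(2)[of "si n"] show "cm + ep <= J f (S m (ga (y (si n))))" by (meson linorder_not_less order_trans)
   qed
  qed
  from LIMSEQ_le_const[OF lim[OF gaA[OF l(1)]], of "cm + ep"] this ep(1) show False by auto
 qed
 then obtain N where N: "!!y. y \<in> ?K ==> J f (S N (ga y)) < cm + ep" by blast
 let ?h = "homotopic_with_canon (%_. True) ?K (- {0 :: real^'n})"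
 have bA: "bary v ~= 0" if "v \<in> A" for v using bary0[of v] that c1 by (auto simp: A_def)
 define b where "b n y = bary (S n (ga y))" for n y
 \<comment> \<open>Partial steps \<open>st (t * ta)\<close> join consecutive iterates inside the
   sublevel, where the barycentre avoids the origin.\<close>
 have ht: "?h (b n) (b (Suc n))" for n
 proof -
  let ?F = "%z :: real \<times> (real^'n). bary (st (fst z*ta) (S n (ga (snd z))))"
  have FA: "st (t*ta) (S n (ga y)) \<in> A" if "t \<in> {0..1}" "y \<in> ?K" for t y
   using SA[OF gaA[OF that(2)]] that ta by (intro stA) (auto simp: mult_left_le_one_le)
  have cF: "continuous_on ({0..1} \<times> ?K) ?F" unfolding continuous_on_sequentially
  proof (intro allI ballI impI)
   fix z and l :: "real \<times> (real^'n)" assume l: "l \<in> {0..1} \<times> ?K" and z: "(\<forall>n. z n \<in> {0..1} \<times> ?K) & z ---> l"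
   have zk: "fst (z k) \<in> {0..1}" "snd (z k) \<in> ?K" "fst l \<in> {0..1}" "snd l \<in> ?K" for k using z l by (auto simp: mem_Times_iff)
   have "(%k. dn (S n (ga (snd (z k)))) (S n (ga (snd l)))) ---> 0" using zk z by (intro St gaA gat tendsto_snd) auto
   hence "(%k. dn (st (fst (z k)*ta) (S n (ga (snd (z k))))) (st (fst l*ta) (S n (ga (snd l))))) ---> 0"
    using SA[OF gaA] zk z by (intro st_tendsto tendsto_intros) (auto simp: A_def)
   thus "(?F \<circ> z) ---> ?F l" unfolding o_def using FA zk by (intro bary_tendsto) (auto simp: A_def)
  qed
  have F0: "?F z ~= 0" if "z \<in> {0..1} \<times> ?K" for z using bA[OF FA[of "fst z" "snd z"]] that by (auto simp: mem_Times_iff)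
  have cm: "continuous_map (prod_topology (top_of_set {0..1}) (top_of_set ?K)) (top_of_set (- {0})) ?F"
   unfolding prod_topology_subtopology_eu continuous_map_subtopology_eu using cF F0 by (auto simp: mem_Times_iff)
  have hF: "?h (%y. ?F (0, y)) (%y. ?F (1, y))" unfolding homotopic_with_def by (intro exI[of _ ?F] conjI cm allI ballI refl TrueI)
  have Fe: "?F (0, y) = b n y" "?F (1, y) = b (Suc n) y" if "y \<in> ?K" for y
   using st_0[of "S n (ga y)"] SA[OF gaA[OF that], of n] by (auto simp: A_def b_def SS)
  show ?thesis by (rule homotopic_with_eq[OF hF]) (use Fe in auto)
 qed
 have bc: "continuous_on ?K (b n)" for n using homotopic_with_imp_continuous[OF ht[of n]] by blast
 \<comment> \<open>The barycentre of each test function has positive inner product with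
   \<open>y\<close>, so the segment from \<open>y\<close> to it misses the origin.\<close>
 have "?h id (b 0)"
 proof (rule homotopic_with_linear)
  fix y assume y: "y \<in> ?K"
  show "closed_segment (id y) (b 0 y) \<subseteq> - {0}"
  proof
   fix z assume "z \<in> closed_segment (id y) (b 0 y)"
   then obtain t where t: "0 <= t" "t <= 1" "z = (1 - t) *\<^sub>R y + t *\<^sub>R b 0 y" by (auto simp: closed_segment_def)
   have "(y \<bullet> y) > 0" "b 0 y \<bullet> y > 0" using gaS(3)[OF y] y R_pos by (auto simp: b_def S_def)
   hence "z \<bullet> y > 0" unfolding t(3) inner_add_left inner_scaleR_left using t(1,2)
    by (cases "t = 0") (auto intro!: add_nonneg_pos simp: not_le)
   thus "z \<in> - {0}" by auto
  qed
 qed (use bc in auto)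
 moreover have "?h (b 0) (b n)" for n
 proof (induction n)
  case 0 show ?case using bc[of 0] bA gaA by (intro homotopic_with_linear) (auto simp: b_def S_def)
 next
  case (Suc n) show ?case by (rule homotopic_with_trans[OF Suc ht])
 qed
 moreover have "?h (b N) (%_. bary w0)"
 proof (rule homotopic_with_linear[OF bc continuous_on_const])
  fix y assume y: "y \<in> ?K"
  have AN: "S N (ga y) \<in> A" using SA[OF gaA[OF y]] .
  have "norm (b N y - bary w0) <= dn (S N (ga y)) w0*5"
   using bary_lip[OF SgD(1) SgD(1), of "S N (ga y)" w0] AN w0 by (simp add: A_def SgD(2) b_def)
  also have "... < etaa*5" using ep(2)[OF AN N[OF y]] by simp
  finally have lt: "norm (b N y - bary w0) < norm (bary w0)" by (simp add: etaa_def)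
  show "closed_segment (b N y) (bary w0) \<subseteq> - {0}"
  proof
   fix z assume "z \<in> closed_segment (b N y) (bary w0)"
   hence "norm (z - bary w0) <= norm (b N y - bary w0)" using segment_bound(2)[of z "b N y" "bary w0"] by (simp add: norm_minus_commute)
   thus "z \<in> - {0}" using lt by auto
  qed
 qed
 ultimately have "?h id (%_. bary w0)" by (meson homotopic_with_trans)
 hence "homotopic_with_canon (%_. True) ?K ?K ((%x. (R/norm x) *\<^sub>R x) \<circ> id) ((%x. (R/norm x) *\<^sub>R x) \<circ> (%_. bary w0))"
  by (rule homotopic_with_compose_continuous_left) (use R_pos in \<open>auto intro!: continuous_intros\<close>)
 hence "homotopic_with_canon (%_. True) ?K ?K id (%_. (R/norm (bary w0)) *\<^sub>R bary w0)"
  by (rule homotopic_with_eq) (use R_pos in auto)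
 hence "contractible ?K" unfolding contractible_def by blast
 thus False using R_pos by (simp add: contractible_sphere)
qed

end

section \<open>Choice of the smallness threshold and conclusion\<close>

context setting
begin

lemma I_AE_cong:
 assumes "f \<in> Hd" "u \<in> H" "v \<in> H" "AE x in L. u x = v x" shows "I f u = I f v"
 using hn_AE_cong[OF assms(2) H_meas[OF assms(3)] assms(4)] Bf_AE_cong[OF H_meas[OF assms(2)] H_meas[OF assms(3)] a_coef assms(4)] dual_AE_cong[OF assms]
 by (simp add: Ifun_eq)

text \<open>Nonpositive energy of the local minimiser gives \<open>k * hn u \<le> fnorm f\<close>,
  so one smallness condition on \<open>f\<close> controls \<open>u\<close> as well. The minimiser is
  replaced by its positive part, which is a nonzero supersolution and therefore has the lower
  barrier that produces the interaction.\<close>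

lemma multiplicity:
 assumes r1: "r1 > 0" and d1: "d1 > 0"
  and locmin: "\<forall>f\<in>Hd. nonneg_dual s f & nonzero_dual s f & fnorm f <= d1 --> strictly_convex_on_Hs s (Hball s r1) (I f) &
    (\<exists>u\<in>Hball s r1. crit_Hs s (I f) u & (\<forall>v\<in>Hball s r1. crit_Hs s (I f) v --> (AE x in L. v x = u x)))"
 shows "\<exists>d5. 0 < d5 & d5 <= d1 & (\<forall>f\<in>Hd. nonneg_dual s f & nonzero_dual s f & fnorm f <= d5 -->
    (\<forall>u\<in>Hball s r1. crit_Hs s (I f) u --> (\<exists>v1 v2. crit_Sigma s (J f) v1 & crit_Sigma s (J f) v2 &
       ~ (AE x in L. v1 x = v2 x) & J f v1 < I f u + c0 & J f v2 < I f u + c0)))"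
proof -
 obtain de where de: "de > 0" "!!f u y. fsm f ==> nonneg_dual s f ==> u \<in> H ==> (!!x. u x >= 0) ==> \<forall>h\<in>H. DI a f u h = 0 ==> hn u <= de ==>
   Xe u y > 0 ==> mdef y <= Xe u y/2 ==> nz (%x. u x + wy y x) \<in> Sg & hn (%x. u x + wy y x) > 0 & J f (nz (%x. u x + wy y x)) < I f u + c0"
  by (rule energy_estimate) blast
 obtain db where db: "db > 0" "!!f v. fsm f ==> fnorm f <= db ==> v \<in> Sg ==> J f v < c0 ==> bary v ~= 0" by (rule low_energy_bary) blast
 obtain dd' Rd where dr: "dd' > 0" "!!u y. u \<in> H ==> hn u <= dd' ==> norm y >= Rd ==> y ~= 0 ==> hn (%x. u x + wy y x) > 0 ==> bary (nz (%x. u x + wy y x)) \<bullet> y > 0"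
  by (rule bary_direction) blast
 define k where "k = kap*(p + 1)/p"
 have k: "k > 0" using kap_pos p_gt_1 by (simp add: k_def)
 \<comment> \<open>In this order the bounds secure: the hypothesis on \<open>f\<close>, the maximum
   on every ray, the modulus of \<open>tm\<close>, nonnegative energy of critical points outside the
   ball, nonvanishing barycentres, and, through \<open>k\<close>, the smallness of \<open>u\<close>
   required by the energy and direction estimates.\<close>
 define d5 where "d5 = min d1 (min dS (min (tlow*(p - 1)/(2*p)) (min (kap*r1) (min db (min (k*de) (k*dd'))))))"
 have d5: "d5 > 0" "d5 <= d1" "d5 <= dS" "d5 <= tlow*(p - 1)/(2*p)" "d5 <= kap*r1" "d5 <= db" "d5 <= k*de" "d5 <= k*dd'"
  using d1 dS_pos tlow_pos p_gt_1 kap_pos r1 db(1) de(1) dr(1) k by (simp_all add: d5_def min_le_iff_disj)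
 have "\<exists>v1 v2. crit_Sigma s (J f) v1 & crit_Sigma s (J f) v2 & ~ (AE x in L. v1 x = v2 x) & J f v1 < I f u0 + c0 & J f v2 < I f u0 + c0"
  if f: "f \<in> Hd" "nonneg_dual s f" "nonzero_dual s f" "fnorm f <= d5" and u0: "u0 \<in> Hball s r1" "crit_Hs s (I f) u0" for f u0
 proof -
  note ci = crit_Hs_iff[OF a_coef f(1)]
  have fs: "fsm f" using f d5 by (simp add: fsm_def)
  have u0H: "u0 \<in> H" and cr0: "\<forall>h\<in>H. DI a f u0 h = 0" using u0(2) ci by auto
  obtain u1 where sc: "strictly_convex_on_Hs s (Hball s r1) (I f)" and u1: "!!v. v \<in> Hball s r1 ==> crit_Hs s (I f) v ==> AE x in L. v x = u1 x"
   using locmin[rule_format, OF f(1)] f(2-4) d5(2) by (metis order_trans)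
  have I0: "I f u0 <= 0" by (rule locmin_energy[OF f(1) u0(1) cr0 r1 sc])
  note ce = crit_energy[OF f(1) u0H cr0]
  have hk: "k*hn u0 <= fnorm f"
  proof (cases "hn u0 = 0")
   case False
   have "kap*(hn u0)^2 <= p/(p + 1)*f u0" using I0 ce(2) by simp
   also have "... <= p/(p + 1)*(fnorm f*hn u0)" using dual_bound[OF f(1) u0H] p_gt_1 by (intro mult_left_mono) (auto simp: abs_le_iff)
   finally have "(kap*hn u0)*hn u0 <= (p/(p + 1)*fnorm f)*hn u0" by (simp add: power2_eq_square mult_ac)
   hence "kap*hn u0 <= p/(p + 1)*fnorm f" using False hn_nonneg[of u0] by (simp only: mult_le_cancel_right)
   thus ?thesis using p_gt_1 by (simp add: k_def field_simps)
  qed (simp add: fnorm_nonneg[OF f(1)])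
  define u where "u = pp u0"
  have ae: "AE x in L. u0 x = max (u0 x) 0" by (rule crit_nonneg[OF f(1,2) u0H cr0])
  note cp = crit_pp[OF f(1) u0H ae, folded u_def]
  have u: "u \<in> H" "!!x. u x >= 0" "hn u = hn u0" "I f u = I f u0" using pp_H[OF u0H] cp by (auto simp: u_def)
  have cr: "\<forall>h\<in>H. DI a f u h = 0" using cp(1) cr0 by simp
  have hle: "hn u <= de" "hn u <= dd'"
  proof -
   have "k*hn u <= k*de" "k*hn u <= k*dd'" using hk f(4) d5(7,8) u(3) by auto
   thus "hn u <= de" "hn u <= dd'" using k by auto
  qed
  have hp: "hn u > 0"
  proof (rule ccontr)
   assume "~ ?thesis"
   hence z: "hn u = 0" using hn_nonneg[of u] by simp
   have "f h = 0" if "h \<in> H" for h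
    using cr[rule_format, OF that] ip_CS[OF u(1) that] Nf_bound[OF a_coef u(1) that] p_gt_1 by (simp add: DI_def z)
   thus False using f(3) by (auto simp: nonzero_dual_def)
  qed
  have "ip u pha >= 0" if "pha \<in> H" "!!x. pha x >= 0" for pha
  proof -
   have "f pha >= 0" using f(2) that by (auto simp: nonneg_dual_def)
   moreover have "Nf a u pha >= 0" unfolding Nf_def using that coefD(2)[OF a_coef] by (intro Bochner_Integration.integral_nonneg) auto
   ultimately show ?thesis using cr[rule_format, OF that(1)] by (simp add: DI_def)
  qed
  then obtain ep where ep: "ep > 0" "AE x in L. u x >= ep * om x" using supersolution_lower_bound[OF u(1,2) hp] by blast
  obtain R1 where R1: "!!y. norm y >= R1 ==> Xe u y > 0 & mdef y <= Xe u y/2" using interaction_dominates[OF u(1,2) ep] by blast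
  define R where "R = max (max R1 Rd) 1"
  \<comment> \<open>Inside the ball uniqueness identifies \<open>u'\<close> with \<open>u0\<close>
    almost everywhere. Outside, \<open>fnorm f \<le> kap * hn u'\<close> makes the energy
    nonnegative, whereas the energy of \<open>u\<close> is nonpositive.\<close>
  have lowest: "I f u <= I f u'" if u': "u' \<in> H" "\<forall>h\<in>H. DI a f u' h = 0" for u'
  proof (cases "hn u' < r1")
   case True
   have "AE x in L. u' x = u1 x" "AE x in L. u0 x = u1 x" using u' True u0 ci by (auto simp: Hball_def intro!: u1)
   hence "AE x in L. u' x = u0 x" by eventually_elim simp
   thus ?thesis using I_AE_cong[OF f(1) u'(1) u0H] u(4) by simp
  next
   case False
   have "p/(p + 1)*f u' <= fnorm f*hn u'"
   proof -
    have "p/(p + 1)*f u' <= p/(p + 1)*(fnorm f*hn u')" using dual_bound[OF f(1) u'(1)] p_gt_1 by (intro mult_left_mono) (auto simp: abs_le_iff)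
    also have "... <= 1*(fnorm f*hn u')" using p_gt_1 fnorm_nonneg[OF f(1)] hn_nonneg[of u'] by (intro mult_right_mono) auto
    finally show ?thesis by simp
   qed
   also have "... <= (kap*hn u')*hn u'"
   proof (rule mult_right_mono[OF _ hn_nonneg])
    have "kap*r1 <= kap*hn u'" using False kap_pos by (intro mult_left_mono) auto
    thus "fnorm f <= kap*hn u'" using f(4) d5(5) by linarith
   qed
   finally show ?thesis using crit_energy(2)[OF f(1) u'] u(4) I0 by (simp add: power2_eq_square)
  qed
  interpret P: perturbed s dd n_type p a wst f u R
  proof unfold_locales
   show "fnorm f <= tlow*(p - 1)/(2*p)" using f(4) d5(4) by linarith
   show "bary v ~= 0" if "v \<in> Sg" "J f v < I f u + c0" for v using db(2)[OF fs _ that(1)] that(2) f(4) d5(6) I0 u(4) by simp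
   fix y :: "real^'n" assume y: "norm y = R"
   hence nb: "norm y >= R1" "norm y >= Rd" "y ~= 0" by (auto simp: R_def)
   have e: "nz (%x. u x + wy y x) \<in> Sg & hn (%x. u x + wy y x) > 0 & J f (nz (%x. u x + wy y x)) < I f u + c0"
    using R1[OF nb(1)] by (intro de(2) fs f u(1,2) cr hle) auto
   thus "nz (%x. u x + wy y x) \<in> Sg & hn (%x. u x + wy y x) > 0 &
    J f (nz (%x. u x + wy y x)) < I f u + c0 & bary (nz (%x. u x + wy y x)) \<bullet> y > 0" using dr(2)[OF u(1) hle(2) nb(2,3)] by simp
  qed (use fs u cr lowest in \<open>auto simp: R_def\<close>)
  obtain v1 v2 where v: "P.crit v1" "P.crit v2" "~ (AE x in L. v1 x = v2 x)" using P.two_critical_points by blast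
  thus ?thesis using crit_SigmaI[OF fs] u(4) by (intro exI[of _ v1] exI[of _ v2]) simp
 qed
 thus ?thesis using d5(1,2) by (intro exI[of _ d5]) simp
qed

end

theorem theorem4p17:
  fixes s p C \<mu> r1 d1 :: real and a :: "real ^ 'n::finite \<Rightarrow> real" and wstar :: "real ^ 'n \<Rightarrow> real"
  assumes s: "0 < s" "s < 1"
    and N: "real CARD('n) > 2 * s"
    and p: "1 < p" "p < (real CARD('n) + 2 * s) / (real CARD('n) - 2 * s)"
    and a_meas: "a \<in> borel_measurable lborel"
    and a_range: "\<forall>x. 0 < a x \<and> a x \<le> 1"
    and a_inf: "\<exists>c>0. \<forall>x. c \<le> a x"
    and a_ne1: "emeasure lborel {x. a x \<noteq> 1} > 0"
    and a_lim: "(a \<longlongrightarrow> 1) at_infinity"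
    and C: "C > 0"
    and mu: "\<mu> > p + 1 + real CARD('n) / (real CARD('n) + 2 * s)"
    and decay: "\<forall>x. 1 - a x \<le> C / (1 + norm x powr (\<mu> * (real CARD('n) + 2 * s)))"
    and r1: "r1 > 0" and d1: "d1 > 0"
    and locmin: "\<forall>f\<in>Hneg s. nonneg_dual s f \<and> nonzero_dual s f \<and> Hneg_norm s f \<le> d1 \<longrightarrow>
        strictly_convex_on_Hs s (Hball s r1) (Ifun s p a f) \<and>
        (\<exists>u\<in>Hball s r1. crit_Hs s (Ifun s p a f) u \<and>
           (\<forall>v\<in>Hball s r1. crit_Hs s (Ifun s p a f) v \<longrightarrow> (AE x in lborel. v x = u x)))"
    and w: "ground_state s p wstar"
  shows "\<exists>d5. 0 < d5 \<and> d5 \<le> d1 \<and>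
     (\<forall>f\<in>Hneg s. nonneg_dual s f \<and> nonzero_dual s f \<and> Hneg_norm s f \<le> d5 \<longrightarrow>
        (\<forall>u\<in>Hball s r1. crit_Hs s (Ifun s p a f) u \<longrightarrow>
           (\<exists>v1 v2. crit_Sigma s (Jfun s p a f) v1 \<and> crit_Sigma s (Jfun s p a f) v2 \<and>
              \<not> (AE x in lborel. v1 x = v2 x) \<and>
              Jfun s p a f v1 < Ifun s p a f u + Ifun s p (\<lambda>_. 1) (\<lambda>_. 0) wstar \<and>
              Jfun s p a f v2 < Ifun s p a f u + Ifun s p (\<lambda>_. 1) (\<lambda>_. 0) wstar)))"
proof -
 define dd where "dd = real CARD('n) + 2 * s"
 interpret nonlinear s dd "TYPE('n)" p using s N p by unfold_locales (auto simp: dd_def)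
 have co: "coef a" using a_meas a_range by (auto simp: coef_def measurable_lborel1 less_imp_le)
 \<comment> \<open>The decay is rewritten as a power \<open>(p + 1)/2\<close> of \<open>om\<close>
   because \<open>om powr ((p + 1)/2) * w powr (p + 1)\<close> is the \<open>p + 1\<close> power of
   the weighted function \<open>et * w\<close>, to which the Sobolev inequality applies.\<close>
 have dec: "1 - a x <= (C*2 powr (\<mu>*dd)) * om x powr ((p + 1)/2)" for x
 proof -
  define M where "M = \<mu>*dd"
  have "real CARD('n)/(real CARD('n) + 2 * s) >= 0" using s by (intro divide_nonneg_nonneg) auto
  hence mp: "(p + 1)/2 <= \<mu>" using mu p by (simp add: field_simps)
  hence M: "dd*((p + 1)/2) <= M" "M >= 0" using dd_pos p mult_left_mono[OF mp, of dd] by (auto simp: M_def mult.commute)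
  have "(1 + norm x) powr M <= 2 powr M*(1 + norm x powr M)" using powr_add_le[of 1 "norm x" M] M by simp
  hence "1/(1 + norm x powr M) <= 2 powr M*(1 + norm x) powr - M"
   by (simp add: powr_minus divide_simps add_pos_nonneg add_nonneg_eq_0_iff mult.commute)
  also have "... <= 2 powr M * om x powr ((p + 1)/2)" unfolding om_def powr_powr using M by (intro mult_left_mono powr_mono) auto
  finally have "C*(1/(1 + norm x powr M)) <= C*(2 powr M * om x powr ((p + 1)/2))" using C by (intro mult_left_mono) auto
  thus ?thesis using decay[rule_format, of x] by (simp add: M_def dd_def mult.assoc)
 qed
 have ne: "~ (AE x in lborel. a x = 1)"
 proof
  assume "AE x in lborel. a x = 1"
  hence "emeasure lborel {x. a x ~= 1} = 0"
   using a_meas by (subst (asm) AE_iff_measurable[of "{x. a x ~= 1}"]) (auto simp: measurable_lborel1)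
  thus False using a_ne1 by simp
 qed
 interpret setting s dd "TYPE('n)" p a wstar using co a_inf dec ne w by unfold_locales auto
 show ?thesis by (rule multiplicity[OF r1 d1 locmin])
qed

end
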